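(* Let $\Gamma=\bigcup_{k=1}^m\Gamma_k$ be a collection of $C^\infty$ curves $\Gamma_k\subset\mathbb{R}^2$ (open or closed), each having only finitely many points with vanishing curvature. Assume that either there are no points with vanishing curvature (in which case put $\kappa=2$), or there are finitely many points with vanishing curvature of maximal order $\kappa-2$, where $\kappa\in\left[2,\frac{3+\sqrt5}{2}\right)$. Let $f$ be smooth on each $\Gamma_k$, let the weight profile $\theta$ have regularity order $q\ge0$, and let $\alpha\in[0,1]$. For a rotation $\eta\in\mathrm{SO}(2)$ and a translation $\boldsymbol\xi\in[0,1]^2$ let $\mathcal{I}_h(f;\eta,\boldsymbol\xi)$ denote the generalized implicit boundary integral with tube width $\varepsilon$ on the transformed collection $\eta\Gamma+h\boldsymbol\xi$. There is $\varepsilon_0>0$ such that if $\varepsilon=\varepsilon(h)=\Theta(h^\alpha)$ with $\varepsilon\le\varepsilon_0$, then, as $h\to0^+$, $$\int_{\mathrm{SO}(2)}\int_{[0,1]^2}\left|\mathcal{I}(f)-\mathcal{I}_h(f;\eta,\boldsymbol\xi)\right|^2d\boldsymbol\xi\,d\eta=\mathcal{O}\left(h^{\frac2\kappa+\frac{2}{\kappa-1}(1-\alpha)}\right),$$ where $d\eta$ is the normalized Haar measure on $\mathrm{SO}(2)$.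
   Context: Each $\Gamma_k$ is a compact embedded $C^\infty$ curve (smooth up to its endpoints if it is open) with unit normal field $\mathbf{n}_k$. The curvature vanishes to order $\kappa'-2$ ($\kappa'>2$) at $\mathbf{z}\in\Gamma_k$ if, after a rigid motion placing $\mathbf{z}$ at the origin, $\Gamma_k$ is locally a graph $(x,g(x))$ (over a two-sided neighbourhood of $0$, or a one-sided one if $\mathbf{z}$ is an endpoint) with $g(x)=|x|^{\kappa'}a(x)$ or $g(x)=\mathrm{sgn}(x)|x|^{\kappa'}a(x)$, $a$ smooth and nowhere zero. "Maximal order $\kappa-2$" means each vanishing order $\kappa'-2$ satisfies $\kappa'\le\kappa$. The segmented tube is $T_{k,\varepsilon}=\{\mathbf{x}+t\,\mathbf{n}_k(\mathbf{x}):(\mathbf{x},t)\in\Gamma_k\times[-\varepsilon,\varepsilon]\}$, with $\varepsilon$ small enough that $(\mathbf{x},t)\mapsto\mathbf{x}+t\mathbf{n}_k(\mathbf{x})$ is injective on $\Gamma_k\times[-\varepsilon,\varepsilon]$. For $\mathbf{y}=\mathbf{x}+t\mathbf{n}_k(\mathbf{x})\in T_{k,\varepsilon}$ put $P_{\Gamma_k}(\mathbf{y})=\mathbf{x}$, $d_{\Gamma_k}(\mathbf{y})=t$, and let $J_\varepsilon(\mathbf{y},t)$ be the Jacobian at $\mathbf{y}$ of $P_{\Gamma_k}$ restricted to the level curve $\{d_{\Gamma_k}=t\}$ (equal to $1-t$ times the appropriately signed curvature of that level curve at $\mathbf{y}$). Weight profile of regularity order $q\in\{0,1,2,\dots\}$: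 a fixed function $\theta:\mathbb{R}\to\mathbb{R}$ with $\mathrm{supp}\,\theta=[-1,1]$, $\int_{-1}^1\theta=1$; if $q\ge1$, $\theta\in C^{q-1}(\mathbb{R})$ and $\theta^{(q)}$ is piecewise $C^1$; if $q=0$, $\theta\in L^\infty$ is piecewise $C^1$ (piecewise $C^1$: finitely many pieces, $C^1$ up to the closure on each). $\theta_\varepsilon(s)=\varepsilon^{-1}\theta(s/\varepsilon)$. Let $\mathcal{Q}_k(\mathbf{y})=f(P_{\Gamma_k}(\mathbf{y}))\,\theta_\varepsilon(d_{\Gamma_k}(\mathbf{y}))\,J_\varepsilon(\mathbf{y},d_{\Gamma_k}(\mathbf{y}))$ for $\mathbf{y}\in T_{k,\varepsilon}$ and $\mathcal{Q}_k=0$ elsewhere. $\mathcal{I}(f)=\sum_{k=1}^m\int_{\Gamma_k}f\,d\sigma$; the generalized implicit boundary integral is $\mathcal{I}_h(f)=h^2\sum_{k=1}^m\sum_{\mathbf{z}\in(h\mathbb{Z})^2\cap T_{k,\varepsilon}}\mathcal{Q}_k(\mathbf{z})$, and for the transformed collection (integrand transported with the curves) $\mathcal{I}_h(f;\eta,\boldsymbol\xi)=h^2\sum_{k=1}^m\sum_{\mathbf{w}\in\mathbb{Z}^2}\mathcal{Q}_k\left(h\eta^{-1}(\mathbf{w}-\boldsymbol\xi)\right)$. $\varepsilon=\Theta(h^\alpha)$ means $c_1h^\alpha\le\varepsilon\le c_2h^\alpha$ with constants $c_1,c_2>0$; the constants in $\mathcal{O}$ are independent of $h$. *)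

theory Defs
  imports "HOL-Analysis.Analysis"
begin

section \<open>Smoothness up to the boundary\<close>

fun nderiv :: "real set \<Rightarrow> nat \<Rightarrow> (real \<Rightarrow> 'a::real_normed_vector) \<Rightarrow> real \<Rightarrow> 'a" where
  "nderiv S 0 g = g"
| "nderiv S (Suc j) g = (\<lambda>t. vector_derivative (nderiv S j g) (at t within S))"

text \<open>Only used for nondegenerate intervals \<open>S\<close>; derivatives are one-sided at endpoints in \<open>S\<close>.\<close>

definition smooth_on :: "real set \<Rightarrow> (real \<Rightarrow> 'a::real_normed_vector) \<Rightarrow> bool" where
  "smooth_on S g \<longleftrightarrow> (\<forall>j. \<forall>t\<in>S. nderiv S j g differentiable (at t within S))"


section \<open>Compact embedded smooth plane curves\<close>

text \<open>A curve is given by a regular parametrization over \<open>[0,1]\<close>: a \<^const>\<open>simple_path\<close> is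
  either an arc (open curve) or a simple closed path (closed curve).  For a closed curve, a
  function of the parameter is smooth on the curve iff moreover all its one-sided derivatives
  at \<open>0\<close> and \<open>1\<close> agree.\<close>

definition smooth_along :: "(real \<Rightarrow> real^2) \<Rightarrow> (real \<Rightarrow> 'a::real_normed_vector) \<Rightarrow> bool" where
  "smooth_along \<gamma> g \<longleftrightarrow> smooth_on {0..1} g \<and>
     (pathfinish \<gamma> = pathstart \<gamma> \<longrightarrow> (\<forall>j. nderiv {0..1} j g 0 = nderiv {0..1} j g 1))"

definition smooth_curve :: "(real \<Rightarrow> real^2) \<Rightarrow> bool" where
  "smooth_curve \<gamma> \<longleftrightarrow> simple_path \<gamma> \<and> smooth_along \<gamma> \<gamma> \<and> (\<forall>t\<in>{0..1}. nderiv {0..1} 1 \<gamma> t \<noteq> 0)"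

definition smooth_fun_on_curve :: "(real \<Rightarrow> real^2) \<Rightarrow> (real^2 \<Rightarrow> real) \<Rightarrow> bool" where
  "smooth_fun_on_curve \<gamma> f \<longleftrightarrow> smooth_along \<gamma> (\<lambda>t. f (\<gamma> t))"

definition unit_normal_field :: "(real \<Rightarrow> real^2) \<Rightarrow> (real^2 \<Rightarrow> real^2) \<Rightarrow> bool" where
  "unit_normal_field \<gamma> n \<longleftrightarrow> continuous_on (path_image \<gamma>) n \<and>
     (\<forall>t\<in>{0..1}. norm (n (\<gamma> t)) = 1 \<and> n (\<gamma> t) \<bullet> nderiv {0..1} 1 \<gamma> t = 0)"

definition curve_integral :: "(real \<Rightarrow> real^2) \<Rightarrow> (real^2 \<Rightarrow> real) \<Rightarrow> real" where
  "curve_integral \<gamma> f = integral {0..1} (\<lambda>t. f (\<gamma> t) * norm (nderiv {0..1} 1 \<gamma> t))"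


section \<open>Points of vanishing curvature\<close>

definition curvature :: "(real \<Rightarrow> real^2) \<Rightarrow> real \<Rightarrow> real" where
  "curvature \<gamma> t =
     (let v = nderiv {0..1} 1 \<gamma> t; w = nderiv {0..1} 2 \<gamma> t
      in (v$1 * w$2 - v$2 * w$1) / norm v ^ 3)"

definition zero_curvature_points :: "(real \<Rightarrow> real^2) \<Rightarrow> (real^2) set" where
  "zero_curvature_points \<gamma> = {\<gamma> t |t. t \<in> {0..1} \<and> curvature \<gamma> t = 0}"

definition curve_endpoints :: "(real \<Rightarrow> real^2) \<Rightarrow> (real^2) set" where
  "curve_endpoints \<gamma> =
     (if pathfinish \<gamma> = pathstart \<gamma> then {} else {pathstart \<gamma>, pathfinish \<gamma>})"

definition SO2 :: "(real^2^2) set" where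
  "SO2 = {A. rotation_matrix A}"

text \<open>\<open>I\<close> is the interval over which the curve, moved rigidly so that \<open>z\<close> lies at the
  origin, is locally (in the open set \<open>U\<close>) the graph of \<open>g\<close>.\<close>

definition curvature_vanishes_to_order :: "(real \<Rightarrow> real^2) \<Rightarrow> real^2 \<Rightarrow> real \<Rightarrow> bool" where
  "curvature_vanishes_to_order \<gamma> z r \<longleftrightarrow>
     (\<exists>\<kappa>'>2. r = \<kappa>' - 2 \<and>
       (\<exists>R\<in>SO2. \<exists>\<delta>>0. \<exists>I U a g.
          (if z \<in> curve_endpoints \<gamma> then I = {0..<\<delta>} \<or> I = {-\<delta><..0} else I = {-\<delta><..<\<delta>}) \<and>
          open U \<and> 0 \<in> U \<and>
          (\<lambda>y. R *v (y - z)) ` path_image \<gamma> \<inter> U = (\<lambda>x. vector [x, g x]) ` I \<and>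
          smooth_on I a \<and> (\<forall>x\<in>I. a x \<noteq> 0) \<and>
          ((\<forall>x\<in>I. g x = \<bar>x\<bar> powr \<kappa>' * a x) \<or> (\<forall>x\<in>I. g x = sgn x * \<bar>x\<bar> powr \<kappa>' * a x))))"


section \<open>Tubes and the tubular coordinates\<close>

definition tube_map :: "(real^2 \<Rightarrow> real^2) \<Rightarrow> (real^2) \<times> real \<Rightarrow> real^2" where
  "tube_map n = (\<lambda>(x, t). x + t *\<^sub>R n x)"

definition tube_domain :: "(real \<Rightarrow> real^2) \<Rightarrow> real \<Rightarrow> ((real^2) \<times> real) set" where
  "tube_domain \<gamma> \<epsilon> = path_image \<gamma> \<times> {-\<epsilon>..\<epsilon>}"

definition tube :: "(real \<Rightarrow> real^2) \<Rightarrow> (real^2 \<Rightarrow> real^2) \<Rightarrow> real \<Rightarrow> (real^2) set" where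
  "tube \<gamma> n \<epsilon> = tube_map n ` tube_domain \<gamma> \<epsilon>"

text \<open>The next two functions are meaningful on the tube when \<^const>\<open>tube_map\<close> is injective on
  \<^const>\<open>tube_domain\<close>.\<close>

definition tube_proj :: "(real \<Rightarrow> real^2) \<Rightarrow> (real^2 \<Rightarrow> real^2) \<Rightarrow> real \<Rightarrow> real^2 \<Rightarrow> real^2" where
  "tube_proj \<gamma> n \<epsilon> y = fst (the_inv_into (tube_domain \<gamma> \<epsilon>) (tube_map n) y)"

definition tube_dist :: "(real \<Rightarrow> real^2) \<Rightarrow> (real^2 \<Rightarrow> real^2) \<Rightarrow> real \<Rightarrow> real^2 \<Rightarrow> real" where
  "tube_dist \<gamma> n \<epsilon> y = snd (the_inv_into (tube_domain \<gamma> \<epsilon>) (tube_map n) y)"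

text \<open>Jacobian at \<open>y\<close> of \<^const>\<open>tube_proj\<close> restricted to the level curve
  \<open>{tube_dist = t}\<close>, i.e. the length of the image of the unit tangent vector of the level curve
  under the tangential derivative.  The level curve is parametrized by \<open>L\<close>, so this is the ratio
  of the speeds of \<open>tube_proj \<circ> L\<close> and \<open>L\<close> at a parameter \<open>s\<close> of \<open>y\<close>.  The only ambiguity in the
  choice of \<open>s\<close> is \<open>0\<close> versus \<open>1\<close> on a closed curve, where both give the same value.\<close>

definition level_jacobian ::
    "(real \<Rightarrow> real^2) \<Rightarrow> (real^2 \<Rightarrow> real^2) \<Rightarrow> real \<Rightarrow> real^2 \<Rightarrow> real \<Rightarrow> real" where
  "level_jacobian \<gamma> n \<epsilon> y t =
     (let L = (\<lambda>u. \<gamma> u + t *\<^sub>R n (\<gamma> u));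
          s = (SOME s. s \<in> {0..1} \<and> L s = y)
      in norm (vector_derivative (\<lambda>u. tube_proj \<gamma> n \<epsilon> (L u)) (at s within {0..1}))
         / norm (vector_derivative L (at s within {0..1})))"


section \<open>Weight profiles\<close>

text \<open>Every bounded open interval free of breakpoints carries a \<open>C\<^sup>1\<close> function that extends to
  the closure; the values at the breakpoints themselves are unconstrained.\<close>

definition piecewise_C1 :: "(real \<Rightarrow> real) \<Rightarrow> bool" where
  "piecewise_C1 g \<longleftrightarrow>
     (\<exists>S. finite S \<and>
       (\<forall>a b. a < b \<longrightarrow> {a<..<b} \<inter> S = {} \<longrightarrow>
         (\<exists>G. G C1_differentiable_on {a..b} \<and> (\<forall>x\<in>{a<..<b}. G x = g x))))"

definition weight_profile :: "nat \<Rightarrow> (real \<Rightarrow> real) \<Rightarrow> bool" where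
  "weight_profile q \<theta> \<longleftrightarrow>
     closure {s. \<theta> s \<noteq> 0} = {-1..1} \<and>
     (LBINT s:{-1..1}. \<theta> s) = 1 \<and>
     (if q = 0
      then \<theta> \<in> borel_measurable lebesgue \<and> (\<exists>B. AE s in lebesgue. \<bar>\<theta> s\<bar> \<le> B) \<and> piecewise_C1 \<theta>
      else (\<forall>j<q-1. \<forall>s. (deriv ^^ j) \<theta> field_differentiable (at s)) \<and>
           continuous_on UNIV ((deriv ^^ (q-1)) \<theta>) \<and>
           (\<exists>S. finite S \<and> (\<forall>s\<in>-S. (deriv ^^ (q-1)) \<theta> field_differentiable (at s))) \<and>
           piecewise_C1 ((deriv ^^ q) \<theta>))"


section \<open>Generalized implicit boundary integrals\<close>

definition ibi_integrand :: "(real \<Rightarrow> real^2) \<Rightarrow> (real^2 \<Rightarrow> real^2) \<Rightarrow> (real^2 \<Rightarrow> real)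
    \<Rightarrow> (real \<Rightarrow> real) \<Rightarrow> real \<Rightarrow> real^2 \<Rightarrow> real" where
  "ibi_integrand \<gamma> n f \<theta> \<epsilon> y =
     (if y \<in> tube \<gamma> n \<epsilon>
      then f (tube_proj \<gamma> n \<epsilon> y) * (\<theta> (tube_dist \<gamma> n \<epsilon> y / \<epsilon>) / \<epsilon>)
             * level_jacobian \<gamma> n \<epsilon> y (tube_dist \<gamma> n \<epsilon> y)
      else 0)"

definition int_lattice :: "(real^2) set" where
  "int_lattice = {w. \<forall>i. w $ i \<in> \<int>}"

text \<open>The lattice sum for the collection moved by \<open>x \<mapsto> \<eta> x + h \<xi>\<close>, pulled back to the original
  curves; only finitely many terms are nonzero.\<close>

definition ibi_transformed :: "nat \<Rightarrow> (nat \<Rightarrow> real \<Rightarrow> real^2) \<Rightarrow> (nat \<Rightarrow> real^2 \<Rightarrow> real^2)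
    \<Rightarrow> (real^2 \<Rightarrow> real) \<Rightarrow> (real \<Rightarrow> real) \<Rightarrow> real \<Rightarrow> real \<Rightarrow> real^2^2 \<Rightarrow> real^2 \<Rightarrow> real" where
  "ibi_transformed m \<gamma> n f \<theta> \<epsilon> h \<eta> \<xi> =
     h\<^sup>2 * (\<Sum>k=1..m. \<Sum>\<^sub>\<infinity>w\<in>int_lattice.
             ibi_integrand (\<gamma> k) (n k) f \<theta> \<epsilon> (h *\<^sub>R (matrix_inv \<eta> *v (w - \<xi>))))"

definition normalized_haar_SO2 :: "(real^2^2) measure \<Rightarrow> bool" where
  "normalized_haar_SO2 \<mu> \<longleftrightarrow>
     space \<mu> = SO2 \<and> sets \<mu> = sets (restrict_space borel SO2) \<and> emeasure \<mu> SO2 = 1 \<and>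
     (\<forall>R\<in>SO2. distr \<mu> \<mu> (\<lambda>\<eta>. R ** \<eta>) = \<mu>)"

end

theory Submission
  imports Defs
begin

text \<open>Smoothness alone makes a curve leave its tangent at a point of zero curvature to order at least 3,
  while \<open>\<kappa> < (3 + sqrt 5) / 2 < 3\<close>. Hence the curvature never vanishes, and the bound to prove is implied
  by \<open>O(h\<^sup>3 / \<epsilon>\<^sup>2)\<close>.

  For a fixed rotation the error is a 1-periodic function of the translation, and by Parseval its mean square
  is the sum over \<open>p \<noteq> 0\<close> of the squared Fourier transforms of the integrand at frequencies of length
  \<open>\<lambda> = 2 \<pi> |p| / h\<close>. One integration by parts over the tube and van der Corput's lemma along the curve bound such
  a transform by \<open>1 / (\<epsilon> \<lambda> sqrt \<lambda>)\<close> plus the contribution \<open>1 / (\<lambda> (1 + \<epsilon> \<lambda> |e \<bullet> \<eta> \<nu>|))\<close> of the ends of the curve,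
  where \<open>e = p / |p|\<close>. The square of the latter has mean \<open>O(1 / (\<epsilon> \<lambda>\<^sup>3))\<close> over the rotations \<open>\<eta>\<close>, so the
  claim follows from the convergence of the sum of \<open>1 / |p|\<^sup>3\<close>.\<close>

section \<open>Parseval on the unit square\<close>

text \<open>The delicate part is the ends of a curve. There the integrand is cut off along a normal
  segment, and for a frequency parallel to the tangent at the end nothing oscillates on that
  segment: the transform decays like \<open>1 / \<lambda>\<close> only, which is not square summable
  over a planar lattice. Such frequencies are rare, and the mean over rotations turns this into the
  missing factor \<open>1 / (\<epsilon> \<lambda>)\<close>; hence rotations are integrated before
  frequencies are summed. A closed curve is cut open at its base point and treated in the same way.
  The profile may jump, so it is cut into pieces that are \<open>C\<^sup>1\<close> up to their ends,
  and a jump costs no more than a boundary term in the normal variable. For the lattice sum of a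
  discontinuous function an inequality in Parseval's formula is enough, and it needs continuity at
  almost every translation only. The bound \<open>h\<^sup>3 / \<epsilon>\<^sup>2\<close> suffices
  because \<open>\<kappa> \<ge> 2\<close> gives \<open>2/\<kappa> \<le> 1\<close> and
  \<open>2/(\<kappa> - 1) \<le> 2\<close>, so that the exponent in the claim is at most
  \<open>1 + 2 (1 - \<alpha>) = 3 - 2 \<alpha>\<close>.\<close>

lemma borel_measurable_vector2 [measurable]:
  "(\<lambda>(x, y). vector [x, y] :: real^2) \<in> borel_measurable (lborel \<Otimes>\<^sub>M lborel)"
proof -
  have "(\<lambda>p. vector [fst p, snd p] :: real^2) = (\<lambda>p. fst p *\<^sub>R axis 1 1 + snd p *\<^sub>R axis 2 1)"
    by (auto simp: fun_eq_iff vec_eq_iff forall_2 axis_def)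
  then show ?thesis by (simp add: case_prod_unfold)
qed

lemma prod_Basis_real2: "(\<Prod>b\<in>(Basis::(real^2) set). x \<bullet> b) = x$1 * x$2"
proof -
  have B: "(Basis::(real^2) set) = {axis 1 1, axis 2 1}"
    by (auto simp: Basis_vec_def axis_eq_axis UNIV_2)
  have "axis 1 1 \<noteq> (axis 2 1 :: real^2)" by (simp add: axis_eq_axis)
  then show ?thesis by (simp add: B inner_axis)
qed

text \<open>Lebesgue measure is determined by its values on boxes, and the image of the product
  measure gives a box its area. Integrals over \<open>real^2\<close> thereby become iterated
  integrals over the line.\<close>

lemma lborel_real2: "(lborel :: (real^2) measure) = distr (lborel \<Otimes>\<^sub>M lborel) borel (\<lambda>(x, y). vector [x, y])"
proof (rule lborel_eqI)
  fix l u :: "real^2"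
  assume le: "\<And>b. b \<in> Basis \<Longrightarrow> l \<bullet> b \<le> u \<bullet> b"
  have le': "l$1 \<le> u$1" "l$2 \<le> u$2"
    using le[of "axis 1 1"] le[of "axis 2 1"] by (auto simp: inner_axis Basis_vec_def)
  have eq: "(\<lambda>(x, y). vector [x, y]) -` box l u = {l$1<..<u$1} \<times> {l$2<..<u$2}"
    by (auto simp: mem_box_cart forall_2)
  have "emeasure (distr (lborel \<Otimes>\<^sub>M lborel) borel (\<lambda>(x, y). vector [x, y])) (box l u)
      = emeasure (lborel \<Otimes>\<^sub>M lborel) ({l$1<..<u$1} \<times> {l$2<..<u$2})"
    by (subst emeasure_distr) (auto simp: eq space_pair_measure)
  also have "\<dots> = ennreal (u$1 - l$1) * ennreal (u$2 - l$2)"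
    using le' by (subst lborel.emeasure_pair_measure_Times) auto
  also have "\<dots> = (\<Prod>b\<in>Basis. (u - l) \<bullet> b)"
    using le' by (simp add: prod_Basis_real2 ennreal_mult)
  finally show "emeasure (distr (lborel \<Otimes>\<^sub>M lborel) borel (\<lambda>(x, y). vector [x, y])) (box l u)
     = (\<Prod>b\<in>Basis. (u - l) \<bullet> b)" .
qed simp

lemma integral_lborel_real2:
  fixes f :: "real^2 \<Rightarrow> 'a::{banach, second_countable_topology}"
  assumes f: "integrable lborel f"
  shows "(\<integral>x. f x \<partial>lborel) = (\<integral>s. (\<integral>t. f (vector [s, t]) \<partial>lborel) \<partial>lborel)"
proof -
  have m: "f \<in> borel_measurable borel" using f by auto
  have i: "integrable (lborel \<Otimes>\<^sub>M lborel) (\<lambda>(s, t). f (vector [s, t]))"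
    using f m unfolding lborel_real2 by (subst (asm) integrable_distr_eq) (auto simp: case_prod_unfold)
  have "(\<integral>x. f x \<partial>lborel) = (\<integral>p. (case p of (s, t) \<Rightarrow> f (vector [s, t])) \<partial>(lborel \<Otimes>\<^sub>M lborel))"
    using m unfolding lborel_real2 by (subst integral_distr) (auto simp: case_prod_unfold)
  also have "\<dots> = (\<integral>s. (\<integral>t. f (vector [s, t]) \<partial>lborel) \<partial>lborel)"
    using lborel_pair.integral_fst[OF i] by simp
  finally show ?thesis .
qed

section \<open>Characters of the torus and their orthogonality\<close>

definition expi2 :: "int \<times> int \<Rightarrow> real^2 \<Rightarrow> complex" where
  "expi2 p x = cis (2*pi*(of_int (fst p) * x$1 + of_int (snd p) * x$2))"

lemma expi2_add: "expi2 p (x + y) = expi2 p x * expi2 p y"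
  by (simp add: expi2_def cis_mult algebra_simps)

lemma norm_expi2 [simp]: "norm (expi2 p x) = 1"
  by (simp add: expi2_def)

lemma expi2_zero [simp]: "expi2 (0, 0) x = 1"
  by (simp add: expi2_def)

lemma continuous_on_expi2 [continuous_intros]:
  "continuous_on S f \<Longrightarrow> continuous_on S (\<lambda>x. expi2 p (f x))"
  unfolding expi2_def cis_conv_exp by (intro continuous_intros)

lemma measurable_expi2 [measurable]: "expi2 p \<in> borel_measurable borel"
  by (intro borel_measurable_continuous_onI continuous_intros)

lemma expi2_mult_cnj: "expi2 p x * cnj (expi2 q x) = expi2 (p - q) x"
  by (simp add: expi2_def cis_cnj cis_mult algebra_simps)

lemma integral_cis_unit:
  fixes k :: int and a :: real
  shows "(\<integral>x. indicator {a..<a+1} x *\<^sub>R cis (2*pi*(of_int k * x)) \<partial>lborel) = (if k = 0 then 1 else 0)"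
proof -
  have eq: "(\<integral>x. indicator {a..<a+1} x *\<^sub>R cis (2*pi*(of_int k * x)) \<partial>lborel)
      = (\<integral>x. indicator {a..a+1} x *\<^sub>R cis (2*pi*(of_int k * x)) \<partial>lborel)"
    by (intro integral_cong_AE)
       (auto intro!: eventually_mono[OF AE_lborel_singleton[of "a+1"]] simp: indicator_def cis_conv_exp)
  show ?thesis
  proof (cases "k = 0")
    case True
    then show ?thesis by (simp add: eq)
  next
    case False
    define F where "F x = cis (2*pi*(real_of_int k * x)) / (complex_of_real (2*pi*real_of_int k) * \<i>)" for x :: real
    have "(\<integral>x. indicator {a..a+1} x *\<^sub>R cis (2*pi*(of_int k * x)) \<partial>lborel) = F (a+1) - F a"
    proof (rule integral_FTC_atLeastAtMost)
      show "(F has_vector_derivative cis (2*pi*(of_int k * x))) (at x within {a..a+1})" for x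
        unfolding F_def cis_conv_exp
        by (rule has_vector_derivative_real_field | rule derivative_eq_intros refl | simp add: False field_simps)+
      show "continuous_on {a..a+1} (\<lambda>x. cis (2*pi*(of_int k * x)))"
        unfolding cis_conv_exp by (intro continuous_intros)
    qed simp
    also have "F (a+1) = F a"
    proof -
      have "cis (2*pi*(of_int k * (a+1))) = cis (2*pi*(of_int k * a)) * cis (2*pi * of_int k)"
        by (simp add: cis_mult algebra_simps)
      also have "cis (2*pi * of_int k) = 1"
        by (simp add: complex_eq_iff cos_int_2pin sin_int_2pin)
      finally show ?thesis by (simp add: F_def)
    qed
    finally show ?thesis using False eq by simp
  qed
qed

text \<open>Half-open, so that the integer translates tile the plane without overlap. Two positions
  occur: \<open>a = 0\<close> is the square of translations, \<open>a = -1/2\<close> the cell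
  centred at the peak of the kernel.\<close>

definition qcube :: "real \<Rightarrow> (real^2) set" where
  "qcube a = {x. a \<le> x$1 \<and> x$1 < a+1 \<and> a \<le> x$2 \<and> x$2 < a+1}"

lemma qcube_sets [measurable]: "qcube a \<in> sets borel"
  unfolding qcube_def by measurable

lemma qcube_subset: "qcube a \<subseteq> cbox (vector [a, a]) (vector [a+1, a+1])"
  by (auto simp: qcube_def mem_box_cart forall_2)

lemma emeasure_qcube_finite: "emeasure lborel (qcube a) < \<infinity>"
  by (rule le_less_trans[OF emeasure_mono[OF qcube_subset]])
     (use emeasure_lborel_cbox_finite[of "vector [a, a]" "vector [a+1, a+1] :: real^2"] in auto)

lemma integrable_on_qcube:
  fixes f :: "real^2 \<Rightarrow> 'a::{banach, second_countable_topology}"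
  assumes "f \<in> borel_measurable borel" "\<And>x. norm (f x) \<le> B"
  shows "integrable lborel (\<lambda>x. indicator (qcube a) x *\<^sub>R f x)"
proof (rule integrableI_bounded_set[where A="qcube a" and B=B])
  show "AE x in lborel. x \<in> qcube a \<longrightarrow> norm (indicat_real (qcube a) x *\<^sub>R f x) \<le> B"
    using assms(2) by (auto simp: indicator_def)
qed (use assms emeasure_qcube_finite in auto)

lemma integral_expi2_qcube:
  "(\<integral>x. indicator (qcube a) x *\<^sub>R expi2 p x \<partial>lborel) = (if p = (0, 0) then 1 else 0)"
proof -
  have "integrable lborel (\<lambda>x. indicator (qcube a) x *\<^sub>R expi2 p x)"
    by (rule integrable_on_qcube[where B=1]) auto
  then have "(\<integral>x. indicator (qcube a) x *\<^sub>R expi2 p x \<partial>lborel)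
     = (\<integral>s. \<integral>t. indicator (qcube a) (vector [s, t] :: real^2) *\<^sub>R expi2 p (vector [s, t]) \<partial>lborel \<partial>lborel)"
    by (rule integral_lborel_real2)
  also have "\<dots> = (\<integral>s. \<integral>t. (indicator {a..<a+1} s *\<^sub>R cis (2*pi*(of_int (fst p) * s))) *
       (indicator {a..<a+1} t *\<^sub>R cis (2*pi*(of_int (snd p) * t))) \<partial>lborel \<partial>lborel)"
    by (intro Bochner_Integration.integral_cong refl)
       (auto simp: qcube_def indicator_def expi2_def cis_mult algebra_simps)
  also have "\<dots> = (if fst p = 0 then 1 else 0) * (if snd p = 0 then 1 else 0)"
    by (simp only: integral_mult_right_zero integral_mult_left_zero integral_cis_unit)
  finally show ?thesis by (cases p) auto
qed

text \<open>De la Vallee Poussin's kernel: a nonnegative approximate identity whose Fourier coefficients lie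
  in \<open>[0, 1]\<close>, so that Fatou's lemma turns the finite Parseval identity into an upper bound.\<close>

definition kern :: "nat \<Rightarrow> real \<Rightarrow> real" where
  "kern N x = (2 * cos (pi * x)) ^ (2*N) / real (2*N choose N)"

text \<open>The Fourier coefficient of \<open>kern N\<close> at frequency \<open>j\<close>; it is
  meaningful only for \<open>j\<close> between \<open>-N\<close> and \<open>N\<close>, the range of
  summation in \<open>kern_expand\<close>. Division by the central binomial coefficient makes the
  mean equal to 1.\<close>

definition kcoef :: "nat \<Rightarrow> int \<Rightarrow> real" where
  "kcoef N j = real (2*N choose nat (j + int N)) / real (2*N choose N)"

lemma kcoef_bounds: "0 \<le> kcoef N j" "kcoef N j \<le> 1" "kcoef N 0 = 1"
  by (auto simp: kcoef_def binomial_maximum' divide_le_eq_1)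

lemma kern_nonneg: "0 \<le> kern N x"
  by (simp add: kern_def power_mult)

text \<open>The central binomial coefficient is at least \<open>4^N / (2 * N)\<close>, so the peak
  of the kernel grows at most linearly in \<open>N\<close>, while away from the peak the power of
  the cosine decays geometrically.\<close>

lemma kern_le:
  assumes "N > 0" shows "kern N x \<le> 2 * real N * (cos (pi*x))^(2*N)"
proof -
  have "(4::real)^N / (2*real N) \<le> real (2*N choose N)"
    using central_binomial_lower_bound[OF assms] by simp
  then have "4^N \<le> 2*real N * real (2*N choose N)" using assms by (simp add: field_simps)
  then have "4^N * (cos (pi*x))^(2*N) \<le> (2*real N * real (2*N choose N)) * (cos (pi*x))^(2*N)"
    by (intro mult_right_mono) (auto simp: power_mult)
  moreover have "(2 * cos (pi*x))^(2*N) = 4^N * (cos (pi*x))^(2*N)"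
    by (simp add: power_mult power_mult_distrib)
  moreover have "0 < real (2*N choose N)" by simp
  ultimately show ?thesis
    unfolding kern_def by (simp only: divide_le_eq mult_ac if_True)
qed

text \<open>Binomial expansion of a power of \<open>cis (pi*x) + cis (-(pi*x))\<close>. The exponent
  \<open>2*N\<close> is even, hence only integer frequencies occur and the kernel has period 1
  although \<open>cos (pi*x)\<close> has not.\<close>

lemma kern_expand:
  "of_real (kern N x) = (\<Sum>j\<in>{-int N..int N}. of_real (kcoef N j) * cis (2*pi*(of_int j * x)))"
proof -
  have 1: "of_real (2 * cos (pi*x)) = cis (pi*x) + cis (-(pi*x))"
    by (simp add: complex_eq_iff)
  have "of_real ((2 * cos (pi*x))^(2*N)) = (cis (pi*x) + cis (-(pi*x)))^(2*N)"
    by (simp only: of_real_power 1)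
  also have "\<dots> = (\<Sum>k\<le>2*N. of_nat (2*N choose k) * cis (pi*x)^k * cis (-(pi*x))^(2*N-k))"
    by (rule binomial_ring)
  also have "\<dots> = (\<Sum>k\<le>2*N. of_nat (2*N choose k) * cis (2*pi*(of_int (int k - int N) * x)))"
  proof (intro sum.cong refl)
    fix k assume "k \<in> {..2*N}"
    then have eq: "real k * (pi*x) + real (2*N-k) * (-(pi*x)) = 2*pi*(of_int (int k - int N) * x)"
      by (simp add: of_nat_diff algebra_simps)
    have "cis (pi*x)^k * cis (-(pi*x))^(2*N-k) = cis (real k * (pi*x) + real (2*N-k) * (-(pi*x)))"
      unfolding Complex.DeMoivre cis_mult ..
    then show "of_nat (2*N choose k) * cis (pi*x)^k * cis (-(pi*x))^(2*N-k) =
       of_nat (2*N choose k) * cis (2*pi*(of_int (int k - int N) * x))"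
      unfolding eq by (simp only: mult.assoc)
  qed
  also have "\<dots> = (\<Sum>j\<in>{-int N..int N}. of_nat (2*N choose nat (j + int N)) * cis (2*pi*(of_int j * x)))"
    by (rule sum.reindex_bij_witness[of _ "\<lambda>j. nat (j + int N)" "\<lambda>k. int k - int N"]) auto
  finally show ?thesis
    by (simp add: kern_def kcoef_def sum_divide_distrib of_real_divide)
qed

lemma kern_periodic: "kern N (x + of_int k) = kern N x"
proof -
  have s: "sin (of_int k * pi) = 0" by (simp add: sin_zero_iff_int2)
  then have "cos (of_int k * pi)^2 = 1" using sin_cos_squared_add[of "of_int k * pi"] by simp
  with s have "cos (pi * (x + of_int k))^2 = cos (pi*x)^2"
    by (simp add: distrib_left cos_add power_mult_distrib mult.commute[of pi "of_int k"])
  then show ?thesis by (simp add: kern_def power_mult power_mult_distrib)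
qed

definition kern2 :: "nat \<Rightarrow> real^2 \<Rightarrow> real" where
  "kern2 N x = kern N (x$1) * kern N (x$2)"

definition kcoef2 :: "nat \<Rightarrow> int \<times> int \<Rightarrow> real" where
  "kcoef2 N p = kcoef N (fst p) * kcoef N (snd p)"

lemma kern2_expand:
  "of_real (kern2 N x) = (\<Sum>p\<in>{-int N..int N}\<times>{-int N..int N}. of_real (kcoef2 N p) * expi2 p x)"
  by (simp add: kern2_def kern_expand sum_product sum.cartesian_product kcoef2_def expi2_def
      distrib_left cis_mult[symmetric] mult_ac case_prod_unfold del: cis_mult)

lemma kcoef2_bounds: "0 \<le> kcoef2 N p" "kcoef2 N p \<le> 1" "kcoef2 N (0,0) = 1"
  using mult_mono[OF kcoef_bounds(2)[of N "fst p"] kcoef_bounds(2)[of N "snd p"]]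
  by (auto simp: kcoef2_def kcoef_bounds)

lemma kern2_nonneg: "0 \<le> kern2 N x"
  by (simp add: kern2_def kern_nonneg)

lemma kern2_periodic: "w \<in> int_lattice \<Longrightarrow> kern2 N (x + w) = kern2 N x"
  by (auto simp: kern2_def int_lattice_def Ints_def forall_2 kern_periodic)

lemma measurable_kern2 [measurable]: "kern2 N \<in> borel_measurable borel"
  unfolding kern2_def kern_def by measurable

text \<open>The summand 1 covers \<open>N = 0\<close>, where the kernel is constantly 1.\<close>

lemma kern_le': "kern N x \<le> 2 * real N + 1"
proof (cases "N = 0")
  case False
  have "(cos (pi*x))^(2*N) \<le> 1" by (simp add: power_mult power_le_one abs_square_le_1)
  then have "2 * real N * (cos (pi*x))^(2*N) \<le> 2 * real N * 1" by (intro mult_left_mono) auto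
  moreover have "kern N x \<le> 2 * real N * (cos (pi*x))^(2*N)" using False by (intro kern_le) auto
  ultimately show ?thesis by linarith
qed (simp add: kern_def)

lemma kern2_le: "kern2 N x \<le> (2 * real N + 1)^2"
  unfolding kern2_def power2_eq_square
  by (intro mult_mono kern_le') (auto simp: kern_nonneg)

text \<open>Only the zero frequency survives integration over a full period, and its coefficient is
  1.\<close>

lemma integral_kern2_qcube: "(\<integral>x. indicator (qcube a) x *\<^sub>R kern2 N x \<partial>lborel) = 1"
proof -
  have int: "integrable lborel (\<lambda>x. indicator (qcube a) x *\<^sub>R expi2 p x)" for p
    by (rule integrable_on_qcube[where B=1]) auto
  have "complex_of_real (\<integral>x. indicator (qcube a) x *\<^sub>R kern2 N x \<partial>lborel)
     = (\<integral>x. of_real (indicator (qcube a) x *\<^sub>R kern2 N x) \<partial>lborel)"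
    by (simp only: integral_complex_of_real)
  also have "\<dots> = (\<integral>x. (\<Sum>p\<in>{-int N..int N}\<times>{-int N..int N}. of_real (kcoef2 N p) * (indicator (qcube a) x *\<^sub>R expi2 p x)) \<partial>lborel)"
    by (intro Bochner_Integration.integral_cong refl)
       (simp add: kern2_expand sum_distrib_left scaleR_conv_of_real mult.left_commute)
  also have "\<dots> = (\<Sum>p\<in>{-int N..int N}\<times>{-int N..int N}. of_real (kcoef2 N p) * (if p = (0,0) then 1 else 0))"
    by (subst Bochner_Integration.integral_sum)
       (auto simp: integral_expi2_qcube int simp del: mult_scaleR_right intro!: integrable_mult_right)
  also have "\<dots> = (\<Sum>p\<in>{-int N..int N}\<times>{-int N..int N}. if p = (0,0) then 1 else 0)"
    by (intro sum.cong refl) (auto simp: kcoef2_bounds)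
  also have "\<dots> = 1" by (subst sum.delta) auto
  finally show ?thesis by (simp only: of_real_eq_1_iff)
qed


lemma cos_pi_mono:
  assumes "d \<le> \<bar>x\<bar>" "\<bar>x\<bar> \<le> 1/2" "0 \<le> d"
  shows "(cos (pi*x))^2 \<le> (cos (pi*d))^2"
proof -
  have 1: "cos (pi*x) = cos (pi*\<bar>x\<bar>)" by (simp add: abs_if)
  have "cos (pi*\<bar>x\<bar>) \<le> cos (pi*d)"
    using assms pi_gt_zero by (intro cos_monotone_0_pi_le) (auto intro!: mult_left_mono simp: mult_le_cancel_left1)
  moreover have "0 \<le> cos (pi*\<bar>x\<bar>)"
    using assms pi_gt_zero by (intro cos_ge_zero) (auto simp: field_simps mult_left_mono intro: order_trans[of _ 0])
  ultimately show ?thesis unfolding 1 by (intro power_mono)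
qed

text \<open>One coordinate is off the peak and contributes the geometric factor; for the other one
  the bound on the peak height is enough.\<close>

lemma kern2_tail:
  assumes "x \<in> qcube (-1/2)" "0 < d" "\<not> (\<bar>x$1\<bar> < d \<and> \<bar>x$2\<bar> < d)"
  shows "kern2 N x \<le> (2 * real N + 1)^2 * ((cos (pi*d))^2)^N"
proof -
  have aux: "kern N y \<le> (2*real N + 1) * ((cos (pi*d))^2)^N" if "\<bar>y\<bar> \<le> 1/2" "d \<le> \<bar>y\<bar>" for y
  proof (cases "N = 0")
    case False
    have "kern N y \<le> 2 * real N * (cos (pi*y))^(2*N)" using False by (intro kern_le) auto
    also have "\<dots> \<le> (2*real N+1) * ((cos (pi*d))^2)^N"
    proof -
      have "((cos (pi*y))^2)^N \<le> ((cos (pi*d))^2)^N"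
        using assms(2) by (intro power_mono[OF cos_pi_mono[OF that(2,1)]]) auto
      then show ?thesis unfolding power_mult by (intro mult_mono) auto
    qed
    finally show ?thesis .
  qed (simp add: kern_def)
  have b: "\<bar>x$1\<bar> \<le> 1/2" "\<bar>x$2\<bar> \<le> 1/2" using assms(1) by (auto simp: qcube_def abs_le_iff)
  consider "d \<le> \<bar>x$1\<bar>" | "d \<le> \<bar>x$2\<bar>" using assms(3) by force
  then show ?thesis
  proof cases
    case 1
    then have "kern2 N x \<le> ((2*real N + 1) * ((cos (pi*d))^2)^N) * (2*real N + 1)"
      unfolding kern2_def by (intro mult_mono aux b kern_le') (auto simp: kern_nonneg)
    then show ?thesis by (simp add: power2_eq_square mult_ac)
  next
    case 2
    then have "kern2 N x \<le> (2*real N + 1) * ((2*real N + 1) * ((cos (pi*d))^2)^N)"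
      unfolding kern2_def by (intro mult_mono aux b kern_le') (auto simp: kern_nonneg)
    then show ?thesis by (simp add: power2_eq_square mult_ac)
  qed
qed

text \<open>Splitting \<open>c^N\<close> as \<open>(sqrt c ^ N)\<^sup>2\<close> gives each of the
  two factors \<open>2 * N + 1\<close> a geometric factor of its own.\<close>

lemma poly_times_geometric_tendsto_0:
  fixes c :: real assumes "0 \<le> c" "c < 1"
  shows "(\<lambda>N. (2 * real N + 1)^2 * c^N) \<longlonglongrightarrow> 0"
proof -
  have 1: "(\<lambda>N. real N * c^N) \<longlonglongrightarrow> 0" 
    using powser_times_n_limit_0[of c] assms by simp
  have sq: "0 \<le> sqrt c" "sqrt c < 1" using assms by auto
  have 2: "(\<lambda>N. real N * sqrt c^N) \<longlonglongrightarrow> 0"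
    using powser_times_n_limit_0[of "sqrt c"] sq by simp
  have 3: "(\<lambda>N. sqrt c^N) \<longlonglongrightarrow> 0" using sq by (intro LIMSEQ_power_zero) auto
  have "(\<lambda>N. (2 * (real N * sqrt c^N) + sqrt c^N)^2) \<longlonglongrightarrow> (2*0 + 0)^2"
    by (intro tendsto_intros 2 3)
  moreover have "(2 * (real N * sqrt c^N) + sqrt c^N)^2 = (2 * real N + 1)^2 * c^N" for N
  proof -
    have "(2 * (real N * sqrt c^N) + sqrt c^N)^2 = ((2 * real N + 1) * sqrt c^N)^2" by (simp add: algebra_simps)
    also have "\<dots> = (2 * real N + 1)^2 * (sqrt c^2)^N" by (simp add: power_mult_distrib flip: power_mult) (simp add: mult.commute)
    finally show ?thesis using assms by simp
  qed
  ultimately show ?thesis by simp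
qed

text \<open>Continuity is asked for at the origin alone: elsewhere \<open>G\<close> is merely
  bounded, and the tail estimate makes the kernel negligible there. This is what admits integrands
  with jumps.\<close>

lemma kern2_approximate_identity:
  fixes G :: "real^2 \<Rightarrow> real"
  assumes G: "G \<in> borel_measurable borel" and bd: "\<And>x. \<bar>G x\<bar> \<le> B" and cont: "isCont G 0"
  shows "(\<lambda>N. \<integral>x. indicator (qcube (-1/2)) x *\<^sub>R (G x * kern2 N x) \<partial>lborel) \<longlonglongrightarrow> G 0"
proof (rule LIMSEQ_I)
  fix e :: real assume e: "e > 0"
  have B: "B \<ge> 0" using bd[of 0] by auto
  obtain r where r: "r > 0" "\<And>x. norm x < r \<Longrightarrow> \<bar>G x - G 0\<bar> < e/2"
    using cont e unfolding continuous_at_eps_delta dist_norm by (auto dest: spec[of _ "e/2"])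
  \<comment> \<open>\<open>r/2\<close> puts the square of half side \<open>d\<close> inside the ball
    of radius \<open>r\<close>, since the norm is at most the sum of the absolute coordinates;
    \<open>1/2\<close> keeps \<open>pi * d\<close> in \<open>[0, pi/2]\<close>, where the cosine is
    nonnegative, so that \<open>c < 1\<close>.\<close>
  define d where "d = min (r/2) (1/2)"
  have d: "0 < d" "d \<le> 1/2" "2*d \<le> r" using r by (auto simp: d_def)
  define c where "c = (cos (pi*d))^2"
  have c: "0 \<le> c" "c < 1"
  proof -
    have "cos (pi*d) < cos 0" using d by (intro cos_monotone_0_pi) (auto simp: mult_le_cancel_left1)
    moreover have "- (pi/2) \<le> 0" "0 \<le> pi * d" "pi * d \<le> pi * (1/2)" using d by (auto intro: mult_left_mono)
    then have "0 \<le> cos (pi*d)" by (intro cos_ge_zero) linarith+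
    ultimately show "c < 1" by (simp add: c_def power_less_one_iff abs_square_less_1)
  qed (simp add: c_def)
  define L where "L = measure lborel (qcube (-1/2))"
  have "(\<lambda>N. 2*B * L * ((2 * real N + 1)^2 * c^N)) \<longlonglongrightarrow> 2*B*L * 0"
    by (intro tendsto_intros poly_times_geometric_tendsto_0 c)
  then have "eventually (\<lambda>N. 2*B * L * ((2 * real N + 1)^2 * c^N) < e/2) sequentially"
    using e by (intro order_tendstoD(2)) auto
  then obtain N0 where N0: "\<And>N. N \<ge> N0 \<Longrightarrow> 2*B * L * ((2 * real N + 1)^2 * c^N) < e/2"
    by (auto simp: eventually_sequentially)
  show "\<exists>N0. \<forall>N\<ge>N0. norm ((\<integral>x. indicator (qcube (-1/2)) x *\<^sub>R (G x * kern2 N x) \<partial>lborel) - G 0) < e"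
  proof (intro exI allI impI)
    fix N assume N: "N \<ge> N0"
    let ?I = "indicator (qcube (-1/2)) :: real^2 \<Rightarrow> real"
    have k: "\<bar>kern2 N x\<bar> \<le> (2*real N+1)^2" for x using kern2_le[of N x] kern2_nonneg[of N x] by simp
    have i1: "integrable lborel (\<lambda>x. ?I x *\<^sub>R kern2 N x)"
      by (rule integrable_on_qcube) (use k in auto)
    have i2: "integrable lborel (\<lambda>x. ?I x *\<^sub>R (G x * kern2 N x))"
    proof (rule integrable_on_qcube)
      show "norm (G x * kern2 N x) \<le> B * (2*real N+1)^2" for x
        unfolding real_norm_def abs_mult by (intro mult_mono bd k B) auto
    qed (use G in measurable)
    have i3: "integrable lborel (\<lambda>x. ?I x *\<^sub>R (1::real))"
      by (rule integrable_on_qcube[where B=1]) auto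
    have "(\<integral>x. ?I x *\<^sub>R (G x * kern2 N x) \<partial>lborel) - G 0
       = (\<integral>x. ?I x *\<^sub>R (G x * kern2 N x) \<partial>lborel) - G 0 * (\<integral>x. ?I x *\<^sub>R kern2 N x \<partial>lborel)"
      by (simp only: integral_kern2_qcube mult.right_neutral)
    also have "\<dots> = (\<integral>x. ?I x *\<^sub>R (G x * kern2 N x) - G 0 * (?I x *\<^sub>R kern2 N x) \<partial>lborel)"
      using i1 i2 by (simp del: real_scaleR_def mult_scaleR_right)
    finally have eq: "(\<integral>x. ?I x *\<^sub>R (G x * kern2 N x) \<partial>lborel) - G 0
       = (\<integral>x. ?I x *\<^sub>R (G x * kern2 N x) - G 0 * (?I x *\<^sub>R kern2 N x) \<partial>lborel)" .
    let ?b = "2*B * ((2 * real N + 1)^2 * c^N)"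
    have "norm (\<integral>x. ?I x *\<^sub>R (G x * kern2 N x) - G 0 * (?I x *\<^sub>R kern2 N x) \<partial>lborel)
       \<le> (\<integral>x. e/2 * (?I x *\<^sub>R kern2 N x) + ?b * (?I x *\<^sub>R 1) \<partial>lborel)"
    proof (rule Bochner_Integration.integral_norm_bound_integral)
      show "integrable lborel (\<lambda>x. ?I x *\<^sub>R (G x * kern2 N x) - G 0 * (?I x *\<^sub>R kern2 N x))"
        using i1 i2 by (simp del: real_scaleR_def mult_scaleR_right)
      show "integrable lborel (\<lambda>x. e/2 * (?I x *\<^sub>R kern2 N x) + ?b * (?I x *\<^sub>R 1))"
        using i1 i3 by (intro Bochner_Integration.integrable_add integrable_mult_right)
      fix x :: "real^2"
      show "norm (?I x *\<^sub>R (G x * kern2 N x) - G 0 * (?I x *\<^sub>R kern2 N x)) \<le> e/2 * (?I x *\<^sub>R kern2 N x) + ?b * (?I x *\<^sub>R 1)"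
      proof (cases "x \<in> qcube (-1/2)")
        case True
        have e1: "norm (?I x *\<^sub>R (G x * kern2 N x) - G 0 * (?I x *\<^sub>R kern2 N x)) = \<bar>G x - G 0\<bar> * kern2 N x"
          using True kern2_nonneg[of N x] by (simp add: abs_mult flip: left_diff_distrib)
        have e2: "e/2 * (?I x *\<^sub>R kern2 N x) + ?b * (?I x *\<^sub>R 1) = e/2 * kern2 N x + ?b" using True by simp
        have b0: "?b \<ge> 0" using B c by auto
        show ?thesis
        proof (cases "\<bar>x$1\<bar> < d \<and> \<bar>x$2\<bar> < d")
          case True
          have "norm x \<le> \<bar>x$1\<bar> + \<bar>x$2\<bar>" using norm_le_l1_cart[of x] by (simp add: sum_2)
          also have "\<dots> < r" using True d by linarith
          finally have "\<bar>G x - G 0\<bar> * kern2 N x \<le> e/2 * kern2 N x"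
            using r(2)[of x] kern2_nonneg[of N x] by (intro mult_right_mono) auto
          then show ?thesis unfolding e1 e2 using b0 by linarith
        next
          case False
          have "\<bar>G x - G 0\<bar> \<le> 2*B" using bd[of x] bd[of 0] by (auto simp: abs_le_iff)
          then have "\<bar>G x - G 0\<bar> * kern2 N x \<le> ?b"
            using kern2_tail[OF True d(1) False, of N] kern2_nonneg[of N x] B
            by (intro mult_mono) (auto simp: c_def)
          moreover have "0 \<le> e/2 * kern2 N x" using e kern2_nonneg[of N x] by simp
          ultimately show ?thesis unfolding e1 e2 by linarith
        qed
      qed simp
    qed
    also have "\<dots> = e/2 * (\<integral>x. ?I x *\<^sub>R kern2 N x \<partial>lborel) + ?b * (\<integral>x. ?I x *\<^sub>R (1::real) \<partial>lborel)"
      unfolding integral_mult_right_zero[symmetric]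
      by (rule Bochner_Integration.integral_add; rule integrable_mult_right; rule i1 i3)
    also have "\<dots> = e/2 + ?b * L"
      using integral_kern2_qcube[of "-1/2" N] by (simp add: L_def)
    also have "\<dots> < e" using N0[OF N] by (simp add: mult_ac)
    finally show "norm ((\<integral>x. ?I x *\<^sub>R (G x * kern2 N x) \<partial>lborel) - G 0) < e"
      by (simp only: eq)
  qed
qed

section \<open>Periodization over the integer lattice and its Fourier series\<close>

lemma finite_int_lattice_bounded:
  "finite {w \<in> int_lattice. norm w \<le> R}"
proof -
  have "{w \<in> int_lattice. norm w \<le> R} \<subseteq>
     (\<lambda>(a, b). vector [of_int a, of_int b]) ` ({-\<lceil>R\<rceil>..\<lceil>R\<rceil>} \<times> {-\<lceil>R\<rceil>..\<lceil>R\<rceil>})"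
  proof
    fix w assume "w \<in> {w \<in> int_lattice. norm w \<le> R}"
    then have w: "w \<in> int_lattice" "norm w \<le> R" by auto
    obtain a b where ab: "w$1 = of_int a" "w$2 = of_int b" using w(1) by (auto simp: int_lattice_def Ints_def forall_2)
    have "\<bar>of_int a\<bar> \<le> R" "\<bar>of_int b\<bar> \<le> R" using component_le_norm_cart[of w 1] component_le_norm_cart[of w 2] w ab by auto
    then have "a \<in> {-\<lceil>R\<rceil>..\<lceil>R\<rceil>}" "b \<in> {-\<lceil>R\<rceil>..\<lceil>R\<rceil>}" by (auto simp: abs_le_iff) linarith+
    moreover have "w = vector [of_int a, of_int b]" by (simp add: vec_eq_iff forall_2 ab)
    ultimately show "w \<in> (\<lambda>(a, b). vector [of_int a, of_int b]) ` ({-\<lceil>R\<rceil>..\<lceil>R\<rceil>} \<times> {-\<lceil>R\<rceil>..\<lceil>R\<rceil>})" by auto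
  qed
  then show ?thesis by (rule finite_subset) auto
qed

text \<open>Rounding each coordinate finds the unique half-open cell that contains \<open>y\<close>.
  The remainder has absolute coordinates at most \<open>1/2\<close>, whence the \<open>+ 1\<close>
  in the norm bound; it confines the cells that meet a bounded set to finitely many.\<close>

lemma int_lattice_round:
  fixes y :: "real^2"
  shows "\<exists>w. w \<in> int_lattice \<and> y - w \<in> qcube (-1/2) \<and> norm w \<le> norm y + 1 \<and>
    (\<forall>w'\<in>int_lattice. y - w' \<in> qcube (-1/2) \<longrightarrow> w' = w)"
proof (intro exI conjI ballI impI)
  define w :: "real^2" where "w = vector [of_int \<lfloor>y$1 + 1/2\<rfloor>, of_int \<lfloor>y$2 + 1/2\<rfloor>]"
  show "w \<in> int_lattice" by (simp add: int_lattice_def w_def forall_2)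
  show q: "y - w \<in> qcube (-1/2)"
    by (simp add: qcube_def w_def) linarith
  have "norm (w - y) \<le> \<bar>(w-y)$1\<bar> + \<bar>(w-y)$2\<bar>" using norm_le_l1_cart[of "w-y"] by (simp add: sum_2)
  also have "\<dots> \<le> 1" using q by (auto simp: qcube_def abs_le_iff field_simps)
  finally show "norm w \<le> norm y + 1" using norm_triangle_ineq2[of w y] by simp
  fix w' assume w': "w' \<in> int_lattice" "y - w' \<in> qcube (-1/2)"
  obtain a b where ab: "w'$1 = of_int a" "w'$2 = of_int b"
    using w'(1) unfolding int_lattice_def forall_2 mem_Collect_eq by (metis Ints_cases)
  have b: "-1/2 \<le> y$1 - of_int a" "y$1 - of_int a < 1/2" "-1/2 \<le> y$2 - of_int b" "y$2 - of_int b < 1/2"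
    using w'(2) by (simp_all add: qcube_def ab)
  have "\<lfloor>y$1 + 1/2\<rfloor> = a" by (rule floor_unique) (use b in linarith)+
  moreover have "\<lfloor>y$2 + 1/2\<rfloor> = b" by (rule floor_unique) (use b in linarith)+
  ultimately show "w' = w" by (simp add: vec_eq_iff forall_2 w_def ab)
qed

text \<open>The argument \<open>w - \<xi>\<close> is the one in the translated lattice sum. With
  this reflected sign the Fourier coefficient at \<open>p\<close> is the integral of
  \<open>g\<close> against \<open>expi2 p\<close> itself, without conjugation, which explains the
  sign in \<open>fcoef\<close>.\<close>

definition periodization :: "(real^2 \<Rightarrow> real) \<Rightarrow> real^2 \<Rightarrow> real" where
  "periodization g \<xi> = (\<Sum>\<^sub>\<infinity>w\<in>int_lattice. g (w - \<xi>))"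

lemma periodization_finite:
  assumes supp: "\<And>x. norm x > R \<Longrightarrow> g x = 0" and "norm \<xi> + R \<le> r"
  shows "periodization g \<xi> = (\<Sum>w\<in>{w \<in> int_lattice. norm w \<le> r}. g (w - \<xi>))"
proof -
  have "periodization g \<xi> = (\<Sum>\<^sub>\<infinity>w\<in>{w \<in> int_lattice. norm w \<le> r}. g (w - \<xi>))"
    unfolding periodization_def
  proof (rule infsum_cong_neutral)
    fix w assume "w \<in> int_lattice - {w \<in> int_lattice. norm w \<le> r}"
    then have "norm w > r" by auto
    then have "norm (w - \<xi>) > R" using norm_triangle_ineq2[of w \<xi>] assms(2) by linarith
    then show "g (w - \<xi>) = 0" by (rule supp)
  qed auto
  then show ?thesis by (simp add: infsum_finite finite_int_lattice_bounded)
qed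

definition fcoef :: "(real^2 \<Rightarrow> real) \<Rightarrow> int \<times> int \<Rightarrow> complex" where
  "fcoef g p = (\<integral>x. g x *\<^sub>R expi2 p x \<partial>lborel)"

lemma integrable_bounded_support:
  fixes g :: "real^2 \<Rightarrow> real"
  assumes "g \<in> borel_measurable borel" "\<And>x. \<bar>g x\<bar> \<le> B" "\<And>x. norm x > R \<Longrightarrow> g x = 0"
    "h \<in> borel_measurable borel" "\<And>x. norm (h x) \<le> K"
  shows "integrable lborel (\<lambda>x. g x *\<^sub>R (h x :: 'a::{banach, second_countable_topology}))"
proof (rule integrableI_bounded_set[where A="cball 0 R" and B="B*K"])
  have "K \<ge> 0" using assms(5)[of 0] norm_ge_zero[of "h 0"] by linarith
  moreover have "B \<ge> 0" using assms(2)[of 0] by linarith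
  ultimately show "AE x in lborel. x \<in> cball 0 R \<longrightarrow> norm (g x *\<^sub>R h x) \<le> B * K"
    using assms(2,5) by (auto intro!: mult_mono)
  show "AE x in lborel. x \<notin> cball 0 R \<longrightarrow> g x *\<^sub>R h x = 0" using assms(3) by auto
  show "emeasure lborel (cball 0 R :: (real^2) set) < \<infinity>"
    using emeasure_compact_finite[OF compact_cball] by simp
qed (use assms in auto)

text \<open>After the substitution \<open>y = \<xi> + x\<close> the plane is cut into cells around
  the lattice points. Periodicity of the kernel moves every cell to the central one, where the
  kernel reproduces the value \<open>g (w - \<xi>)\<close>. Bounded support leaves finitely many
  cells.\<close>

lemma kern2_convolution_tendsto:
  fixes g :: "real^2 \<Rightarrow> real"
  assumes g: "g \<in> borel_measurable borel" and bd: "\<And>x. \<bar>g x\<bar> \<le> B"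
    and supp: "\<And>x. norm x > R \<Longrightarrow> g x = 0"
    and cont: "\<And>w. w \<in> int_lattice \<Longrightarrow> isCont g (w - \<xi>)"
  shows "(\<lambda>N. \<integral>x. g x *\<^sub>R kern2 N (\<xi> + x) \<partial>lborel) \<longlonglongrightarrow> periodization g \<xi>"
proof -
  define W where "W = {w \<in> int_lattice. norm w \<le> norm \<xi> + R + 1}"
  have W: "finite W" unfolding W_def by (rule finite_int_lattice_bounded)
  let ?I = "indicator (qcube (-1/2)) :: real^2 \<Rightarrow> real"
  have k: "\<bar>kern2 N x\<bar> \<le> (2*real N+1)^2" for x N using kern2_le[of N x] kern2_nonneg[of N x] by simp
  have B: "B \<ge> 0" using bd[of 0] by linarith
  have eq: "(\<integral>x. g x *\<^sub>R kern2 N (\<xi> + x) \<partial>lborel) = (\<Sum>w\<in>W. \<integral>y. ?I y *\<^sub>R (g (w + y - \<xi>) * kern2 N y) \<partial>lborel)" for N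
  proof -
    have "(\<integral>x. g x *\<^sub>R kern2 N (\<xi> + x) \<partial>lborel) = (\<integral>x. g x *\<^sub>R kern2 N (\<xi> + x) \<partial>distr lborel borel ((+) (-\<xi>)))"
      by (simp only: lborel_distr_plus)
    also have "\<dots> = (\<integral>y. g (y - \<xi>) *\<^sub>R kern2 N y \<partial>lborel)"
      using g by (subst integral_distr) auto
    also have "\<dots> = (\<integral>y. (\<Sum>w\<in>W. ?I (y - w) *\<^sub>R (g (y - \<xi>) * kern2 N y)) \<partial>lborel)"
    proof (rule Bochner_Integration.integral_cong[OF refl])
      fix y
      show "g (y - \<xi>) *\<^sub>R kern2 N y = (\<Sum>w\<in>W. ?I (y - w) *\<^sub>R (g (y - \<xi>) * kern2 N y))"
      proof (cases "norm (y - \<xi>) > R")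
        case True then show ?thesis using supp by simp
      next
        case False
        obtain w where w: "w \<in> int_lattice" "y - w \<in> qcube (-1/2)" "norm w \<le> norm y + 1"
          "\<forall>w'\<in>int_lattice. y - w' \<in> qcube (-1/2) \<longrightarrow> w' = w" using int_lattice_round[of y] by blast
        have "norm y \<le> norm \<xi> + R" using False norm_triangle_ineq2[of y \<xi>] by linarith
        with w(1,3) have wW: "w \<in> W" by (simp add: W_def)
        have "(\<Sum>w\<in>W. ?I (y - w) *\<^sub>R (g (y - \<xi>) * kern2 N y)) = (\<Sum>w'\<in>W. if w' = w then g (y - \<xi>) * kern2 N y else 0)"
        proof (rule sum.cong[OF refl])
          fix w' assume "w' \<in> W"
          then have "y - w' \<in> qcube (-1/2) \<longleftrightarrow> w' = w" using w(2,4) by (auto simp only: W_def mem_Collect_eq)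
          then show "?I (y - w') *\<^sub>R (g (y - \<xi>) * kern2 N y) = (if w' = w then g (y - \<xi>) * kern2 N y else 0)"
            by (simp add: indicator_def)
        qed
        then show ?thesis using wW W by simp
      qed
    qed
    also have "\<dots> = (\<Sum>w\<in>W. \<integral>y. ?I (y - w) *\<^sub>R (g (y - \<xi>) * kern2 N y) \<partial>lborel)"
    proof (rule Bochner_Integration.integral_sum)
      fix w assume "w \<in> W"
      have "integrable lborel (\<lambda>x. g x *\<^sub>R (?I (x + \<xi> - w) * kern2 N (x + \<xi>)))"
      proof (rule integrable_bounded_support[OF g bd supp])
        show "norm (?I (x + \<xi> - w) * kern2 N (x + \<xi>)) \<le> 1 * (2*real N+1)^2" for x
          unfolding real_norm_def abs_mult by (intro mult_mono k) (auto simp: indicator_def)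
        show "(\<lambda>x. ?I (x + \<xi> - w) * kern2 N (x + \<xi>)) \<in> borel_measurable borel"
          by measurable
      qed
      then have "integrable (distr lborel borel ((+) (-\<xi>))) (\<lambda>x. g x *\<^sub>R (?I (x + \<xi> - w) * kern2 N (x + \<xi>)))"
        by (simp only: lborel_distr_plus)
      then have "integrable lborel (\<lambda>y. g (y - \<xi>) *\<^sub>R (?I (y - w) * kern2 N y))"
        using g by (subst (asm) integrable_distr_eq) auto
      then show "integrable lborel (\<lambda>y. ?I (y - w) *\<^sub>R (g (y - \<xi>) * kern2 N y))"
        by (simp add: mult.left_commute)
    qed
    also have "\<dots> = (\<Sum>w\<in>W. \<integral>y. ?I y *\<^sub>R (g (w + y - \<xi>) * kern2 N y) \<partial>lborel)"
    proof (intro sum.cong refl)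
      fix w assume w: "w \<in> W"
      have "(\<integral>y. ?I (y - w) *\<^sub>R (g (y - \<xi>) * kern2 N y) \<partial>lborel)
         = (\<integral>y. ?I (y - w) *\<^sub>R (g (y - \<xi>) * kern2 N y) \<partial>distr lborel borel ((+) w))"
        by (simp only: lborel_distr_plus)
      also have "\<dots> = (\<integral>y. ?I (w + y - w) *\<^sub>R (g (w + y - \<xi>) * kern2 N (w + y)) \<partial>lborel)"
        using g by (subst integral_distr) auto
      also have "\<dots> = (\<integral>y. ?I y *\<^sub>R (g (w + y - \<xi>) * kern2 N y) \<partial>lborel)"
        using w kern2_periodic[of w N] by (intro Bochner_Integration.integral_cong) (auto simp: W_def add.commute)
      finally show "(\<integral>y. ?I (y - w) *\<^sub>R (g (y - \<xi>) * kern2 N y) \<partial>lborel) = (\<integral>y. ?I y *\<^sub>R (g (w + y - \<xi>) * kern2 N y) \<partial>lborel)" .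
    qed
    finally show ?thesis .
  qed
  have "(\<lambda>N. \<Sum>w\<in>W. \<integral>y. ?I y *\<^sub>R (g (w + y - \<xi>) * kern2 N y) \<partial>lborel) \<longlonglongrightarrow> (\<Sum>w\<in>W. g (w + 0 - \<xi>))"
  proof (intro tendsto_sum)
    fix w assume "w \<in> W"
    then have "isCont g (w + 0 - \<xi>)" using cont[of w] by (simp add: W_def)
    then have c: "isCont (\<lambda>y. g (w + y - \<xi>)) 0"
      by (intro isCont_o2[where f="\<lambda>y. w + y - \<xi>" and g=g and a=0]) auto
    show "(\<lambda>N. \<integral>y. ?I y *\<^sub>R (g (w + y - \<xi>) * kern2 N y) \<partial>lborel) \<longlonglongrightarrow> g (w + 0 - \<xi>)"
      by (rule kern2_approximate_identity[OF _ bd c]) (use g in measurable)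
  qed
  moreover have "periodization g \<xi> = (\<Sum>w\<in>W. g (w - \<xi>))"
    unfolding W_def by (rule periodization_finite[OF supp]) auto
  ultimately show ?thesis by (simp only: eq add_0_right)
qed

text \<open>The convolution is a trigonometric polynomial: the kernel damps every Fourier
  coefficient by a factor in \<open>[0, 1]\<close> and removes the frequencies beyond
  \<open>N\<close>.\<close>

lemma kern2_convolution_expand:
  fixes g :: "real^2 \<Rightarrow> real"
  assumes g: "g \<in> borel_measurable borel" and bd: "\<And>x. \<bar>g x\<bar> \<le> B"
    and supp: "\<And>x. norm x > R \<Longrightarrow> g x = 0"
  shows "complex_of_real (\<integral>x. g x *\<^sub>R kern2 N (\<xi> + x) \<partial>lborel) =
    (\<Sum>p\<in>{-int N..int N}\<times>{-int N..int N}. of_real (kcoef2 N p) * fcoef g p * expi2 p \<xi>)"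
proof -
  have i: "integrable lborel (\<lambda>x. g x *\<^sub>R expi2 p x)" for p
    by (rule integrable_bounded_support[OF g bd supp, where K=1]) auto
  have "complex_of_real (\<integral>x. g x *\<^sub>R kern2 N (\<xi> + x) \<partial>lborel) = (\<integral>x. of_real (g x *\<^sub>R kern2 N (\<xi> + x)) \<partial>lborel)"
    by (rule integral_complex_of_real[symmetric])
  also have "\<dots> = (\<integral>x. (\<Sum>p\<in>{-int N..int N}\<times>{-int N..int N}. (of_real (kcoef2 N p) * expi2 p \<xi>) * (g x *\<^sub>R expi2 p x)) \<partial>lborel)"
    by (intro Bochner_Integration.integral_cong refl)
       (simp add: kern2_expand expi2_add sum_distrib_left scaleR_conv_of_real mult_ac)
  also have "\<dots> = (\<Sum>p\<in>{-int N..int N}\<times>{-int N..int N}. (of_real (kcoef2 N p) * expi2 p \<xi>) * fcoef g p)"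
    by (subst Bochner_Integration.integral_sum)
       (auto simp: fcoef_def i simp del: mult_scaleR_right intro!: integrable_mult_right)
  finally show ?thesis by (simp add: mult_ac)
qed

text \<open>The square is expanded as \<open>s * cnj s\<close> into a double sum, and orthogonality
  of the characters keeps the diagonal.\<close>

lemma finite_Parseval:
  fixes s :: "real^2 \<Rightarrow> real"
  assumes s: "\<And>\<xi>. complex_of_real (s \<xi>) = (\<Sum>p\<in>P. b p * expi2 p \<xi>)" and P: "finite P"
  shows "(\<integral>\<^sup>+\<xi>. indicator (qcube 0) \<xi> * ennreal ((s \<xi>)\<^sup>2) \<partial>lborel) = ennreal (\<Sum>p\<in>P. (norm (b p))\<^sup>2)"
proof -
  have "continuous_on UNIV (\<lambda>\<xi>. Re (\<Sum>p\<in>P. b p * expi2 p \<xi>))" by (intro continuous_intros)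
  then have sm: "s \<in> borel_measurable borel"
    by (intro borel_measurable_continuous_onI) (simp flip: s)
  have sb: "\<bar>s \<xi>\<bar> \<le> (\<Sum>p\<in>P. norm (b p))" for \<xi>
  proof -
    have "\<bar>s \<xi>\<bar> = norm (\<Sum>p\<in>P. b p * expi2 p \<xi>)" by (simp flip: s)
    also have "\<dots> \<le> (\<Sum>p\<in>P. norm (b p))" by (rule order_trans[OF norm_sum]) (simp add: norm_mult)
    finally show ?thesis .
  qed
  have i: "integrable lborel (\<lambda>\<xi>. indicator (qcube 0) \<xi> *\<^sub>R (s \<xi>)\<^sup>2)"
    by (rule integrable_on_qcube[where B="(\<Sum>p\<in>P. norm (b p))^2"])
       (use sm sb in \<open>auto intro: power_mono simp: abs_le_square_iff[symmetric] abs_of_nonneg sum_nonneg\<close>)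
  have "complex_of_real (\<integral>\<xi>. indicator (qcube 0) \<xi> *\<^sub>R (s \<xi>)\<^sup>2 \<partial>lborel)
     = (\<integral>\<xi>. of_real (indicator (qcube 0) \<xi> *\<^sub>R (s \<xi>)\<^sup>2) \<partial>lborel)" by (simp only: integral_complex_of_real)
  also have "\<dots> = (\<integral>\<xi>. (\<Sum>p\<in>P. \<Sum>q\<in>P. (b p * cnj (b q)) * (indicator (qcube 0) \<xi> *\<^sub>R expi2 (p - q) \<xi>)) \<partial>lborel)"
  proof (rule Bochner_Integration.integral_cong[OF refl])
    fix \<xi>
    have "complex_of_real ((s \<xi>)\<^sup>2) = of_real (s \<xi>) * cnj (of_real (s \<xi>))" by (simp add: power2_eq_square)
    also have "\<dots> = (\<Sum>p\<in>P. \<Sum>q\<in>P. (b p * cnj (b q)) * expi2 (p - q) \<xi>)"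
      unfolding s cnj_sum sum_product by (simp add: expi2_mult_cnj[symmetric] mult_ac)
    finally show "complex_of_real (indicator (qcube 0) \<xi> *\<^sub>R (s \<xi>)\<^sup>2) =
       (\<Sum>p\<in>P. \<Sum>q\<in>P. (b p * cnj (b q)) * (indicator (qcube 0) \<xi> *\<^sub>R expi2 (p - q) \<xi>))"
      by (simp add: indicator_def)
  qed
  also have "\<dots> = (\<Sum>p\<in>P. \<Sum>q\<in>P. (b p * cnj (b q)) * (if p - q = (0,0) then 1 else 0))"
  proof -
    have j: "integrable lborel (\<lambda>\<xi>. (b p * cnj (b q)) * (indicator (qcube 0) \<xi> *\<^sub>R expi2 (p - q) \<xi>))" for p q
      by (intro integrable_mult_right integrable_on_qcube[where B=1]) auto
    show ?thesis
      by (subst Bochner_Integration.integral_sum, rule Bochner_Integration.integrable_sum, rule j,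
          subst Bochner_Integration.integral_sum, rule j)
         (simp only: integral_mult_right_zero integral_expi2_qcube)
  qed
  also have "\<dots> = (\<Sum>p\<in>P. \<Sum>q\<in>P. if q = p then b p * cnj (b p) else 0)"
    by (intro sum.cong refl) (auto simp: prod_eq_iff)
  also have "\<dots> = of_real (\<Sum>p\<in>P. (norm (b p))\<^sup>2)"
    using P by (simp only: sum.delta of_real_sum complex_norm_square if_True cong: sum.cong)
  finally have "(\<integral>\<xi>. indicator (qcube 0) \<xi> *\<^sub>R (s \<xi>)\<^sup>2 \<partial>lborel) = (\<Sum>p\<in>P. (norm (b p))\<^sup>2)"
    by (simp only: of_real_eq_iff)
  moreover have "(\<integral>\<^sup>+\<xi>. ennreal (indicator (qcube 0) \<xi> *\<^sub>R (s \<xi>)\<^sup>2) \<partial>lborel) = ennreal (\<integral>\<xi>. indicator (qcube 0) \<xi> *\<^sub>R (s \<xi>)\<^sup>2 \<partial>lborel)"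
    by (rule nn_integral_eq_integral[OF i]) auto
  moreover have "ennreal (indicator (qcube 0) \<xi> *\<^sub>R (s \<xi>)\<^sup>2) = indicator (qcube 0) \<xi> * ennreal ((s \<xi>)\<^sup>2)" for \<xi>
    by (simp add: indicator_def)
  ultimately show ?thesis by simp
qed

theorem Parseval_periodization_le:
  fixes g :: "real^2 \<Rightarrow> real"
  assumes g: "g \<in> borel_measurable borel" and bd: "\<And>x. \<bar>g x\<bar> \<le> B"
    and supp: "\<And>x. norm x > R \<Longrightarrow> g x = 0"
    and cont: "AE \<xi> in lborel. \<forall>w\<in>int_lattice. isCont g (w - \<xi>)"
  shows "(\<integral>\<^sup>+\<xi>. indicator (qcube 0) \<xi> * ennreal ((periodization g \<xi> - (\<integral>x. g x \<partial>lborel))\<^sup>2) \<partial>lborel)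
    \<le> (\<integral>\<^sup>+p. ennreal ((norm (fcoef g p))\<^sup>2) \<partial>count_space (-{(0,0)}))"
proof -
  define c where "c = (\<integral>x. g x \<partial>lborel)"
  define \<sigma> where "\<sigma> N \<xi> = (\<integral>x. g x *\<^sub>R kern2 N (\<xi> + x) \<partial>lborel) - c" for N \<xi>
  define S where "S = (\<integral>\<^sup>+p. ennreal ((norm (fcoef g p))\<^sup>2) \<partial>count_space (-{(0,0)}))"
  have f0: "fcoef g (0,0) = of_real c"
    unfolding fcoef_def c_def by (simp add: scaleR_conv_of_real integral_complex_of_real)
  \<comment> \<open>The zero frequency is removed: its coefficient is the mean \<open>c\<close> and
    its damping factor is exactly 1, so subtracting \<open>c\<close> in \<open>\<sigma>\<close>
    cancels it for every \<open>N\<close>.\<close>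
  define P where "P N = {-int N..int N}\<times>{-int N..int N} - {(0,0)}" for N
  have P: "finite (P N)" "P N \<subseteq> -{(0,0)}" for N by (auto simp: P_def)
  have exp: "complex_of_real (\<sigma> N \<xi>) = (\<Sum>p\<in>P N. of_real (kcoef2 N p) * fcoef g p * expi2 p \<xi>)" for N \<xi>
  proof -
    have "complex_of_real (\<integral>x. g x *\<^sub>R kern2 N (\<xi> + x) \<partial>lborel) =
       of_real (kcoef2 N (0,0)) * fcoef g (0,0) * expi2 (0,0) \<xi> + (\<Sum>p\<in>P N. of_real (kcoef2 N p) * fcoef g p * expi2 p \<xi>)"
      unfolding P_def by (rule trans[OF kern2_convolution_expand[OF g bd supp] sum.remove]) auto
    then show ?thesis by (simp add: \<sigma>_def kcoef2_bounds f0)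
  qed
  have le: "(\<integral>\<^sup>+\<xi>. indicator (qcube 0) \<xi> * ennreal ((\<sigma> N \<xi>)\<^sup>2) \<partial>lborel) \<le> S" for N
  proof -
    have "(\<integral>\<^sup>+\<xi>. indicator (qcube 0) \<xi> * ennreal ((\<sigma> N \<xi>)\<^sup>2) \<partial>lborel)
      = ennreal (\<Sum>p\<in>P N. (norm (of_real (kcoef2 N p) * fcoef g p))\<^sup>2)"
      by (rule finite_Parseval[OF exp P(1)])
    also have "\<dots> \<le> ennreal (\<Sum>p\<in>P N. (norm (fcoef g p))\<^sup>2)"
    proof (intro ennreal_leI sum_mono power_mono)
      fix p
      show "norm (of_real (kcoef2 N p) * fcoef g p) \<le> norm (fcoef g p)"
        unfolding norm_mult norm_of_real using kcoef2_bounds(1,2)[of N p] by (intro mult_left_le_one_le) auto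
    qed auto
    also have "\<dots> = (\<integral>\<^sup>+p. ennreal ((norm (fcoef g p))\<^sup>2) \<partial>count_space (P N))"
      using P by (subst nn_integral_count_space_finite) auto
    also have "\<dots> \<le> S" unfolding S_def
      by (subst (1 2) nn_integral_count_space_indicator)
         (use P in \<open>auto intro!: nn_integral_mono simp: indicator_def\<close>)
    finally show ?thesis .
  qed
  have meas: "\<sigma> N \<in> borel_measurable borel" for N
  proof -
    have "continuous_on UNIV (\<lambda>\<xi>. Re (\<Sum>p\<in>P N. of_real (kcoef2 N p) * fcoef g p * expi2 p \<xi>))" by (intro continuous_intros)
    then show ?thesis by (intro borel_measurable_continuous_onI) (simp flip: exp)
  qed
  have "(\<integral>\<^sup>+\<xi>. indicator (qcube 0) \<xi> * ennreal ((periodization g \<xi> - c)\<^sup>2) \<partial>lborel)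
     \<le> (\<integral>\<^sup>+\<xi>. liminf (\<lambda>N. indicator (qcube 0) \<xi> * ennreal ((\<sigma> N \<xi>)\<^sup>2)) \<partial>lborel)"
  proof (rule nn_integral_mono_AE, use cont in eventually_elim)
    fix \<xi> assume "\<forall>w\<in>int_lattice. isCont g (w - \<xi>)"
    then have "(\<lambda>N. \<sigma> N \<xi>) \<longlonglongrightarrow> periodization g \<xi> - c"
      unfolding \<sigma>_def by (intro tendsto_intros kern2_convolution_tendsto[OF g bd supp]) auto
    then have "(\<lambda>N. ennreal ((\<sigma> N \<xi>)\<^sup>2)) \<longlonglongrightarrow> ennreal ((periodization g \<xi> - c)\<^sup>2)"
      by (intro tendsto_intros)
    then have "(\<lambda>N. indicator (qcube 0) \<xi> * ennreal ((\<sigma> N \<xi>)\<^sup>2)) \<longlonglongrightarrow> indicator (qcube 0) \<xi> * ennreal ((periodization g \<xi> - c)\<^sup>2)"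
      by (auto simp: indicator_def)
    then show "indicator (qcube 0) \<xi> * ennreal ((periodization g \<xi> - c)\<^sup>2) \<le> liminf (\<lambda>N. indicator (qcube 0) \<xi> * ennreal ((\<sigma> N \<xi>)\<^sup>2))"
      by (simp add: lim_imp_Liminf)
  qed
  also have "\<dots> \<le> liminf (\<lambda>N. \<integral>\<^sup>+\<xi>. indicator (qcube 0) \<xi> * ennreal ((\<sigma> N \<xi>)\<^sup>2) \<partial>lborel)"
    by (rule nn_integral_liminf) (use meas in measurable)
  also have "\<dots> \<le> S"
    by (rule Liminf_le) (use le in auto)
  finally show ?thesis unfolding c_def S_def .
qed

section \<open>Oscillatory integrals\<close>

lemma abs_arctan_le: "\<bar>arctan x\<bar> \<le> 2"
  using arctan_bounded[of x] pi_less_4 by auto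

text \<open>The derivative of \<open>p' arctan (p / d) / d\<close> produces the factor \<open>p'\<^sup>2 / (p\<^sup>2 + d\<^sup>2)\<close>.\<close>

lemma integral_inverse_square_le:
  fixes p p' p'' :: "real \<Rightarrow> real"
  assumes p: "\<And>s. s \<in> {0..1} \<Longrightarrow> (p has_real_derivative p' s) (at s within {0..1})"
    and p': "\<And>s. s \<in> {0..1} \<Longrightarrow> (p' has_real_derivative p'' s) (at s within {0..1})"
    and cont: "continuous_on {0..1} p''"
    and bd: "\<And>s. s \<in> {0..1} \<Longrightarrow> \<bar>p' s\<bar> \<le> M" "\<And>s. s \<in> {0..1} \<Longrightarrow> \<bar>p'' s\<bar> \<le> M"
    and c: "c > 0" "\<And>s. s \<in> {0..1} \<Longrightarrow> c \<le> (p s)\<^sup>2 + (p' s)\<^sup>2"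
    and d: "0 < d" "d \<le> 1"
  shows "integral {0..1} (\<lambda>s. 1 / ((p s)\<^sup>2 + d\<^sup>2)) \<le> (6*M+1) / c / d"
proof -
  have cp: "continuous_on {0..1} p" "continuous_on {0..1} p'"
    by (rule DERIV_continuous_on, erule p p')+
  have pos: "(p s)\<^sup>2 + d\<^sup>2 > 0" for s using d by (simp add: sum_power2_gt_zero_iff)
  note ne = pos[THEN less_imp_neq, symmetric]
  have M: "M \<ge> 0" using bd(1)[of 0] by auto
  define H where "H s = p' s * (arctan (p s / d) / d)" for s
  define H' where "H' s = p'' s * (arctan (p s / d) / d) + (p' s)\<^sup>2 / ((p s)\<^sup>2 + d\<^sup>2)" for s
  have Hd: "(H has_real_derivative H' s) (at s within {0..1})" if s: "s \<in> {0..1}" for s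
  proof -
    have 1: "1 + (p s / d)\<^sup>2 = ((p s)\<^sup>2 + d\<^sup>2) / d\<^sup>2" using d by (simp add: field_simps)
    have "(H has_real_derivative (p'' s * (arctan (p s / d) / d) + (inverse (1 + (p s / d)\<^sup>2) * (p' s / d) / d) * p' s)) (at s within {0..1})"
      unfolding H_def[abs_def]
      by (rule DERIV_mult p'[OF s] DERIV_cdivide DERIV_chain2[OF DERIV_arctan] p[OF s])+
    also have "(inverse (1 + (p s / d)\<^sup>2) * (p' s / d) / d) * p' s = (p' s)\<^sup>2 / ((p s)\<^sup>2 + d\<^sup>2)"
      unfolding 1 inverse_divide using d by (simp add: power2_eq_square)
    finally show ?thesis by (simp add: H'_def)
  qed
  have intH: "(H' has_integral (H 1 - H 0)) {0..1}"
    by (rule fundamental_theorem_of_calculus) (use Hd in \<open>auto simp: has_real_derivative_iff_has_vector_derivative[symmetric]\<close>)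
  have Hb: "\<bar>H s\<bar> \<le> 2*M/d" if "s \<in> {0..1}" for s
  proof -
    have "\<bar>H s\<bar> = \<bar>p' s\<bar> * \<bar>arctan (p s / d)\<bar> / d" using d by (simp add: H_def abs_mult)
    also have "\<dots> \<le> M * 2 / d"
      using d M bd(1)[OF that] abs_arctan_le by (intro divide_right_mono mult_mono) auto
    finally show ?thesis by (simp add: mult.commute)
  qed
  \<comment> \<open>The lower bound \<open>c\<close> is split: \<open>p\<^sup>2\<close> over the
    denominator is at most 1, and \<open>p'\<^sup>2\<close> over the denominator is
    \<open>H'\<close> up to an error of at most \<open>2 * M / d\<close>.\<close>
  have pt: "1 / ((p s)\<^sup>2 + d\<^sup>2) \<le> (H' s + (2*M/d + 1)) / c" if s: "s \<in> {0..1}" for s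
  proof -
    have a: "\<bar>p'' s * (arctan (p s / d) / d)\<bar> \<le> 2*M/d"
    proof -
      have "\<bar>p'' s * (arctan (p s / d) / d)\<bar> = \<bar>p'' s\<bar> * \<bar>arctan (p s / d)\<bar> / d" using d by (simp add: abs_mult)
      also have "\<dots> \<le> M * 2 / d"
        using d M bd(2)[OF s] abs_arctan_le by (intro divide_right_mono mult_mono) auto
      finally show ?thesis by (simp only: mult.commute)
    qed
    have b: "(p s)\<^sup>2 / ((p s)\<^sup>2 + d\<^sup>2) \<le> 1" using pos[of s] by (simp add: divide_le_eq_1)
    have "c / ((p s)\<^sup>2 + d\<^sup>2) \<le> ((p s)\<^sup>2 + (p' s)\<^sup>2) / ((p s)\<^sup>2 + d\<^sup>2)"
      using c(2)[OF s] pos[of s] by (simp add: divide_right_mono)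
    also have "\<dots> = (p s)\<^sup>2 / ((p s)\<^sup>2 + d\<^sup>2) + (p' s)\<^sup>2 / ((p s)\<^sup>2 + d\<^sup>2)" by (simp add: add_divide_distrib)
    also have "\<dots> \<le> 1 + (H' s + 2*M/d)" using a b unfolding H'_def by linarith
    finally show ?thesis using c by (simp add: field_simps)
  qed
  have int2: "((\<lambda>s. (H' s + (2*M/d + 1)) / c) has_integral (H 1 - H 0 + (2*M/d + 1) * (1 - 0)) / c) {0..1}"
    using has_integral_add[OF intH has_integral_const_real[of "2*M/d+1" 0 1], THEN has_integral_divide, of c]
    by simp
  have "integral {0..1} (\<lambda>s. 1 / ((p s)\<^sup>2 + d\<^sup>2)) \<le> (H 1 - H 0 + (2*M/d + 1) * (1 - 0)) / c"
  proof (rule integral_le[THEN order_trans])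
    show "(\<lambda>s. 1 / ((p s)\<^sup>2 + d\<^sup>2)) integrable_on {0..1}"
      by (intro integrable_continuous_interval continuous_intros cp) (use ne in auto)
    show "(\<lambda>s. (H' s + (2*M/d + 1)) / c) integrable_on {0..1}" using int2 by blast
    show "integral {0..1} (\<lambda>s. (H' s + (2*M/d + 1)) / c) \<le> (H 1 - H 0 + (2*M/d + 1) * (1 - 0)) / c"
      unfolding integral_unique[OF int2] by (rule order_refl)
  qed (use pt in auto)
  also have "\<dots> \<le> (6*M/d + 1/d) / c"
  proof -
    \<comment> \<open>Origin of \<open>6*M + 1\<close>: \<open>4*M/d\<close> from the two boundary
      values of \<open>H\<close>, \<open>2*M/d\<close> from the term with \<open>p''\<close>, and
      \<open>1 \<le> 1/d\<close> from the trivial part.\<close>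
    have "1 \<le> 1/d" using d by simp
    moreover have "\<bar>H 1\<bar> \<le> 2*M/d" "\<bar>H 0\<bar> \<le> 2*M/d" using Hb by auto
    moreover have "6*M/d = 3 * (2*M/d)" by simp
    ultimately have "H 1 - H 0 + (2*M/d + 1) * (1 - 0) \<le> 6*M/d + 1/d"
      by (simp only: diff_zero mult_1_right)
    then show ?thesis using c by (simp add: divide_right_mono)
  qed
  also have "\<dots> = (6*M+1) / c / d" by (simp add: add_divide_distrib mult.commute)
  finally show ?thesis .
qed

text \<open>Integration by parts against the regularised multiplier \<open>\<phi>' / (\<phi>'\<^sup>2 + 1/lam)\<close>, which
  avoids splitting off a neighbourhood of the stationary points.\<close>

lemma van_der_Corput:
  fixes \<phi> \<phi>' \<phi>'' \<phi>''' A A' :: "real \<Rightarrow> real"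
  assumes ph: "\<And>s. s \<in> {0..1} \<Longrightarrow> (\<phi> has_real_derivative \<phi>' s) (at s within {0..1})"
    and ph': "\<And>s. s \<in> {0..1} \<Longrightarrow> (\<phi>' has_real_derivative \<phi>'' s) (at s within {0..1})"
    and ph'': "\<And>s. s \<in> {0..1} \<Longrightarrow> (\<phi>'' has_real_derivative \<phi>''' s) (at s within {0..1})"
    and cont: "continuous_on {0..1} \<phi>'''"
    and bd: "\<And>s. s \<in> {0..1} \<Longrightarrow> \<bar>\<phi>'' s\<bar> \<le> M" "\<And>s. s \<in> {0..1} \<Longrightarrow> \<bar>\<phi>''' s\<bar> \<le> M"
    and c: "c > 0" "\<And>s. s \<in> {0..1} \<Longrightarrow> c \<le> (\<phi>' s)\<^sup>2 + (\<phi>'' s)\<^sup>2"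
    and A: "\<And>s. s \<in> {0..1} \<Longrightarrow> (A has_real_derivative A' s) (at s within {0..1})"
    and cA: "continuous_on {0..1} A'"
    and bA: "\<And>s. s \<in> {0..1} \<Longrightarrow> \<bar>A s\<bar> \<le> K" "\<And>s. s \<in> {0..1} \<Longrightarrow> \<bar>A' s\<bar> \<le> K"
    and lam1: "lam \<ge> 1"
  shows "norm (integral {0..1} (\<lambda>s. A s *\<^sub>R cis (lam * \<phi> s))) \<le> K * (3 + (M+1) * (6*M+1) / c) / sqrt lam"
proof -
  \<comment> \<open>The choice balances the two costs of the regularisation: the multiplier can be
    as large as \<open>1/d\<close>, and the defect \<open>lam * d\<^sup>2 / q\<close> has an
    integral of order \<open>lam * d\<close>. With \<open>lam * d\<^sup>2 = 1\<close> both are of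
    order \<open>sqrt lam\<close>.\<close>
  define d where "d = 1 / sqrt lam"
  have d: "0 < d" "d \<le> 1" "d\<^sup>2 = 1 / lam" using lam1 by (auto simp: d_def power_divide)
  have K: "K \<ge> 0" using bA(1)[of 0] by auto
  have cph: "continuous_on {0..1} \<phi>" "continuous_on {0..1} \<phi>'" "continuous_on {0..1} \<phi>''" "continuous_on {0..1} A"
    by (rule DERIV_continuous_on, erule ph ph' ph'' A)+
  define q where "q s = (\<phi>' s)\<^sup>2 + d\<^sup>2" for s
  have q: "q s > 0" "q s \<noteq> 0" for s using d(1) by (simp_all add: q_def sum_power2_gt_zero_iff)
  have cq: "continuous_on {0..1} q" unfolding q_def by (intro continuous_intros cph)
  have q': "(q has_real_derivative 2 * \<phi>' s * \<phi>'' s) (at s within {0..1})" if "s \<in> {0..1}" for s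
    unfolding q_def by (rule derivative_eq_intros ph'[OF that] refl | simp)+
  define B where "B s = \<phi>' s / q s" for s
  define B' where "B' s = \<phi>'' s * (d\<^sup>2 - (\<phi>' s)\<^sup>2) / (q s)\<^sup>2" for s
  have B: "(B has_real_derivative B' s) (at s within {0..1})" if "s \<in> {0..1}" for s
  proof -
    have "(B has_real_derivative (\<phi>'' s * q s - \<phi>' s * (2 * \<phi>' s * \<phi>'' s)) / (q s * q s)) (at s within {0..1})"
      unfolding B_def by (rule DERIV_divide[OF ph'[OF that] q'[OF that] q(2)])
    moreover have "(\<phi>'' s * q s - \<phi>' s * (2 * \<phi>' s * \<phi>'' s)) / (q s * q s) = B' s"
      by (simp add: B'_def q_def power2_eq_square algebra_simps)
    ultimately show ?thesis by simp
  qed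
  have Bb: "\<bar>B s\<bar> \<le> 1 / d" for s
  proof -
    have "2 * \<bar>\<phi>' s\<bar> * d \<le> q s"
      using sum_squares_bound[of "\<bar>\<phi>' s\<bar>" d] by (simp add: q_def)
    moreover have "0 \<le> \<bar>\<phi>' s\<bar> * d" using d by simp
    ultimately have "\<bar>\<phi>' s\<bar> * d \<le> q s" by linarith
    then have "\<bar>\<phi>' s\<bar> / q s \<le> 1 / d"
      using q(1)[of s] d(1) by (simp only: pos_divide_le_eq pos_le_divide_eq times_divide_eq_left mult_1)
    then show ?thesis using q(1)[of s] by (simp add: B_def)
  qed
  have B'b: "\<bar>B' s\<bar> \<le> M * (1 / q s)" if "s \<in> {0..1}" for s
  proof -
    have "\<bar>d\<^sup>2 - (\<phi>' s)\<^sup>2\<bar> \<le> q s" by (simp add: q_def abs_le_iff)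
    then have "\<bar>B' s\<bar> \<le> M * q s / (q s)\<^sup>2"
      using bd(1)[OF that] unfolding B'_def abs_divide abs_mult
      by (intro frac_le mult_mono) (use q in auto)
    then show ?thesis using q(2)[of s] by (simp add: power2_eq_square)
  qed
  \<comment> \<open>\<open>E\<close> supplies the boundary terms of the integration by parts. Since
    \<open>\<phi>' * B = 1 - d\<^sup>2 / q\<close>, its derivative is \<open>\<i> * lam\<close>
    times the integrand, plus \<open>E1\<close> from differentiating the amplitude, minus the defect
    \<open>E2\<close>, in which \<open>lam * d\<^sup>2\<close> has become 1.\<close>
  define E where "E s = (A s * B s) *\<^sub>R cis (lam * \<phi> s)" for s
  define E1 where "E1 s = (A' s * B s + A s * B' s) *\<^sub>R cis (lam * \<phi> s)" for s
  define E2 where "E2 s = (A s * (1 / q s)) *\<^sub>R (\<i> * cis (lam * \<phi> s))" for s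
  have cis': "((\<lambda>s. cis (lam * \<phi> s)) has_vector_derivative (lam * \<phi>' s) *\<^sub>R (\<i> * cis (lam * \<phi> s))) (at s within {0..1})"
    if "s \<in> {0..1}" for s
  proof -
    have "((\<lambda>s. lam * \<phi> s) has_vector_derivative lam * \<phi>' s) (at s within {0..1})"
      using DERIV_cmult[OF ph[OF that], of lam] by (simp add: has_real_derivative_iff_has_vector_derivative)
    moreover have "(cis has_vector_derivative \<i> * cis y) (at y within S)" for y S
      unfolding cis_conv_exp
      by (rule has_vector_derivative_real_field | rule derivative_eq_intros refl | simp)+
    ultimately show ?thesis
      using vector_diff_chain_within[of "\<lambda>s. lam * \<phi> s" "lam * \<phi>' s" s "{0..1}" cis] by (simp add: o_def)
  qed
  have E': "(E has_vector_derivative (lam *\<^sub>R (\<i> * (A s *\<^sub>R cis (lam * \<phi> s))) + E1 s - E2 s)) (at s within {0..1})"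
    if s: "s \<in> {0..1}" for s
  proof -
    have AB: "((\<lambda>s. A s * B s) has_real_derivative A' s * B s + B' s * A s) (at s within {0..1})"
      by (rule DERIV_mult[OF A[OF s] B[OF s]])
    have "(E has_vector_derivative (A s * B s) *\<^sub>R ((lam * \<phi>' s) *\<^sub>R (\<i> * cis (lam * \<phi> s)))
        + (A' s * B s + B' s * A s) *\<^sub>R cis (lam * \<phi> s)) (at s within {0..1})"
      unfolding E_def by (rule has_vector_derivative_scaleR[OF AB cis'[OF s]])
    moreover have "\<phi>' s * B s = 1 - d\<^sup>2 * (1 / q s)"
      using q[of s] by (simp add: B_def q_def field_simps power2_eq_square)
    then have "lam * A s * (\<phi>' s * B s) = lam * A s - (lam * d\<^sup>2) * (A s * (1 / q s))"
      by (simp only: right_diff_distrib mult_1_right mult_ac)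
    then have "(A s * B s) * (lam * \<phi>' s) = lam * A s - A s * (1 / q s)"
      using d(3) lam1 by (simp add: mult_ac)
    then have "(A s * B s) *\<^sub>R ((lam * \<phi>' s) *\<^sub>R (\<i> * cis (lam * \<phi> s)))
       = (lam * A s) *\<^sub>R (\<i> * cis (lam * \<phi> s)) - E2 s"
      by (simp only: scaleR_scaleR scaleR_diff_left E2_def)
    moreover have "lam *\<^sub>R (\<i> * (A s *\<^sub>R cis (lam * \<phi> s))) = (lam * A s) *\<^sub>R (\<i> * cis (lam * \<phi> s))"
      by simp
    ultimately show ?thesis
      by (simp add: E1_def mult.commute[of "B' s"] diff_add_eq)
  qed
  have cB: "continuous_on {0..1} B" "continuous_on {0..1} B'"
    unfolding B_def B'_def by (intro continuous_intros cph cq; use q in auto)+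
  have cI: "continuous_on {0..1} (\<lambda>s. A s *\<^sub>R cis (lam * \<phi> s))"
    unfolding cis_conv_exp by (intro continuous_intros cph)
  have cE: "continuous_on {0..1} E1" "continuous_on {0..1} E2"
    unfolding E1_def E2_def cis_conv_exp by (intro continuous_intros cph cB cA cq; use q in auto)+
  note int = cI[THEN integrable_continuous_interval] cE[THEN integrable_continuous_interval]
  define I where "I = integral {0..1} (\<lambda>s. A s *\<^sub>R cis (lam * \<phi> s))"
  have "((\<lambda>s. lam *\<^sub>R (\<i> * (A s *\<^sub>R cis (lam * \<phi> s))) + E1 s - E2 s) has_integral (E 1 - E 0)) {0..1}"
    by (rule fundamental_theorem_of_calculus) (use E' in auto)
  moreover have "((\<lambda>s. lam *\<^sub>R (\<i> * (A s *\<^sub>R cis (lam * \<phi> s))) + E1 s - E2 s) has_integral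
      (lam *\<^sub>R (\<i> * I) + integral {0..1} E1 - integral {0..1} E2)) {0..1}"
    unfolding I_def
    by (intro has_integral_add has_integral_diff has_integral_cmul has_integral_mult_right integrable_integral int)
  ultimately have "E 1 - E 0 = lam *\<^sub>R (\<i> * I) + integral {0..1} E1 - integral {0..1} E2"
    by (rule has_integral_unique)
  then have eq: "lam *\<^sub>R (\<i> * I) = E 1 - E 0 - integral {0..1} E1 + integral {0..1} E2"
    by simp
  \<comment> \<open>Nondegeneracy of the phase enters here: \<open>J\<close> is of order
    \<open>1/d\<close>, by the estimate for the integral of
    \<open>1 / (p\<^sup>2 + d\<^sup>2)\<close> applied to \<open>\<phi>'\<close>.\<close>
  define J where "J = integral {0..1} (\<lambda>s. 1 / q s)"
  have iq: "(\<lambda>s. 1 / q s) integrable_on {0..1}"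
    by (intro integrable_continuous_interval continuous_intros cq) (use q in auto)
  have J: "J \<le> (6*M+1) / c / d"
    unfolding J_def q_def
    by (rule integral_inverse_square_le[OF ph' ph'' cont bd c d(1,2)]) auto
  have n1: "norm (integral {0..1} E1) \<le> integral {0..1} (\<lambda>s. K * (1/d) + K * M * (1 / q s))"
  proof (rule integral_norm_bound_integral)
    show "(\<lambda>s. K * (1/d) + K * M * (1 / q s)) integrable_on {0..1}"
      by (intro integrable_continuous_interval continuous_intros cq) (use q in auto)
    fix s :: real assume s: "s \<in> {0..1}"
    have "norm (E1 s) \<le> \<bar>A' s * B s\<bar> + \<bar>A s * B' s\<bar>" by (simp add: E1_def)
    also have "\<dots> \<le> K * (1/d) + K * (M * (1 / q s))"
      unfolding abs_mult using K by (intro add_mono mult_mono bA s Bb B'b) auto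
    finally show "norm (E1 s) \<le> K * (1/d) + K * M * (1 / q s)" by simp
  qed (rule int)
  have n1': "integral {0..1} (\<lambda>s. K * (1/d) + K * M * (1 / q s)) = K * (1/d) + K * M * J"
  proof -
    have h: "(\<lambda>s. K * M * (1 / q s)) integrable_on {0..1}"
      by (intro integrable_continuous_interval continuous_intros cq) (use q in auto)
    have "integral {0..1} (\<lambda>s. K * (1/d) + K * M * (1 / q s))
        = integral {0..1} (\<lambda>s::real. K * (1/d)) + integral {0..1} (\<lambda>s. K * M * (1 / q s))"
      by (rule Henstock_Kurzweil_Integration.integral_add[OF _ h]) auto
    also have "integral {0..1} (\<lambda>s. K * M * (1 / q s)) = K * M * J"
      unfolding J_def by (rule Henstock_Kurzweil_Integration.integral_mult_right)
    finally show ?thesis by simp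
  qed
  have n2: "norm (integral {0..1} E2) \<le> integral {0..1} (\<lambda>s. K * (1 / q s))"
  proof (rule integral_norm_bound_integral)
    show "(\<lambda>s. K * (1 / q s)) integrable_on {0..1}"
      by (intro integrable_continuous_interval continuous_intros cq) (use q in auto)
    fix s :: real assume s: "s \<in> {0..1}"
    have "norm (E2 s) = \<bar>A s\<bar> * (1 / q s)" using q[of s] by (simp add: E2_def norm_mult)
    also have "\<dots> \<le> K * (1 / q s)" using bA(1)[OF s] q[of s] by (intro mult_right_mono) auto
    finally show "norm (E2 s) \<le> K * (1 / q s)" .
  qed (rule int)
  have n2': "integral {0..1} (\<lambda>s. K * (1 / q s)) = K * J"
    unfolding J_def by (rule Henstock_Kurzweil_Integration.integral_mult_right)
  have nE: "norm (E s) \<le> K * (1/d)" if "s \<in> {0..1}" for s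
  proof -
    have "\<bar>A s * B s\<bar> \<le> K * (1/d)"
      unfolding abs_mult using K d by (intro mult_mono bA that Bb) auto
    then show ?thesis by (simp add: E_def)
  qed
  have "lam * norm I = norm (lam *\<^sub>R (\<i> * I))" using lam1 by (simp add: norm_mult)
  also have "\<dots> \<le> norm (E 1) + norm (E 0) + norm (integral {0..1} E1) + norm (integral {0..1} E2)"
    unfolding eq
    by (rule order_trans[OF norm_triangle_ineq add_right_mono[OF order_trans[OF norm_triangle_ineq4 add_right_mono[OF norm_triangle_ineq4]]]])
  also have "\<dots> \<le> K * (1/d) + K * (1/d) + (K * (1/d) + K * M * J) + K * J"
    using nE[of 0] nE[of 1] n1 n2 n1' n2' by simp
  also have "\<dots> = K * (3/d + (M+1) * J)" by (simp add: algebra_simps)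
  also have "\<dots> \<le> K * (3/d + (M+1) * ((6*M+1) / c / d))"
    using J K bd(1)[of 0] by (intro mult_left_mono add_left_mono) auto
  also have "\<dots> = K * (3 + (M+1) * (6*M+1) / c) * sqrt lam"
  proof -
    have "1 / d = sqrt lam" by (simp add: d_def)
    then have "x / d = x * sqrt lam" for x by (metis times_divide_eq_right mult.right_neutral)
    then show ?thesis by (simp add: algebra_simps)
  qed
  finally have "norm I \<le> K * (3 + (M+1) * (6*M+1) / c) * sqrt lam / lam"
    using lam1 by (simp add: field_simps)
  also have "sqrt lam / lam = 1 / sqrt lam" using lam1 by (simp add: real_div_sqrt field_simps)
  then have "K * (3 + (M+1) * (6*M+1) / c) * sqrt lam / lam = K * (3 + (M+1) * (6*M+1) / c) / sqrt lam"
    by (metis times_divide_eq_right mult.right_neutral)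
  finally show ?thesis unfolding I_def .
qed

section \<open>Amplitudes with uniform C1 bounds\<close>

text \<open>A single constant serves the amplitude and its derivative, so that van der Corput's
  bound becomes uniform over families of amplitudes that depend on the direction of the frequency
  and on the distance \<open>t\<close>.\<close>

definition C1_bound :: "real \<Rightarrow> (real \<Rightarrow> real) \<Rightarrow> bool" where
  "C1_bound K A \<longleftrightarrow> (\<exists>A'. (\<forall>s\<in>{0..1}. (A has_real_derivative A' s) (at s within {0..1}) \<and>
      \<bar>A s\<bar> \<le> K \<and> \<bar>A' s\<bar> \<le> K) \<and> continuous_on {0..1} A')"

lemma abs_mult_le:
  fixes x y a b :: real
  assumes "\<bar>x\<bar> \<le> a" "\<bar>y\<bar> \<le> b" shows "\<bar>x * y\<bar> \<le> a * b"
  unfolding abs_mult using assms by (intro mult_mono) auto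

lemma C1_boundI:
  assumes "\<And>s. s \<in> {0..1} \<Longrightarrow> (A has_real_derivative A' s) (at s within {0..1})"
    "\<And>s. s \<in> {0..1} \<Longrightarrow> \<bar>A s\<bar> \<le> K" "\<And>s. s \<in> {0..1} \<Longrightarrow> \<bar>A' s\<bar> \<le> K" "continuous_on {0..1} A'"
  shows "C1_bound K A"
  using assms unfolding C1_bound_def by blast

lemma C1_bound_mult:
  assumes "C1_bound K A" "C1_bound L B" shows "C1_bound (2*K*L) (\<lambda>s. A s * B s)"
proof -
  obtain A' where A: "\<forall>s\<in>{0..1}. (A has_real_derivative A' s) (at s within {0..1}) \<and>
      \<bar>A s\<bar> \<le> K \<and> \<bar>A' s\<bar> \<le> K" "continuous_on {0..1} A'" using assms(1) unfolding C1_bound_def by blast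
  obtain B' where B: "\<forall>s\<in>{0..1}. (B has_real_derivative B' s) (at s within {0..1}) \<and>
      \<bar>B s\<bar> \<le> L \<and> \<bar>B' s\<bar> \<le> L" "continuous_on {0..1} B'" using assms(2) unfolding C1_bound_def by blast
  have c: "continuous_on {0..1} A" "continuous_on {0..1} B" using A(1) B(1) by (auto intro!: DERIV_continuous_on)
  have KL: "0 \<le> K" "0 \<le> L" using A(1) B(1) by fastforce+
  have m: "\<bar>x * y\<bar> \<le> K * L" if "\<bar>x\<bar> \<le> K" "\<bar>y\<bar> \<le> L" for x y
    unfolding abs_mult using that KL by (intro mult_mono) auto
  show ?thesis
  proof (rule C1_boundI)
    fix s :: real assume s: "s \<in> {0..1}"
    show "((\<lambda>s. A s * B s) has_real_derivative (A' s * B s + B' s * A s)) (at s within {0..1})"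
      using A(1) B(1) s by (intro DERIV_mult) auto
    have "\<bar>A s * B s\<bar> \<le> K * L" using A B s by (intro m) auto
    then show "\<bar>A s * B s\<bar> \<le> 2*K*L" using KL by (simp add: mult.assoc)
    have "\<bar>A' s * B s\<bar> \<le> K * L" "\<bar>A s * B' s\<bar> \<le> K * L" using A B s by (intro m; auto)+
    then show "\<bar>A' s * B s + B' s * A s\<bar> \<le> 2*K*L" by (simp add: mult.commute[of "B' s"]) 
  qed (intro continuous_intros A B c)
qed

lemma C1_bound_add:
  assumes "C1_bound K A" "C1_bound L B" shows "C1_bound (K+L) (\<lambda>s. A s + B s)"
proof -
  obtain A' where A: "\<forall>s\<in>{0..1}. (A has_real_derivative A' s) (at s within {0..1}) \<and>
      \<bar>A s\<bar> \<le> K \<and> \<bar>A' s\<bar> \<le> K" "continuous_on {0..1} A'" using assms(1) unfolding C1_bound_def by blast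
  obtain B' where B: "\<forall>s\<in>{0..1}. (B has_real_derivative B' s) (at s within {0..1}) \<and>
      \<bar>B s\<bar> \<le> L \<and> \<bar>B' s\<bar> \<le> L" "continuous_on {0..1} B'" using assms(2) unfolding C1_bound_def by blast
  have "((\<lambda>s. A s + B s) has_real_derivative (A' s + B' s)) (at s within {0..1}) \<and>
      \<bar>A s + B s\<bar> \<le> K + L \<and> \<bar>A' s + B' s\<bar> \<le> K + L" if "s \<in> {0..1}" for s
    using A(1) B(1) that by (auto intro!: DERIV_add) (smt (verit) atLeastAtMost_iff)+
  then show ?thesis using A(2) B(2) unfolding C1_bound_def
    by (intro exI[of _ "\<lambda>s. A' s + B' s"]) (auto intro: continuous_on_add)
qed

lemma C1_bound_uminus: "C1_bound K A \<Longrightarrow> C1_bound K (\<lambda>s. - A s)"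
proof -
  assume "C1_bound K A"
  then obtain A' where A: "\<forall>s\<in>{0..1}. (A has_real_derivative A' s) (at s within {0..1}) \<and>
      \<bar>A s\<bar> \<le> K \<and> \<bar>A' s\<bar> \<le> K" "continuous_on {0..1} A'" unfolding C1_bound_def by blast
  then show ?thesis
    by (intro C1_boundI[where A'="\<lambda>s. - A' s"] DERIV_minus continuous_on_minus) auto
qed

lemma has_vector_derivative_cis:
  assumes "(g has_real_derivative g') (at x within S)"
  shows "((\<lambda>s. cis (g s)) has_vector_derivative g' *\<^sub>R (\<i> * cis (g x))) (at x within S)"
proof -
  have "(cis has_vector_derivative \<i> * cis y) (at y within T)" for y T
    unfolding cis_conv_exp
    by (rule has_vector_derivative_real_field | rule derivative_eq_intros refl | simp)+
  with assms show ?thesis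
    using vector_diff_chain_within[of g g' x S cis] by (simp add: o_def has_real_derivative_iff_has_vector_derivative)
qed

lemma continuous_on_cis [continuous_intros]:
  "continuous_on S g \<Longrightarrow> continuous_on S (\<lambda>x. cis (g x))"
  unfolding cis_conv_exp by (intro continuous_intros)

text \<open>Combines the trivial bound \<open>2*K\<close>, from length at most 2, with the bound
  \<open>4*K / |\<Lambda>|\<close> from one integration by parts; the denominator
  \<open>1 + |\<Lambda>|\<close> keeps the result finite when the phase is constant.\<close>

lemma integral_cis_linear_le:
  fixes H H' :: "real \<Rightarrow> real"
  assumes ab: "a \<le> b" "b - a \<le> 2"
    and H: "\<And>u. u \<in> {a..b} \<Longrightarrow> (H has_real_derivative H' u) (at u within {a..b})"
    and cH': "continuous_on {a..b} H'"
    and K: "\<And>u. u \<in> {a..b} \<Longrightarrow> \<bar>H u\<bar> \<le> K" "\<And>u. u \<in> {a..b} \<Longrightarrow> \<bar>H' u\<bar> \<le> K"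
  shows "norm (integral {a..b} (\<lambda>u. H u *\<^sub>R cis (\<Lambda> * u))) \<le> 8 * K / (1 + \<bar>\<Lambda>\<bar>)"
proof -
  have K0: "K \<ge> 0" using K(1)[of a] ab by auto
  have cH: "continuous_on {a..b} H" by (rule DERIV_continuous_on, erule H)
  have i: "(\<lambda>u. H u *\<^sub>R cis (\<Lambda> * u)) integrable_on {a..b}" "(\<lambda>u. H' u *\<^sub>R cis (\<Lambda> * u)) integrable_on {a..b}"
    by (intro integrable_continuous_interval continuous_intros cH cH')+
  have triv: "norm (integral {a..b} (\<lambda>u. h u *\<^sub>R cis (\<Lambda> * u))) \<le> 2 * K"
    if "(\<lambda>u. h u *\<^sub>R cis (\<Lambda> * u)) integrable_on {a..b}" "\<And>u. u \<in> {a..b} \<Longrightarrow> \<bar>h u\<bar> \<le> K" for h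
  proof -
    have "norm (integral {a..b} (\<lambda>u. h u *\<^sub>R cis (\<Lambda> * u))) \<le> integral {a..b} (\<lambda>u. K)"
      by (rule integral_norm_bound_integral[OF that(1)]) (use that in auto)
    also have "\<dots> = (b - a) * K" using ab by simp
    also have "\<dots> \<le> 2 * K" using ab K0 by (intro mult_right_mono) auto
    finally show ?thesis .
  qed
  let ?I = "integral {a..b} (\<lambda>u. H u *\<^sub>R cis (\<Lambda> * u))"
  have "((\<lambda>u. \<Lambda> *\<^sub>R (\<i> * (H u *\<^sub>R cis (\<Lambda> * u))) + H' u *\<^sub>R cis (\<Lambda> * u)) has_integral
      (H b *\<^sub>R cis (\<Lambda> * b) - H a *\<^sub>R cis (\<Lambda> * a))) {a..b}"
  proof (rule fundamental_theorem_of_calculus[OF ab(1)])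
    fix u assume u: "u \<in> {a..b}"
    have "((\<lambda>u. \<Lambda> * u) has_real_derivative \<Lambda>) (at u within {a..b})"
      by (rule derivative_eq_intros refl | simp)+
    from has_vector_derivative_scaleR[OF H[OF u] has_vector_derivative_cis[OF this]]
    show "((\<lambda>u. H u *\<^sub>R cis (\<Lambda> * u)) has_vector_derivative (\<Lambda> *\<^sub>R (\<i> * (H u *\<^sub>R cis (\<Lambda> * u))) + H' u *\<^sub>R cis (\<Lambda> * u))) (at u within {a..b})"
      by (simp add: mult.commute)
  qed
  moreover have "((\<lambda>u. \<Lambda> *\<^sub>R (\<i> * (H u *\<^sub>R cis (\<Lambda> * u))) + H' u *\<^sub>R cis (\<Lambda> * u)) has_integral
      (\<Lambda> *\<^sub>R (\<i> * ?I) + integral {a..b} (\<lambda>u. H' u *\<^sub>R cis (\<Lambda> * u)))) {a..b}"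
    by (intro has_integral_add has_integral_cmul has_integral_mult_right integrable_integral i)
  ultimately have eq: "\<Lambda> *\<^sub>R (\<i> * ?I) = H b *\<^sub>R cis (\<Lambda> * b) - H a *\<^sub>R cis (\<Lambda> * a) - integral {a..b} (\<lambda>u. H' u *\<^sub>R cis (\<Lambda> * u))"
    by (metis (no_types, lifting) add_diff_cancel_right' has_integral_unique)
  have "\<bar>\<Lambda>\<bar> * norm ?I = norm (\<Lambda> *\<^sub>R (\<i> * ?I))" by (simp add: norm_mult)
  also have "\<dots> \<le> \<bar>H b\<bar> + \<bar>H a\<bar> + norm (integral {a..b} (\<lambda>u. H' u *\<^sub>R cis (\<Lambda> * u)))"
    unfolding eq by (rule order_trans[OF norm_triangle_ineq4 add_right_mono], rule order_trans[OF norm_triangle_ineq4]) auto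
  also have "\<dots> \<le> K + K + 2 * K"
    using ab by (intro add_mono K triv i) auto
  finally have 1: "\<bar>\<Lambda>\<bar> * norm ?I \<le> 4 * K" by simp
  have 2: "norm ?I \<le> 2 * K" by (rule triv[OF i(1)]) (use K in auto)
  have "norm ?I * (1 + \<bar>\<Lambda>\<bar>) \<le> 8 * K" using 1 2 K0 by (simp add: algebra_simps)
  then show ?thesis by (simp add: pos_le_divide_eq)
qed

text \<open>\<open>\<mu>\<close> is the signed curvature times the speed \<open>v\<close>, and \<open>v + t \<mu>\<close> is the speed of the parallel curve
  at distance \<open>t\<close>.\<close>

locale moving_frame =
  fixes \<gamma> \<tau> \<nu> :: "real \<Rightarrow> real^2" and v v1 v2 \<mu> \<mu>1 \<mu>2 :: "real \<Rightarrow> real" and K c0 e0 :: real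
  assumes d\<gamma>: "\<And>s. s \<in> {0..1} \<Longrightarrow> (\<gamma> has_vector_derivative v s *\<^sub>R \<tau> s) (at s within {0..1})"
    and d\<tau>: "\<And>s. s \<in> {0..1} \<Longrightarrow> (\<tau> has_vector_derivative - (\<mu> s *\<^sub>R \<nu> s)) (at s within {0..1})"
    and d\<nu>: "\<And>s. s \<in> {0..1} \<Longrightarrow> (\<nu> has_vector_derivative \<mu> s *\<^sub>R \<tau> s) (at s within {0..1})"
    and dv: "\<And>s. s \<in> {0..1} \<Longrightarrow> (v has_real_derivative v1 s) (at s within {0..1})"
    and dv1: "\<And>s. s \<in> {0..1} \<Longrightarrow> (v1 has_real_derivative v2 s) (at s within {0..1})"
    and d\<mu>: "\<And>s. s \<in> {0..1} \<Longrightarrow> (\<mu> has_real_derivative \<mu>1 s) (at s within {0..1})"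
    and d\<mu>1: "\<And>s. s \<in> {0..1} \<Longrightarrow> (\<mu>1 has_real_derivative \<mu>2 s) (at s within {0..1})"
    and c2: "continuous_on {0..1} v2" "continuous_on {0..1} \<mu>2"
    and frame: "\<And>s. s \<in> {0..1} \<Longrightarrow> norm (\<tau> s) = 1" "\<And>s. s \<in> {0..1} \<Longrightarrow> norm (\<nu> s) = 1"
       "\<And>s. s \<in> {0..1} \<Longrightarrow> \<tau> s \<bullet> \<nu> s = 0"
    and bound: "\<And>s g. s \<in> {0..1} \<Longrightarrow> g \<in> {v, v1, v2, \<mu>, \<mu>1, \<mu>2} \<Longrightarrow> \<bar>g s\<bar> \<le> K"
    and K: "1 \<le> K" and c0: "0 < c0" and e0: "0 < e0" "e0 \<le> 1"
    and nondeg: "\<And>s. s \<in> {0..1} \<Longrightarrow> c0 \<le> \<bar>\<mu> s\<bar>"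
      "\<And>s t. s \<in> {0..1} \<Longrightarrow> \<bar>t\<bar> \<le> e0 \<Longrightarrow> c0 \<le> v s + t * \<mu> s"
begin

lemma parseval2:
  assumes "s \<in> {0..1}" "norm \<omega> = 1"
  shows "(\<omega> \<bullet> \<tau> s)\<^sup>2 + (\<omega> \<bullet> \<nu> s)\<^sup>2 = 1"
proof -
  have t: "\<tau> s$1^2 + \<tau> s$2^2 = 1" "\<nu> s$1^2 + \<nu> s$2^2 = 1" "\<tau> s$1 * \<nu> s$1 + \<tau> s$2 * \<nu> s$2 = 0" "\<omega>$1^2 + \<omega>$2^2 = 1"
    using frame[OF assms(1)] assms(2)
    by (simp_all add: norm_vec_def L2_set_def sum_2 inner_vec_def)
  have "((\<omega> \<bullet> \<tau> s)\<^sup>2 + (\<omega> \<bullet> \<nu> s)\<^sup>2 - 1) = 0"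
    using t unfolding inner_vec_def sum_2 inner_real_def by algebra
  then show ?thesis by simp
qed

lemma abs_inner_le1:
  assumes "s \<in> {0..1}" "norm \<omega> = 1"
  shows "\<bar>\<omega> \<bullet> \<tau> s\<bar> \<le> 1" "\<bar>\<omega> \<bullet> \<nu> s\<bar> \<le> 1"
  using Cauchy_Schwarz_ineq2[of \<omega>] frame[OF assms(1)] assms(2) by (metis mult_1)+

lemma dp: "s \<in> {0..1} \<Longrightarrow> ((\<lambda>s. \<omega> \<bullet> \<tau> s) has_real_derivative - (\<mu> s * (\<omega> \<bullet> \<nu> s))) (at s within {0..1})"
  using bounded_linear.has_vector_derivative[OF bounded_linear_inner_right d\<tau>, of s \<omega>]
  by (simp add: has_real_derivative_iff_has_vector_derivative)

lemma dr: "s \<in> {0..1} \<Longrightarrow> ((\<lambda>s. \<omega> \<bullet> \<nu> s) has_real_derivative \<mu> s * (\<omega> \<bullet> \<tau> s)) (at s within {0..1})"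
  using bounded_linear.has_vector_derivative[OF bounded_linear_inner_right d\<nu>, of s \<omega>]
  by (simp add: has_real_derivative_iff_has_vector_derivative)

lemma dg: "s \<in> {0..1} \<Longrightarrow> ((\<lambda>s. \<omega> \<bullet> \<gamma> s) has_real_derivative v s * (\<omega> \<bullet> \<tau> s)) (at s within {0..1})"
  using bounded_linear.has_vector_derivative[OF bounded_linear_inner_right d\<gamma>, of s \<omega>]
  by (simp add: has_real_derivative_iff_has_vector_derivative)

definition w :: "real \<Rightarrow> real \<Rightarrow> real" where "w t s = v s + t * \<mu> s"
definition w1 :: "real \<Rightarrow> real \<Rightarrow> real" where "w1 t s = v1 s + t * \<mu>1 s"
definition w2 :: "real \<Rightarrow> real \<Rightarrow> real" where "w2 t s = v2 s + t * \<mu>2 s"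

lemma dw: "s \<in> {0..1} \<Longrightarrow> (w t has_real_derivative w1 t s) (at s within {0..1})"
  unfolding w_def[abs_def] w1_def by (intro DERIV_add DERIV_cmult dv d\<mu>)

lemma dw1: "s \<in> {0..1} \<Longrightarrow> (w1 t has_real_derivative w2 t s) (at s within {0..1})"
  unfolding w1_def[abs_def] w2_def by (intro DERIV_add DERIV_cmult dv1 d\<mu>1)

lemma conts: "continuous_on {0..1} v" "continuous_on {0..1} v1" "continuous_on {0..1} \<mu>" "continuous_on {0..1} \<mu>1"
    "continuous_on {0..1} \<gamma>" "continuous_on {0..1} \<tau>" "continuous_on {0..1} \<nu>"
  by ((rule DERIV_continuous_on, erule dv dv1 d\<mu> d\<mu>1)+,
      (rule continuous_on_vector_derivative, erule d\<gamma>), (rule continuous_on_vector_derivative, erule d\<tau>),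
      (rule continuous_on_vector_derivative, erule d\<nu>))

lemma w_ge: "s \<in> {0..1} \<Longrightarrow> \<bar>t\<bar> \<le> e0 \<Longrightarrow> c0 \<le> w t s"
  using nondeg(2) by (simp add: w_def)

lemma w_bounds:
  assumes "s \<in> {0..1}" "\<bar>t\<bar> \<le> e0"
  shows "\<bar>w t s\<bar> \<le> 2*K" "\<bar>w1 t s\<bar> \<le> 2*K" "\<bar>w2 t s\<bar> \<le> 2*K"
proof -
  have *: "\<bar>x + t * y\<bar> \<le> 2 * K" if "\<bar>x\<bar> \<le> K" "\<bar>y\<bar> \<le> K" for x y
  proof -
    have "\<bar>t * y\<bar> \<le> 1 * K" unfolding abs_mult using assms e0 that K by (intro mult_mono) auto
    then show ?thesis using that by linarith
  qed
  show "\<bar>w t s\<bar> \<le> 2*K" "\<bar>w1 t s\<bar> \<le> 2*K" "\<bar>w2 t s\<bar> \<le> 2*K"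
    unfolding w_def w1_def w2_def by (intro * bound assms; simp)+
qed

text \<open>The phase has first derivative \<open>w * p\<close> and second derivative
  \<open>w1 * p - w * \<mu> * r\<close>, where \<open>p\<close> and \<open>r\<close> are the
  components of \<open>\<omega>\<close> along the tangent and the normal. Since
  \<open>p\<^sup>2 + r\<^sup>2 = 1\<close> and both \<open>w\<close> and \<open>|\<mu>|\<close> are
  at least \<open>c0\<close>, the two derivatives cannot be small together. The constant is fixed
  before direction, distance, frequency and amplitude.\<close>

lemma vdC:
  "\<exists>C\<ge>0. \<forall>\<omega> t lam A L. norm \<omega> = 1 \<longrightarrow> \<bar>t\<bar> \<le> e0 \<longrightarrow> 1 \<le> lam \<longrightarrow> C1_bound L A \<longrightarrow>
     norm (integral {0..1} (\<lambda>s. A s *\<^sub>R cis (lam * (\<omega> \<bullet> \<gamma> s + t * (\<omega> \<bullet> \<nu> s))))) \<le> C * L / sqrt lam"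
proof -
  \<comment> \<open>As \<open>K \<ge> 1\<close>, all powers of \<open>K\<close> in the bounds for
    \<open>f2\<close> and \<open>f3\<close> are absorbed in \<open>K^3\<close>. \<open>Lc\<close>
    gathers the coefficients with which \<open>1 = p\<^sup>2 + r\<^sup>2\<close> is bounded by
    \<open>f1\<^sup>2\<close> and \<open>f2\<^sup>2\<close>.\<close>
  define M where "M = 20 * K^3"
  define Lc where "Lc = 1/c0^2 + 8*K^2/(c0^4*c0^2) + 2/(c0^2*c0^2)"
  define c where "c = 1 / Lc"
  have Lc: "Lc > 0" unfolding Lc_def using c0 K by (intro add_pos_pos add_pos_nonneg) auto
  have M0: "0 \<le> M" using K by (simp add: M_def)
  define C where "C = 3 + (M+1) * (6*M+1) / c"
  have C0: "C \<ge> 0" using Lc M0 by (simp add: C_def c_def)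
  have "norm (integral {0..1} (\<lambda>s. A s *\<^sub>R cis (lam * (\<omega> \<bullet> \<gamma> s + t * (\<omega> \<bullet> \<nu> s))))) \<le> C * L / sqrt lam"
    if \<omega>: "norm \<omega> = 1" and t: "\<bar>t\<bar> \<le> e0" and lam1: "1 \<le> lam" and A: "C1_bound L A" for \<omega> t lam A L
  proof -
    obtain A' where A': "\<forall>s\<in>{0..1}. (A has_real_derivative A' s) (at s within {0..1}) \<and>
      \<bar>A s\<bar> \<le> L \<and> \<bar>A' s\<bar> \<le> L" "continuous_on {0..1} A'" using A unfolding C1_bound_def by blast
    let ?p = "\<lambda>s. \<omega> \<bullet> \<tau> s" let ?r = "\<lambda>s. \<omega> \<bullet> \<nu> s"
    define f1 where "f1 s = w t s * ?p s" for s
    define f2 where "f2 s = w1 t s * ?p s - w t s * \<mu> s * ?r s" for s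
    define f3 where "f3 s = w2 t s * ?p s - w1 t s * \<mu> s * ?r s - (w1 t s * \<mu> s + w t s * \<mu>1 s) * ?r s - w t s * \<mu> s * \<mu> s * ?p s" for s
    have "norm (integral {0..1} (\<lambda>s. A s *\<^sub>R cis (lam * (\<omega> \<bullet> \<gamma> s + t * (\<omega> \<bullet> \<nu> s))))) \<le> L * (3 + (M+1) * (6*M+1) / c) / sqrt lam"
    proof (rule van_der_Corput[where \<phi>' = f1 and \<phi>'' = f2 and \<phi>''' = f3])
      fix s :: real assume s: "s \<in> {0..1}"
      show "((\<lambda>s. \<omega> \<bullet> \<gamma> s + t * (\<omega> \<bullet> \<nu> s)) has_real_derivative f1 s) (at s within {0..1})"
        by (rule DERIV_cong[OF DERIV_add[OF dg[OF s] DERIV_cmult[OF dr[OF s]]]]) (simp add: f1_def w_def algebra_simps)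
      show "(f1 has_real_derivative f2 s) (at s within {0..1})"
        unfolding f1_def[abs_def]
        by (rule DERIV_cong[OF DERIV_mult[OF dw[OF s] dp[OF s]]]) (simp add: f2_def algebra_simps)
      show "(f2 has_real_derivative f3 s) (at s within {0..1})"
        unfolding f2_def[abs_def]
        by (rule DERIV_cong[OF DERIV_diff[OF DERIV_mult[OF dw1[OF s] dp[OF s]] DERIV_mult[OF DERIV_mult[OF dw[OF s] d\<mu>[OF s]] dr[OF s]]]])
           (simp add: f3_def algebra_simps)
      note wb = w_bounds[OF s t] and ib = abs_inner_le1[OF s \<omega>]
      have mb: "\<bar>\<mu> s\<bar> \<le> K" "\<bar>\<mu>1 s\<bar> \<le> K" using bound[OF s] by auto
      have K0: "0 \<le> K" using K by simp
      have KK: "K \<le> K^3" "K^2 \<le> K^3" using K power_increasing[of 1 3 K] power_increasing[of 2 3 K] by auto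
      have a1: "\<bar>w1 t s * ?p s\<bar> \<le> 2*K * 1" "\<bar>w2 t s * ?p s\<bar> \<le> 2*K*1"
        by (intro abs_mult_le wb ib)+
      have a2: "\<bar>w t s * \<mu> s * ?r s\<bar> \<le> 2*K*K*1" "\<bar>w1 t s * \<mu> s * ?r s\<bar> \<le> 2*K*K*1" "\<bar>w t s * \<mu>1 s * ?r s\<bar> \<le> 2*K*K*1"
        by (intro abs_mult_le wb ib mb)+
      have a3: "\<bar>w t s * \<mu> s * \<mu> s * ?p s\<bar> \<le> 2*K*K*K*1"
        by (intro abs_mult_le wb ib mb)
      have e: "2*K*K*K*1 = 2*K^3" "2*K*K*1 = 2*K^2" by (simp_all add: power2_eq_square power3_eq_cube)
      have "\<bar>f2 s\<bar> \<le> 2*K + 2*K^2" using a1(1) a2(1) unfolding f2_def e by linarith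
      also have "\<dots> \<le> M" unfolding M_def using KK K by linarith
      finally show "\<bar>f2 s\<bar> \<le> M" .
      have "f3 s = w2 t s * ?p s - w1 t s * \<mu> s * ?r s - w1 t s * \<mu> s * ?r s - w t s * \<mu>1 s * ?r s - w t s * \<mu> s * \<mu> s * ?p s"
        by (simp add: f3_def algebra_simps)
      then have "\<bar>f3 s\<bar> \<le> 2*K + 6*K^2 + 2*K^3" using a1(2) a2(2,3) a3 unfolding e by linarith
      also have "\<dots> \<le> M" unfolding M_def using KK K by linarith
      finally show "\<bar>f3 s\<bar> \<le> M" .
      have wg: "c0 \<le> w t s" by (rule w_ge[OF s t])
      have p2: "(?p s)\<^sup>2 \<le> (f1 s)\<^sup>2 * (1/c0^2)"
      proof -
        have "c0^2 * (?p s)\<^sup>2 \<le> (w t s)^2 * (?p s)\<^sup>2" using wg c0 by (intro mult_right_mono power_mono) auto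
        then show ?thesis using c0 by (simp add: f1_def power_mult_distrib field_simps)
      qed
      \<comment> \<open>\<open>w * \<mu> * r = w1 * p - f2\<close>, so the normal component is
        controlled by \<open>f2\<close> and, through \<open>p\<close>, by \<open>f1\<close>.\<close>
      have r2: "(?r s)\<^sup>2 \<le> (f2 s)\<^sup>2 * (2/(c0^2*c0^2)) + (f1 s)\<^sup>2 * (8*K^2/(c0^4*c0^2))"
      proof -
        have "c0 * c0 \<le> w t s * \<bar>\<mu> s\<bar>" using wg nondeg(1)[OF s] c0 by (intro mult_mono) auto
        then have "(c0 * c0)\<^sup>2 \<le> (w t s * \<bar>\<mu> s\<bar>)\<^sup>2" using c0 by (intro power_mono) auto
        then have "(c0*c0)\<^sup>2 * (?r s)\<^sup>2 \<le> (w t s * \<mu> s * ?r s)\<^sup>2" by (simp add: power_mult_distrib mult_right_mono)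
        also have "\<dots> = (w1 t s * ?p s - f2 s)\<^sup>2" by (simp add: f2_def)
        also have "\<dots> \<le> 2 * (w1 t s * ?p s)\<^sup>2 + 2 * (f2 s)\<^sup>2"
          using zero_le_power2[of "w1 t s * ?p s + f2 s"] by (simp add: power2_sum power2_diff)
        also have "(w1 t s * ?p s)\<^sup>2 \<le> (2*K)\<^sup>2 * ((f1 s)\<^sup>2 * (1/c0^2))"
        proof -
          have "(w1 t s)\<^sup>2 \<le> (2*K)\<^sup>2" using power_mono[OF wb(2), of 2] by simp
          then show ?thesis unfolding power_mult_distrib[of "w1 t s"] by (intro mult_mono p2) auto
        qed
        finally have "(c0*c0)\<^sup>2 * (?r s)\<^sup>2 \<le> 2 * ((2*K)\<^sup>2 * ((f1 s)\<^sup>2 * (1/c0^2))) + 2 * (f2 s)\<^sup>2" by simp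
        then have "(?r s)\<^sup>2 \<le> (2 * ((2*K)\<^sup>2 * ((f1 s)\<^sup>2 * (1/c0^2))) + 2 * (f2 s)\<^sup>2) / (c0*c0)\<^sup>2"
          using c0 by (simp add: pos_le_divide_eq mult.commute)
        also have "\<dots> = (f2 s)\<^sup>2 * (2/(c0^2*c0^2)) + (f1 s)\<^sup>2 * (8*K^2/(c0^4*c0^2))"
          using c0 by (simp add: add_divide_distrib power_mult_distrib power2_eq_square power4_eq_xxxx mult_ac)
        finally show ?thesis .
      qed
      have "1 = (?p s)\<^sup>2 + (?r s)\<^sup>2" using parseval2[OF s \<omega>] by simp
      also have "\<dots> \<le> (f1 s)\<^sup>2 * (1/c0^2 + 8*K^2/(c0^4*c0^2)) + (f2 s)\<^sup>2 * (2/(c0^2*c0^2))"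
        using p2 r2 by (simp add: distrib_left)
      also have "\<dots> \<le> (f1 s)\<^sup>2 * Lc + (f2 s)\<^sup>2 * Lc"
      proof -
        have "0 \<le> 8*K^2/(c0^4*c0^2)" "0 \<le> 2/(c0^2*c0^2)" "0 \<le> 1/c0^2" using c0 by simp_all
        then have "1/c0^2 + 8*K^2/(c0^4*c0^2) \<le> Lc" "2/(c0^2*c0^2) \<le> Lc" unfolding Lc_def by linarith+
        then show ?thesis by (intro add_mono mult_left_mono) auto
      qed
      finally show "c \<le> (f1 s)\<^sup>2 + (f2 s)\<^sup>2" using Lc by (simp add: c_def divide_le_eq distrib_right)
      show "(A has_real_derivative A' s) (at s within {0..1})" "\<bar>A s\<bar> \<le> L" "\<bar>A' s\<bar> \<le> L" using A'(1) s by auto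
    next
      show "continuous_on {0..1} f3" unfolding f3_def[abs_def] w_def w1_def w2_def
        by (intro continuous_intros conts c2)
      show "0 < c" using Lc by (simp add: c_def)
    qed (use A' lam1 in auto)
    then show ?thesis by (simp add: C_def mult.commute)
  qed
  then show ?thesis using C0 by blast
qed


section \<open>Bounds for the amplitudes left by integration by parts\<close>

lemma C1_bound_p:
  assumes "norm \<omega> = 1" shows "C1_bound K (\<lambda>s. \<omega> \<bullet> \<tau> s)"
proof (rule C1_boundI[OF dp], assumption)
  fix s :: real assume s: "s \<in> {0..1}"
  show "\<bar>\<omega> \<bullet> \<tau> s\<bar> \<le> K" using abs_inner_le1[OF s assms] K by linarith
  have "\<bar>\<mu> s * (\<omega> \<bullet> \<nu> s)\<bar> \<le> K * 1"
    unfolding abs_mult using abs_inner_le1[OF s assms] bound[OF s] K by (intro mult_mono) auto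
  then show "\<bar>- (\<mu> s * (\<omega> \<bullet> \<nu> s))\<bar> \<le> K" by simp
qed (intro continuous_intros conts)+

lemma C1_bound_r:
  assumes "norm \<omega> = 1" shows "C1_bound K (\<lambda>s. \<omega> \<bullet> \<nu> s)"
proof (rule C1_boundI[OF dr], assumption)
  fix s :: real assume s: "s \<in> {0..1}"
  show "\<bar>\<omega> \<bullet> \<nu> s\<bar> \<le> K" using abs_inner_le1[OF s assms] K by linarith
  have "\<bar>\<mu> s * (\<omega> \<bullet> \<tau> s)\<bar> \<le> K * 1"
    unfolding abs_mult using abs_inner_le1[OF s assms] bound[OF s] K by (intro mult_mono) auto
  then show "\<bar>\<mu> s * (\<omega> \<bullet> \<tau> s)\<bar> \<le> K" by simp
qed (intro continuous_intros conts)+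

lemma C1_bound_mu: "C1_bound K \<mu>"
  by (rule C1_boundI[OF d\<mu>]) (auto intro: bound conts)

lemma continuous_w: "continuous_on {0..1} (w t)" "continuous_on {0..1} (w1 t)" "continuous_on {0..1} (w2 t)"
  unfolding w_def[abs_def] w1_def[abs_def] w2_def[abs_def] by (intro continuous_intros conts c2)+

lemma C1_bound_w1: "\<bar>t\<bar> \<le> e0 \<Longrightarrow> C1_bound (2*K) (w1 t)"
  by (rule C1_boundI[OF dw1]) (auto intro: w_bounds continuous_w)

lemma d_inverse_w:
  assumes s: "s \<in> {0..1}" and t: "\<bar>t\<bar> \<le> e0"
  shows "((\<lambda>s. 1 / w t s) has_real_derivative - (w1 t s * (1 / w t s) * (1 / w t s))) (at s within {0..1})"
proof -
  have "w t s \<noteq> 0" using w_ge[OF s t] c0 by auto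
  from DERIV_inverse_fun[OF dw[OF s] this] show ?thesis by (simp add: inverse_eq_divide power2_eq_square)
qed

lemma inverse_w_bound: "s \<in> {0..1} \<Longrightarrow> \<bar>t\<bar> \<le> e0 \<Longrightarrow> \<bar>1 / w t s\<bar> \<le> 1 / c0"
  using w_ge[of s t] c0 by (simp add: frac_le)

lemma continuous_inverse_w: "\<bar>t\<bar> \<le> e0 \<Longrightarrow> continuous_on {0..1} (\<lambda>s. 1 / w t s)"
  using w_ge[of _ t] c0 by (intro continuous_intros continuous_w) force

lemma C1_bound_inverse_w:
  assumes t: "\<bar>t\<bar> \<le> e0" shows "C1_bound (1/c0 + 2*K*(1/c0)*(1/c0)) (\<lambda>s. 1 / w t s)"
proof (rule C1_boundI[OF d_inverse_w[OF _ t]], assumption)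
  fix s :: real assume s: "s \<in> {0..1}"
  show "\<bar>1 / w t s\<bar> \<le> 1/c0 + 2*K*(1/c0)*(1/c0)" using inverse_w_bound[OF s t] K c0 by (simp add: add_increasing2)
  have "\<bar>w1 t s * (1 / w t s) * (1 / w t s)\<bar> \<le> 2*K*(1/c0)*(1/c0)"
    unfolding abs_mult using inverse_w_bound[OF s t] w_bounds[OF s t] K c0 by (intro mult_mono) auto
  then show "\<bar>- (w1 t s * (1 / w t s) * (1 / w t s))\<bar> \<le> 1/c0 + 2*K*(1/c0)*(1/c0)" using c0 by (simp add: add_increasing)
qed (intro continuous_intros continuous_w continuous_inverse_w t)+

text \<open>The factor \<open>1 / w\<close> is what division by the tangential phase derivative
  leaves at an end of the curve. Its derivative in \<open>u\<close> carries a factor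
  \<open>\<epsilon> \<le> 1\<close>, so the constant does not depend on
  \<open>\<epsilon>\<close>.\<close>

lemma oscillatory_edge_bound:
  fixes G G' :: "real \<Rightarrow> real"
  assumes ab: "-1 \<le> a" "a \<le> b" "b \<le> 1"
    and G: "\<And>u. u \<in> {a..b} \<Longrightarrow> (G has_real_derivative G' u) (at u within {a..b})"
    and cG': "continuous_on {a..b} G'"
    and L: "\<And>u. u \<in> {a..b} \<Longrightarrow> \<bar>G u\<bar> \<le> L" "\<And>u. u \<in> {a..b} \<Longrightarrow> \<bar>G' u\<bar> \<le> L"
    and s: "s \<in> {0..1}" and \<epsilon>: "0 < \<epsilon>" "\<epsilon> \<le> e0"
  shows "norm (integral {a..b} (\<lambda>u. (G u * (1 / w (\<epsilon> * u) s)) *\<^sub>R cis (\<Lambda> * u)))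
     \<le> 8 * (L * (1/c0) + L * (K * (1/c0) * (1/c0))) / (1 + \<bar>\<Lambda>\<bar>)"
proof -
  have L0: "0 \<le> L" using L(1)[of a] ab by auto
  have eu: "\<bar>\<epsilon> * u\<bar> \<le> e0" if "u \<in> {a..b}" for u
  proof -
    have "\<bar>\<epsilon> * u\<bar> \<le> \<epsilon> * 1" unfolding abs_mult using that ab \<epsilon> by (intro mult_mono) auto
    then show ?thesis using \<epsilon> by simp
  qed
  define W' where "W' u = - (\<epsilon> * \<mu> s * (1 / w (\<epsilon> * u) s) * (1 / w (\<epsilon> * u) s))" for u
  have wne: "w (\<epsilon> * u) s \<noteq> 0" if "u \<in> {a..b}" for u using w_ge[OF s eu[OF that]] c0 by auto
  have dW: "((\<lambda>u. 1 / w (\<epsilon> * u) s) has_real_derivative W' u) (at u within {a..b})" if u: "u \<in> {a..b}" for u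
  proof -
    have "((\<lambda>u. w (\<epsilon> * u) s) has_real_derivative \<epsilon> * \<mu> s) (at u within {a..b})"
      unfolding w_def by (rule derivative_eq_intros refl | simp)+
    from DERIV_inverse_fun[OF this wne[OF u]] show ?thesis by (simp add: W'_def inverse_eq_divide power2_eq_square)
  qed
  have cw: "continuous_on {a..b} (\<lambda>u. w (\<epsilon> * u) s)" unfolding w_def by (intro continuous_intros)
  have cG: "continuous_on {a..b} G" by (rule DERIV_continuous_on, erule G)
  show ?thesis
  proof (rule integral_cis_linear_le[where H'="\<lambda>u. G' u * (1 / w (\<epsilon> * u) s) + W' u * G u"])
    fix u assume u: "u \<in> {a..b}"
    show "((\<lambda>u. G u * (1 / w (\<epsilon> * u) s)) has_real_derivative G' u * (1 / w (\<epsilon> * u) s) + W' u * G u) (at u within {a..b})"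
      by (rule DERIV_mult[OF G[OF u] dW[OF u]])
    note iw = inverse_w_bound[OF s eu[OF u]]
    have Kc: "0 \<le> L * (K * (1/c0) * (1/c0))" "0 \<le> L * (1/c0)" using L0 K c0 by auto
    have 1: "\<bar>G u * (1 / w (\<epsilon> * u) s)\<bar> \<le> L * (1/c0)" "\<bar>G' u * (1 / w (\<epsilon> * u) s)\<bar> \<le> L * (1/c0)"
      unfolding abs_mult using iw L[OF u] L0 by (intro mult_mono; simp)+
    have "\<bar>W' u\<bar> \<le> 1 * K * (1/c0) * (1/c0)"
      unfolding W'_def abs_minus_cancel abs_mult using iw \<epsilon> e0 bound[OF s] K c0 by (intro mult_mono) auto
    then have 2: "\<bar>W' u * G u\<bar> \<le> K * (1/c0) * (1/c0) * L"
      unfolding abs_mult using L[OF u] K c0 by (intro mult_mono) auto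
    show "\<bar>G u * (1 / w (\<epsilon> * u) s)\<bar> \<le> L * (1/c0) + L * (K * (1/c0) * (1/c0))" using 1(1) Kc by linarith
    show "\<bar>G' u * (1 / w (\<epsilon> * u) s) + W' u * G u\<bar> \<le> L * (1/c0) + L * (K * (1/c0) * (1/c0))"
      using abs_triangle_ineq[of "G' u * (1 / w (\<epsilon> * u) s)" "W' u * G u"] 1(2) 2
      unfolding mult.commute[of L "K * (1/c0) * (1/c0)"] by linarith
  next
    show "continuous_on {a..b} (\<lambda>u. G' u * (1 / w (\<epsilon> * u) s) + W' u * G u)"
      unfolding W'_def by (intro continuous_intros cG cG' cw) (use wne in auto)
  qed (use ab in auto)
qed

text \<open>When \<open>F1\<close> is the derivative of \<open>F\<close>, the three summands are the
  product rule for the \<open>s\<close>-derivative of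
  \<open>F * (\<omega> \<bullet> \<tau>) / w\<close>; the bound is uniform in
  \<open>\<omega>\<close> and \<open>t\<close>.\<close>

lemma amplitude_bound:
  assumes "C1_bound L F" "C1_bound L F1"
  shows "\<exists>M. \<forall>\<omega> t. norm \<omega> = 1 \<longrightarrow> \<bar>t\<bar> \<le> e0 \<longrightarrow>
     C1_bound M (\<lambda>s. F1 s * (\<omega> \<bullet> \<tau> s) * (1 / w t s) + - (F s * (\<mu> s * (\<omega> \<bullet> \<nu> s)) * (1 / w t s))
        + - (F s * (\<omega> \<bullet> \<tau> s) * (w1 t s * (1 / w t s) * (1 / w t s))))"
proof -
  define I where "I = 1/c0 + 2*K*(1/c0)*(1/c0)"
  show ?thesis
    by (rule exI[of _ "2*(2*L*K)*I + 2*(2*L*(2*K*K))*I + 2*(2*L*K)*(2*(2*(2*K)*I)*I)"])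
       (unfold I_def, intro allI impI C1_bound_add C1_bound_uminus C1_bound_mult C1_bound_p C1_bound_r
         C1_bound_w1 C1_bound_inverse_w C1_bound_mu assms)
qed

lemma amplitude_bound2:
  assumes "C1_bound L F"
  shows "\<exists>M. \<forall>\<omega>. norm \<omega> = 1 \<longrightarrow> C1_bound M (\<lambda>s. F s * (\<omega> \<bullet> \<nu> s))"
  by (rule exI[of _ "2*L*K"]) (intro allI impI C1_bound_mult C1_bound_r assms)

text \<open>Integrating by parts along the gradient of the phase gains a factor \<open>1 / norm \<xi>\<close>. What remains
  oscillates in \<open>s\<close> and is handled by van der Corput's lemma, except on the two ends \<open>s = 0\<close> and
  \<open>s = 1\<close>, where only the oscillation in \<open>u\<close> is available.\<close>

theorem piece_estimate:
  fixes F F1 F2 G G' :: "real \<Rightarrow> real"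
  assumes F: "\<And>s. s \<in> {0..1} \<Longrightarrow> (F has_real_derivative F1 s) (at s within {0..1})"
      "\<And>s. s \<in> {0..1} \<Longrightarrow> (F1 has_real_derivative F2 s) (at s within {0..1})" "continuous_on {0..1} F2"
    and ab: "-1 \<le> a" "a \<le> b" "b \<le> 1"
    and G: "\<And>u. u \<in> {a..b} \<Longrightarrow> (G has_real_derivative G' u) (at u within {a..b})"
    and cG': "continuous_on {a..b} G'"
  shows "\<exists>C\<ge>0. \<forall>\<epsilon> \<xi>. 0 < \<epsilon> \<longrightarrow> \<epsilon> \<le> e0 \<longrightarrow> 1 \<le> norm \<xi> \<longrightarrow>
     norm (integral {0..1} (\<lambda>s. integral {a..b} (\<lambda>u. (F s * G u) *\<^sub>R cis (\<xi> \<bullet> (\<gamma> s + (\<epsilon> * u) *\<^sub>R \<nu> s)))))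
     \<le> C * (1 / (\<epsilon> * norm \<xi> * sqrt (norm \<xi>))
        + 1 / norm \<xi> * (1 / (1 + \<epsilon> * \<bar>\<xi> \<bullet> \<nu> 0\<bar>) + 1 / (1 + \<epsilon> * \<bar>\<xi> \<bullet> \<nu> 1\<bar>)))"
proof -
  have cF: "continuous_on {0..1} F" "continuous_on {0..1} F1" by (rule DERIV_continuous_on, erule F)+
  have cG: "continuous_on {a..b} G" by (rule DERIV_continuous_on, erule G)
  have bnd: "\<exists>B. \<forall>x\<in>S. \<bar>g x\<bar> \<le> B" if "continuous_on S g" "compact S" for g :: "real \<Rightarrow> real" and S
    using compact_imp_bounded[OF compact_continuous_image[OF that]] by (auto simp: bounded_iff)
  obtain B0 B1 B2 where B: "\<forall>x\<in>{0..1}. \<bar>F x\<bar> \<le> B0" "\<forall>x\<in>{0..1}. \<bar>F1 x\<bar> \<le> B1" "\<forall>x\<in>{0..1}. \<bar>F2 x\<bar> \<le> B2"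
    using bnd[OF cF(1)] bnd[OF cF(2)] bnd[OF F(3)] by auto
  define LF where "LF = max B0 (max B1 B2)"
  have LF: "\<bar>F s\<bar> \<le> LF" "\<bar>F1 s\<bar> \<le> LF" "\<bar>F2 s\<bar> \<le> LF" if "s \<in> {0..1}" for s
    using B that unfolding LF_def by (auto simp: le_max_iff_disj)
  have LF0: "0 \<le> LF" using LF(1)[of 0] by auto
  obtain B3 B4 where B': "\<forall>x\<in>{a..b}. \<bar>G x\<bar> \<le> B3" "\<forall>x\<in>{a..b}. \<bar>G' x\<bar> \<le> B4"
    using bnd[OF cG] bnd[OF cG'] by auto
  define LG where "LG = max B3 B4"
  have LG: "\<bar>G s\<bar> \<le> LG" "\<bar>G' s\<bar> \<le> LG" if "s \<in> {a..b}" for s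
    using B' that unfolding LG_def by (auto simp: le_max_iff_disj)
  have LG0: "0 \<le> LG" using LG(1)[of a] ab by auto
  have cbF: "C1_bound LF F" by (rule C1_boundI[OF F(1)]) (use LF cF in auto)
  have cbF1: "C1_bound LF F1" by (rule C1_boundI[OF F(2)]) (use LF F in auto)
  obtain M1 where M1: "\<And>\<omega> t. norm \<omega> = 1 \<Longrightarrow> \<bar>t\<bar> \<le> e0 \<Longrightarrow>
     C1_bound M1 (\<lambda>s. F1 s * (\<omega> \<bullet> \<tau> s) * (1 / w t s) + - (F s * (\<mu> s * (\<omega> \<bullet> \<nu> s)) * (1 / w t s))
        + - (F s * (\<omega> \<bullet> \<tau> s) * (w1 t s * (1 / w t s) * (1 / w t s))))"
    using amplitude_bound[OF cbF cbF1] by blast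
  obtain M2 where M2: "\<And>\<omega>. norm \<omega> = 1 \<Longrightarrow> C1_bound M2 (\<lambda>s. F s * (\<omega> \<bullet> \<nu> s))"
    using amplitude_bound2[OF cbF] by blast
  obtain Cv where Cv0: "Cv \<ge> 0" and Cv: "\<And>\<omega> t lam A L. norm \<omega> = 1 \<Longrightarrow> \<bar>t\<bar> \<le> e0 \<Longrightarrow> 1 \<le> lam \<Longrightarrow> C1_bound L A \<Longrightarrow>
     norm (integral {0..1} (\<lambda>s. A s *\<^sub>R cis (lam * (\<omega> \<bullet> \<gamma> s + t * (\<omega> \<bullet> \<nu> s))))) \<le> Cv * L / sqrt lam"
    using vdC by blast
  define LH where "LH = LG * (1/c0) + LG * (K * (1/c0) * (1/c0))"
  have LH0: "0 \<le> LH" using LG0 K c0 by (simp add: LH_def)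
  define C where "C = max 0 (4 * LG * (Cv * \<bar>M2\<bar>) + 2 * LG * (Cv * \<bar>M1\<bar>)) + LF * (8 * LH)"
  have C: "0 \<le> C" "4 * LG * (Cv * \<bar>M2\<bar>) + 2 * LG * (Cv * \<bar>M1\<bar>) \<le> C" "LF * (8 * LH) \<le> C"
    using max.cobounded1[of 0 "4 * LG * (Cv * \<bar>M2\<bar>) + 2 * LG * (Cv * \<bar>M1\<bar>)"]
      max.cobounded2[of "4 * LG * (Cv * \<bar>M2\<bar>) + 2 * LG * (Cv * \<bar>M1\<bar>)" 0]
      mult_nonneg_nonneg[OF LF0, of "8 * LH"] LH0 unfolding C_def by linarith+
  have "norm (integral {0..1} (\<lambda>s. integral {a..b} (\<lambda>u. (F s * G u) *\<^sub>R cis (\<xi> \<bullet> (\<gamma> s + (\<epsilon> * u) *\<^sub>R \<nu> s)))))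
     \<le> C * (1 / (\<epsilon> * norm \<xi> * sqrt (norm \<xi>))
        + 1 / norm \<xi> * (1 / (1 + \<epsilon> * \<bar>\<xi> \<bullet> \<nu> 0\<bar>) + 1 / (1 + \<epsilon> * \<bar>\<xi> \<bullet> \<nu> 1\<bar>)))"
    if \<epsilon>: "0 < \<epsilon>" "\<epsilon> \<le> e0" and \<xi>: "1 \<le> norm \<xi>" for \<epsilon> \<xi>
  proof -
    define lam where "lam = norm \<xi>"
    define \<omega> where "\<omega> = \<xi> /\<^sub>R lam"
    have lam: "1 \<le> lam" using \<xi> by (simp add: lam_def)
    have lam_inv: "inverse lam * lam = 1" using lam by simp
    have \<omega>: "norm \<omega> = 1" using lam_inv unfolding \<omega>_def lam_def by simp
    have \<xi>\<omega>: "\<xi> = lam *\<^sub>R \<omega>"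
      using lam_inv by (simp only: \<omega>_def scaleR_scaleR mult.commute[of lam] scaleR_one)
    define p where "p s = \<omega> \<bullet> \<tau> s" for s
    define r where "r s = \<omega> \<bullet> \<nu> s" for s
    define E where "E s u = cis (lam * (\<omega> \<bullet> \<gamma> s + (\<epsilon> * u) * r s))" for s u
    have nE: "norm (E s u) = 1" for s u by (simp add: E_def)
    have Eeq: "cis (\<xi> \<bullet> (\<gamma> s + (\<epsilon> * u) *\<^sub>R \<nu> s)) = E s u" for s u
      by (simp add: \<xi>\<omega> E_def r_def inner_add_right distrib_left mult.left_commute)
    have eu: "\<bar>\<epsilon> * u\<bar> \<le> e0" if "u \<in> {a..b}" for u
    proof -
      have "\<bar>\<epsilon> * u\<bar> \<le> \<epsilon> * 1" unfolding abs_mult using that ab \<epsilon> by (intro mult_mono) auto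
      then show ?thesis using \<epsilon> by simp
    qed
    have cpr: "continuous_on {0..1} p" "continuous_on {0..1} r"
      unfolding p_def[abs_def] r_def[abs_def] by (intro continuous_intros conts)+
    have cgam: "continuous_on {0..1} (\<lambda>s. \<omega> \<bullet> \<gamma> s)" by (intro continuous_intros conts)
    have comp: "continuous_on ({0..1} \<times> {a..b}) (\<lambda>z. f (fst z))" if "continuous_on {0..1} f" for f :: "real \<Rightarrow> real"
      by (rule continuous_on_compose2[OF that]) (auto intro: continuous_intros)
    have comp2: "continuous_on ({0..1} \<times> {a..b}) (\<lambda>z. f (snd z))" if "continuous_on {a..b} f" for f :: "real \<Rightarrow> real"
      by (rule continuous_on_compose2[OF that]) (auto intro: continuous_intros)
    have cE2: "continuous_on ({0..1} \<times> {a..b}) (\<lambda>z. E (fst z) (snd z))"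
      unfolding E_def by (intro continuous_intros comp cgam cpr)
    have cEs: "continuous_on {0..1} (\<lambda>s. E s u)" for u unfolding E_def by (intro continuous_intros cgam cpr)
    have cEu: "continuous_on {a..b} (\<lambda>u. E s u)" for s unfolding E_def by (intro continuous_intros)
    note prod_int = integrable_continuous_interval
    have param: "continuous_on {0..1} (\<lambda>s. integral {a..b} (g s))"
      if "continuous_on ({0..1} \<times> {a..b}) (\<lambda>z. g (fst z) (snd z))" for g :: "real \<Rightarrow> real \<Rightarrow> complex"
      using integral_continuous_on_param[of "{0..1}" a b g] that by (simp add: case_prod_unfold)
    have swap: "integral {0..1} (\<lambda>s. integral {a..b} (g s)) = integral {a..b} (\<lambda>u. integral {0..1} (\<lambda>s. g s u))"
      if "continuous_on ({0..1} \<times> {a..b}) (\<lambda>z. g (fst z) (snd z))" for g :: "real \<Rightarrow> real \<Rightarrow> complex"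
      using integral_swap_continuous[of 0 a 1 b g] that by (simp add: case_prod_unfold cbox_Pair_eq)
    have param': "continuous_on {a..b} (\<lambda>u. integral {0..1} (\<lambda>s. g s u))"
      if "continuous_on ({0..1} \<times> {a..b}) (\<lambda>z. g (fst z) (snd z))" for g :: "real \<Rightarrow> real \<Rightarrow> complex"
    proof -
      have "continuous_on ({a..b} \<times> {0..1}) (\<lambda>z. g (snd z) (fst z))"
        by (rule continuous_on_compose2[OF that, of _ "\<lambda>z. (snd z, fst z)", simplified])
           (auto intro!: continuous_on_Pair continuous_on_fst continuous_on_snd continuous_on_id)
      then show ?thesis
        using integral_continuous_on_param[of "{a..b}" 0 1 "\<lambda>u s. g s u"] by (simp add: case_prod_unfold)
    qed
    have int_le: "norm (integral {a..b} (\<lambda>u. h u *\<^sub>R V u)) \<le> 2 * (LG * B)"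
      if "continuous_on {a..b} h" "continuous_on {a..b} V" "\<And>u. u \<in> {a..b} \<Longrightarrow> \<bar>h u\<bar> \<le> LG"
        "\<And>u. u \<in> {a..b} \<Longrightarrow> norm (V u) \<le> B" for h :: "real \<Rightarrow> real" and V :: "real \<Rightarrow> complex" and B
    proof -
      have "norm (V a) \<le> B" using that(4) ab by auto
      then have B0: "0 \<le> B" using norm_ge_zero order_trans by blast
      have "norm (integral {a..b} (\<lambda>u. h u *\<^sub>R V u)) \<le> integral {a..b} (\<lambda>u. LG * B)"
      proof (rule integral_norm_bound_integral)
        show "(\<lambda>u. h u *\<^sub>R V u) integrable_on {a..b}" by (intro prod_int continuous_intros that)
        show "norm (h u *\<^sub>R V u) \<le> LG * B" if "u \<in> {a..b}" for u
          unfolding norm_scaleR using \<open>u \<in> {a..b}\<close> that LG0 by (intro mult_mono) (auto intro: \<open>\<And>u. u \<in> {a..b} \<Longrightarrow> \<bar>h u\<bar> \<le> LG\<close> \<open>\<And>u. u \<in> {a..b} \<Longrightarrow> norm (V u) \<le> B\<close>)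
      qed auto
      also have "\<dots> = (b - a) * (LG * B)" using ab by simp
      also have "\<dots> \<le> 2 * (LG * B)" using ab LG0 B0 by (intro mult_right_mono) auto
      finally show ?thesis .
    qed
    define V2 where "V2 u = integral {0..1} (\<lambda>s. (F s * r s) *\<^sub>R E s u)" for u
    have V2: "norm (V2 u) \<le> Cv * \<bar>M2\<bar> / sqrt lam" if "u \<in> {a..b}" for u
    proof -
      have "norm (V2 u) \<le> Cv * M2 / sqrt lam"
        unfolding V2_def E_def r_def by (rule Cv[OF \<omega> eu[OF that] lam M2[OF \<omega>]])
      also have "\<dots> \<le> Cv * \<bar>M2\<bar> / sqrt lam" using Cv0 lam by (intro divide_right_mono mult_left_mono) auto
      finally show ?thesis .
    qed
    define A1 where "A1 t s = F1 s * p s * (1 / w t s) + - (F s * (\<mu> s * r s) * (1 / w t s))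
        + - (F s * p s * (w1 t s * (1 / w t s) * (1 / w t s)))" for t s
    define V1 where "V1 u = integral {0..1} (\<lambda>s. A1 (\<epsilon> * u) s *\<^sub>R E s u)" for u
    have V1: "norm (V1 u) \<le> Cv * \<bar>M1\<bar> / sqrt lam" if "u \<in> {a..b}" for u
    proof -
      have "norm (V1 u) \<le> Cv * M1 / sqrt lam"
        unfolding V1_def A1_def E_def r_def p_def by (rule Cv[OF \<omega> eu[OF that] lam M1[OF \<omega> eu[OF that]]])
      also have "\<dots> \<le> Cv * \<bar>M1\<bar> / sqrt lam" using Cv0 lam by (intro divide_right_mono mult_left_mono) auto
      finally show ?thesis .
    qed
    \<comment> \<open>\<open>p\<^sup>2 + r\<^sup>2 = 1\<close> splits the integrand into a part that
      is integrated by parts along the curve and a part that is integrated by parts across it. One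
      factor \<open>p\<close> or \<open>r\<close> cancels against the phase derivative, which
      contains the same factor, so nothing is divided by a small quantity.\<close>
    define I where "I = integral {0..1} (\<lambda>s. integral {a..b} (\<lambda>u. (F s * G u) *\<^sub>R E s u))"
    define I1 where "I1 = integral {0..1} (\<lambda>s. integral {a..b} (\<lambda>u. (F s * G u * (p s)\<^sup>2) *\<^sub>R E s u))"
    define I2 where "I2 = integral {0..1} (\<lambda>s. integral {a..b} (\<lambda>u. (F s * G u * (r s)\<^sup>2) *\<^sub>R E s u))"
    have cI1: "continuous_on ({0..1} \<times> {a..b}) (\<lambda>z. (F (fst z) * G (snd z) * (p (fst z))\<^sup>2) *\<^sub>R E (fst z) (snd z))"
      by (intro continuous_intros comp comp2 cE2 cF cG cpr)
    have cI2: "continuous_on ({0..1} \<times> {a..b}) (\<lambda>z. (F (fst z) * G (snd z) * (r (fst z))\<^sup>2) *\<^sub>R E (fst z) (snd z))"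
      by (intro continuous_intros comp comp2 cE2 cF cG cpr)
    have "I = I1 + I2"
    proof -
      have "integral {a..b} (\<lambda>u. (F s * G u) *\<^sub>R E s u)
         = integral {a..b} (\<lambda>u. (F s * G u * (p s)\<^sup>2) *\<^sub>R E s u) + integral {a..b} (\<lambda>u. (F s * G u * (r s)\<^sup>2) *\<^sub>R E s u)"
        if s: "s \<in> {0..1}" for s
      proof -
        have "integral {a..b} (\<lambda>u. (F s * G u * (p s)\<^sup>2) *\<^sub>R E s u) + integral {a..b} (\<lambda>u. (F s * G u * (r s)\<^sup>2) *\<^sub>R E s u)
          = integral {a..b} (\<lambda>u. (F s * G u * (p s)\<^sup>2) *\<^sub>R E s u + (F s * G u * (r s)\<^sup>2) *\<^sub>R E s u)"
          by (rule Henstock_Kurzweil_Integration.integral_add[symmetric]; intro prod_int continuous_intros cG cEu)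
        also have "(\<lambda>u. (F s * G u * (p s)\<^sup>2) *\<^sub>R E s u + (F s * G u * (r s)\<^sup>2) *\<^sub>R E s u) = (\<lambda>u. (F s * G u) *\<^sub>R E s u)"
        proof
          fix u
          have "(F s * G u * (p s)\<^sup>2) *\<^sub>R E s u + (F s * G u * (r s)\<^sup>2) *\<^sub>R E s u = (F s * G u * ((p s)\<^sup>2 + (r s)\<^sup>2)) *\<^sub>R E s u"
            by (simp only: distrib_left scaleR_add_left)
          then show "(F s * G u * (p s)\<^sup>2) *\<^sub>R E s u + (F s * G u * (r s)\<^sup>2) *\<^sub>R E s u = (F s * G u) *\<^sub>R E s u"
            using parseval2[OF s \<omega>] by (simp add: p_def r_def)
        qed
        finally show ?thesis by simp
      qed
      then have "I = integral {0..1} (\<lambda>s. integral {a..b} (\<lambda>u. (F s * G u * (p s)\<^sup>2) *\<^sub>R E s u) + integral {a..b} (\<lambda>u. (F s * G u * (r s)\<^sup>2) *\<^sub>R E s u))"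
        unfolding I_def by (intro Henstock_Kurzweil_Integration.integral_cong) auto
      also have "\<dots> = I1 + I2"
        unfolding I1_def I2_def by (rule Henstock_Kurzweil_Integration.integral_add; intro prod_int param cI1 cI2)
      finally show ?thesis .
    qed
    \<comment> \<open>In \<open>u\<close> the phase has the constant derivative
      \<open>lam * \<epsilon> * r\<close>, whence the factor \<open>1 / (\<epsilon> * lam)\<close>.
      The remaining \<open>F * r\<close> still oscillates in \<open>s\<close>, on the sides
      \<open>u = a\<close>, \<open>u = b\<close> and inside, and van der Corput supplies
      \<open>1 / sqrt lam\<close>.\<close>
    have nI2: "norm I2 \<le> 4 * LG * (Cv * \<bar>M2\<bar>) / (\<epsilon> * lam * sqrt lam)"
    proof -
      have inner: "(\<i> * of_real (lam * \<epsilon>)) * integral {a..b} (\<lambda>u. (F s * G u * (r s)\<^sup>2) *\<^sub>R E s u)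
          = (G b) *\<^sub>R ((F s * r s) *\<^sub>R E s b) - G a *\<^sub>R ((F s * r s) *\<^sub>R E s a) - integral {a..b} (\<lambda>u. (F s * r s * G' u) *\<^sub>R E s u)" for s
      proof -
        have "((\<lambda>u. (\<i> * of_real (lam * \<epsilon>)) * ((F s * G u * (r s)\<^sup>2) *\<^sub>R E s u) + (F s * r s * G' u) *\<^sub>R E s u) has_integral
           (F s * r s * G b) *\<^sub>R E s b - (F s * r s * G a) *\<^sub>R E s a) {a..b}"
        proof (rule fundamental_theorem_of_calculus[OF ab(2)])
          fix u assume u: "u \<in> {a..b}"
          have "((\<lambda>u. lam * (\<omega> \<bullet> \<gamma> s + (\<epsilon> * u) * r s)) has_real_derivative lam * (\<epsilon> * r s)) (at u within {a..b})"
            by (rule derivative_eq_intros refl | simp)+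
          from has_vector_derivative_scaleR[OF DERIV_cmult[OF G[OF u], of "F s * r s"] has_vector_derivative_cis[OF this]]
          show "((\<lambda>u. (F s * r s * G u) *\<^sub>R E s u) has_vector_derivative
              (\<i> * of_real (lam * \<epsilon>)) * ((F s * G u * (r s)\<^sup>2) *\<^sub>R E s u) + (F s * r s * G' u) *\<^sub>R E s u) (at u within {a..b})"
            unfolding E_def by (simp add: scaleR_conv_of_real power2_eq_square mult_ac)
        qed
        moreover have "((\<lambda>u. (\<i> * of_real (lam * \<epsilon>)) * ((F s * G u * (r s)\<^sup>2) *\<^sub>R E s u) + (F s * r s * G' u) *\<^sub>R E s u) has_integral
           (\<i> * of_real (lam * \<epsilon>)) * integral {a..b} (\<lambda>u. (F s * G u * (r s)\<^sup>2) *\<^sub>R E s u) + integral {a..b} (\<lambda>u. (F s * r s * G' u) *\<^sub>R E s u)) {a..b}"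
          by (intro has_integral_add has_integral_mult_right integrable_integral; intro prod_int continuous_intros cG cG' cEu)
        ultimately have "(F s * r s * G b) *\<^sub>R E s b - (F s * r s * G a) *\<^sub>R E s a =
           (\<i> * of_real (lam * \<epsilon>)) * integral {a..b} (\<lambda>u. (F s * G u * (r s)\<^sup>2) *\<^sub>R E s u) + integral {a..b} (\<lambda>u. (F s * r s * G' u) *\<^sub>R E s u)"
          by (rule has_integral_unique)
        moreover have "(F s * r s * G x) *\<^sub>R E s x = G x *\<^sub>R ((F s * r s) *\<^sub>R E s x)" for x by (simp add: mult.commute)
        ultimately show ?thesis by (simp only: add_diff_cancel_right')
      qed
      have c3: "continuous_on ({0..1} \<times> {a..b}) (\<lambda>z. (F (fst z) * r (fst z) * G' (snd z)) *\<^sub>R E (fst z) (snd z))"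
        by (intro continuous_intros comp comp2 cE2 cF cG' cpr)
      have i1: "(\<lambda>s. G u *\<^sub>R ((F s * r s) *\<^sub>R E s u)) integrable_on {0..1}" for u
        by (intro prod_int continuous_intros cF cpr cEs)
      have i2: "(\<lambda>s. integral {a..b} (\<lambda>u. (F s * r s * G' u) *\<^sub>R E s u)) integrable_on {0..1}"
        by (intro prod_int param c3)
      have "(\<i> * of_real (lam * \<epsilon>)) * I2 = integral {0..1} (\<lambda>s. (\<i> * of_real (lam * \<epsilon>)) * integral {a..b} (\<lambda>u. (F s * G u * (r s)\<^sup>2) *\<^sub>R E s u))"
        unfolding I2_def by (rule Henstock_Kurzweil_Integration.integral_mult_right[symmetric])
      also have "\<dots> = integral {0..1} (\<lambda>s. (G b) *\<^sub>R ((F s * r s) *\<^sub>R E s b) - G a *\<^sub>R ((F s * r s) *\<^sub>R E s a)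
           - integral {a..b} (\<lambda>u. (F s * r s * G' u) *\<^sub>R E s u))" by (simp only: inner)
      also have "\<dots> = G b *\<^sub>R V2 b - G a *\<^sub>R V2 a - integral {0..1} (\<lambda>s. integral {a..b} (\<lambda>u. (F s * r s * G' u) *\<^sub>R E s u))"
        unfolding V2_def by (simp only: Henstock_Kurzweil_Integration.integral_diff[OF Henstock_Kurzweil_Integration.integrable_diff[OF i1 i1] i2] Henstock_Kurzweil_Integration.integral_diff[OF i1 i1] Henstock_Kurzweil_Integration.integral_cmul)
      also have "integral {0..1} (\<lambda>s. integral {a..b} (\<lambda>u. (F s * r s * G' u) *\<^sub>R E s u)) = integral {a..b} (\<lambda>u. G' u *\<^sub>R V2 u)"
        unfolding swap[OF c3] V2_def by (simp add: mult.commute flip: Henstock_Kurzweil_Integration.integral_cmul)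
      finally have eq: "(\<i> * of_real (lam * \<epsilon>)) * I2 = G b *\<^sub>R V2 b - G a *\<^sub>R V2 a - integral {a..b} (\<lambda>u. G' u *\<^sub>R V2 u)" .
      have cV2: "continuous_on {a..b} V2" unfolding V2_def[abs_def]
        by (rule param') (intro continuous_intros comp cE2 cF cpr)
      define R where "R = Cv * \<bar>M2\<bar> / sqrt lam"
      have ge: "norm (G u *\<^sub>R V2 u) \<le> LG * R" if "u \<in> {a..b}" for u
        unfolding norm_scaleR R_def using LG(1)[OF that] V2[OF that] LG0 by (intro mult_mono) auto
      have "\<epsilon> * lam * norm I2 = norm ((\<i> * of_real (lam * \<epsilon>)) * I2)" using \<epsilon> lam by (simp add: norm_mult)
      also have "\<dots> \<le> norm (G b *\<^sub>R V2 b) + norm (G a *\<^sub>R V2 a) + norm (integral {a..b} (\<lambda>u. G' u *\<^sub>R V2 u))"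
        unfolding eq by (rule order_trans[OF norm_triangle_ineq4 add_right_mono[OF norm_triangle_ineq4]])
      also have "\<dots> \<le> LG * R + LG * R + 2 * (LG * R)"
        by (intro add_mono ge int_le cG' cV2 LG) (use ab V2 R_def in auto)
      finally have "\<epsilon> * lam * norm I2 \<le> 4 * (LG * R)" by simp
      then have "norm I2 \<le> 4 * (LG * R) / (\<epsilon> * lam)" using \<epsilon> lam by (simp add: pos_le_divide_eq mult.commute)
      then show ?thesis by (simp add: R_def mult_ac)
    qed
    \<comment> \<open>The boundary terms at the ends of the curve. With \<open>s\<close> fixed, the
      only oscillation left is that in \<open>u\<close>, of frequency \<open>lam * \<epsilon> * r =
      \<epsilon> * (\<xi> \<bullet> \<nu> s)\<close>.\<close>
    define T where "T s = integral {a..b} (\<lambda>u. G u *\<^sub>R ((F s * p s * (1 / w (\<epsilon> * u) s)) *\<^sub>R E s u))" for s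
    have T: "norm (T s) \<le> LF * (8 * LH) / (1 + \<epsilon> * \<bar>\<xi> \<bullet> \<nu> s\<bar>)" if s: "s \<in> {0..1}" for s
    proof -
      have "T s = integral {a..b} (\<lambda>u. (of_real (F s * p s) * cis (lam * (\<omega> \<bullet> \<gamma> s))) * ((G u * (1 / w (\<epsilon> * u) s)) *\<^sub>R cis ((lam * \<epsilon> * r s) * u)))"
        unfolding T_def E_def by (intro Henstock_Kurzweil_Integration.integral_cong) (simp add: scaleR_conv_of_real distrib_left cis_mult[symmetric] mult_ac del: cis_mult)
      also have "\<dots> = (of_real (F s * p s) * cis (lam * (\<omega> \<bullet> \<gamma> s))) * integral {a..b} (\<lambda>u. (G u * (1 / w (\<epsilon> * u) s)) *\<^sub>R cis ((lam * \<epsilon> * r s) * u))"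
        by (rule Henstock_Kurzweil_Integration.integral_mult_right)
      finally have "norm (T s) = \<bar>F s * p s\<bar> * norm (integral {a..b} (\<lambda>u. (G u * (1 / w (\<epsilon> * u) s)) *\<^sub>R cis ((lam * \<epsilon> * r s) * u)))"
        by (simp only: norm_mult norm_of_real norm_cis mult_1_right)
      also have "\<dots> \<le> (LF * 1) * (8 * LH / (1 + \<bar>lam * \<epsilon> * r s\<bar>))"
      proof (rule mult_mono)
        show "norm (integral {a..b} (\<lambda>u. (G u * (1 / w (\<epsilon> * u) s)) *\<^sub>R cis ((lam * \<epsilon> * r s) * u)))
           \<le> 8 * LH / (1 + \<bar>lam * \<epsilon> * r s\<bar>)"
          unfolding LH_def by (rule oscillatory_edge_bound[OF ab G cG' LG s \<epsilon>])
        show "\<bar>F s * p s\<bar> \<le> LF * 1" unfolding abs_mult p_def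
          using LF(1)[OF s] abs_inner_le1[OF s \<omega>] LF0 by (intro mult_mono) auto
      qed (use LF0 in auto)
      also have "\<bar>lam * \<epsilon> * r s\<bar> = \<epsilon> * \<bar>\<xi> \<bullet> \<nu> s\<bar>" using lam \<epsilon> by (simp add: \<xi>\<omega> r_def abs_mult mult_ac)
      finally show ?thesis by simp
    qed
    have nI1: "norm I1 \<le> LF * (8 * LH) / lam * (1 / (1 + \<epsilon> * \<bar>\<xi> \<bullet> \<nu> 0\<bar>) + 1 / (1 + \<epsilon> * \<bar>\<xi> \<bullet> \<nu> 1\<bar>)) + 2 * LG * (Cv * \<bar>M1\<bar>) / (lam * sqrt lam)"
    proof -
      \<comment> \<open>\<open>Q\<close> is \<open>F * p\<^sup>2\<close> divided by
        \<open>w * p\<close>, the phase derivative without its factor \<open>lam\<close>; it stays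
        smooth where \<open>p\<close> vanishes, and its derivative is the amplitude
        \<open>A1\<close>.\<close>
      define Q where "Q u s = F s * p s * (1 / w (\<epsilon> * u) s)" for u s
      have cA1: "continuous_on {0..1} (A1 (\<epsilon> * u))" if "u \<in> {a..b}" for u
      proof -
        have "w (\<epsilon> * u) s \<noteq> 0" if "s \<in> {0..1}" for s
          using w_ge[OF that eu[OF \<open>u \<in> {a..b}\<close>]] c0 by auto
        then show ?thesis
          unfolding A1_def[abs_def] by (intro continuous_intros cF cpr conts continuous_w) auto
      qed
      have inner: "(\<i> * of_real lam) * integral {0..1} (\<lambda>s. (F s * (p s)\<^sup>2) *\<^sub>R E s u) = Q u 1 *\<^sub>R E 1 u - Q u 0 *\<^sub>R E 0 u - V1 u"
        if u: "u \<in> {a..b}" for u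
      proof -
        have "((\<lambda>s. (\<i> * of_real lam) * ((F s * (p s)\<^sup>2) *\<^sub>R E s u) + A1 (\<epsilon> * u) s *\<^sub>R E s u) has_integral
           (Q u 1 *\<^sub>R E 1 u - Q u 0 *\<^sub>R E 0 u)) {0..1}"
        proof (rule fundamental_theorem_of_calculus)
          fix s :: real assume s: "s \<in> {0..1}"
          have d1: "((\<lambda>s. lam * (\<omega> \<bullet> \<gamma> s + (\<epsilon> * u) * r s)) has_real_derivative lam * (w (\<epsilon> * u) s * p s)) (at s within {0..1})"
            unfolding r_def p_def
            by (rule DERIV_cong[OF DERIV_cmult[OF DERIV_add[OF dg[OF s] DERIV_cmult[OF dr[OF s]]]]]) (simp add: w_def algebra_simps)
          have d2: "(Q u has_real_derivative A1 (\<epsilon> * u) s) (at s within {0..1})"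
            unfolding Q_def[abs_def] p_def
            by (rule DERIV_cong[OF DERIV_mult[OF DERIV_mult[OF F(1)[OF s] dp[OF s]] d_inverse_w[OF s eu[OF u]]]])
               (simp add: A1_def p_def r_def algebra_simps)
          have "w (\<epsilon> * u) s \<noteq> 0" using w_ge[OF s eu[OF u]] c0 by auto
          then have "Q u s * (lam * (w (\<epsilon> * u) s * p s)) = lam * (F s * (p s)\<^sup>2)" by (simp add: Q_def power2_eq_square)
          then have "Q u s *\<^sub>R ((lam * (w (\<epsilon> * u) s * p s)) *\<^sub>R (\<i> * E s u)) = (\<i> * of_real lam) * ((F s * (p s)\<^sup>2) *\<^sub>R E s u)"
            by (simp only: scaleR_scaleR) (simp add: scaleR_conv_of_real mult_ac)
          with has_vector_derivative_scaleR[OF d2 has_vector_derivative_cis[OF d1]]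
          show "((\<lambda>s. Q u s *\<^sub>R E s u) has_vector_derivative
             (\<i> * of_real lam) * ((F s * (p s)\<^sup>2) *\<^sub>R E s u) + A1 (\<epsilon> * u) s *\<^sub>R E s u) (at s within {0..1})"
            unfolding E_def by simp
        qed simp
        moreover have "((\<lambda>s. (\<i> * of_real lam) * ((F s * (p s)\<^sup>2) *\<^sub>R E s u) + A1 (\<epsilon> * u) s *\<^sub>R E s u) has_integral
           (\<i> * of_real lam) * integral {0..1} (\<lambda>s. (F s * (p s)\<^sup>2) *\<^sub>R E s u) + V1 u) {0..1}"
          unfolding V1_def
          by (intro has_integral_add has_integral_mult_right integrable_integral; intro prod_int continuous_intros cF cpr cEs cA1 u)
        ultimately have "Q u 1 *\<^sub>R E 1 u - Q u 0 *\<^sub>R E 0 u = (\<i> * of_real lam) * integral {0..1} (\<lambda>s. (F s * (p s)\<^sup>2) *\<^sub>R E s u) + V1 u"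
          by (rule has_integral_unique)
        then show ?thesis by simp
      qed
      have cV1: "continuous_on {a..b} V1"
      proof -
        have cw: "continuous_on ({0..1} \<times> {a..b}) (\<lambda>z. w (\<epsilon> * snd z) (fst z))" "continuous_on ({0..1} \<times> {a..b}) (\<lambda>z. w1 (\<epsilon> * snd z) (fst z))"
          unfolding w_def w1_def by (intro continuous_intros comp conts)+
        have "w (\<epsilon> * snd z) (fst z) \<noteq> 0" if "z \<in> {0..1} \<times> {a..b}" for z
          using w_ge[of "fst z" "\<epsilon> * snd z"] eu[of "snd z"] c0 that by auto
        then show ?thesis unfolding V1_def[abs_def] A1_def
          by (intro param' continuous_intros comp cE2 cF cpr conts cw) auto
      qed
      have cQ: "continuous_on {a..b} (\<lambda>u. G u *\<^sub>R (Q u s *\<^sub>R E s u))" if s: "s \<in> {0..1}" for s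
      proof -
        have "w (\<epsilon> * u) s \<noteq> 0" if "u \<in> {a..b}" for u using w_ge[OF s eu[OF that]] c0 by auto
        moreover have "continuous_on {a..b} (\<lambda>u. w (\<epsilon> * u) s)" unfolding w_def by (intro continuous_intros)
        ultimately show ?thesis unfolding Q_def by (intro continuous_intros cG cEu) auto
      qed
      have iQ: "(\<lambda>u. G u *\<^sub>R (Q u 1 *\<^sub>R E 1 u)) integrable_on {a..b}" "(\<lambda>u. G u *\<^sub>R (Q u 0 *\<^sub>R E 0 u)) integrable_on {a..b}"
        "(\<lambda>u. G u *\<^sub>R V1 u) integrable_on {a..b}"
        by (intro prod_int cQ; simp)+ (intro prod_int continuous_intros cG cV1)
      have "I1 = integral {a..b} (\<lambda>u. G u *\<^sub>R integral {0..1} (\<lambda>s. (F s * (p s)\<^sup>2) *\<^sub>R E s u))"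
        unfolding I1_def swap[OF cI1] by (simp add: mult_ac flip: Henstock_Kurzweil_Integration.integral_cmul)
      then have "(\<i> * of_real lam) * I1 = integral {a..b} (\<lambda>u. (\<i> * of_real lam) * (G u *\<^sub>R integral {0..1} (\<lambda>s. (F s * (p s)\<^sup>2) *\<^sub>R E s u)))"
        by (simp only: Henstock_Kurzweil_Integration.integral_mult_right)
      also have "\<dots> = integral {a..b} (\<lambda>u. G u *\<^sub>R (Q u 1 *\<^sub>R E 1 u) - G u *\<^sub>R (Q u 0 *\<^sub>R E 0 u) - G u *\<^sub>R V1 u)"
      proof (rule Henstock_Kurzweil_Integration.integral_cong)
        fix u assume "u \<in> {a..b}"
        from inner[OF this] show "(\<i> * of_real lam) * (G u *\<^sub>R integral {0..1} (\<lambda>s. (F s * (p s)\<^sup>2) *\<^sub>R E s u))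
          = G u *\<^sub>R (Q u 1 *\<^sub>R E 1 u) - G u *\<^sub>R (Q u 0 *\<^sub>R E 0 u) - G u *\<^sub>R V1 u"
          by (simp only: mult_scaleR_right scaleR_diff_right)
      qed
      also have "\<dots> = T 1 - T 0 - integral {a..b} (\<lambda>u. G u *\<^sub>R V1 u)"
        unfolding T_def using iQ by (simp add: Henstock_Kurzweil_Integration.integral_diff Henstock_Kurzweil_Integration.integrable_diff Q_def)
      finally have eq: "(\<i> * of_real lam) * I1 = T 1 - T 0 - integral {a..b} (\<lambda>u. G u *\<^sub>R V1 u)" .
      have "lam * norm I1 = norm ((\<i> * of_real lam) * I1)" using lam by (simp add: norm_mult)
      also have "\<dots> \<le> norm (T 1) + norm (T 0) + norm (integral {a..b} (\<lambda>u. G u *\<^sub>R V1 u))"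
        unfolding eq by (rule order_trans[OF norm_triangle_ineq4 add_right_mono[OF norm_triangle_ineq4]])
      also have "\<dots> \<le> LF * (8 * LH) / (1 + \<epsilon> * \<bar>\<xi> \<bullet> \<nu> 1\<bar>) + LF * (8 * LH) / (1 + \<epsilon> * \<bar>\<xi> \<bullet> \<nu> 0\<bar>) + 2 * (LG * (Cv * \<bar>M1\<bar> / sqrt lam))"
        by (intro add_mono T int_le cG cV1 LG V1) auto
      finally have "norm I1 \<le> (LF * (8 * LH) / (1 + \<epsilon> * \<bar>\<xi> \<bullet> \<nu> 1\<bar>) + LF * (8 * LH) / (1 + \<epsilon> * \<bar>\<xi> \<bullet> \<nu> 0\<bar>) + 2 * (LG * (Cv * \<bar>M1\<bar> / sqrt lam))) / lam"
        using lam by (simp add: pos_le_divide_eq mult.commute)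
      also have "\<dots> = LF * (8 * LH) / lam * (1 / (1 + \<epsilon> * \<bar>\<xi> \<bullet> \<nu> 0\<bar>) + 1 / (1 + \<epsilon> * \<bar>\<xi> \<bullet> \<nu> 1\<bar>)) + 2 * LG * (Cv * \<bar>M1\<bar>) / (lam * sqrt lam)"
        by (simp add: add_divide_distrib distrib_left mult_ac)
      finally show ?thesis .
    qed
    define S where "S = 1 / lam * (1 / (1 + \<epsilon> * \<bar>\<xi> \<bullet> \<nu> 0\<bar>) + 1 / (1 + \<epsilon> * \<bar>\<xi> \<bullet> \<nu> 1\<bar>))"
    have S0: "0 \<le> S" unfolding S_def using lam \<epsilon> by (intro mult_nonneg_nonneg add_nonneg_nonneg) auto
    define U where "U = 1 / (\<epsilon> * lam * sqrt lam)"
    have U0: "0 \<le> U" using \<epsilon> lam by (simp add: U_def)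
    \<comment> \<open>The interior part of \<open>I1\<close> lacks the factor
      \<open>1 / \<epsilon>\<close>; as \<open>\<epsilon> \<le> 1\<close>, it is absorbed in
      \<open>U\<close>.\<close>
    have "1 / (lam * sqrt lam) \<le> U"
      unfolding U_def using \<epsilon> e0 lam by (intro divide_left_mono) (auto simp: mult_le_cancel_right1 intro!: mult_pos_pos)
    then have u2: "2 * LG * (Cv * \<bar>M1\<bar>) / (lam * sqrt lam) \<le> 2 * LG * (Cv * \<bar>M1\<bar>) * U"
      using LG0 Cv0 by (metis abs_ge_zero mult_left_mono mult_nonneg_nonneg times_divide_eq_right mult.right_neutral zero_le_numeral)
    have "norm I \<le> norm I1 + norm I2" unfolding \<open>I = I1 + I2\<close> by (rule norm_triangle_ineq)
    also have "\<dots> \<le> LF * (8 * LH) * S + (4 * LG * (Cv * \<bar>M2\<bar>) + 2 * LG * (Cv * \<bar>M1\<bar>)) * U"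
    proof -
      have "norm I2 \<le> 4 * LG * (Cv * \<bar>M2\<bar>) * U" using nI2 by (simp add: U_def)
      moreover have "norm I1 \<le> LF * (8 * LH) * S + 2 * LG * (Cv * \<bar>M1\<bar>) / (lam * sqrt lam)"
        using nI1 by (simp add: S_def)
      ultimately show ?thesis using u2 by (simp add: distrib_right)
    qed
    also have "\<dots> \<le> C * S + C * U"
      by (intro add_mono mult_right_mono C S0 U0)
    finally show ?thesis unfolding I_def Eeq S_def U_def lam_def[symmetric] by (simp add: distrib_left)
  qed
  then show ?thesis using C(1) by blast
qed

end

section \<open>Smooth curves and their frames\<close>

text \<open>Derivatives are taken within \<open>[0, 1]\<close> and quantified existentially rather
  than iterated by \<open>nderiv\<close>; closure under products, reciprocals and square roots is
  then a direct induction on the order.\<close>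

fun Ck :: "nat \<Rightarrow> (real \<Rightarrow> real) \<Rightarrow> bool" where
  "Ck 0 g = continuous_on {0..1} g"
| "Ck (Suc k) g = (\<exists>g'. (\<forall>s\<in>{0..1}. (g has_real_derivative g' s) (at s within {0..1})) \<and> Ck k g')"

definition Cinf :: "(real \<Rightarrow> real) \<Rightarrow> bool" where "Cinf g \<longleftrightarrow> (\<forall>k. Ck k g)"

lemma Ck_SucI:
  "(\<And>s. s \<in> {0..1} \<Longrightarrow> (g has_real_derivative g' s) (at s within {0..1})) \<Longrightarrow> Ck k g' \<Longrightarrow> Ck (Suc k) g"
  by (subst Ck.simps(2)) blast

lemma Ck_SucE:
  assumes "Ck (Suc k) g"
  obtains g' where "\<And>s. s \<in> {0..1} \<Longrightarrow> (g has_real_derivative g' s) (at s within {0..1})" "Ck k g'"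
  using assms unfolding Ck.simps(2) by blast

lemma Ck_continuous: "Ck k g \<Longrightarrow> continuous_on {0..1} g"
proof (cases k)
  case (Suc j)
  assume "Ck k g"
  then obtain g' where "\<And>s. s \<in> {0..1} \<Longrightarrow> (g has_real_derivative g' s) (at s within {0..1})"
    unfolding Suc by (rule Ck_SucE) blast
  then show ?thesis by (rule DERIV_continuous_on)
qed simp

lemma Ck_SucD: "Ck (Suc k) g \<Longrightarrow> Ck k g"
proof (induction k arbitrary: g)
  case 0
  then show ?case using Ck_continuous[of "Suc 0" g] by (simp only: Ck.simps(1))
next
  case (Suc k)
  from Suc.prems obtain g' where g': "\<And>s. s \<in> {0..1} \<Longrightarrow> (g has_real_derivative g' s) (at s within {0..1})" "Ck (Suc k) g'"
    by (rule Ck_SucE) blast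
  show ?case by (rule Ck_SucI[OF g'(1) Suc.IH[OF g'(2)]])
qed

lemma DERIV_unique_01:
  fixes f :: "real \<Rightarrow> real"
  assumes "s \<in> {0..1}" "(f has_real_derivative a) (at s within {0..1})" "(f has_real_derivative b) (at s within {0..1})"
  shows "a = b"
  using vector_derivative_within_closed_interval[of 0 1 s f a] vector_derivative_within_closed_interval[of 0 1 s f b] assms
  by (simp add: has_real_derivative_iff_has_vector_derivative)

lemma DERIV_cong_01:
  fixes f g :: "real \<Rightarrow> real"
  assumes "(f has_real_derivative a) (at s within {0..1})" "s \<in> {0..1}" "\<And>s. s \<in> {0..1} \<Longrightarrow> f s = g s"
  shows "(g has_real_derivative a) (at s within {0..1})"
  by (rule has_field_derivative_transform_within[OF assms(1) zero_less_one assms(2)]) (rule assms(3))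

lemma Ck_cong:
  assumes "Ck k f" and eq: "\<And>s. s \<in> {0..1} \<Longrightarrow> f s = g s" shows "Ck k g"
proof (cases k)
  case 0
  then show ?thesis using assms(1) continuous_on_cong[of "{0..1}" "{0..1}" f g] eq by (simp only: Ck.simps(1))
next
  case (Suc j)
  obtain f' where f': "\<And>s. s \<in> {0..1} \<Longrightarrow> (f has_real_derivative f' s) (at s within {0..1})" "Ck j f'"
    using assms(1) unfolding Suc by (rule Ck_SucE) blast
  show ?thesis unfolding Suc by (rule Ck_SucI[OF DERIV_cong_01[OF f'(1) _ eq] f'(2)])
qed

lemma Ck_const: "Ck k (\<lambda>s. c)"
proof (induction k arbitrary: c)
  case (Suc k)
  show ?case by (rule Ck_SucI[of _ "\<lambda>s. 0"]) (auto simp: Suc.IH)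
qed simp

lemma Ck_add: "Ck k f \<Longrightarrow> Ck k g \<Longrightarrow> Ck k (\<lambda>s. f s + g s)"
proof (induction k arbitrary: f g)
  case (Suc k)
  obtain f' where f': "\<forall>s\<in>{0..1}. (f has_real_derivative f' s) (at s within {0..1})" "Ck k f'"
    using Suc.prems(1) by auto
  obtain g' where g': "\<forall>s\<in>{0..1}. (g has_real_derivative g' s) (at s within {0..1})" "Ck k g'"
    using Suc.prems(2) by auto
  have "\<forall>s\<in>{0..1}. ((\<lambda>s. f s + g s) has_real_derivative f' s + g' s) (at s within {0..1})"
    using f' g' by (auto intro!: DERIV_add)
  then show ?case using Suc.IH[OF f'(2) g'(2)] by (intro Ck_SucI) auto
qed (auto intro: continuous_intros)

lemma Ck_mult: "Ck k f \<Longrightarrow> Ck k g \<Longrightarrow> Ck k (\<lambda>s. f s * g s)"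
proof (induction k arbitrary: f g)
  case (Suc k)
  obtain f' where f': "\<forall>s\<in>{0..1}. (f has_real_derivative f' s) (at s within {0..1})" "Ck k f'"
    using Suc.prems(1) by auto
  obtain g' where g': "\<forall>s\<in>{0..1}. (g has_real_derivative g' s) (at s within {0..1})" "Ck k g'"
    using Suc.prems(2) by auto
  have d: "\<forall>s\<in>{0..1}. ((\<lambda>s. f s * g s) has_real_derivative f' s * g s + g' s * f s) (at s within {0..1})"
    using f' g' by (auto intro!: DERIV_mult)
  have "Ck k (\<lambda>s. f' s * g s + g' s * f s)"
    by (intro Ck_add Suc.IH f' g' Ck_SucD[OF Suc.prems(1)] Ck_SucD[OF Suc.prems(2)])
  then show ?case by (rule Ck_SucI[rotated]) (use d in blast)
qed (auto intro: continuous_intros)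

lemma Ck_inverse: "Ck k f \<Longrightarrow> (\<And>s. s \<in> {0..1} \<Longrightarrow> f s \<noteq> 0) \<Longrightarrow> Ck k (\<lambda>s. inverse (f s))"
proof (induction k)
  case (Suc k)
  obtain f' where f': "\<forall>s\<in>{0..1}. (f has_real_derivative f' s) (at s within {0..1})" "Ck k f'"
    using Suc.prems(1) by auto
  have i: "Ck k (\<lambda>s. inverse (f s))" by (rule Suc.IH[OF Ck_SucD[OF Suc.prems(1)] Suc.prems(2)])
  have d: "\<forall>s\<in>{0..1}. ((\<lambda>s. inverse (f s)) has_real_derivative (-1) * (f' s * (inverse (f s) * inverse (f s)))) (at s within {0..1})"
  proof
    fix s :: real assume s: "s \<in> {0..1}"
    from DERIV_inverse_fun[OF bspec[OF f'(1) s] Suc.prems(2)[OF s]]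
    show "((\<lambda>s. inverse (f s)) has_real_derivative (-1) * (f' s * (inverse (f s) * inverse (f s)))) (at s within {0..1})"
      by (simp add: power2_eq_square)
  qed
  have "Ck k (\<lambda>s. (-1) * (f' s * (inverse (f s) * inverse (f s))))"
    by (intro Ck_mult Ck_const f' i)
  then show ?case by (rule Ck_SucI[rotated]) (use d in blast)
qed (auto intro: continuous_intros)

lemma Ck_sqrt: "Ck k f \<Longrightarrow> (\<And>s. s \<in> {0..1} \<Longrightarrow> f s > 0) \<Longrightarrow> Ck k (\<lambda>s. sqrt (f s))"
proof (induction k)
  case (Suc k)
  obtain f' where f': "\<forall>s\<in>{0..1}. (f has_real_derivative f' s) (at s within {0..1})" "Ck k f'"
    using Suc.prems(1) by auto
  have i: "Ck k (\<lambda>s. sqrt (f s))" by (rule Suc.IH[OF Ck_SucD[OF Suc.prems(1)] Suc.prems(2)])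
  have d: "\<forall>s\<in>{0..1}. ((\<lambda>s. sqrt (f s)) has_real_derivative (1/2) * (f' s * inverse (sqrt (f s)))) (at s within {0..1})"
  proof
    fix s :: real assume s: "s \<in> {0..1}"
    from DERIV_chain2[OF DERIV_real_sqrt[OF Suc.prems(2)[OF s]] bspec[OF f'(1) s]]
    show "((\<lambda>s. sqrt (f s)) has_real_derivative (1/2) * (f' s * inverse (sqrt (f s)))) (at s within {0..1})"
      by (simp add: mult_ac)
  qed
  have "Ck k (\<lambda>s. inverse (sqrt (f s)))"
    by (rule Ck_inverse[OF i]) (use Suc.prems(2) in force)
  then have "Ck k (\<lambda>s. (1/2) * (f' s * inverse (sqrt (f s))))"
    by (intro Ck_mult Ck_const f')
  then show ?case by (rule Ck_SucI[rotated]) (use d in blast)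
qed (auto intro: continuous_intros)

lemma Cinf_intros:
  "Cinf (\<lambda>s. c)" "Cinf f \<Longrightarrow> Cinf g \<Longrightarrow> Cinf (\<lambda>s. f s + g s)" "Cinf f \<Longrightarrow> Cinf g \<Longrightarrow> Cinf (\<lambda>s. f s * g s)"
  "Cinf f \<Longrightarrow> (\<And>s. s \<in> {0..1} \<Longrightarrow> f s \<noteq> 0) \<Longrightarrow> Cinf (\<lambda>s. inverse (f s))"
  "Cinf f \<Longrightarrow> (\<And>s. s \<in> {0..1} \<Longrightarrow> f s > 0) \<Longrightarrow> Cinf (\<lambda>s. sqrt (f s))"
  unfolding Cinf_def by (auto intro: Ck_const Ck_add Ck_mult Ck_inverse Ck_sqrt)

lemma Cinf_uminus: "Cinf f \<Longrightarrow> Cinf (\<lambda>s. - f s)"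
  using Cinf_intros(3)[OF Cinf_intros(1)[of "-1"], of f] by simp

text \<open>Each order provides its own witness for the derivative. Since derivatives within
  \<open>[0, 1]\<close> are unique, all witnesses agree there with the
  \<open>vector_derivative\<close>, and one function serves every order.\<close>

lemma Cinf_deriv:
  assumes "Cinf f"
  obtains f' where "\<And>s. s \<in> {0..1} \<Longrightarrow> (f has_real_derivative f' s) (at s within {0..1})" "Cinf f'"
proof -
  define f' where "f' s = vector_derivative f (at s within {0..1})" for s
  have uniq: "f' s = g s" if "s \<in> {0..1}" "(f has_real_derivative g s) (at s within {0..1})" for g s
    using vector_derivative_within_closed_interval[of 0 1 s f "g s"] that
    by (simp add: f'_def has_real_derivative_iff_has_vector_derivative)
  have "(f has_real_derivative f' s) (at s within {0..1})" if s: "s \<in> {0..1}" for s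
  proof -
    have "Ck (Suc 0) f" using assms unfolding Cinf_def by blast
    then obtain g where "\<And>s. s \<in> {0..1} \<Longrightarrow> (f has_real_derivative g s) (at s within {0..1})" by (rule Ck_SucE) blast
    with s have "(f has_real_derivative g s) (at s within {0..1})" by blast
    with uniq[of s g] s show ?thesis by simp
  qed
  moreover have "Cinf f'" unfolding Cinf_def
  proof
    fix k
    have "Ck (Suc k) f" using assms unfolding Cinf_def by blast
    then obtain g where g: "\<forall>s\<in>{0..1}. (f has_real_derivative g s) (at s within {0..1})" "Ck k g" by auto
    show "Ck k f'" by (rule Ck_cong[OF g(2)]) (use uniq[of _ g] g(1) in auto)
  qed
  ultimately show ?thesis using that by blast
qed

lemma Cinf_bounded:
  assumes "Cinf f" obtains B where "\<And>s. s \<in> {0..1} \<Longrightarrow> \<bar>f s\<bar> \<le> B"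
proof -
  have "continuous_on {0..1} f" using assms Ck_continuous unfolding Cinf_def by blast
  from compact_imp_bounded[OF compact_continuous_image[OF this compact_Icc]]
  obtain a where "\<forall>x\<in>f ` {0..1}. norm x \<le> a" unfolding bounded_iff by blast
  then show ?thesis by (intro that[of a]) auto
qed

lemma Cinf_continuous: "Cinf f \<Longrightarrow> continuous_on {0..1} f"
  using Ck_continuous unfolding Cinf_def by blast

lemma nderiv_has_vector_derivative:
  assumes "smooth_on {0..1} g" "t \<in> {0..1}"
  shows "(nderiv {0..1} j g has_vector_derivative nderiv {0..1} (Suc j) g t) (at t within {0..1})"
  using assms unfolding smooth_on_def by (simp add: vector_derivative_works)

text \<open>A linear functional is carried along so that the coordinates of a curve and a scalar
  function on it are covered at once.\<close>

lemma Cinf_nderiv: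
  fixes L :: "'a::real_normed_vector \<Rightarrow> real"
  assumes "smooth_on {0..1} g" and L: "bounded_linear L"
  shows "Cinf (\<lambda>t. L (nderiv {0..1} j g t))"
proof -
  have d: "((\<lambda>t. L (nderiv {0..1} j g t)) has_real_derivative L (nderiv {0..1} (Suc j) g s)) (at s within {0..1})"
    if "s \<in> {0..1}" for s j
    using bounded_linear.has_vector_derivative[OF L nderiv_has_vector_derivative[OF assms(1) that]]
    by (simp add: has_real_derivative_iff_has_vector_derivative)
  have "Ck k (\<lambda>t. L (nderiv {0..1} j g t))" for k
  proof (induction k arbitrary: j)
    case 0
    show ?case unfolding Ck.simps(1) by (rule DERIV_continuous_on, erule d)
  next
    case (Suc k)
    show ?case by (rule Ck_SucI[OF d Suc])
  qed
  then show ?thesis by (simp add: Cinf_def)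
qed

section \<open>The moving frame of a smooth curve\<close>

lemma norm_real2: "norm (x::real^2) = sqrt ((x$1)\<^sup>2 + (x$2)\<^sup>2)"
  by (simp add: norm_vec_def L2_set_def sum_2)

lemma inner_real2: "(x::real^2) \<bullet> y = x$1 * y$1 + x$2 * y$2"
  by (simp add: inner_vec_def sum_2)

lemma has_vector_derivative_real2:
  fixes f :: "real \<Rightarrow> real^2"
  assumes "((\<lambda>s. f s $ 1) has_real_derivative f'$1) (at s within S)"
    "((\<lambda>s. f s $ 2) has_real_derivative f'$2) (at s within S)"
  shows "(f has_vector_derivative f') (at s within S)"
proof -
  have "((\<lambda>s. (f s$1) *\<^sub>R axis 1 1 + (f s$2) *\<^sub>R axis 2 1 :: real^2) has_vector_derivative (f'$1 *\<^sub>R axis 1 1 + f'$2 *\<^sub>R axis 2 1)) (at s within S)"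
    using assms by (auto intro!: derivative_eq_intros)
  moreover have "(\<lambda>s. (f s$1) *\<^sub>R axis 1 1 + (f s$2) *\<^sub>R axis 2 1) = f"
    by (auto simp: fun_eq_iff vec_eq_iff forall_2 axis_def)
  moreover have "f'$1 *\<^sub>R axis 1 1 + f'$2 *\<^sub>R axis 2 1 = f'"
    by (auto simp: vec_eq_iff forall_2 axis_def)
  ultimately show ?thesis by simp
qed

text \<open>The field \<open>n\<close> comes with continuity only, yet along the curve it is a unit
  vector orthogonal to the tangent, hence the rotated tangent up to a sign. Continuity makes the
  sign constant, and the normal inherits the smoothness of the tangent.\<close>

lemma unit_normal_frame:
  fixes \<gamma> :: "real \<Rightarrow> real^2"
  assumes sc: "smooth_curve \<gamma>" and un: "unit_normal_field \<gamma> n"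
    and curv: "\<And>t. t \<in> {0..1} \<Longrightarrow> curvature \<gamma> t \<noteq> 0"
  shows "\<exists>\<tau> v v1 v2 \<mu> \<mu>1 \<mu>2 K c0 e0. moving_frame \<gamma> \<tau> (\<lambda>s. n (\<gamma> s)) v v1 v2 \<mu> \<mu>1 \<mu>2 K c0 e0 \<and>
    (\<forall>s\<in>{0..1}. nderiv {0..1} 1 \<gamma> s = v s *\<^sub>R \<tau> s \<and> 0 < v s) \<and> Cinf v \<and>
    (pathfinish \<gamma> = pathstart \<gamma> \<longrightarrow> \<tau> 0 = \<tau> 1)"
proof -
  have sm: "smooth_on {0..1} \<gamma>" and nz: "\<And>t. t \<in> {0..1} \<Longrightarrow> nderiv {0..1} 1 \<gamma> t \<noteq> 0"
    using sc unfolding smooth_curve_def smooth_along_def by auto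
  define x where "x j t = nderiv {0..1} j \<gamma> t $ 1" for j t
  define y where "y j t = nderiv {0..1} j \<gamma> t $ 2" for j t
  have Cxy: "Cinf (x j)" "Cinf (y j)" for j
    unfolding x_def[abs_def] y_def[abs_def]
    by (rule Cinf_nderiv[OF sm bounded_linear_vec_nth])+
  have dxy: "(x j has_real_derivative x (Suc j) s) (at s within {0..1})" "(y j has_real_derivative y (Suc j) s) (at s within {0..1})"
    if "s \<in> {0..1}" for j s
    using bounded_linear.has_vector_derivative[OF bounded_linear_vec_nth nderiv_has_vector_derivative[OF sm that]]
    unfolding x_def[abs_def] y_def[abs_def] has_real_derivative_iff_has_vector_derivative by blast+
  define q where "q s = x 1 s * x 1 s + y 1 s * y 1 s" for s
  have q: "q s > 0" if "s \<in> {0..1}" for s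
    using nz[OF that] by (auto simp: q_def x_def y_def vec_eq_iff forall_2 sum_squares_gt_zero_iff)
  define v where "v s = sqrt (q s)" for s
  have v: "v s > 0" if "s \<in> {0..1}" for s using q[OF that] by (simp add: v_def)
  have v2: "v s * v s = q s" if "s \<in> {0..1}" for s using q[OF that] by (simp add: v_def)
  have Cv: "Cinf v" unfolding v_def[abs_def] by (rule Cinf_intros(5)) (unfold q_def[abs_def], (intro Cinf_intros(2,3) Cxy), rule q[unfolded q_def])
  have Civ: "Cinf (\<lambda>s. inverse (v s))" by (rule Cinf_intros(4)[OF Cv]) (use v in force)
  define p1 where "p1 s = x 1 s * inverse (v s)" for s
  define p2 where "p2 s = y 1 s * inverse (v s)" for s
  have Cp: "Cinf p1" "Cinf p2" unfolding p1_def[abs_def] p2_def[abs_def] by (intro Cinf_intros(3) Cxy Civ)+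
  have p1: "p1 s * p1 s + p2 s * p2 s = 1" if "s \<in> {0..1}" for s
  proof -
    have "p1 s * p1 s + p2 s * p2 s = q s * (inverse (v s) * inverse (v s))"
      by (simp add: p1_def p2_def q_def algebra_simps)
    also have "\<dots> = 1" using v[OF that] unfolding v2[OF that, symmetric] by (simp add: field_simps)
    finally show ?thesis .
  qed
  have xp: "x 1 s = v s * p1 s" "y 1 s = v s * p2 s" if "s \<in> {0..1}" for s
    using v[OF that] by (simp_all add: p1_def p2_def)
  define \<tau> where "\<tau> s = (vector [p1 s, p2 s] :: real^2)" for s
  define rt where "rt s = (vector [- p2 s, p1 s] :: real^2)" for s
  have g1: "nderiv {0..1} 1 \<gamma> s = v s *\<^sub>R \<tau> s" if "s \<in> {0..1}" for s
    using xp[OF that] by (simp add: vec_eq_iff forall_2 \<tau>_def x_def y_def)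
  define \<nu> where "\<nu> s = n (\<gamma> s)" for s
  have nu: "norm (\<nu> s) = 1" "\<nu> s \<bullet> \<tau> s = 0" if s: "s \<in> {0..1}" for s
  proof -
    show "norm (\<nu> s) = 1" using un s unfolding unit_normal_field_def \<nu>_def by blast
    have "\<nu> s \<bullet> nderiv {0..1} 1 \<gamma> s = 0" using un s unfolding unit_normal_field_def \<nu>_def by blast
    then show "\<nu> s \<bullet> \<tau> s = 0" unfolding g1[OF s] using v[OF s] by simp
  qed
  define sg where "sg s = \<nu> s \<bullet> rt s" for s
  have nurt: "\<nu> s = sg s *\<^sub>R rt s" "sg s * sg s = 1" if s: "s \<in> {0..1}" for s
  proof -
    have a: "\<nu> s$1 * p1 s + \<nu> s$2 * p2 s = 0" "\<nu> s$1 * \<nu> s$1 + \<nu> s$2 * \<nu> s$2 = 1" "p1 s * p1 s + p2 s * p2 s = 1"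
      using nu[OF s] p1[OF s] by (simp_all add: inner_real2 \<tau>_def norm_real2 power2_eq_square)
    have sgd: "sg s = \<nu> s$2 * p1 s - \<nu> s$1 * p2 s" by (simp add: sg_def inner_real2 rt_def)
    have "\<nu> s$1 = - (sg s * p2 s)" "\<nu> s$2 = sg s * p1 s" unfolding sgd using a by algebra+
    then show "\<nu> s = sg s *\<^sub>R rt s" by (simp add: vec_eq_iff forall_2 rt_def)
    show "sg s * sg s = 1" unfolding sgd using a by algebra
  qed
  have cnu: "continuous_on {0..1} \<nu>"
  proof -
    have "path \<gamma>" using sc unfolding smooth_curve_def simple_path_def by blast
    then show ?thesis using un unfolding unit_normal_field_def \<nu>_def path_def path_image_def
      by (intro continuous_on_compose2[of "\<gamma> ` {0..1}" n "{0..1}" \<gamma>]) auto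
  qed
  have crt: "continuous_on {0..1} rt"
  proof -
    have "rt = (\<lambda>s. (- p2 s) *\<^sub>R axis 1 1 + p1 s *\<^sub>R axis 2 1)" by (auto simp: fun_eq_iff vec_eq_iff forall_2 axis_def rt_def)
    then show ?thesis by (auto intro!: continuous_intros Cinf_continuous Cp)
  qed
  have "sg constant_on {0..1}"
  proof (rule continuous_finite_range_constant)
    show "continuous_on {0..1} sg" unfolding sg_def[abs_def] by (intro continuous_intros cnu crt)
    have "sg ` {0..1} \<subseteq> {1, -1}" using nurt(2) by (simp add: image_subset_iff square_eq_1_iff)
    then show "finite (sg ` {0..1})" by (rule finite_subset) auto
  qed auto
  then obtain \<sigma> where \<sigma>: "\<And>s. s \<in> {0..1} \<Longrightarrow> sg s = \<sigma>" unfolding constant_on_def by blast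
  have \<sigma>2: "\<sigma> * \<sigma> = 1" using nurt(2)[of 0] \<sigma>[of 0] by simp
  have nueq: "\<nu> s = \<sigma> *\<^sub>R rt s" if "s \<in> {0..1}" for s using nurt(1)[OF that] \<sigma>[OF that] by simp
  obtain p1' where p1': "\<And>s. s \<in> {0..1} \<Longrightarrow> (p1 has_real_derivative p1' s) (at s within {0..1})" "Cinf p1'"
    using Cinf_deriv[OF Cp(1)] by blast
  obtain p2' where p2': "\<And>s. s \<in> {0..1} \<Longrightarrow> (p2 has_real_derivative p2' s) (at s within {0..1})" "Cinf p2'"
    using Cinf_deriv[OF Cp(2)] by blast
  have orth: "p1 s * p1' s + p2 s * p2' s = 0" if s: "s \<in> {0..1}" for s
  proof -
    have "((\<lambda>s. p1 s * p1 s + p2 s * p2 s) has_real_derivative (p1' s * p1 s + p1' s * p1 s + (p2' s * p2 s + p2' s * p2 s))) (at s within {0..1})"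
      by (intro DERIV_add DERIV_mult p1' p2' s)
    then have "((\<lambda>s. 1) has_real_derivative (p1' s * p1 s + p1' s * p1 s + (p2' s * p2 s + p2' s * p2 s))) (at s within {0..1})"
      by (rule DERIV_cong_01[OF _ s p1])
    then have "p1' s * p1 s + p1' s * p1 s + (p2' s * p2 s + p2' s * p2 s) = 0"
      by (rule DERIV_unique_01[OF s]) simp
    then show ?thesis by (simp add: algebra_simps)
  qed
  \<comment> \<open>\<open>\<mu>\<close> is minus the normal component of the derivative of
    \<open>\<tau>\<close>; by \<open>orth\<close> that derivative has no tangential component. Up to
    sign it is the curvature times the speed, so it inherits the nonvanishing.\<close>
  define \<mu> where "\<mu> s = \<sigma> * (p1' s * p2 s + - (p2' s * p1 s))" for s
  have C\<mu>: "Cinf \<mu>" unfolding \<mu>_def[abs_def] by (intro Cinf_intros(1,2,3) Cinf_uminus Cp p1' p2')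
  obtain v1 where v1: "\<And>s. s \<in> {0..1} \<Longrightarrow> (v has_real_derivative v1 s) (at s within {0..1})" "Cinf v1"
    using Cinf_deriv[OF Cv] by blast
  obtain v2' where v2': "\<And>s. s \<in> {0..1} \<Longrightarrow> (v1 has_real_derivative v2' s) (at s within {0..1})" "Cinf v2'"
    using Cinf_deriv[OF v1(2)] by blast
  obtain \<mu>1 where \<mu>1: "\<And>s. s \<in> {0..1} \<Longrightarrow> (\<mu> has_real_derivative \<mu>1 s) (at s within {0..1})" "Cinf \<mu>1"
    using Cinf_deriv[OF C\<mu>] by blast
  obtain \<mu>2 where \<mu>2: "\<And>s. s \<in> {0..1} \<Longrightarrow> (\<mu>1 has_real_derivative \<mu>2 s) (at s within {0..1})" "Cinf \<mu>2"
    using Cinf_deriv[OF \<mu>1(2)] by blast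
  have \<mu>nz: "\<mu> s \<noteq> 0" if s: "s \<in> {0..1}" for s
  proof
    assume \<mu>0: "\<mu> s = 0"
    have x2: "x 2 s = v1 s * p1 s + p1' s * v s" "y 2 s = v1 s * p2 s + p2' s * v s"
    proof -
      have "(x 1 has_real_derivative v1 s * p1 s + p1' s * v s) (at s within {0..1})"
        by (rule DERIV_cong_01[OF DERIV_mult[OF v1(1)[OF s] p1'(1)[OF s]] s xp(1)[symmetric]])
      from DERIV_unique_01[OF s dxy(1)[OF s] this] show "x 2 s = v1 s * p1 s + p1' s * v s"
        by (simp add: numeral_2_eq_2)
      have "(y 1 has_real_derivative v1 s * p2 s + p2' s * v s) (at s within {0..1})"
        by (rule DERIV_cong_01[OF DERIV_mult[OF v1(1)[OF s] p2'(1)[OF s]] s xp(2)[symmetric]])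
      from DERIV_unique_01[OF s dxy(2)[OF s] this] show "y 2 s = v1 s * p2 s + p2' s * v s"
        by (simp add: numeral_2_eq_2)
    qed
    have "\<sigma> \<noteq> 0" using \<sigma>2 by auto
    with \<mu>0 have "p1' s * p2 s = p2' s * p1 s" by (simp add: \<mu>_def)
    then have "x 1 s * y 2 s - y 1 s * x 2 s = 0" unfolding x2 xp[OF s] by algebra
    then have "curvature \<gamma> s = 0" by (simp add: curvature_def Let_def x_def y_def)
    with curv[OF s] show False by simp
  qed
  have C: "Cinf v" "Cinf v1" "Cinf v2'" "Cinf \<mu>" "Cinf \<mu>1" "Cinf \<mu>2" by fact+
  have "\<exists>K. 1 \<le> K \<and> (\<forall>s\<in>{0..1}. \<forall>g\<in>{v, v1, v2', \<mu>, \<mu>1, \<mu>2}. \<bar>g s\<bar> \<le> K)"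
  proof -
    have "\<exists>B. \<forall>s\<in>{0..1}. \<bar>f s\<bar> \<le> B" if "Cinf f" for f using Cinf_bounded[OF that] by metis
    then have "\<forall>f\<in>{v, v1, v2', \<mu>, \<mu>1, \<mu>2}. \<exists>B. \<forall>s\<in>{0..1}. \<bar>f s\<bar> \<le> B"
      using C by simp
    then obtain B where B: "\<And>f s. f \<in> {v, v1, v2', \<mu>, \<mu>1, \<mu>2} \<Longrightarrow> s \<in> {0..1} \<Longrightarrow> \<bar>f s\<bar> \<le> B f"
      by metis
    define K where "K = Max (insert 1 (B ` {v, v1, v2', \<mu>, \<mu>1, \<mu>2}))"
    have "B f \<le> K" if "f \<in> {v, v1, v2', \<mu>, \<mu>1, \<mu>2}" for f unfolding K_def using that by (intro Max_ge) auto
    then have "\<forall>s\<in>{0..1}. \<forall>g\<in>{v, v1, v2', \<mu>, \<mu>1, \<mu>2}. \<bar>g s\<bar> \<le> K" using B by (meson order_trans)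
    moreover have "1 \<le> K" unfolding K_def by (intro Max_ge) auto
    ultimately show ?thesis by blast
  qed
  then obtain K where K: "1 \<le> K" "\<And>s g. s \<in> {0..1} \<Longrightarrow> g \<in> {v, v1, v2', \<mu>, \<mu>1, \<mu>2} \<Longrightarrow> \<bar>g s\<bar> \<le> K" by blast
  have low: "\<exists>c>0. \<forall>s\<in>{0..1}. c \<le> \<bar>f s\<bar>" if "continuous_on {0..1} f" "\<And>s. s \<in> {0..1} \<Longrightarrow> f s \<noteq> 0" for f :: "real \<Rightarrow> real"
  proof -
    have "continuous_on {0..1} (\<lambda>s. \<bar>f s\<bar>)" by (intro continuous_intros that)
    then obtain s0 where "s0 \<in> {0..1}" "\<forall>s\<in>{0..1}. \<bar>f s0\<bar> \<le> \<bar>f s\<bar>"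
      using continuous_attains_inf[of "{0..1::real}" "\<lambda>s. \<bar>f s\<bar>"] by auto
    then show ?thesis using that(2)[of s0] by (intro exI[of _ "\<bar>f s0\<bar>"]) auto
  qed
  obtain a where a: "a > 0" "\<And>s. s \<in> {0..1} \<Longrightarrow> a \<le> \<bar>v s\<bar>"
    using low[OF Cinf_continuous[OF Cv]] v by (metis less_irrefl)
  obtain b where b: "b > 0" "\<And>s. s \<in> {0..1} \<Longrightarrow> b \<le> \<bar>\<mu> s\<bar>"
    using low[OF Cinf_continuous[OF C\<mu>]] \<mu>nz by blast
  \<comment> \<open>For \<open>|t| \<le> a / (2*K)\<close> the term \<open>t * \<mu>\<close> takes
    at most \<open>a/2\<close> from the speed, which is at least \<open>a\<close>; hence
    \<open>a/2\<close>. The lower bound of \<open>|\<mu>|\<close> is \<open>b\<close>.\<close>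
  define c0 where "c0 = min (a/2) b"
  define e0 where "e0 = min 1 (a / (2*K))"
  have frame: "moving_frame \<gamma> \<tau> (\<lambda>s. n (\<gamma> s)) v v1 v2' \<mu> \<mu>1 \<mu>2 K c0 e0"
  proof
    fix s :: real assume s: "s \<in> {0..1}"
    show "(\<gamma> has_vector_derivative v s *\<^sub>R \<tau> s) (at s within {0..1})"
      using nderiv_has_vector_derivative[OF sm s, of 0] g1[OF s] by simp
    have rel: "p1' s = \<sigma> * \<mu> s * p2 s" "p2' s = - (\<sigma> * \<mu> s * p1 s)"
      unfolding \<mu>_def using orth[OF s] p1[OF s] \<sigma>2 by algebra+
    show "(\<tau> has_vector_derivative - (\<mu> s *\<^sub>R n (\<gamma> s))) (at s within {0..1})"
      by (rule has_vector_derivative_real2)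
         (use p1'(1)[OF s] p2'(1)[OF s] rel nueq[OF s] in \<open>simp_all add: \<tau>_def rt_def \<nu>_def mult_ac\<close>)
    have "((\<lambda>s. \<sigma> *\<^sub>R rt s) has_vector_derivative \<mu> s *\<^sub>R \<tau> s) (at s within {0..1})"
    proof (rule has_vector_derivative_real2)
      have \<sigma>rel: "\<sigma> * (- p2' s) = \<mu> s * p1 s" "\<sigma> * p1' s = \<mu> s * p2 s" unfolding rel using \<sigma>2 by algebra+
      have "((\<lambda>s. \<sigma> * (- p2 s)) has_real_derivative \<sigma> * (- p2' s)) (at s within {0..1})"
        by (intro DERIV_cmult DERIV_minus p2'(1)[OF s])
      then show "((\<lambda>s. (\<sigma> *\<^sub>R rt s) $ 1) has_real_derivative (\<mu> s *\<^sub>R \<tau> s) $ 1) (at s within {0..1})"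
        unfolding \<sigma>rel by (simp add: rt_def \<tau>_def)
      have "((\<lambda>s. \<sigma> * p1 s) has_real_derivative \<sigma> * p1' s) (at s within {0..1})"
        by (intro DERIV_cmult p1'(1)[OF s])
      then show "((\<lambda>s. (\<sigma> *\<^sub>R rt s) $ 2) has_real_derivative (\<mu> s *\<^sub>R \<tau> s) $ 2) (at s within {0..1})"
        unfolding \<sigma>rel by (simp add: rt_def \<tau>_def)
    qed
    then show "((\<lambda>s. n (\<gamma> s)) has_vector_derivative \<mu> s *\<^sub>R \<tau> s) (at s within {0..1})"
      by (rule has_vector_derivative_transform_within[OF _ zero_less_one s]) (use nueq in \<open>simp add: \<nu>_def\<close>)
    show "norm (\<tau> s) = 1" using p1[OF s] by (simp add: norm_real2 \<tau>_def power2_eq_square)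
    show "norm (n (\<gamma> s)) = 1" using nu(1)[OF s] by (simp add: \<nu>_def)
    show "\<tau> s \<bullet> n (\<gamma> s) = 0" using nu(2)[OF s] by (simp add: \<nu>_def inner_commute)
    show "\<bar>g s\<bar> \<le> K" if "g \<in> {v, v1, v2', \<mu>, \<mu>1, \<mu>2}" for g using K(2)[OF s that] .
    show "c0 \<le> \<bar>\<mu> s\<bar>" using b(2)[OF s] by (simp add: c0_def)
    show "c0 \<le> v s + t * \<mu> s" if t: "\<bar>t\<bar> \<le> e0" for t
    proof -
      have "\<bar>t * \<mu> s\<bar> \<le> a / (2*K) * K"
        by (rule abs_mult_le) (use t K(2)[OF s] in \<open>auto simp: e0_def\<close>)
      then have "\<bar>t * \<mu> s\<bar> \<le> a/2" using K(1) by simp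
      moreover have "a \<le> v s" using a(2)[OF s] v[OF s] by simp
      ultimately show ?thesis unfolding c0_def by linarith
    qed
    show "(v has_real_derivative v1 s) (at s within {0..1})" "(v1 has_real_derivative v2' s) (at s within {0..1})"
      "(\<mu> has_real_derivative \<mu>1 s) (at s within {0..1})" "(\<mu>1 has_real_derivative \<mu>2 s) (at s within {0..1})"
      by (rule v1 v2' \<mu>1 \<mu>2, rule s)+
  next
    show "continuous_on {0..1} v2'" "continuous_on {0..1} \<mu>2" using v2'(2) \<mu>2(2) by (auto intro: Cinf_continuous)
    show "1 \<le> K" by (rule K)
    show "0 < c0" using a b by (simp add: c0_def)
    show "0 < e0" "e0 \<le> 1" using a K(1) by (auto simp: e0_def)
  qed
  have "\<tau> 0 = \<tau> 1" if "pathfinish \<gamma> = pathstart \<gamma>"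
  proof -
    have "nderiv {0..1} 1 \<gamma> 0 = nderiv {0..1} 1 \<gamma> 1"
      using sc that unfolding smooth_curve_def smooth_along_def by blast
    then have "x 1 0 = x 1 1" "y 1 0 = y 1 1" by (simp_all add: x_def y_def)
    then show ?thesis by (simp add: \<tau>_def p1_def p2_def v_def q_def)
  qed
  with frame g1 v Cv show ?thesis by blast
qed

section \<open>Vanishing curvature\<close>

text \<open>One step of Taylor's estimate by the mean value inequality. Three applications lead from
  a bounded third derivative to a cubic bound.\<close>

lemma abs_le_power_of_deriv:
  fixes f :: "real \<Rightarrow> real"
  assumes d: "\<And>t. t \<in> {0..1} \<Longrightarrow> (f has_real_derivative f' t) (at t within {0..1})"
    and b: "\<And>t. t \<in> {0..1} \<Longrightarrow> \<bar>f' t\<bar> \<le> C * \<bar>t - t0\<bar> ^ k"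
    and t0: "t0 \<in> {0..1}" "f t0 = 0" and t: "t \<in> {0..1}" and C: "0 \<le> C"
  shows "\<bar>f t\<bar> \<le> C * \<bar>t - t0\<bar> ^ Suc k"
proof -
  have sub: "closed_segment t0 t \<subseteq> {0..1}"
    using t0 t by (auto simp: closed_segment_eq_real_ivl)
  have "norm (f t - f t0) \<le> (C * \<bar>t - t0\<bar> ^ k) * norm (t - t0)"
  proof (rule field_differentiable_bound[of "closed_segment t0 t" f f'])
    fix x assume x: "x \<in> closed_segment t0 t"
    then have x01: "x \<in> {0..1}" using sub by blast
    show "(f has_field_derivative f' x) (at x within closed_segment t0 t)"
      using DERIV_subset[OF d[OF x01] sub] .
    have "\<bar>x - t0\<bar> \<le> \<bar>t - t0\<bar>" using x by (auto simp: closed_segment_eq_real_ivl split: if_splits)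
    then have "C * \<bar>x - t0\<bar> ^ k \<le> C * \<bar>t - t0\<bar> ^ k" using C by (intro mult_left_mono power_mono) auto
    with b[OF x01] show "norm (f' x) \<le> C * \<bar>t - t0\<bar> ^ k" by simp
  qed auto
  then show ?thesis using t0 by (simp add: mult_ac)
qed

lemma SO2_coords:
  assumes "R \<in> SO2"
  shows "(R$1$1)\<^sup>2 + (R$1$2)\<^sup>2 = 1" "R$2$1 = - R$1$2" "R$2$2 = R$1$1"
proof -
  have o: "orthogonal_matrix R" and d: "det R = 1" using assms by (auto simp: SO2_def rotation_matrix_def)
  have d': "R$1$1 * R$2$2 - R$1$2 * R$2$1 = 1" using d by (simp add: det_2)
  have "R ** transpose R = mat 1" using o by (simp add: orthogonal_matrix_def)
  then have e: "(R ** transpose R)$i$j = mat 1$i$j" for i j by simp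
  have e11: "R$1$1 * R$1$1 + R$1$2 * R$1$2 = 1" and e12: "R$1$1 * R$2$1 + R$1$2 * R$2$2 = 0"
    and e22: "R$2$1 * R$2$1 + R$2$2 * R$2$2 = 1"
    using e[of 1 1] e[of 1 2] e[of 2 2] by (simp_all add: matrix_matrix_mult_def transpose_def sum_2 mat_def)
  show "(R$1$1)\<^sup>2 + (R$1$2)\<^sup>2 = 1" using e11 by (simp add: power2_eq_square)
  show "R$2$2 = R$1$1" using d' e11 e12 by algebra
  show "R$2$1 = - R$1$2" using d' e11 e12 by algebra
qed

text \<open>If the curvature vanishes at \<open>z\<close>, then in the rotated coordinates the curve stays within
  \<open>O(h\<^sup>3)\<close> of its tangent at distance \<open>h\<close> from \<open>z\<close>, so a graph \<open>|x| powr \<kappa>'\<close> forces \<open>\<kappa>' \<ge> 3\<close>.\<close>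

lemma curvature_vanishing_exponent:
  fixes \<gamma> :: "real \<Rightarrow> real^2"
  assumes sc: "smooth_curve \<gamma>" and t0: "t0 \<in> {0..1}" and curv: "curvature \<gamma> t0 = 0"
    and van: "curvature_vanishes_to_order \<gamma> (\<gamma> t0) r"
  shows "1 \<le> r"
proof (rule ccontr)
  assume "\<not> 1 \<le> r"
  obtain k where kk: "2 < k \<and> r = k - 2 \<and> (\<exists>R\<in>SO2. \<exists>\<delta>>0. \<exists>I U a g.
          (if \<gamma> t0 \<in> curve_endpoints \<gamma> then I = {0..<\<delta>} \<or> I = {-\<delta><..0} else I = {-\<delta><..<\<delta>}) \<and>
          open U \<and> 0 \<in> U \<and>
          (\<lambda>y. R *v (y - \<gamma> t0)) ` path_image \<gamma> \<inter> U = (\<lambda>x. vector [x, g x]) ` I \<and>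
          smooth_on I a \<and> (\<forall>x\<in>I. a x \<noteq> 0) \<and>
          ((\<forall>x\<in>I. g x = \<bar>x\<bar> powr k * a x) \<or> (\<forall>x\<in>I. g x = sgn x * \<bar>x\<bar> powr k * a x)))"
    using van unfolding curvature_vanishes_to_order_def by (rule exE)
  have k: "2 < k" "r = k - 2" using kk by simp_all
  note ex = kk[THEN conjunct2, THEN conjunct2]
  from ex obtain R \<delta> I U a g where R: "R \<in> SO2" and \<delta>: "\<delta> > 0"
    and I: "if \<gamma> t0 \<in> curve_endpoints \<gamma> then I = {0..<\<delta>} \<or> I = {-\<delta><..0} else I = {-\<delta><..<\<delta>}"
    and U: "open U" "0 \<in> U"
    and gr: "(\<lambda>y. R *v (y - \<gamma> t0)) ` path_image \<gamma> \<inter> U = (\<lambda>x. vector [x, g x]) ` I"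
    and a: "smooth_on I a" "\<forall>x\<in>I. a x \<noteq> 0"
    and g: "(\<forall>x\<in>I. g x = \<bar>x\<bar> powr k * a x) \<or> (\<forall>x\<in>I. g x = sgn x * \<bar>x\<bar> powr k * a x)"
    by blast
  have k3: "k < 3" using \<open>\<not> 1 \<le> r\<close> k by simp
  have I0: "0 \<in> I" using I \<delta> by (auto split: if_splits)
  note R' = SO2_coords[OF R]
  define A where "A = R$1$1" define B where "B = R$1$2"
  have AB: "A\<^sup>2 + B\<^sup>2 = 1" and R22: "R$2$1 = -B" "R$2$2 = A" using R' by (auto simp: A_def B_def)
  have sm: "smooth_on {0..1} \<gamma>" using sc unfolding smooth_curve_def smooth_along_def by auto
  define x where "x j t = nderiv {0..1} j \<gamma> t $ 1" for j t
  define y where "y j t = nderiv {0..1} j \<gamma> t $ 2" for j t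
  \<comment> \<open>Coordinates after the rigid motion. The base point is subtracted for
    \<open>j = 0\<close> only, since the constant disappears from the derivatives.\<close>
  define X where "X j t = A * (x j t - (if j = 0 then x 0 t0 else 0)) + B * (y j t - (if j = 0 then y 0 t0 else 0))" for j t
  define Y where "Y j t = - B * (x j t - (if j = 0 then x 0 t0 else 0)) + A * (y j t - (if j = 0 then y 0 t0 else 0))" for j t
  have dxy: "(x j has_real_derivative x (Suc j) s) (at s within {0..1})" "(y j has_real_derivative y (Suc j) s) (at s within {0..1})"
    if "s \<in> {0..1}" for j s
    using bounded_linear.has_vector_derivative[OF bounded_linear_vec_nth nderiv_has_vector_derivative[OF sm that]]
    unfolding x_def[abs_def] y_def[abs_def] has_real_derivative_iff_has_vector_derivative by blast+
  have dXY: "(X j has_real_derivative X (Suc j) s) (at s within {0..1})" "(Y j has_real_derivative Y (Suc j) s) (at s within {0..1})"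
    if "s \<in> {0..1}" for j s
    unfolding X_def[abs_def] Y_def[abs_def]
    by (rule DERIV_cong, (rule DERIV_add DERIV_cmult DERIV_diff dxy that DERIV_const)+, simp)+
  have XY0: "X 0 t0 = 0" "Y 0 t0 = 0" by (simp_all add: X_def Y_def)
  \<comment> \<open>Within \<open>[0, 1]\<close> the approach is one-sided when \<open>t0\<close> is
    0 or 1, also at the base point of a closed curve; a single side of the graph suffices for the
    contradiction.\<close>
  define F where "F = at t0 within {0..1::real}"
  have Fnt: "F \<noteq> bot" unfolding F_def using t0 by (simp add: trivial_limit_within)
  have F01: "\<forall>\<^sub>F t in F. t \<in> {0..1} \<and> t \<noteq> t0" unfolding F_def eventually_at_topological by auto
  have limt: "((\<lambda>t. t) \<longlongrightarrow> t0) F" unfolding F_def by (rule tendsto_ident_at)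
  then have lim0: "((\<lambda>t. \<bar>t - t0\<bar>) \<longlongrightarrow> 0) F"
    using tendsto_rabs[OF tendsto_diff[OF limt tendsto_const[of t0]]] by simp
  have limX: "(X 0 \<longlongrightarrow> 0) F" and limY: "(Y 0 \<longlongrightarrow> 0) F"
    using DERIV_continuous[OF dXY(1)[OF t0, of 0]] DERIV_continuous[OF dXY(2)[OF t0, of 0]] XY0
    by (simp_all add: F_def continuous_within)
  have coords: "R *v (\<gamma> t - \<gamma> t0) = vector [X 0 t, Y 0 t]" for t
    by (simp add: vec_eq_iff forall_2 matrix_vector_mult_def sum_2 X_def Y_def x_def y_def R22 flip: A_def B_def)
  have evU: "\<forall>\<^sub>F t in F. R *v (\<gamma> t - \<gamma> t0) \<in> U"
  proof -
    have "((\<lambda>t. R *v (\<gamma> t - \<gamma> t0)) \<longlongrightarrow> 0) F"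
    proof (rule vec_tendstoI)
      fix i :: 2
      show "((\<lambda>t. (R *v (\<gamma> t - \<gamma> t0)) $ i) \<longlongrightarrow> 0 $ i) F"
        using exhaust_2[of i] limX limY by (auto simp: coords)
    qed
    then show ?thesis using U by (rule topological_tendstoD)
  qed
  have evI: "\<forall>\<^sub>F t in F. X 0 t \<in> I \<and> Y 0 t = g (X 0 t)"
    using evU F01
  proof eventually_elim
    case (elim t)
    have "R *v (\<gamma> t - \<gamma> t0) \<in> (\<lambda>y. R *v (y - \<gamma> t0)) ` path_image \<gamma> \<inter> U"
      using elim by (auto simp: path_image_def)
    then obtain s where s: "s \<in> I" "R *v (\<gamma> t - \<gamma> t0) = vector [s, g s]" unfolding gr by auto
    from s(2) have "X 0 t = s" "Y 0 t = g s" unfolding coords by (simp_all add: vec_eq_iff forall_2)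
    with s(1) show ?case by simp
  qed
  have lima: "((\<lambda>t. a (X 0 t)) \<longlongrightarrow> a 0) F"
  proof -
    have "continuous (at 0 within I) a"
      using a(1) I0 unfolding smooth_on_def by (auto dest!: spec[of _ 0] intro!: differentiable_imp_continuous_within)
    then have ca: "(a \<longlongrightarrow> a 0) (at 0 within I)" by (simp add: continuous_within)
    show ?thesis
    proof (rule topological_tendstoI)
      fix S assume S: "open S" "a 0 \<in> S"
      from topological_tendstoD[OF ca this] obtain T where T: "open T" "0 \<in> T" "\<And>x. x \<in> T \<Longrightarrow> x \<in> I \<Longrightarrow> a x \<in> S"
        unfolding eventually_at_topological using S(2) by (metis)
      have "\<forall>\<^sub>F t in F. X 0 t \<in> T" using limX T(1,2) by (rule topological_tendstoD)
      then show "\<forall>\<^sub>F t in F. a (X 0 t) \<in> S" using evI by eventually_elim (use T(3) in blast)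
    qed
  qed
  define a0 where "a0 = \<bar>a 0\<bar>"
  have a0: "a0 > 0" using a(2) I0 by (simp add: a0_def)
  have aev: "\<forall>\<^sub>F t in F. a0/2 < \<bar>a (X 0 t)\<bar> \<and> \<bar>a (X 0 t)\<bar> < 2*a0"
  proof -
    have l: "((\<lambda>t. \<bar>a (X 0 t)\<bar>) \<longlongrightarrow> a0) F" unfolding a0_def by (rule tendsto_rabs[OF lima])
    show ?thesis
      by (rule eventually_conj[OF order_tendstoD(1)[OF l] order_tendstoD(2)[OF l]]) (use a0 in auto)
  qed
  have absY: "\<forall>\<^sub>F t in F. \<bar>Y 0 t\<bar> = \<bar>X 0 t\<bar> powr k * \<bar>a (X 0 t)\<bar>"
    using evI by eventually_elim (use g in \<open>auto simp: abs_mult sgn_if\<close>)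
  define h where "h t = \<bar>t - t0\<bar>" for t
  have hpos: "\<forall>\<^sub>F t in F. 0 < h t" using F01 by eventually_elim (auto simp: h_def)
  have limh: "(h \<longlongrightarrow> 0) F" unfolding h_def[abs_def] by (rule lim0)
  have qX: "((\<lambda>t. \<bar>X 0 t\<bar> / h t) \<longlongrightarrow> \<bar>X 1 t0\<bar>) F" and qY: "((\<lambda>t. \<bar>Y 0 t\<bar> / h t) \<longlongrightarrow> \<bar>Y 1 t0\<bar>) F"
  proof -
    have "((\<lambda>t. (X 0 t - X 0 t0) / (t - t0)) \<longlongrightarrow> X 1 t0) F" "((\<lambda>t. (Y 0 t - Y 0 t0) / (t - t0)) \<longlongrightarrow> Y 1 t0) F"
      using dXY[OF t0, of 0] unfolding has_field_derivative_iff F_def by simp_all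
    from this[THEN tendsto_rabs] show "((\<lambda>t. \<bar>X 0 t\<bar> / h t) \<longlongrightarrow> \<bar>X 1 t0\<bar>) F" "((\<lambda>t. \<bar>Y 0 t\<bar> / h t) \<longlongrightarrow> \<bar>Y 1 t0\<bar>) F"
      by (simp_all add: XY0 h_def)
  qed
  have powlim: "((\<lambda>t. h t powr e) \<longlongrightarrow> 0) F" if "e > 0" for e
    using tendsto_powr'[OF limh tendsto_const[of e]] that by (simp add: h_def)
  \<comment> \<open>On the graph \<open>|Y| / h = (|X| / h) powr k * |a| * h powr (k - 1)\<close>,
    which tends to 0 because \<open>k > 1\<close>: the tangent at the point is horizontal.\<close>
  have Y1: "Y 1 t0 = 0"
  proof -
    have "((\<lambda>t. (\<bar>X 0 t\<bar> / h t) powr k * \<bar>a (X 0 t)\<bar> * h t powr (k - 1)) \<longlongrightarrow> \<bar>X 1 t0\<bar> powr k * \<bar>a 0\<bar> * 0) F"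
      using k by (intro tendsto_mult tendsto_powr' qX tendsto_const tendsto_rabs lima powlim) (auto simp: h_def)
    moreover have "\<forall>\<^sub>F t in F. (\<bar>X 0 t\<bar> / h t) powr k * \<bar>a (X 0 t)\<bar> * h t powr (k - 1) = \<bar>Y 0 t\<bar> / h t"
      using absY hpos
    proof eventually_elim
      case (elim t)
      have "(\<bar>X 0 t\<bar> / h t) powr k * \<bar>a (X 0 t)\<bar> * h t powr (k - 1) = \<bar>X 0 t\<bar> powr k * \<bar>a (X 0 t)\<bar> * (h t powr (k - 1) / h t powr k)"
        using elim(2) by (simp add: powr_divide)
      also have "h t powr (k - 1) / h t powr k = h t powr (-1)" by (simp flip: powr_diff)
      also have "\<dots> = 1 / h t" using elim(2) by (simp add: powr_minus_divide)
      finally show ?case using elim(1) by simp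
    qed
    ultimately have "((\<lambda>t. \<bar>Y 0 t\<bar> / h t) \<longlongrightarrow> \<bar>X 1 t0\<bar> powr k * \<bar>a 0\<bar> * 0) F"
      by (simp add: filterlim_cong)
    with qY have "\<bar>Y 1 t0\<bar> = \<bar>X 1 t0\<bar> powr k * \<bar>a 0\<bar> * 0" using Fnt tendsto_unique by blast
    then show ?thesis by simp
  qed
  have ndz: "nderiv {0..1} 1 \<gamma> t0 \<noteq> 0" using sc t0 unfolding smooth_curve_def by blast
  have X1: "X 1 t0 \<noteq> 0"
  proof
    assume "X 1 t0 = 0"
    then have "A * x 1 t0 + B * y 1 t0 = 0" "- B * x 1 t0 + A * y 1 t0 = 0" using Y1 by (simp_all add: X_def Y_def)
    then have "x 1 t0 = 0" "y 1 t0 = 0" using AB by algebra+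
    then show False using ndz by (simp add: x_def y_def vec_eq_iff forall_2)
  qed
  \<comment> \<open>The numerator of the curvature is invariant under the rotation, and with
    \<open>Y 1 t0 = 0\<close> it reduces to \<open>X 1 t0 * Y 2 t0\<close>.\<close>
  have Y2: "Y 2 t0 = 0"
  proof -
    have "norm (nderiv {0..1} 1 \<gamma> t0) \<noteq> 0" using ndz by simp
    then have "x 1 t0 * y 2 t0 - y 1 t0 * x 2 t0 = 0"
      using curv by (simp add: curvature_def Let_def x_def y_def)
    moreover have "X 1 t0 * Y 2 t0 - Y 1 t0 * X 2 t0 = (A\<^sup>2 + B\<^sup>2) * (x 1 t0 * y 2 t0 - y 1 t0 * x 2 t0)"
      by (simp add: X_def Y_def power2_eq_square algebra_simps)
    ultimately have "X 1 t0 * Y 2 t0 = 0" using Y1 by simp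
    then show ?thesis using X1 by simp
  qed
  have CY: "Cinf (Y 3)"
  proof -
    have "Y 3 = (\<lambda>t. (- B) * nderiv {0..1} 3 \<gamma> t $ 1 + A * nderiv {0..1} 3 \<gamma> t $ 2)"
      by (auto simp: Y_def x_def y_def fun_eq_iff)
    then show ?thesis
      by (simp only:) (intro Cinf_intros(1-3) Cinf_nderiv[OF sm bounded_linear_vec_nth])
  qed
  obtain C where C: "\<And>t. t \<in> {0..1} \<Longrightarrow> \<bar>Y 3 t\<bar> \<le> C" using Cinf_bounded[OF CY] by blast
  have C0: "0 \<le> C" using C[OF t0] by linarith
  have Yle: "\<bar>Y 0 t\<bar> \<le> C * h t ^ 3" if t: "t \<in> {0..1}" for t
  proof -
    have 2: "\<bar>Y 2 s\<bar> \<le> C * \<bar>s - t0\<bar> ^ Suc 0" if "s \<in> {0..1}" for s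
      by (rule abs_le_power_of_deriv[where f="Y 2" and f'="Y 3", OF _ _ t0 Y2 that C0]) (use dXY(2)[of _ 2] C in \<open>auto simp: eval_nat_numeral\<close>)
    have 1: "\<bar>Y 1 s\<bar> \<le> C * \<bar>s - t0\<bar> ^ Suc (Suc 0)" if "s \<in> {0..1}" for s
      by (rule abs_le_power_of_deriv[where f="Y 1" and f'="Y 2", OF _ 2 t0 Y1 that C0]) (use dXY(2)[of _ 1] in \<open>auto simp: eval_nat_numeral\<close>)
    have "\<bar>Y 0 t\<bar> \<le> C * \<bar>t - t0\<bar> ^ Suc (Suc (Suc 0))"
      by (rule abs_le_power_of_deriv[where f="Y 0" and f'="Y 1", OF _ 1 t0 XY0(2) t C0]) (use dXY(2)[of _ 0] in auto)
    then show ?thesis by (simp add: h_def eval_nat_numeral)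
  qed
  \<comment> \<open>Division of the cubic bound by \<open>h powr k\<close>: the left side tends to a
    positive limit, whereas the right side tends to 0 when \<open>k < 3\<close>.\<close>
  have ineq: "\<forall>\<^sub>F t in F. (\<bar>X 0 t\<bar> / h t) powr k * \<bar>a (X 0 t)\<bar> \<le> C * h t powr (3 - k)"
    using absY hpos F01
  proof eventually_elim
    case (elim t)
    have "(\<bar>X 0 t\<bar> / h t) powr k * \<bar>a (X 0 t)\<bar> = \<bar>Y 0 t\<bar> / h t powr k"
      using elim by (simp add: powr_divide)
    also have "\<dots> \<le> C * h t ^ 3 / h t powr k" using Yle elim(3) by (intro divide_right_mono) auto
    also have "h t ^ 3 = h t powr 3" using elim(2) by simp
    also have "C * h t powr 3 / h t powr k = C * h t powr (3 - k)" by (simp add: powr_diff)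
    finally show ?case .
  qed
  have l1: "((\<lambda>t. (\<bar>X 0 t\<bar> / h t) powr k * \<bar>a (X 0 t)\<bar>) \<longlongrightarrow> \<bar>X 1 t0\<bar> powr k * \<bar>a 0\<bar>) F"
    using X1 by (intro tendsto_mult tendsto_powr qX tendsto_const tendsto_rabs lima) auto
  have l2: "((\<lambda>t. C * h t powr (3 - k)) \<longlongrightarrow> C * 0) F"
    using k3 by (intro tendsto_mult tendsto_const powlim) auto
  have "\<bar>X 1 t0\<bar> powr k * \<bar>a 0\<bar> \<le> C * 0"
    by (rule tendsto_le[OF Fnt l2 l1 ineq])
  moreover have "0 < \<bar>X 1 t0\<bar> powr k * \<bar>a 0\<bar>" using X1 a0 by (simp add: a0_def)
  ultimately show False by simp
qed

lemma curvature_nonvanishing: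
  fixes \<gamma> :: "real \<Rightarrow> real^2"
  assumes sc: "smooth_curve \<gamma>" and \<kappa>: "\<kappa> < (3 + sqrt 5) / 2"
    and van: "\<forall>z\<in>zero_curvature_points \<gamma>. \<exists>r\<le>\<kappa> - 2. curvature_vanishes_to_order \<gamma> z r"
    and t: "t \<in> {0..1}"
  shows "curvature \<gamma> t \<noteq> 0"
proof
  assume c: "curvature \<gamma> t = 0"
  then have "\<gamma> t \<in> zero_curvature_points \<gamma>" using t unfolding zero_curvature_points_def by blast
  then obtain r where r: "r \<le> \<kappa> - 2" "curvature_vanishes_to_order \<gamma> (\<gamma> t) r" using van by blast
  have "sqrt 5 < 3" by (rule real_less_lsqrt) auto
  then have "(3 + sqrt 5) / 2 < 3" by simp
  then have "r < 1" using r(1) \<kappa> by linarith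
  with curvature_vanishing_exponent[OF sc t c r(2)] show False by simp
qed

section \<open>Lipschitz frames and injectivity of the tube\<close>

context moving_frame
begin

lemma \<nu>_lipschitz:
  assumes "s \<in> {0..1}" "s' \<in> {0..1}"
  shows "norm (\<nu> s - \<nu> s') \<le> K * \<bar>s - s'\<bar>"
proof -
  have "norm (\<nu> s - \<nu> s') \<le> K * norm (s - s')"
  proof (rule differentiable_bound[of "{0..1}" \<nu> "\<lambda>x y. y *\<^sub>R (\<mu> x *\<^sub>R \<tau> x)"])
    fix x :: real assume x: "x \<in> {0..1}"
    show "(\<nu> has_derivative (\<lambda>y. y *\<^sub>R (\<mu> x *\<^sub>R \<tau> x))) (at x within {0..1})"
      using d\<nu>[OF x] by (simp add: has_vector_derivative_def)
    have "\<bar>\<mu> x\<bar> * \<bar>y\<bar> \<le> K * \<bar>y\<bar>" for y by (intro mult_right_mono bound[OF x]) auto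
    then show "onorm (\<lambda>y. y *\<^sub>R (\<mu> x *\<^sub>R \<tau> x)) \<le> K"
      by (intro onorm_le) (simp add: frame(1)[OF x] abs_mult mult.commute)
  qed (use assms in auto)
  then show ?thesis by simp
qed

lemma \<tau>_lipschitz:
  assumes "s \<in> {0..1}" "s' \<in> {0..1}"
  shows "norm (\<tau> s - \<tau> s') \<le> K * \<bar>s - s'\<bar>"
proof -
  have "norm (\<tau> s - \<tau> s') \<le> K * norm (s - s')"
  proof (rule differentiable_bound[of "{0..1}" \<tau> "\<lambda>x y. y *\<^sub>R (- (\<mu> x *\<^sub>R \<nu> x))"])
    fix x :: real assume x: "x \<in> {0..1}"
    show "(\<tau> has_derivative (\<lambda>y. y *\<^sub>R (- (\<mu> x *\<^sub>R \<nu> x)))) (at x within {0..1})"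
      using d\<tau>[OF x] by (simp add: has_vector_derivative_def)
    have "\<bar>\<mu> x\<bar> * \<bar>y\<bar> \<le> K * \<bar>y\<bar>" for y by (intro mult_right_mono bound[OF x]) auto
    then show "onorm (\<lambda>y. y *\<^sub>R (- (\<mu> x *\<^sub>R \<nu> x))) \<le> K"
      by (intro onorm_le) (simp add: frame(2)[OF x] abs_mult mult.commute)
  qed (use assms in auto)
  then show ?thesis by simp
qed

text \<open>At parameter distance at most \<open>1/K\<close> from \<open>c\<close> the tangent
  differs from \<open>\<tau> c\<close> by at most 1 in norm, which for unit vectors means an inner
  product of at least \<open>1/2\<close>; the speed is at least \<open>c0\<close>. The base
  \<open>c\<close> is separate from \<open>s\<close> and \<open>s'\<close> so that it can be either
  end of a closed curve.\<close>

lemma tangential_growth: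
  assumes s: "s \<in> {0..1}" "s' \<in> {0..1}" "s' \<le> s" and c: "c \<in> {0..1}" "\<bar>s - c\<bar> \<le> 1/K" "\<bar>s' - c\<bar> \<le> 1/K"
  shows "c0/2 * (s - s') \<le> (\<gamma> s - \<gamma> s') \<bullet> \<tau> c"
proof -
  define f where "f x = \<tau> c \<bullet> \<gamma> x - c0/2 * x" for x
  have df: "(f has_real_derivative (v x * (\<tau> c \<bullet> \<tau> x) - c0/2)) (at x within {0..1})" if x01: "x \<in> {0..1}" for x
    unfolding f_def[abs_def] by (rule DERIV_cong[OF DERIV_diff[OF dg[OF x01] DERIV_cmult[OF DERIV_ident]]]) simp
  have "f s' \<le> f s"
  proof (rule DERIV_nonneg_imp_increasing_open[OF s(3)])
    fix x assume x: "s' < x" "x < s"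
    then have x01: "x \<in> {0..1}" and xo: "0 < x" "x < 1" using s by auto
    have "norm (\<tau> x - \<tau> c) \<le> K * \<bar>x - c\<bar>" by (rule \<tau>_lipschitz[OF x01 c(1)])
    also have "\<dots> \<le> K * (1/K)" using x c K by (intro mult_left_mono) auto
    finally have "norm (\<tau> x - \<tau> c) \<le> 1" using K by simp
    then have "(norm (\<tau> x - \<tau> c))\<^sup>2 \<le> 1" by (simp add: power_le_one)
    moreover have "(norm (\<tau> x - \<tau> c))\<^sup>2 = 2 - 2 * (\<tau> c \<bullet> \<tau> x)"
      using frame(1)[OF x01] frame(1)[OF c(1)]
      by (simp add: power2_norm_eq_inner inner_diff_left inner_diff_right inner_commute norm_eq_1)
    ultimately have h: "1/2 \<le> \<tau> c \<bullet> \<tau> x" by simp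
    have "c0 \<le> v x" using nondeg(2)[OF x01, of 0] e0 by simp
    then have "c0 * (1/2) \<le> v x * (\<tau> c \<bullet> \<tau> x)" using h c0 by (intro mult_mono) auto
    then have "0 \<le> v x * (\<tau> c \<bullet> \<tau> x) - c0/2" by simp
    moreover have "(f has_real_derivative (v x * (\<tau> c \<bullet> \<tau> x) - c0/2)) (at x)"
      using df[OF x01] at_within_Icc_at[OF xo] by simp
    ultimately show "\<exists>y. (f has_real_derivative y) (at x) \<and> 0 \<le> y" by blast
  next
    have "continuous_on {0..1} f" by (rule DERIV_continuous_on, erule df)
    then show "continuous_on {s'..s} f" by (rule continuous_on_subset) (use s in auto)
  qed
  then show ?thesis
    by (simp add: f_def inner_diff_left inner_commute[of "\<tau> c"] right_diff_distrib diff_divide_distrib)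
qed

text \<open>Locally, the tangential component of a collision is bounded by \<open>\<epsilon> K |s - s'|\<close> but grows like
  \<open>c0/2 |s - s'|\<close>; the third case is a pair straddling the base point of a closed curve.\<close>

lemma tube_injective:
  assumes sp: "simple_path \<gamma>" and cl: "pathfinish \<gamma> = pathstart \<gamma> \<Longrightarrow> \<tau> 0 = \<tau> 1 \<and> \<nu> 0 = \<nu> 1"
  shows "\<exists>e1>0. \<forall>s\<in>{0..1}. \<forall>s'\<in>{0..1}. \<forall>t t'. \<bar>t\<bar> \<le> e1 \<longrightarrow> \<bar>t'\<bar> \<le> e1 \<longrightarrow>
    \<gamma> s + t *\<^sub>R \<nu> s = \<gamma> s' + t' *\<^sub>R \<nu> s' \<longrightarrow> \<gamma> s = \<gamma> s' \<and> t = t'"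
proof -
  define \<delta> where "\<delta> = 1 / K"
  define closed where "closed \<longleftrightarrow> pathfinish \<gamma> = pathstart \<gamma>"
  have inj: "s = s' \<or> (s = 0 \<and> s' = 1) \<or> (s = 1 \<and> s' = 0)" if "s \<in> {0..1}" "s' \<in> {0..1}" "\<gamma> s = \<gamma> s'" for s s'
    using sp that unfolding simple_path_def loop_free_def by blast
  \<comment> \<open>Pairs of parameters that are not close, for a closed curve also not close across
    the base point. On this compact set simplicity of the path keeps the two points at a distance of
    at least \<open>m\<close>.\<close>
  define P where "P = {z \<in> {0..1} \<times> {0..1::real}. \<delta> \<le> fst z - snd z \<and> (closed \<longrightarrow> fst z - snd z \<le> 1 - \<delta>)}"
  have dpos: "\<delta> > 0" using K by (simp add: \<delta>_def)
  have "compact P"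
  proof -
    have "P = ({0..1} \<times> {0..1::real}) \<inter> ({z. \<delta> \<le> fst z - snd z} \<inter> (if closed then {z. fst z - snd z \<le> 1 - \<delta>} else UNIV))"
      unfolding P_def by auto
    moreover have "Topological_Spaces.closed ({z::real \<times> real. \<delta> \<le> fst z - snd z} \<inter> (if closed then {z. fst z - snd z \<le> 1 - \<delta>} else UNIV))"
      by (auto intro!: closed_Int closed_Collect_le continuous_intros)
    ultimately show ?thesis by (simp only:) (intro compact_Int_closed compact_Times compact_Icc)
  qed
  have ne: "\<gamma> (fst z) \<noteq> \<gamma> (snd z)" if z: "z \<in> P" for z
  proof
    assume eq: "\<gamma> (fst z) = \<gamma> (snd z)"
    have z': "fst z \<in> {0..1}" "snd z \<in> {0..1}" "\<delta> \<le> fst z - snd z" "closed \<longrightarrow> fst z - snd z \<le> 1 - \<delta>" using z unfolding P_def by auto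
    with inj[OF z'(1,2) eq] dpos have "fst z = 1" "snd z = 0" by auto
    moreover from this eq have closed by (simp add: closed_def pathfinish_def pathstart_def)
    ultimately show False using z' dpos by auto
  qed
  obtain m where m: "m > 0" "\<And>z. z \<in> P \<Longrightarrow> m \<le> norm (\<gamma> (fst z) - \<gamma> (snd z))"
  proof (cases "P = {}")
    case True then show ?thesis using that[of 1] by simp
  next
    case False
    have "continuous_on P (\<lambda>z. norm (\<gamma> (fst z) - \<gamma> (snd z)))"
      by (intro continuous_intros continuous_on_compose2[OF conts(5)]) (auto simp: P_def)
    then obtain z0 where "z0 \<in> P" "\<forall>z\<in>P. norm (\<gamma> (fst z0) - \<gamma> (snd z0)) \<le> norm (\<gamma> (fst z) - \<gamma> (snd z))"
      using continuous_attains_inf[OF \<open>compact P\<close> False] by blast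
    then show ?thesis using that[of "norm (\<gamma> (fst z0) - \<gamma> (snd z0))"] ne by auto
  qed
  \<comment> \<open>\<open>m/4\<close> excludes collisions of pairs in \<open>P\<close>, where the
    two normal offsets together bridge at most \<open>2 * e1 < m\<close>; \<open>c0/(4*K)\<close>
    gives \<open>e1 * K < c0/2\<close>, so that for close pairs tangential growth beats the turning
    of the normals.\<close>
  define e1 where "e1 = min (m/4) (c0/(4*K))"
  have e1: "e1 > 0" "2 * e1 < m" "e1 * K < c0 / 2"
  proof -
    show "e1 > 0" "2 * e1 < m" using m c0 K by (auto simp: e1_def)
    have "e1 * K \<le> c0/(4*K) * K" using K by (intro mult_right_mono) (auto simp: e1_def)
    also have "\<dots> = c0/4" using K by simp
    finally show "e1 * K < c0 / 2" using c0 by simp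
  qed
  have main: "\<gamma> s = \<gamma> s' \<and> t = t'"
    if s: "s \<in> {0..1}" "s' \<in> {0..1}" "s' \<le> s" and t: "\<bar>t\<bar> \<le> e1" "\<bar>t'\<bar> \<le> e1"
      and eq: "\<gamma> s + t *\<^sub>R \<nu> s = \<gamma> s' + t' *\<^sub>R \<nu> s'" for s s' t t'
  proof -
    have diff: "\<gamma> s - \<gamma> s' = t' *\<^sub>R \<nu> s' - t *\<^sub>R \<nu> s" using eq by (simp add: algebra_simps)
    have fin: "t = t'" if "\<gamma> s = \<gamma> s'" "\<nu> s = \<nu> s'"
    proof -
      have "(t' - t) *\<^sub>R \<nu> s = 0" using diff that by (simp add: scaleR_diff_left)
      moreover have "\<nu> s \<noteq> 0" using frame(2)[OF s(1)] by auto
      ultimately show ?thesis by simp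
    qed
    \<comment> \<open>\<open>\<nu> c\<close> is orthogonal to \<open>\<tau> c\<close>, so the
      component of a normal offset at \<open>x\<close> along \<open>\<tau> c\<close> comes from the
      turning of the normal between \<open>c\<close> and \<open>x\<close> only.\<close>
    have small: "\<bar>u * (\<nu> x \<bullet> \<tau> c)\<bar> \<le> e1 * (K * \<bar>x - c\<bar>)" if "\<bar>u\<bar> \<le> e1" "x \<in> {0..1}" "c \<in> {0..1}" for u x c
    proof (rule abs_mult_le[OF that(1)])
      have "\<nu> x \<bullet> \<tau> c = (\<nu> x - \<nu> c) \<bullet> \<tau> c" using frame(3)[OF that(3)] by (simp add: inner_diff_left inner_commute[of "\<nu> c"])
      also have "\<bar>\<dots>\<bar> \<le> norm (\<nu> x - \<nu> c) * norm (\<tau> c)" by (rule Cauchy_Schwarz_ineq2)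
      also have "\<dots> \<le> K * \<bar>x - c\<bar>" using \<nu>_lipschitz[OF that(2,3)] frame(1)[OF that(3)] by simp
      finally show "\<bar>\<nu> x \<bullet> \<tau> c\<bar> \<le> K * \<bar>x - c\<bar>" .
    qed
    consider "s - s' \<le> \<delta>" | "\<delta> \<le> s - s'" "closed \<longrightarrow> s - s' \<le> 1 - \<delta>" | "closed" "1 - \<delta> \<le> s - s'"
      by linarith
    then show ?thesis
    proof cases
      case 1
      have "c0/2 * (s - s') \<le> (\<gamma> s - \<gamma> s') \<bullet> \<tau> s'"
        by (rule tangential_growth) (use s 1 dpos in \<open>auto simp: \<delta>_def\<close>)
      also have "\<dots> = - (t * (\<nu> s \<bullet> \<tau> s'))"
        unfolding diff using frame(3)[OF s(2)] by (simp add: inner_diff_left inner_commute[of "\<nu> s'"])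
      also have "\<dots> \<le> e1 * (K * \<bar>s - s'\<bar>)" using small[OF t(1) s(1,2)] by linarith
      also have "\<dots> = (e1 * K) * (s - s')" using s by simp
      finally have "(c0/2 - e1 * K) * (s - s') \<le> 0" by (simp add: left_diff_distrib)
      then have "s = s'" using e1(3) s by (simp add: mult_le_0_iff)
      then show ?thesis using fin by simp
    next
      case 2
      then have "(s, s') \<in> P" using s by (simp add: P_def)
      from m(2)[OF this] have "m \<le> norm (\<gamma> s - \<gamma> s')" by simp
      also have "\<dots> \<le> norm (t' *\<^sub>R \<nu> s') + norm (t *\<^sub>R \<nu> s)" unfolding diff by (rule norm_triangle_ineq4)
      also have "\<dots> \<le> 2 * e1" using t frame(2) s by simp
      finally show ?thesis using e1 by simp
    next
      case 3
      have cl': "\<tau> 0 = \<tau> 1" "\<nu> 0 = \<nu> 1" "\<gamma> 1 = \<gamma> 0"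
        using cl 3(1) by (auto simp: closed_def pathfinish_def pathstart_def)
      have "c0/2 * (s' - 0) \<le> (\<gamma> s' - \<gamma> 0) \<bullet> \<tau> 0" "c0/2 * (1 - s) \<le> (\<gamma> 1 - \<gamma> s) \<bullet> \<tau> 1"
        by (rule tangential_growth; use s 3 dpos in \<open>auto simp: \<delta>_def\<close>)+
      then have "c0/2 * (s' + (1 - s)) \<le> (\<gamma> s' - \<gamma> s) \<bullet> \<tau> 0"
        unfolding cl' by (simp add: inner_diff_left distrib_left)
      also have "\<dots> = t * (\<nu> s \<bullet> \<tau> 1) - t' * (\<nu> s' \<bullet> \<tau> 0)"
      proof -
        have "\<gamma> s' - \<gamma> s = t *\<^sub>R \<nu> s - t' *\<^sub>R \<nu> s'" using eq by (simp add: algebra_simps)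
        then show ?thesis using cl' by (simp add: inner_diff_left)
      qed
      also have "\<dots> \<le> e1 * (K * \<bar>s - 1\<bar>) + e1 * (K * \<bar>s' - 0\<bar>)"
        using small[OF t(1) s(1), of 1] small[OF t(2) s(2), of 0] by simp
      also have "\<dots> = (e1 * K) * (s' + (1 - s))" using s by (simp add: algebra_simps)
      finally have "(c0/2 - e1 * K) * (s' + (1 - s)) \<le> 0" by (simp add: left_diff_distrib)
      then have "s' + (1 - s) \<le> 0" using e1(3) by (simp add: mult_le_0_iff)
      then have "s' = 0" "s = 1" using s by auto
      then show ?thesis using fin cl' by simp
    qed
  qed
  have "\<gamma> s = \<gamma> s' \<and> t = t'"
    if "s \<in> {0..1}" "s' \<in> {0..1}" "\<bar>t\<bar> \<le> e1" "\<bar>t'\<bar> \<le> e1" "\<gamma> s + t *\<^sub>R \<nu> s = \<gamma> s' + t' *\<^sub>R \<nu> s'" for s s' t t'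
    using main[of s s' t t'] main[of s' s t' t] that by (metis linear)
  then show ?thesis using e1(1) by blast
qed

end

section \<open>Averages over rotations\<close>

text \<open>Parametrized with period 1, so that Lebesgue measure on \<open>[0, 1]\<close> is the
  uniform probability on the circle of rotations.\<close>

definition rot :: "real \<Rightarrow> real^2^2" where
  "rot s = vector [vector [cos (2*pi * s), - sin (2*pi * s)], vector [sin (2*pi * s), cos (2*pi * s)]]"

lemma rot_SO2: "rot s \<in> SO2"
proof -
  have sc: "sin (2*pi * s) * sin (2*pi * s) + cos (2*pi * s) * cos (2*pi * s) = 1"
    using sin_cos_squared_add[of "2*pi * s"] by (simp add: power2_eq_square)
  have "rot s ** transpose (rot s) = mat 1"
    using sc by (simp add: vec_eq_iff forall_2 matrix_matrix_mult_def transpose_def sum_2 mat_def rot_def algebra_simps)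
  then have "orthogonal_matrix (rot s)" by (simp add: orthogonal_matrix_def matrix_left_right_inverse)
  moreover have "det (rot s) = 1" using sc by (simp add: det_2 rot_def algebra_simps)
  ultimately show ?thesis by (simp add: SO2_def rotation_matrix_def)
qed

lemma norm_SO2: assumes "R \<in> SO2" shows "norm (R *v x) = norm x"
proof -
  note c = SO2_coords[OF assms]
  have "(R$1$1 * x$1 + R$1$2 * x$2)\<^sup>2 + (- R$1$2 * x$1 + R$1$1 * x$2)\<^sup>2 = ((R$1$1)\<^sup>2 + (R$1$2)\<^sup>2) * ((x$1)\<^sup>2 + (x$2)\<^sup>2)"
    by (simp add: power2_eq_square algebra_simps)
  then show ?thesis
    by (simp add: norm_real2 matrix_vector_mult_def sum_2 c)
qed

text \<open>\<open>p s = e \<bullet> (rot s *v x)\<close> is a sinusoid with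
  \<open>p\<^sup>2 + (p1 / (2*pi))\<^sup>2 = 1\<close>, so the estimate for the integral of
  \<open>1 / (p\<^sup>2 + d\<^sup>2)\<close> applies with \<open>d = 1/A\<close> and
  \<open>c = 1\<close>. The bound 64 for both derivatives comes from
  \<open>(2*pi)\<^sup>2 \<le> 64\<close>, and \<open>385 = 6*64 + 1\<close>.\<close>

lemma rotation_average:
  fixes x e :: "real^2"
  assumes x: "norm x = 1" and e: "norm e = 1" and A: "0 < A"
  shows "(\<integral>\<^sup>+s. indicator {0..1} s * ennreal (1 / (1 + A\<^sup>2 * (e \<bullet> (rot s *v x))\<^sup>2)) \<partial>lborel) \<le> ennreal (385 / A)"
proof -
  define P where "P = e \<bullet> x"
  define Q where "Q = e$2 * x$1 - e$1 * x$2"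
  define p where "p s = P * cos (2*pi * s) + Q * sin (2*pi * s)" for s
  define p1 where "p1 s = 2*pi * (Q * cos (2*pi * s) - P * sin (2*pi * s))" for s
  define p2 where "p2 s = - ((2*pi)\<^sup>2 * p s)" for s
  have peq: "e \<bullet> (rot s *v x) = p s" for s
    by (simp add: p_def P_def Q_def inner_real2 matrix_vector_mult_def sum_2 rot_def algebra_simps)
  have n: "x$1 * x$1 + x$2 * x$2 = 1" "e$1 * e$1 + e$2 * e$2 = 1" using x e by (simp_all add: norm_real2 power2_eq_square)
  have PQ: "P\<^sup>2 + Q\<^sup>2 = 1" using n unfolding P_def Q_def inner_real2 by algebra
  have key: "(p s)\<^sup>2 + (p1 s / (2*pi))\<^sup>2 = 1" for s
  proof -
    have "(p s)\<^sup>2 + (p1 s / (2*pi))\<^sup>2 = (P\<^sup>2 + Q\<^sup>2) * ((sin (2*pi * s))\<^sup>2 + (cos (2*pi * s))\<^sup>2)"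
    proof -
      have "p1 s / (2*pi) = Q * cos (2*pi * s) - P * sin (2*pi * s)" by (simp add: p1_def)
      then show ?thesis unfolding p_def by (simp only:) (simp only: power2_eq_square algebra_simps)
    qed
    then show ?thesis using PQ by simp
  qed
  have pi3: "3 < pi" "pi < 4" using pi_gt3 pi_less_4 by auto
  have ple: "\<bar>p s\<bar> \<le> 1" "\<bar>p1 s / (2*pi)\<bar> \<le> 1" for s
  proof -
    have "(p s)\<^sup>2 \<le> 1" "(p1 s / (2*pi))\<^sup>2 \<le> 1"
      using key[of s] zero_le_power2[of "p s"] zero_le_power2[of "p1 s / (2*pi)"] by linarith+
    then show "\<bar>p s\<bar> \<le> 1" "\<bar>p1 s / (2*pi)\<bar> \<le> 1" by (simp_all only: abs_square_le_1)
  qed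
  have "(2*pi)\<^sup>2 \<le> (8::real)\<^sup>2" using pi3 by (intro power_mono) auto
  then have pi64: "(2*pi)\<^sup>2 \<le> 64" by simp
  have b1: "\<bar>p1 s\<bar> \<le> 64" for s
  proof -
    have "\<bar>p1 s\<bar> = \<bar>p1 s / (2*pi)\<bar> * (2*pi)" by (simp add: abs_mult)
    also have "\<dots> \<le> 1 * (2*pi)" using ple(2)[of s] pi3 by (intro mult_right_mono) auto
    finally show ?thesis using pi3 by simp
  qed
  have b2: "\<bar>p2 s\<bar> \<le> 64" for s
  proof -
    have "\<bar>p2 s\<bar> = (2*pi)\<^sup>2 * \<bar>p s\<bar>" by (simp add: p2_def abs_mult)
    also have "\<dots> \<le> 64 * 1" using ple(1)[of s] pi64 by (intro mult_mono) auto
    finally show ?thesis by simp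
  qed
  have low: "1 \<le> (p s)\<^sup>2 + (p1 s)\<^sup>2" for s
  proof -
    have "(p1 s / (2*pi))\<^sup>2 \<le> (p1 s)\<^sup>2"
    proof -
      have "1 \<le> (2*pi)\<^sup>2" by (rule one_le_power) (use pi3 in simp)
      then have "(p1 s)\<^sup>2 / (2*pi)\<^sup>2 \<le> (p1 s)\<^sup>2 / 1" by (intro divide_left_mono) auto
      then show ?thesis by (simp add: power_divide)
    qed
    then show ?thesis using key[of s] by linarith
  qed
  have d1: "(p has_real_derivative p1 s) (at s within {0..1})" for s
    unfolding p_def[abs_def] p1_def by (auto intro!: derivative_eq_intros simp: algebra_simps)
  have d2: "(p1 has_real_derivative p2 s) (at s within {0..1})" for s
    unfolding p_def p1_def[abs_def] p2_def by (auto intro!: derivative_eq_intros simp: algebra_simps power2_eq_square)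
  have cp: "continuous_on {0..1} p" "continuous_on {0..1} p2"
    unfolding p2_def[abs_def] p_def[abs_def] by (intro continuous_intros)+
  have pos: "1 + A\<^sup>2 * (p s)\<^sup>2 > 0" for s by (rule add_pos_nonneg) auto
  define f where "f s = 1 / (1 + A\<^sup>2 * (p s)\<^sup>2)" for s
  have cf: "continuous_on {0..1} f"
    unfolding f_def[abs_def] by (intro continuous_intros cp) (use pos in \<open>auto simp: less_imp_neq[symmetric]\<close>)
  have intf: "integral {0..1} f \<le> 385 / A"
  \<comment> \<open>The estimate needs \<open>d \<le> 1\<close>; for \<open>A \<le> 1\<close> the
    trivial bound 1 is already below \<open>385 / A\<close>.\<close>
  proof (cases "A \<le> 1")
    case True
    have "integral {0..1} f \<le> integral {0..1} (\<lambda>s::real. 1)"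
      by (rule integral_le) (use cf pos in \<open>auto intro: integrable_continuous_interval simp: f_def divide_le_eq_1\<close>)
    also have "\<dots> = 1" by simp
    also have "1 \<le> 385 / A" using True A by simp
    finally show ?thesis .
  next
    case False
    define d where "d = 1 / A"
    have d: "0 < d" "d \<le> 1" using False by (auto simp: d_def)
    have feq: "f s = d\<^sup>2 * (1 / ((p s)\<^sup>2 + d\<^sup>2))" for s
      using A pos[of s] by (simp add: f_def d_def field_simps)
    have "integral {0..1} f = d\<^sup>2 * integral {0..1} (\<lambda>s. 1 / ((p s)\<^sup>2 + d\<^sup>2))"
      unfolding feq[abs_def] by (rule Henstock_Kurzweil_Integration.integral_mult_right)
    also have "\<dots> \<le> d\<^sup>2 * ((6*64+1) / 1 / d)"
      by (intro mult_left_mono integral_inverse_square_le[OF d1 d2 cp(2) b1 b2 _ low d]) auto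
    also have "\<dots> = 385 / A" using A by (simp add: d_def power2_eq_square)
    finally show ?thesis .
  qed
  have "(\<integral>\<^sup>+s. indicator {0..1} s * ennreal (f s) \<partial>lborel) = ennreal (integral {0..1} f)"
  proof -
    have "(f has_integral integral {0..1} f) {0..1}" using cf by (intro integrable_integral integrable_continuous_interval)
    moreover have "0 \<le> f s" for s using pos[of s] by (simp add: f_def)
    ultimately have "(\<integral>\<^sup>+s. ennreal (indicator {0..1} s * f s) \<partial>lborel) = ennreal (integral {0..1} f)"
      by (intro nn_integral_has_integral_lebesgue) auto
    moreover have "ennreal (indicator {0..1} s * f s) = indicator {0..1} s * ennreal (f s)" for s
      by (simp add: indicator_def)
    ultimately show ?thesis by simp
  qed
  also have "\<dots> \<le> ennreal (385 / A)" by (rule ennreal_leI[OF intf])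
  finally show ?thesis by (simp add: peq f_def)
qed

text \<open>The measure is accessible through its invariance. Averaging over the circle
  \<open>rot s\<close> leaves the integral unchanged; after the integrals are exchanged, the inner
  one is the case of \<open>rotation_average\<close> with the unit vector \<open>\<eta> *v x\<close>
  in place of \<open>x\<close>.\<close>

lemma haar_average:
  fixes \<mu> :: "(real^2^2) measure" and x e :: "real^2"
  assumes \<mu>: "normalized_haar_SO2 \<mu>" and x: "norm x = 1" and e: "norm e = 1" and A: "0 < A"
  shows "(\<lambda>\<eta>. 1 / (1 + A\<^sup>2 * (e \<bullet> (\<eta> *v x))\<^sup>2)) \<in> borel_measurable \<mu>"
    "(\<integral>\<^sup>+\<eta>. ennreal (1 / (1 + A\<^sup>2 * (e \<bullet> (\<eta> *v x))\<^sup>2)) \<partial>\<mu>) \<le> ennreal (385 / A)"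
proof -
  have sp: "space \<mu> = SO2" and st: "sets \<mu> = sets (restrict_space borel SO2)" and one: "emeasure \<mu> SO2 = 1"
    and inv: "\<And>R. R \<in> SO2 \<Longrightarrow> distr \<mu> \<mu> (\<lambda>\<eta>. R ** \<eta>) = \<mu>"
    using \<mu> unfolding normalized_haar_SO2_def by auto
  have m: "f \<in> borel_measurable \<mu>" if "continuous_on UNIV f" for f :: "real^2^2 \<Rightarrow> real"
  proof -
    have "f \<in> borel_measurable (restrict_space borel SO2)"
      by (rule measurable_restrict_space1) (rule borel_measurable_continuous_onI[OF that])
    then show ?thesis using measurable_cong_sets[OF st refl] by blast
  qed
  define X where "X i \<eta> = (\<eta> *v x) $ i" for i and \<eta> :: "real^2^2"
  have Xm [measurable]: "X i \<in> borel_measurable \<mu>" for i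
    unfolding X_def by (rule m) (simp add: matrix_vector_mult_def, intro continuous_intros)
  define g where "g \<eta> = 1 / (1 + A\<^sup>2 * (e \<bullet> (\<eta> *v x))\<^sup>2)" for \<eta>
  have gX: "g \<eta> = 1 / (1 + A\<^sup>2 * (e$1 * X 1 \<eta> + e$2 * X 2 \<eta>)\<^sup>2)" for \<eta> by (simp add: g_def X_def inner_real2)
  show gm: "(\<lambda>\<eta>. 1 / (1 + A\<^sup>2 * (e \<bullet> (\<eta> *v x))\<^sup>2)) \<in> borel_measurable \<mu>"
    unfolding g_def[symmetric] gX by measurable
  interpret M: finite_measure \<mu> by (rule finite_measureI) (simp add: sp one)
  interpret pair_sigma_finite lborel \<mu> by (rule pair_sigma_finite.intro) (rule sigma_finite_lborel, rule M.sigma_finite_measure_axioms)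
  have rotX: "e \<bullet> (rot s *v (\<eta> *v x)) = cos (2*pi * s) * (e$1 * X 1 \<eta> + e$2 * X 2 \<eta>) + sin (2*pi * s) * (e$2 * X 1 \<eta> - e$1 * X 2 \<eta>)" for s \<eta>
  proof -
    have "e \<bullet> (rot s *v y) = cos (2*pi * s) * (e$1 * y$1 + e$2 * y$2) + sin (2*pi * s) * (e$2 * y$1 - e$1 * y$2)" for y
      by (simp add: inner_real2 matrix_vector_mult_def sum_2 rot_def algebra_simps)
    then show ?thesis unfolding X_def .
  qed
  define H where "H s \<eta> = ennreal (1 / (1 + A\<^sup>2 * (e \<bullet> (rot s *v (\<eta> *v x)))\<^sup>2))" for s \<eta>
  have inv': "(\<integral>\<^sup>+\<eta>. ennreal (g \<eta>) \<partial>\<mu>) = (\<integral>\<^sup>+\<eta>. H s \<eta> \<partial>\<mu>)" for s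
  proof -
    have mm: "(\<lambda>\<eta>. rot s ** \<eta>) \<in> measurable \<mu> \<mu>"
    proof (rule ccontr)
      have R: "rot s ** \<eta> \<in> SO2" if "\<eta> \<in> SO2" for \<eta>
        using rot_SO2[of s] that by (auto simp: SO2_def rotation_matrix_def orthogonal_matrix_mul det_mul)
      have "(\<lambda>\<eta>. rot s ** \<eta>) \<in> measurable (restrict_space borel SO2) (restrict_space borel SO2)"
      proof (rule measurable_restrict_space3)
        have "continuous_on UNIV (\<lambda>\<eta>. rot s ** \<eta>)"
          unfolding matrix_matrix_mult_def by (intro continuous_intros)
        then show "(\<lambda>\<eta>. rot s ** \<eta>) \<in> borel_measurable borel" by (rule borel_measurable_continuous_onI)
      qed (use R in auto)
      then show "(\<lambda>\<eta>. rot s ** \<eta>) \<notin> measurable \<mu> \<mu> \<Longrightarrow> False"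
        using measurable_cong_sets[OF st st] by blast
    qed
    have "(\<integral>\<^sup>+\<eta>. ennreal (g \<eta>) \<partial>\<mu>) = (\<integral>\<^sup>+\<eta>. ennreal (g \<eta>) \<partial>distr \<mu> \<mu> (\<lambda>\<eta>. rot s ** \<eta>))"
      by (simp add: inv[OF rot_SO2])
    also have "\<dots> = (\<integral>\<^sup>+\<eta>. ennreal (g (rot s ** \<eta>)) \<partial>\<mu>)"
      using gm unfolding g_def[symmetric] by (intro nn_integral_distr[OF mm]) measurable
    finally show ?thesis by (simp add: H_def g_def matrix_vector_mul_assoc)
  qed
  have Hm: "(\<lambda>(s, \<eta>). indicator {0..1} s * H s \<eta>) \<in> borel_measurable (lborel \<Otimes>\<^sub>M \<mu>)"
    unfolding H_def rotX by measurable
  have "(\<integral>\<^sup>+\<eta>. ennreal (g \<eta>) \<partial>\<mu>) = (\<integral>\<^sup>+s. indicator {0..1::real} s * (\<integral>\<^sup>+\<eta>. ennreal (g \<eta>) \<partial>\<mu>) \<partial>lborel)"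
    by (subst nn_integral_multc) auto
  also have "\<dots> = (\<integral>\<^sup>+s. (\<integral>\<^sup>+\<eta>. indicator {0..1} s * H s \<eta> \<partial>\<mu>) \<partial>lborel)"
  proof (rule nn_integral_cong)
    fix s
    have "(\<lambda>\<eta>. H s \<eta>) \<in> borel_measurable \<mu>" unfolding H_def rotX by measurable
    then show "indicator {0..1::real} s * (\<integral>\<^sup>+\<eta>. ennreal (g \<eta>) \<partial>\<mu>) = (\<integral>\<^sup>+\<eta>. indicator {0..1} s * H s \<eta> \<partial>\<mu>)"
      unfolding inv'[of s] by (rule nn_integral_cmult[symmetric])
  qed
  also have "\<dots> = (\<integral>\<^sup>+\<eta>. (\<integral>\<^sup>+s. indicator {0..1} s * H s \<eta> \<partial>lborel) \<partial>\<mu>)"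
    by (rule Fubini'[OF Hm, symmetric])
  also have "\<dots> \<le> (\<integral>\<^sup>+\<eta>. ennreal (385 / A) \<partial>\<mu>)"
  proof (rule nn_integral_mono)
    fix \<eta> assume "\<eta> \<in> space \<mu>"
    then have "norm (\<eta> *v x) = 1" using norm_SO2[of \<eta> x] x sp by simp
    then show "(\<integral>\<^sup>+s. indicator {0..1} s * H s \<eta> \<partial>lborel) \<le> ennreal (385 / A)"
      unfolding H_def by (rule rotation_average[OF _ e A])
  qed
  also have "\<dots> = ennreal (385 / A)" using sp one by simp
  finally show "(\<integral>\<^sup>+\<eta>. ennreal (1 / (1 + A\<^sup>2 * (e \<bullet> (\<eta> *v x))\<^sup>2)) \<partial>\<mu>) \<le> ennreal (385 / A)"
    by (simp add: g_def)
qed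

section \<open>Decomposition of the weight profile\<close>

text \<open>\<open>G\<close> lives on the closed interval and has one-sided derivatives at its ends,
  so that integration by parts can reach breakpoints at which the profile jumps.\<close>

definition piece_of :: "(real \<Rightarrow> real) \<Rightarrow> real \<Rightarrow> real \<Rightarrow> (real \<Rightarrow> real) \<Rightarrow> (real \<Rightarrow> real) \<Rightarrow> bool" where
  "piece_of \<theta> a b G G' \<longleftrightarrow> (\<forall>u\<in>{a..b}. (G has_real_derivative G' u) (at u within {a..b})) \<and>
     continuous_on {a..b} G' \<and> (\<forall>u\<in>{a<..<b}. G u = \<theta> u)"

lemma piecewise_C1_pieces:
  assumes "piecewise_C1 g"
  shows "\<exists>S. finite S \<and> (\<forall>a b. a < b \<longrightarrow> {a<..<b} \<inter> S = {} \<longrightarrow> (\<exists>G G'. piece_of g a b G G'))"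
proof -
  obtain S where S: "finite S" "\<And>a b. a < b \<Longrightarrow> {a<..<b} \<inter> S = {} \<Longrightarrow>
         (\<exists>G. G C1_differentiable_on {a..b} \<and> (\<forall>x\<in>{a<..<b}. G x = g x))"
    using assms unfolding piecewise_C1_def by blast
  have "\<exists>G G'. piece_of g a b G G'" if ab: "a < b" "{a<..<b} \<inter> S = {}" for a b
  proof -
    obtain G where G: "G C1_differentiable_on {a..b}" "\<forall>x\<in>{a<..<b}. G x = g x" using S(2)[OF ab] by blast
    then obtain D where D: "\<forall>x\<in>{a..b}. (G has_vector_derivative D x) (at x)" "continuous_on {a..b} D"
      unfolding C1_differentiable_on_def by blast
    have "piece_of g a b G D" unfolding piece_of_def
      using D G(2) by (auto simp: has_real_derivative_iff_has_vector_derivative intro: has_vector_derivative_at_within)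
    then show ?thesis by blast
  qed
  with S(1) show ?thesis by blast
qed

text \<open>The extension up to the ends is obtained by integrating the extension \<open>H\<close>
  of the derivative, starting from \<open>\<theta> a\<close>; continuity of \<open>\<theta>\<close>
  and the fundamental theorem identify it with \<open>\<theta>\<close> inside.\<close>

lemma antiderivative_piece:
  fixes \<theta> :: "real \<Rightarrow> real"
  assumes "continuous_on UNIV \<theta>" "a < b" "\<And>u. u \<in> {a<..<b} \<Longrightarrow> \<theta> field_differentiable (at u)"
    "continuous_on {a..b} H" "\<And>u. u \<in> {a<..<b} \<Longrightarrow> H u = deriv \<theta> u"
  shows "\<exists>G G'. piece_of \<theta> a b G G'"
proof -
  define G where "G x = \<theta> a + integral {a..x} H" for x
  have d: "(G has_real_derivative H u) (at u within {a..b})" if "u \<in> {a..b}" for u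
    unfolding G_def[abs_def]
    using DERIV_add[OF DERIV_const integral_has_real_derivative[OF assms(4) that], of "\<theta> a"] by simp
  have "G u = \<theta> u" if u: "u \<in> {a<..<b}" for u
  proof -
    have "(H has_integral (\<theta> u - \<theta> a)) {a..u}"
    proof (rule fundamental_theorem_of_calculus_interior)
      show "continuous_on {a..u} \<theta>" using assms(1) by (rule continuous_on_subset) auto
      fix x assume x: "x \<in> {a<..<u}"
      then have x': "x \<in> {a<..<b}" using u by auto
      then show "(\<theta> has_vector_derivative H x) (at x)"
        using assms(3)[OF x'] assms(5)[OF x'] DERIV_deriv_iff_field_differentiable
        by (metis has_real_derivative_iff_has_vector_derivative)
    qed (use u in auto)
    then show ?thesis by (simp add: G_def integral_unique)
  qed
  with d assms(4) have "piece_of \<theta> a b G H" by (auto simp: piece_of_def)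
  then show ?thesis by blast
qed

text \<open>For \<open>q = 0\<close> the pieces are given. For \<open>q = 1\<close> they are
  recovered from those of the derivative, with the points of nondifferentiability as further
  breakpoints. For \<open>q \<ge> 2\<close> the profile is \<open>C\<^sup>1\<close> on the whole
  line and there is no breakpoint.\<close>

lemma weight_profile_pieces:
  assumes "weight_profile q \<theta>"
  shows "\<exists>S. finite S \<and> (\<forall>a b. a < b \<longrightarrow> {a<..<b} \<inter> S = {} \<longrightarrow> (\<exists>G G'. piece_of \<theta> a b G G'))"
proof (cases "q = 0")
  case True
  then show ?thesis using assms piecewise_C1_pieces unfolding weight_profile_def by auto
next
  case False
  then have w: "\<forall>j<q-1. \<forall>s. (deriv ^^ j) \<theta> field_differentiable (at s)"
      "continuous_on UNIV ((deriv ^^ (q-1)) \<theta>)"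
      "\<exists>S. finite S \<and> (\<forall>s\<in>-S. (deriv ^^ (q-1)) \<theta> field_differentiable (at s))"
      "piecewise_C1 ((deriv ^^ q) \<theta>)"
    using assms unfolding weight_profile_def by auto
  have fd_cont: "continuous_on UNIV g" if "\<And>s. g field_differentiable (at s)" for g :: "real \<Rightarrow> real"
    using that by (simp add: continuous_on_eq_continuous_at field_differentiable_imp_continuous_at)
  show ?thesis
  proof (cases "q = 1")
    case True
    then have c: "continuous_on UNIV \<theta>" and p: "piecewise_C1 (deriv \<theta>)" using w by simp_all
    obtain S1 where S1: "finite S1" "\<forall>s\<in>-S1. \<theta> field_differentiable (at s)" using w(3) True by auto
    obtain S2 where S2: "finite S2" "\<And>a b. a < b \<Longrightarrow> {a<..<b} \<inter> S2 = {} \<Longrightarrow> (\<exists>G G'. piece_of (deriv \<theta>) a b G G')"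
      using piecewise_C1_pieces[OF p] by blast
    have "\<exists>G G'. piece_of \<theta> a b G G'" if ab: "a < b" "{a<..<b} \<inter> (S1 \<union> S2) = {}" for a b
    proof -
      obtain G G' where G: "piece_of (deriv \<theta>) a b G G'" using S2(2)[of a b] ab by blast
      have cG: "continuous_on {a..b} G" by (rule DERIV_continuous_on) (use G in \<open>auto simp: piece_of_def\<close>)
      show ?thesis
        by (rule antiderivative_piece[OF c ab(1) _ cG]) (use G ab S1 in \<open>auto simp: piece_of_def\<close>)
    qed
    then show ?thesis using S1(1) S2(1) by (intro exI[of _ "S1 \<union> S2"]) auto
  next
    case False
    then have q: "0 < q - 1" using \<open>q \<noteq> 0\<close> by simp
    have fd: "\<theta> field_differentiable (at s)" for s using w(1) q by (metis funpow_0)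
    have "continuous_on UNIV (deriv \<theta>)"
    proof (cases "q = 2")
      case True then show ?thesis using w(2) by simp
    next
      case F: False
      then have "1 < q - 1" using q False by simp
      with w(1) have "(deriv ^^ 1) \<theta> field_differentiable (at s)" for s by blast
      then show ?thesis by (intro fd_cont) simp
    qed
    then have "\<exists>G G'. piece_of \<theta> a b G G'" if "a < b" for a b
      by (intro antiderivative_piece[OF fd_cont[OF fd] that fd, of "deriv \<theta>"]) (auto intro: continuous_on_subset)
    then show ?thesis by (intro exI[of _ "{}"]) auto
  qed
qed

text \<open>Equality is claimed off the finite set \<open>T\<close> because the values at the
  breakpoints are arbitrary; the integrals do not see them, and the pieces together keep the total
  mass 1.\<close>

lemma weight_profile_decomposition:
  assumes w: "weight_profile q \<theta>"
  shows "\<exists>P G G' T. finite P \<and> finite T \<and>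
    (\<forall>p\<in>P. -1 \<le> fst p \<and> fst p < snd p \<and> snd p \<le> (1::real) \<and>
       (\<forall>u\<in>{fst p..snd p}. (G p has_real_derivative G' p u) (at u within {fst p..snd p})) \<and>
       continuous_on {fst p..snd p} (G' p)) \<and>
    (\<forall>x. x \<notin> T \<longrightarrow> \<theta> x = (\<Sum>p\<in>P. indicator {fst p<..<snd p} x * G p x)) \<and>
    (\<Sum>p\<in>P. integral {fst p..snd p} (G p)) = 1"
proof -
  obtain S where S: "finite S" "\<And>a b. a < b \<Longrightarrow> {a<..<b} \<inter> S = {} \<Longrightarrow> (\<exists>G G'. piece_of \<theta> a b G G')"
    using weight_profile_pieces[OF w] by blast
  define T where "T = insert (-1) (insert 1 (S \<inter> {-1..1}))"
  have T: "finite T" "-1 \<in> T" "1 \<in> T" "T \<subseteq> {-1..1}" using S(1) by (auto simp: T_def)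
  \<comment> \<open>The gaps between neighbouring points of \<open>T\<close>, each represented by
    its two ends.\<close>
  define P where "P = {p \<in> T \<times> T. fst p < snd p \<and> {fst p<..<snd p} \<inter> T = {}}"
  have P: "finite P" unfolding P_def using T(1) by simp
  have "\<exists>G G'. piece_of \<theta> (fst p) (snd p) G G'" if "p \<in> P" for p
  proof (rule S(2))
    show "fst p < snd p" using that by (simp add: P_def)
    have "{fst p<..<snd p} \<subseteq> {-1..1}" using that T(4) by (force simp: P_def)
    then show "{fst p<..<snd p} \<inter> S = {}" using that unfolding P_def T_def by blast
  qed
  then obtain G G' where G: "\<And>p. p \<in> P \<Longrightarrow> piece_of \<theta> (fst p) (snd p) (G p) (G' p)" by metis
  have Pb: "-1 \<le> fst p \<and> fst p < snd p \<and> snd p \<le> 1" if "p \<in> P" for p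
    using that T(4) by (force simp: P_def)
  have \<theta>0: "\<theta> x = 0" if "x \<notin> {-1..1}" for x
  proof -
    have "closure {s. \<theta> s \<noteq> 0} = {-1..1}" using w unfolding weight_profile_def by blast
    then show ?thesis using that closure_subset[of "{s. \<theta> s \<noteq> 0}"] by auto
  qed
  have dec: "\<theta> x = (\<Sum>p\<in>P. indicator {fst p<..<snd p} x * G p x)" if x: "x \<notin> T" for x
  proof (cases "x \<in> {-1..1}")
    case False
    then have "indicator {fst p<..<snd p} x = (0::real)" if "p \<in> P" for p using Pb[OF that] by (auto simp: indicator_def)
    then show ?thesis using \<theta>0[OF False] by simp
  next
    case True
    define a where "a = Max {t\<in>T. t < x}"
    define b where "b = Min {t\<in>T. x < t}"
    have "-1 < x" "x < 1" using True x T by (auto simp: less_le)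
    then have neA: "{t\<in>T. t < x} \<noteq> {}" and neB: "{t\<in>T. x < t} \<noteq> {}" using T by auto
    have a: "a \<in> T" "a < x" using Max_in[OF _ neA] T(1) by (auto simp: a_def)
    have b: "b \<in> T" "x < b" using Min_in[OF _ neB] T(1) by (auto simp: b_def)
    have am: "t \<le> a" if "t \<in> T" "t < x" for t unfolding a_def using that T(1) by (intro Max_ge) auto
    have bm: "b \<le> t" if "t \<in> T" "x < t" for t unfolding b_def using that T(1) by (intro Min_le) auto
    have abP: "(a, b) \<in> P"
    proof -
      have "{a<..<b} \<inter> T = {}"
      proof (rule ccontr)
        assume "{a<..<b} \<inter> T \<noteq> {}"
        then obtain t where t: "t \<in> T" "a < t" "t < b" by auto
        have "t \<noteq> x" using t(1) x by blast
        then show False using am[OF t(1)] bm[OF t(1)] t by linarith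
      qed
      then show ?thesis using a b by (auto simp: P_def)
    qed
    have uniq: "p = (a, b)" if p: "p \<in> P" "x \<in> {fst p<..<snd p}" for p
    proof -
      have p': "fst p \<in> T" "snd p \<in> T" "{fst p<..<snd p} \<inter> T = {}" using p(1) by (auto simp: P_def)
      have "fst p \<le> a" "b \<le> snd p" using am[OF p'(1)] bm[OF p'(2)] p(2) by auto
      moreover have "\<not> fst p < a" "\<not> b < snd p"
      proof -
        have "a < snd p" "fst p < b" using a b p(2) by auto
        then show "\<not> fst p < a" "\<not> b < snd p" using p'(3) a(1) b(1) by (auto simp: disjoint_iff)
      qed
      ultimately show ?thesis by (simp add: prod_eq_iff)
    qed
    have "(\<Sum>p\<in>P. indicator {fst p<..<snd p} x * G p x) = (\<Sum>p\<in>P. if p = (a, b) then G (a, b) x else 0)"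
    proof (rule sum.cong[OF refl])
      fix p assume p: "p \<in> P"
      show "indicator {fst p<..<snd p} x * G p x = (if p = (a, b) then G (a, b) x else 0)"
      proof (cases "p = (a, b)")
        case True then show ?thesis using a b by simp
      next
        case False
        then have "x \<notin> {fst p<..<snd p}" using uniq[OF p] by blast
        then show ?thesis using False by simp
      qed
    qed
    also have "\<dots> = G (a, b) x" using P abP by simp
    also have "\<dots> = \<theta> x" using G[OF abP] a b by (simp add: piece_of_def)
    finally show ?thesis by simp
  qed
  have cG: "continuous_on {fst p..snd p} (G p)" if "p \<in> P" for p
    by (rule DERIV_continuous_on) (use G[OF that] in \<open>auto simp: piece_of_def\<close>)
  have intG: "integrable lborel (\<lambda>x. indicator {fst p..snd p} x *\<^sub>R G p x)" if "p \<in> P" for p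
    by (rule borel_integrable_compact[OF compact_Icc cG[OF that]])
  have one: "(LBINT s:{-1..1}. \<theta> s) = 1" using w unfolding weight_profile_def by blast
  \<comment> \<open>A function that is not integrable has integral 0 by convention, so the value 1
    implies integrability.\<close>
  have int\<theta>: "integrable lborel (\<lambda>s. indicator {-1..1} s *\<^sub>R \<theta> s)"
    using one not_integrable_integral_eq unfolding set_lebesgue_integral_def by fastforce
  have "1 = (\<integral>s. indicator {-1..1} s *\<^sub>R \<theta> s \<partial>lborel)" using one unfolding set_lebesgue_integral_def by simp
  also have "\<dots> = (\<integral>s. (\<Sum>p\<in>P. indicator {fst p..snd p} s *\<^sub>R G p s) \<partial>lborel)"
  proof (rule integral_cong_AE)
    have "AE s in lborel. s \<notin> T" by (rule AE_not_in) (use T(1) in \<open>simp add: finite_imp_null_set_lborel\<close>)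
    then show "AE s in lborel. indicator {-1..1} s *\<^sub>R \<theta> s = (\<Sum>p\<in>P. indicator {fst p..snd p} s *\<^sub>R G p s)"
    proof eventually_elim
      case (elim s)
      have "indicator {-1..1} s *\<^sub>R \<theta> s = \<theta> s" using \<theta>0 by (auto simp: indicator_def)
      also have "\<dots> = (\<Sum>p\<in>P. indicator {fst p..snd p} s *\<^sub>R G p s)"
        unfolding dec[OF elim] using elim by (intro sum.cong refl) (auto simp: indicator_def P_def less_le)
      finally show ?case .
    qed
  qed (use int\<theta> intG in auto)
  also have "\<dots> = (\<Sum>p\<in>P. \<integral>s. indicator {fst p..snd p} s *\<^sub>R G p s \<partial>lborel)"
    by (rule Bochner_Integration.integral_sum) (rule intG)
  also have "\<dots> = (\<Sum>p\<in>P. integral {fst p..snd p} (G p))"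
  proof (rule sum.cong[OF refl])
    fix p assume p: "p \<in> P"
    have "set_integrable lborel {fst p..snd p} (G p)" using intG[OF p] by (simp add: set_integrable_def)
    from set_borel_integral_eq_integral(2)[OF this]
    show "(\<integral>s. indicator {fst p..snd p} s *\<^sub>R G p s \<partial>lborel) = integral {fst p..snd p} (G p)"
      by (simp add: set_lebesgue_integral_def)
  qed
  finally have sum1: "(\<Sum>p\<in>P. integral {fst p..snd p} (G p)) = 1" by simp
  show ?thesis
    by (rule exI[of _ P], rule exI[of _ G], rule exI[of _ G'], rule exI[of _ T])
       (use P T(1) Pb G dec sum1 in \<open>auto simp: piece_of_def\<close>)
qed

section \<open>Convergence of the lattice sum, iterated integrals, null sets\<close>

text \<open>For \<open>p = (a, b)\<close> not zero,
  \<open>(1 + |a|) * (1 + |b|) \<le> (2 * |p|)\<^sup>2\<close>. Raised to the power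
  \<open>3/2\<close>, this bounds \<open>1 / |p|^3\<close> by 8 times a product of terms of two
  convergent one-dimensional series.\<close>

lemma sum_lattice_cubes:
  "\<exists>S\<ge>0. (\<integral>\<^sup>+p. ennreal (1 / norm (vector [of_int (fst p), of_int (snd p)] :: real^2) ^ 3) \<partial>count_space (-{(0::int,0::int)})) \<le> ennreal S"
proof -
  define g where "g a = ennreal ((1 + \<bar>real_of_int a\<bar>) powr (-3/2))" for a
  have sm: "summable (\<lambda>j::nat. (1 + real j) powr (-3/2))"
  proof -
    have "summable (\<lambda>j::nat. real j powr (-3/2))" by (subst summable_real_powr_iff) simp
    then have "summable (\<lambda>j::nat. real (Suc j) powr (-3/2))" by (subst summable_Suc_iff)
    then show ?thesis by (simp add: add.commute)
  qed
  define s where "s = (\<Sum>j. (1 + real j) powr (-3/2))"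
  have s0: "0 \<le> s" unfolding s_def by (rule suminf_nonneg[OF sm]) simp
  have nat: "(\<integral>\<^sup>+j. ennreal ((1 + real j) powr (-3/2)) \<partial>count_space (UNIV::nat set)) = ennreal s"
    unfolding nn_integral_count_space_nat s_def by (rule suminf_ennreal_eq) (use sm summable_sums in auto)
  have G: "(\<integral>\<^sup>+a. g a \<partial>count_space UNIV) \<le> ennreal (2 * s)"
  proof -
    have "(\<integral>\<^sup>+a. g a \<partial>count_space UNIV) \<le> (\<integral>\<^sup>+a. g a * indicator (range int) a + g a * indicator (range (\<lambda>j. - int j)) a \<partial>count_space UNIV)"
    proof (rule nn_integral_mono)
      fix a :: int
      \<comment> \<open>Zero lies in both ranges and is counted twice, which only enlarges the upper
        bound.\<close>
      have "a \<in> range int \<or> a \<in> range (\<lambda>j. - int j)"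
        by (cases a rule: int_cases2) auto
      then show "g a \<le> g a * indicator (range int) a + g a * indicator (range (\<lambda>j. - int j)) a"
        by (auto simp: indicator_def)
    qed
    also have "\<dots> = (\<integral>\<^sup>+a. g a * indicator (range int) a \<partial>count_space UNIV) + (\<integral>\<^sup>+a. g a * indicator (range (\<lambda>j. - int j)) a \<partial>count_space UNIV)"
      by (rule nn_integral_add) auto
    also have "(\<integral>\<^sup>+a. g a * indicator (range int) a \<partial>count_space UNIV) = (\<integral>\<^sup>+a. g a \<partial>count_space (range int))"
      by (subst (2) nn_integral_count_space_indicator) (auto intro!: nn_integral_cong simp: mult.commute)
    also have "\<dots> = (\<integral>\<^sup>+j. g (int j) \<partial>count_space UNIV)"
      by (rule nn_integral_bij_count_space[symmetric]) (auto intro!: inj_on_imp_bij_betw inj_onI)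
    also have "(\<integral>\<^sup>+a. g a * indicator (range (\<lambda>j. - int j)) a \<partial>count_space UNIV) = (\<integral>\<^sup>+a. g a \<partial>count_space (range (\<lambda>j. - int j)))"
      by (subst (2) nn_integral_count_space_indicator) (auto intro!: nn_integral_cong simp: mult.commute)
    also have "\<dots> = (\<integral>\<^sup>+j. g (- int j) \<partial>count_space UNIV)"
      by (rule nn_integral_bij_count_space[symmetric]) (auto intro!: inj_on_imp_bij_betw inj_onI)
    also have "(\<integral>\<^sup>+j. g (int j) \<partial>count_space UNIV) + (\<integral>\<^sup>+j. g (- int j) \<partial>count_space UNIV) = ennreal (2 * s)"
      using nat s0 by (simp add: g_def flip: ennreal_plus)
    finally show ?thesis .
  qed
  have pt: "ennreal (1 / norm (vector [of_int (fst p), of_int (snd p)] :: real^2) ^ 3) \<le> ennreal 8 * (g (fst p) * g (snd p))"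
    if p: "p \<noteq> (0, 0)" for p :: "int \<times> int"
  proof -
    define n :: "real^2" where "n = vector [of_int (fst p), of_int (snd p)]"
    define x y where "x = \<bar>real_of_int (fst p)\<bar>" and "y = \<bar>real_of_int (snd p)\<bar>"
    have xn: "x \<le> norm n" "y \<le> norm n" using component_le_norm_cart[of n 1] component_le_norm_cart[of n 2] by (simp_all add: n_def x_def y_def)
    have "1 \<le> x \<or> 1 \<le> y" using p unfolding x_def y_def by (cases p) auto
    then have n1: "1 \<le> norm n" using xn by linarith
    have xy: "0 \<le> x" "0 \<le> y" by (simp_all add: x_def y_def)
    have "(1 + x) * (1 + y) \<le> (2 * norm n) * (2 * norm n)"
      using xn n1 xy by (intro mult_mono) auto
    then have "((1 + x) * (1 + y)) powr (3/2) \<le> ((2 * norm n) * (2 * norm n)) powr (3/2)"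
      using xy by (intro powr_mono2) auto
    also have "((2 * norm n) * (2 * norm n)) powr (3/2) = 8 * norm n ^ 3"
    proof -
      have "(2 * norm n) * (2 * norm n) = (2 * norm n) powr 2" using n1 by (simp add: power2_eq_square)
      then have "((2 * norm n) * (2 * norm n)) powr (3/2) = ((2 * norm n) powr 2) powr (3/2)" by (rule arg_cong)
      also have "\<dots> = (2 * norm n) powr 3" by (subst powr_powr) simp
      also have "\<dots> = (2 * norm n) ^ 3" using n1 by (simp add: powr_realpow[symmetric])
      finally show ?thesis by (simp add: power_mult_distrib)
    qed
    finally have le: "((1 + x) * (1 + y)) powr (3/2) \<le> 8 * norm n ^ 3" .
    have pos: "0 < ((1 + x) * (1 + y)) powr (3/2)" using xy by (simp add: add_pos_nonneg)
    have "1 / norm n ^ 3 = 8 / (8 * norm n ^ 3)" by simp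
    also have "\<dots> \<le> 8 / ((1 + x) * (1 + y)) powr (3/2)" using le pos by (intro divide_left_mono mult_pos_pos) auto
    also have "\<dots> = 8 * ((1 + x) powr (-3/2) * (1 + y) powr (-3/2))"
      using xy by (simp add: powr_mult powr_minus_divide)
    finally have "ennreal (1 / norm n ^ 3) \<le> ennreal (8 * ((1 + x) powr (-3/2) * (1 + y) powr (-3/2)))"
      by (rule ennreal_leI)
    also have "\<dots> = ennreal 8 * (ennreal ((1 + x) powr (-3/2)) * ennreal ((1 + y) powr (-3/2)))"
      by (simp only: ennreal_mult powr_ge_zero zero_le_numeral mult_nonneg_nonneg)
    finally show ?thesis unfolding g_def x_def y_def n_def .
  qed
  have "(\<integral>\<^sup>+p. ennreal (1 / norm (vector [of_int (fst p), of_int (snd p)] :: real^2) ^ 3) \<partial>count_space (-{(0::int,0::int)}))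
     \<le> (\<integral>\<^sup>+p. ennreal 8 * (g (fst p) * g (snd p)) \<partial>count_space (-{(0::int,0::int)}))"
    by (rule nn_integral_mono) (use pt in auto)
  also have "\<dots> \<le> (\<integral>\<^sup>+p. ennreal 8 * (g (fst p) * g (snd p)) \<partial>count_space UNIV)"
    by (subst nn_integral_count_space_indicator) (auto intro!: nn_integral_mono simp: indicator_def)
  also have "\<dots> = (\<integral>\<^sup>+a. (\<integral>\<^sup>+c. ennreal 8 * (g a * g c) \<partial>count_space UNIV) \<partial>count_space UNIV)"
    using nn_integral_fst_count_space[of "\<lambda>p. ennreal 8 * (g (fst p) * g (snd p))"] by simp
  also have "\<dots> = ennreal 8 * ((\<integral>\<^sup>+a. g a \<partial>count_space UNIV) * (\<integral>\<^sup>+c. g c \<partial>count_space UNIV))"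
    by (simp add: nn_integral_cmult nn_integral_multc)
  also have "\<dots> \<le> ennreal 8 * (ennreal (2 * s) * ennreal (2 * s))"
    by (intro mult_left_mono mult_mono G) auto
  also have "\<dots> = ennreal (8 * (2 * s * (2 * s)))"    by (simp only: ennreal_mult mult_nonneg_nonneg zero_le_numeral s0)
  finally show ?thesis using s0 by (intro exI[of _ "8 * (2 * s * (2 * s))"]) auto
qed

lemma integral_cbox_real2:
  fixes f :: "real^2 \<Rightarrow> real"
  assumes f: "continuous_on (cbox (vector [a, c]) (vector [b, d])) f"
  shows "integral (cbox (vector [a, c]) (vector [b, d])) f = integral {a..b} (\<lambda>s. integral {c..d} (\<lambda>t. f (vector [s, t])))"
proof -
  let ?B = "cbox (vector [a, c]) (vector [b, d]) :: (real^2) set"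
  have mem: "vector [s, t] \<in> ?B \<longleftrightarrow> s \<in> {a..b} \<and> t \<in> {c..d}" for s t
    by (auto simp: mem_box_cart forall_2)
  have vec: "(\<lambda>z::real \<times> real. vector [fst z, snd z] :: real^2) = (\<lambda>z. fst z *\<^sub>R axis 1 1 + snd z *\<^sub>R axis 2 1)"
    by (auto simp: fun_eq_iff vec_eq_iff forall_2 axis_def)
  have cv: "continuous_on S (\<lambda>z::real \<times> real. vector [fst z, snd z] :: real^2)" for S
    unfolding vec by (intro continuous_intros)
  have cf2: "continuous_on ({a..b} \<times> {c..d}) (\<lambda>z. f (vector [fst z, snd z]))"
    by (rule continuous_on_compose2[OF f cv]) (auto simp: mem)
  have int: "integrable lborel (\<lambda>x. indicator ?B x *\<^sub>R f x)" by (rule borel_integrable_compact[OF compact_cbox f])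
  have "integral ?B f = (\<integral>x. indicator ?B x *\<^sub>R f x \<partial>lborel)"
    using set_borel_integral_eq_integral(2)[of ?B f] int by (simp add: set_integrable_def set_lebesgue_integral_def)
  also have "\<dots> = (\<integral>s. (\<integral>t. indicator ?B (vector [s, t] :: real^2) *\<^sub>R f (vector [s, t]) \<partial>lborel) \<partial>lborel)"
    by (rule integral_lborel_real2[OF int])
  also have "\<dots> = (\<integral>s. indicator {a..b} s *\<^sub>R integral {c..d} (\<lambda>t. f (vector [s, t])) \<partial>lborel)"
  proof (rule Bochner_Integration.integral_cong[OF refl])
    fix s
    show "(\<integral>t. indicator ?B (vector [s, t] :: real^2) *\<^sub>R f (vector [s, t]) \<partial>lborel) = indicator {a..b} s *\<^sub>R integral {c..d} (\<lambda>t. f (vector [s, t]))"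
    proof (cases "s \<in> {a..b}")
      case True
      have "continuous_on {c..d} (\<lambda>t. f (vector [s, t]))"
      proof -
        have p: "continuous_on {c..d} (Pair s)" by (intro continuous_on_Pair continuous_on_const continuous_on_id)
        have "Pair s ` {c..d} \<subseteq> {a..b} \<times> {c..d}" using True by auto
        from continuous_on_compose2[OF cf2 p this] show ?thesis by simp
      qed
      from borel_integrable_compact[OF compact_Icc this]
      have "set_integrable lborel {c..d} (\<lambda>t. f (vector [s, t]))" by (simp add: set_integrable_def)
      from set_borel_integral_eq_integral(2)[OF this]
      have "integral {c..d} (\<lambda>t. f (vector [s, t])) = (\<integral>t. indicator {c..d} t *\<^sub>R f (vector [s, t]) \<partial>lborel)"
        by (simp add: set_lebesgue_integral_def)
      moreover have "(\<integral>t. indicator ?B (vector [s, t] :: real^2) *\<^sub>R f (vector [s, t]) \<partial>lborel) = (\<integral>t. indicator {c..d} t *\<^sub>R f (vector [s, t]) \<partial>lborel)"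
        by (rule Bochner_Integration.integral_cong[OF refl]) (use True in \<open>simp add: indicator_def mem\<close>)
      ultimately show ?thesis using True by simp
    next
      case False
      then have "vector [s, t] \<notin> ?B" for t using mem by blast
      then have "indicator ?B (vector [s, t] :: real^2) = (0::real)" for t by (rule indicator_simps(2))
      then show ?thesis using False by simp
    qed
  qed
  also have "\<dots> = integral {a..b} (\<lambda>s. integral {c..d} (\<lambda>t. f (vector [s, t])))"
  proof -
    have "continuous_on {a..b} (\<lambda>s. integral {c..d} (\<lambda>t. f (vector [s, t])))"
      using integral_continuous_on_param[of "{a..b}" c d "\<lambda>s t. f (vector [s, t])"] cf2 by (simp add: case_prod_unfold)
    from borel_integrable_compact[OF compact_Icc this]
    have "set_integrable lborel {a..b} (\<lambda>s. integral {c..d} (\<lambda>t. f (vector [s, t])))" by (simp add: set_integrable_def)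
    from set_borel_integral_eq_integral(2)[OF this] show ?thesis by (simp add: set_lebesgue_integral_def)
  qed
  finally show ?thesis .
qed

lemma AE_not_in_negligible:
  fixes N :: "'a::euclidean_space set"
  assumes "negligible N" shows "AE x in lborel. x \<notin> N"
proof -
  have "AE x in lebesgue. x \<notin> N"
    using assms unfolding negligible_iff_null_sets by (rule AE_not_in)
  then show ?thesis by (simp add: AE_completion_iff)
qed

lemma countable_int_lattice: "countable int_lattice"
proof -
  have "int_lattice = (\<lambda>(a, b). vector [of_int a, of_int b]) ` (UNIV :: (int \<times> int) set)"
  proof
    show "int_lattice \<subseteq> (\<lambda>(a, b). vector [of_int a, of_int b]) ` (UNIV :: (int \<times> int) set)"
    proof
      fix w assume "w \<in> int_lattice"
      then obtain a b where ab: "w$1 = of_int a" "w$2 = of_int b"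
        unfolding int_lattice_def forall_2 mem_Collect_eq by (metis Ints_cases)
      then have "w = vector [of_int a, of_int b]" by (simp add: vec_eq_iff forall_2)
      then show "w \<in> (\<lambda>(a, b). vector [of_int a, of_int b]) ` (UNIV :: (int \<times> int) set)" by auto
    qed
  qed (auto simp: int_lattice_def forall_2)
  then show ?thesis by (metis countable_image countableI_type)
qed

section \<open>The rescaled tube\<close>

text \<open>\<open>tube_inj\<close> concludes \<open>\<gamma> s = \<gamma> s'\<close> and not
  \<open>s = s'\<close>: on a closed curve the parameters 0 and 1 give the same point.\<close>

locale tube_frame = moving_frame +
  fixes e1 :: real
  assumes e1: "0 < e1" "e1 \<le> e0" and simple: "simple_path \<gamma>"
    and tube_inj: "\<And>s s' t t'. s \<in> {0..1} \<Longrightarrow> s' \<in> {0..1} \<Longrightarrow> \<bar>t\<bar> \<le> e1 \<Longrightarrow> \<bar>t'\<bar> \<le> e1 \<Longrightarrow>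
      \<gamma> s + t *\<^sub>R \<nu> s = \<gamma> s' + t' *\<^sub>R \<nu> s' \<Longrightarrow> \<gamma> s = \<gamma> s' \<and> t = t'"

locale scaled_tube = tube_frame +
  fixes \<eta> :: "real^2^2" and h \<epsilon> :: real
  assumes \<eta>: "\<eta> \<in> SO2" and h: "0 < h" and \<epsilon>: "0 < \<epsilon>" "\<epsilon> \<le> e1"
begin

text \<open>Tube coordinates in lattice units: the image of \<open>(s, u)\<close> is the point that
  the map of the lattice sum, scaling by \<open>h\<close> after the inverse rotation, sends to
  \<open>\<gamma> s + \<epsilon> u \<nu> s\<close>. A term of the lattice sum is thus read at
  \<open>w - \<xi>\<close>, and the profile appears unscaled in \<open>u\<close>, over the fixed
  interval \<open>[-1, 1]\<close>.\<close>

definition \<Phi> :: "real^2 \<Rightarrow> real^2" where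
  "\<Phi> z = (1/h) *\<^sub>R (\<eta> *v (\<gamma> (z$1) + (\<epsilon> * z$2) *\<^sub>R \<nu> (z$1)))"

definition D\<Phi> :: "real^2 \<Rightarrow> real^2 \<Rightarrow> real^2" where
  "D\<Phi> z d = (1/h) *\<^sub>R (\<eta> *v (d$1 *\<^sub>R (w (\<epsilon> * z$2) (z$1) *\<^sub>R \<tau> (z$1)) + d$2 *\<^sub>R (\<epsilon> *\<^sub>R \<nu> (z$1))))"

abbreviation Dom :: "(real^2) set" where "Dom \<equiv> cbox (vector [0, -1]) (vector [1, 1])"

lemma mem_Dom: "z \<in> Dom \<longleftrightarrow> z$1 \<in> {0..1} \<and> z$2 \<in> {-1..1}"
  by (auto simp: mem_box_cart forall_2)

lemma eu: "u \<in> {-1..1} \<Longrightarrow> \<bar>\<epsilon> * u\<bar> \<le> e1" "u \<in> {-1..1} \<Longrightarrow> \<bar>\<epsilon> * u\<bar> \<le> e0"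
proof -
  assume "u \<in> {-1..1}"
  then have "\<bar>\<epsilon> * u\<bar> \<le> \<epsilon> * 1" using \<epsilon> by (intro abs_mult_le) auto
  then show "\<bar>\<epsilon> * u\<bar> \<le> e1" "\<bar>\<epsilon> * u\<bar> \<le> e0" using \<epsilon> e1 by auto
qed

lemma \<Phi>_has_derivative:
  assumes z: "z \<in> Dom" shows "(\<Phi> has_derivative D\<Phi> z) (at z within Dom)"
proof -
  have d1: "((\<lambda>z. z$1) has_derivative (\<lambda>d. d$1)) (at z within Dom)"
    by (rule bounded_linear.has_derivative[OF bounded_linear_vec_nth has_derivative_ident])
  have d2: "((\<lambda>z. \<epsilon> * z$2) has_derivative (\<lambda>d. \<epsilon> * d$2)) (at z within Dom)"
    by (intro has_derivative_mult_right bounded_linear.has_derivative[OF bounded_linear_vec_nth has_derivative_ident])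
  have im: "(\<lambda>z. z$1) ` Dom \<subseteq> {0..1}" by (auto simp: mem_Dom)
  have dga: "((\<lambda>z. \<gamma> (z$1)) has_derivative (\<lambda>d. d$1 *\<^sub>R (v (z$1) *\<^sub>R \<tau> (z$1)))) (at z within Dom)"
    by (rule has_derivative_in_compose2[OF _ im z d1, where g'="\<lambda>x y. y *\<^sub>R (v x *\<^sub>R \<tau> x)"])
       (use d\<gamma> in \<open>simp add: has_vector_derivative_def\<close>)
  have dnu: "((\<lambda>z. \<nu> (z$1)) has_derivative (\<lambda>d. d$1 *\<^sub>R (\<mu> (z$1) *\<^sub>R \<tau> (z$1)))) (at z within Dom)"
    by (rule has_derivative_in_compose2[OF _ im z d1, where g'="\<lambda>x y. y *\<^sub>R (\<mu> x *\<^sub>R \<tau> x)"])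
       (use d\<nu> in \<open>simp add: has_vector_derivative_def\<close>)
  have "((\<lambda>z. \<gamma> (z$1) + (\<epsilon> * z$2) *\<^sub>R \<nu> (z$1)) has_derivative
     (\<lambda>d. d$1 *\<^sub>R (v (z$1) *\<^sub>R \<tau> (z$1)) + ((\<epsilon> * z$2) *\<^sub>R (d$1 *\<^sub>R (\<mu> (z$1) *\<^sub>R \<tau> (z$1))) + (\<epsilon> * d$2) *\<^sub>R \<nu> (z$1)))) (at z within Dom)"
    by (intro has_derivative_add dga has_derivative_scaleR d2 dnu)
  then have "(\<Phi> has_derivative (\<lambda>d. (1/h) *\<^sub>R (\<eta> *v (d$1 *\<^sub>R (v (z$1) *\<^sub>R \<tau> (z$1)) + ((\<epsilon> * z$2) *\<^sub>R (d$1 *\<^sub>R (\<mu> (z$1) *\<^sub>R \<tau> (z$1))) + (\<epsilon> * d$2) *\<^sub>R \<nu> (z$1)))))) (at z within Dom)"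
    unfolding \<Phi>_def[abs_def]
    by (intro has_derivative_scaleR_right bounded_linear.has_derivative[OF matrix_vector_mul_bounded_linear])
  moreover have "(\<lambda>d. (1/h) *\<^sub>R (\<eta> *v (d$1 *\<^sub>R (v (z$1) *\<^sub>R \<tau> (z$1)) + ((\<epsilon> * z$2) *\<^sub>R (d$1 *\<^sub>R (\<mu> (z$1) *\<^sub>R \<tau> (z$1))) + (\<epsilon> * d$2) *\<^sub>R \<nu> (z$1))))) = D\<Phi> z"
    by (auto simp: D\<Phi>_def fun_eq_iff w_def algebra_simps)
  ultimately show ?thesis by simp
qed

lemma continuous_\<Phi>: "continuous_on Dom \<Phi>"
  using \<Phi>_has_derivative by (rule has_derivative_continuous_on)

text \<open>The rotation has determinant 1 and the frame is orthonormal; what remains is the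
  stretching by \<open>w\<close> along the curve, by \<open>\<epsilon>\<close> across it, and by
  \<open>1/h\<close> in both directions.\<close>

lemma det_D\<Phi>:
  assumes z: "z \<in> Dom" shows "\<bar>det (matrix (D\<Phi> z))\<bar> = \<epsilon> * w (\<epsilon> * z$2) (z$1) / h\<^sup>2"
proof -
  note S = SO2_coords[OF \<eta>]
  define A where "A = \<eta>$1$1" define B where "B = \<eta>$1$2"
  define W where "W = w (\<epsilon> * z$2) (z$1)"
  define t where "t = \<tau> (z$1)" define n where "n = \<nu> (z$1)"
  have z1: "z$1 \<in> {0..1}" "z$2 \<in> {-1..1}" using z by (simp_all add: mem_Dom)
  have W: "0 < W" using w_ge[OF z1(1) eu(2)[OF z1(2)]] c0 by (simp add: W_def)
  have fr: "t$1 * t$1 + t$2 * t$2 = 1" "n$1 * n$1 + n$2 * n$2 = 1" "t$1 * n$1 + t$2 * n$2 = 0"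
    using frame[OF z1(1)] by (simp_all add: norm_real2 inner_real2 power2_eq_square t_def n_def)
  have "det (matrix (D\<Phi> z)) = (A\<^sup>2 + B\<^sup>2) * (W * \<epsilon> * (t$1 * n$2 - t$2 * n$1)) / h\<^sup>2"
    unfolding det_2 matrix_def D\<Phi>_def W_def[symmetric] t_def[symmetric] n_def[symmetric]
    by (simp add: matrix_vector_mult_def sum_2 axis_def S(2,3) A_def[symmetric] B_def[symmetric] power2_eq_square
          algebra_simps add_divide_distrib diff_divide_distrib)
  also have "A\<^sup>2 + B\<^sup>2 = 1" using S(1) by (simp add: A_def B_def)
  finally have "\<bar>det (matrix (D\<Phi> z))\<bar> = W * \<epsilon> * \<bar>t$1 * n$2 - t$2 * n$1\<bar> / h\<^sup>2"
    using W \<epsilon> by (simp add: abs_mult)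
  moreover have "(t$1 * n$2 - t$2 * n$1)\<^sup>2 = 1" using fr by algebra
  then have "\<bar>t$1 * n$2 - t$2 * n$1\<bar> = 1" by (simp only: abs_square_eq_1)
  ultimately show ?thesis by (simp add: W_def mult.commute)
qed

lemma \<eta>_cancel: "matrix_inv \<eta> ** \<eta> = mat 1"
proof -
  have o: "orthogonal_matrix \<eta>" using \<eta> by (simp add: SO2_def rotation_matrix_def)
  then have "\<exists>A'. \<eta> ** A' = mat 1 \<and> A' ** \<eta> = mat 1" by (auto simp: orthogonal_matrix_def)
  from someI_ex[OF this] show ?thesis unfolding matrix_inv_def by blast
qed

lemma \<Phi>_inverse: "h *\<^sub>R (matrix_inv \<eta> *v \<Phi> z) = \<gamma> (z$1) + (\<epsilon> * z$2) *\<^sub>R \<nu> (z$1)"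
  using h by (simp add: \<Phi>_def matrix_vector_mult_scaleR matrix_vector_mul_assoc \<eta>_cancel)

text \<open>One of the two points has to be off the sides \<open>z$1 = 0\<close> and
  \<open>z$1 = 1\<close>, which have the same image on a closed curve; the other may be
  arbitrary.\<close>

lemma \<Phi>_inj:
  assumes z: "z \<in> Dom" "z' \<in> Dom" "0 < z$1" "z$1 < 1" and eq: "\<Phi> z = \<Phi> z'"
  shows "z = z'"
proof -
  have "\<gamma> (z$1) + (\<epsilon> * z$2) *\<^sub>R \<nu> (z$1) = \<gamma> (z'$1) + (\<epsilon> * z'$2) *\<^sub>R \<nu> (z'$1)"
    using eq \<Phi>_inverse[of z] \<Phi>_inverse[of z'] by simp
  then have "\<gamma> (z$1) = \<gamma> (z'$1)" "\<epsilon> * z$2 = \<epsilon> * z'$2"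
    using tube_inj[of "z$1" "z'$1" "\<epsilon> * z$2" "\<epsilon> * z'$2"] eu z(1,2) by (auto simp: mem_Dom)
  moreover have "z$1 = z'$1"
    using simple z \<open>\<gamma> (z$1) = \<gamma> (z'$1)\<close> unfolding simple_path_def loop_free_def mem_Dom by fastforce
  ultimately show ?thesis using \<epsilon> by (simp add: vec_eq_iff forall_2)
qed

lemma negligible_\<Phi>_image:
  assumes "negligible N" "N \<subseteq> Dom" shows "negligible ((\<lambda>z. c - \<Phi> z) ` N)"
proof (rule negligible_differentiable_image_negligible[OF _ assms(1)])
  have "\<Phi> differentiable_on N" unfolding differentiable_on_def
  proof
    fix x assume "x \<in> N"
    then show "\<Phi> differentiable (at x within N)"
      using has_derivative_subset[OF \<Phi>_has_derivative assms(2)] assms(2) by (auto intro: differentiableI)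
  qed
  then show "(\<lambda>z. c - \<Phi> z) differentiable_on N"
    by (intro differentiable_on_diff differentiable_on_const)
qed simp

end

section \<open>One piece of the profile in tube coordinates\<close>

text \<open>\<open>F\<close> will be \<open>f\<close> along the curve times the speed, and
  \<open>G\<close> one piece of the weight profile on \<open>[a, b]\<close>.\<close>

locale tube_piece = scaled_tube +
  fixes F F1 F2 G G' :: "real \<Rightarrow> real" and a b :: real
  assumes dF: "\<And>s. s \<in> {0..1} \<Longrightarrow> (F has_real_derivative F1 s) (at s within {0..1})"
      "\<And>s. s \<in> {0..1} \<Longrightarrow> (F1 has_real_derivative F2 s) (at s within {0..1})" "continuous_on {0..1} F2"
    and ab: "-1 \<le> a" "a < b" "b \<le> 1"
    and dG: "\<And>u. u \<in> {a..b} \<Longrightarrow> (G has_real_derivative G' u) (at u within {a..b})"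
    and cG': "continuous_on {a..b} G'"
begin

abbreviation B0 :: "(real^2) set" where "B0 \<equiv> box (vector [0, a]) (vector [1, b])"
abbreviation B1 :: "(real^2) set" where "B1 \<equiv> cbox (vector [0, a]) (vector [1, b])"

lemma mem_B: "z \<in> B0 \<longleftrightarrow> z$1 \<in> {0<..<1} \<and> z$2 \<in> {a<..<b}" "z \<in> B1 \<longleftrightarrow> z$1 \<in> {0..1} \<and> z$2 \<in> {a..b}"
  by (auto simp: mem_box_cart forall_2)

lemma B_sub: "B0 \<subseteq> B1" "B1 \<subseteq> Dom" "B0 \<subseteq> Dom"
proof -
  show "B0 \<subseteq> B1" by (rule box_subset_cbox)
  show "B1 \<subseteq> Dom" "B0 \<subseteq> Dom" using ab by (auto simp: mem_B mem_Dom subset_iff)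
qed

lemma inj_\<Phi>_B0: "inj_on \<Phi> B0"
  using \<Phi>_inj B_sub by (auto simp: inj_on_def mem_B subset_iff)

text \<open>\<open>F * G\<close> divided by the Jacobian of \<open>\<Phi>\<close>, so that the
  change of variables leaves exactly \<open>F * G\<close>. It agrees with \<open>h\<^sup>2\<close>
  times the integrand because the Jacobian of the projection is \<open>v / w\<close>.\<close>

definition dens :: "real^2 \<Rightarrow> real" where
  "dens z = h\<^sup>2 * (F (z$1) * G (z$2) / (\<epsilon> * w (\<epsilon> * z$2) (z$1)))"

text \<open>The rescaled integrand \<open>h\<^sup>2 Q(h \<eta>\<^sup>-\<^sup>1 x)\<close>, restricted to one smooth piece of the weight profile.\<close>

definition gp :: "real^2 \<Rightarrow> real" where
  "gp x = indicator (\<Phi> ` B0) x *\<^sub>R dens (the_inv_into B0 \<Phi> x)"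

lemma gp_\<Phi>: "z \<in> B0 \<Longrightarrow> gp (\<Phi> z) = dens z"
  using inj_\<Phi>_B0 by (simp add: gp_def the_inv_into_f_f)

lemma gp_\<Phi>_out: "z \<in> Dom \<Longrightarrow> 0 < z$1 \<Longrightarrow> z$1 < 1 \<Longrightarrow> z \<notin> B0 \<Longrightarrow> gp (\<Phi> z) = 0"
  unfolding gp_def using \<Phi>_inj[of z] B_sub(3) by (auto simp: indicator_def)

lemma cF: "continuous_on {0..1} F" "continuous_on {0..1} F1"
  by (rule DERIV_continuous_on, erule dF)+

lemma cG: "continuous_on {a..b} G"
  by (rule DERIV_continuous_on, erule dG)

lemma comp_B1: "continuous_on {0..1} f \<Longrightarrow> continuous_on B1 (\<lambda>z. f (z$1))"
   "continuous_on {a..b} g \<Longrightarrow> continuous_on B1 (\<lambda>z. g (z$2))" for f g :: "real \<Rightarrow> real"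
  by (erule continuous_on_compose2; auto simp: mem_B intro!: continuous_intros)+

lemma w_pos: "z \<in> B1 \<Longrightarrow> 0 < w (\<epsilon> * z$2) (z$1)"
  using w_ge[of "z$1" "\<epsilon> * z$2"] eu(2)[of "z$2"] c0 ab by (auto simp: mem_B)

lemma continuous_dens: "continuous_on B1 dens"
  unfolding dens_def[abs_def] w_def
  by (intro continuous_intros comp_B1 cF cG conts)
     (use w_pos \<epsilon> in \<open>auto simp: w_def less_imp_neq[symmetric]\<close>)

lemma open_\<Phi>B0: "open (\<Phi> ` B0)"
  by (rule invariance_of_domain[OF continuous_on_subset[OF continuous_\<Phi> B_sub(3)] open_box inj_\<Phi>_B0])

lemma continuous_gp_inner: "continuous_on (\<Phi> ` B0) (\<lambda>x. dens (the_inv_into B0 \<Phi> x))"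
proof (rule continuous_on_compose2[OF continuous_on_subset[OF continuous_dens B_sub(1)]])
  show "continuous_on (\<Phi> ` B0) (the_inv_into B0 \<Phi>)"
    by (rule continuous_on_inverse_open[OF open_box continuous_on_subset[OF continuous_\<Phi> B_sub(3)]])
       (auto simp: the_inv_into_f_f[OF inj_\<Phi>_B0])
  show "the_inv_into B0 \<Phi> ` \<Phi> ` B0 \<subseteq> B0" by (auto simp: the_inv_into_f_f[OF inj_\<Phi>_B0])
qed

lemma gp_measurable [measurable]: "gp \<in> borel_measurable borel"
  unfolding gp_def[abs_def]
  by (rule borel_measurable_continuous_on_indicator[OF borel_open[OF open_\<Phi>B0] continuous_gp_inner])

lemma compact_\<Phi>B1: "compact (\<Phi> ` B1)"
  by (rule compact_continuous_image[OF continuous_on_subset[OF continuous_\<Phi> B_sub(2)] compact_cbox])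

lemma gp_bounded: "\<exists>B. \<forall>x. \<bar>gp x\<bar> \<le> B"
proof -
  from compact_imp_bounded[OF compact_continuous_image[OF continuous_dens compact_cbox]]
  obtain B where B: "\<And>z. z \<in> B1 \<Longrightarrow> \<bar>dens z\<bar> \<le> B" unfolding bounded_iff by force
  have "B \<ge> 0" using B[of "vector [0, a]"] ab by (auto simp: mem_B)
  have "\<bar>gp x\<bar> \<le> B" for x
  proof (cases "x \<in> \<Phi> ` B0")
    case True
    then obtain z where z: "z \<in> B0" "x = \<Phi> z" by blast
    then show ?thesis using gp_\<Phi>[OF z(1)] B[of z] B_sub(1) by auto
  qed (use \<open>B \<ge> 0\<close> in \<open>simp add: gp_def\<close>)
  then show ?thesis by blast
qed

lemma gp_support: "\<exists>R. \<forall>x. norm x > R \<longrightarrow> gp x = 0"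
proof -
  from compact_imp_bounded[OF compact_\<Phi>B1] obtain R where R: "\<forall>x\<in>\<Phi> ` B1. norm x \<le> R" unfolding bounded_iff by blast
  have "gp x = 0" if "norm x > R" for x
    using that R B_sub(1) by (force simp: gp_def indicator_def)
  then show ?thesis by blast
qed

text \<open>\<open>gp\<close> is continuous on the open image of the open rectangle and zero off the
  compact image of the closed one. What remains is the image of the frontier, a null set.\<close>

lemma gp_isCont: "x \<notin> \<Phi> ` (B1 - B0) \<Longrightarrow> isCont gp x"
proof (cases "x \<in> \<Phi> ` B0")
  case True
  have "continuous_on (\<Phi> ` B0) gp"
    by (rule continuous_on_cong[OF refl, THEN iffD1, OF _ continuous_gp_inner]) (simp add: gp_def)
  then show ?thesis using True open_\<Phi>B0 continuous_on_eq_continuous_at by blast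
next
  case False
  assume "x \<notin> \<Phi> ` (B1 - B0)"
  with False have x: "x \<in> - \<Phi> ` B1" by blast
  have o: "open (- \<Phi> ` B1)" using compact_imp_closed[OF compact_\<Phi>B1] by (simp add: open_Compl)
  have "continuous_on (- \<Phi> ` B1) gp"
    by (rule continuous_on_cong[OF refl, THEN iffD1, OF _ continuous_on_const[of _ 0]]) (use B_sub(1) in \<open>auto simp: gp_def indicator_def\<close>)
  then show ?thesis using x o continuous_on_eq_continuous_at by blast
qed

lemma AE_isCont_gp: "AE \<xi> in lborel. \<forall>w\<in>int_lattice. isCont gp (w - \<xi>)"
proof (rule AE_ball_countable'[OF _ countable_int_lattice])
  fix w assume "w \<in> int_lattice"
  have "AE \<xi> in lborel. \<xi> \<notin> (\<lambda>z. w - \<Phi> z) ` (B1 - B0)"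
    by (rule AE_not_in_negligible, rule negligible_\<Phi>_image[OF negligible_frontier_interval]) (use B_sub(2) in blast)
  then show "AE \<xi> in lborel. isCont gp (w - \<xi>)"
  proof eventually_elim
    case (elim \<xi>)
    show ?case
    proof (rule gp_isCont, rule notI)
      assume "w - \<xi> \<in> \<Phi> ` (B1 - B0)"
      then obtain z where z: "z \<in> B1 - B0" "w - \<xi> = \<Phi> z" by blast
      have "\<xi> = w - \<Phi> z" unfolding z(2)[symmetric] by simp
      with z(1) elim show False by blast
    qed
  qed
qed

text \<open>The test function \<open>k\<close> is general so that \<open>k = 1\<close> gives the
  total mass, while the real and imaginary parts of a character give the Fourier
  coefficients.\<close>

lemma integral_gp:
  fixes k :: "real^2 \<Rightarrow> real"
  assumes ck: "continuous_on UNIV k" and kb: "\<And>x. \<bar>k x\<bar> \<le> 1"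
  shows "(\<integral>x. gp x * k x \<partial>lborel) = integral {0..1} (\<lambda>s. integral {a..b} (\<lambda>u. F s * G u * k (\<Phi> (vector [s, u]))))"
proof -
  obtain B where B: "\<And>x. \<bar>gp x\<bar> \<le> B" using gp_bounded by blast
  obtain R where R: "\<And>x. norm x > R \<Longrightarrow> gp x = 0" using gp_support by blast
  have km: "k \<in> borel_measurable borel" by (rule borel_measurable_continuous_onI[OF ck])
  have int: "integrable lborel (\<lambda>x. gp x * k x)"
    using integrable_bounded_support[OF gp_measurable B R km, where K=1] kb by simp
  define q where "q z = F (z$1) * G (z$2) * k (\<Phi> z)" for z
  have cq: "continuous_on B1 q"
    unfolding q_def[abs_def]
    by (intro continuous_intros comp_B1 cF cG continuous_on_compose2[OF ck continuous_on_subset[OF continuous_\<Phi> B_sub(2)]]) auto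
  \<comment> \<open>The change of variables is formulated for functions with values in
    \<open>real^'n\<close>; \<open>real^1\<close> stands for \<open>real\<close>.\<close>
  have cqv: "continuous_on B1 (\<lambda>z. vec (q z) :: real^1)"
    unfolding vec_def by (intro continuous_on_vec_lambda cq)
  have aq: "(\<lambda>z. vec (q z) :: real^1) absolutely_integrable_on B0"
  proof (rule set_integrable_subset)
    have i: "integrable lborel (\<lambda>z. indicator B1 z *\<^sub>R (vec (q z) :: real^1))"
      by (rule borel_integrable_compact[OF compact_cbox cqv])
    then show "(\<lambda>z. vec (q z) :: real^1) absolutely_integrable_on B1"
      unfolding set_integrable_def by (subst integrable_completion) auto
  qed (use B_sub in auto)
  have eq: "\<bar>det (matrix (D\<Phi> z))\<bar> *\<^sub>R (vec (gp (\<Phi> z) * k (\<Phi> z)) :: real^1) = vec (q z)" if z: "z \<in> B0" for z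
  proof -
    have zD: "z \<in> Dom" "z \<in> B1" using z B_sub by blast+
    have "\<epsilon> * w (\<epsilon> * z$2) (z$1) / h\<^sup>2 * (gp (\<Phi> z) * k (\<Phi> z)) = q z"
      unfolding gp_\<Phi>[OF z] dens_def q_def using w_pos[OF zD(2)] \<epsilon> h by simp
    then show ?thesis unfolding det_D\<Phi>[OF zD(1)] by (simp add: vec_eq_iff)
  qed
  define b' where "b' = integral B0 (\<lambda>z. vec (q z) :: real^1)"
  have L: "(\<lambda>z. \<bar>det (matrix (D\<Phi> z))\<bar> *\<^sub>R (vec (gp (\<Phi> z) * k (\<Phi> z)) :: real^1)) absolutely_integrable_on B0 \<and>
      integral B0 (\<lambda>z. \<bar>det (matrix (D\<Phi> z))\<bar> *\<^sub>R (vec (gp (\<Phi> z) * k (\<Phi> z)) :: real^1)) = b'"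
  proof
    show "(\<lambda>z. \<bar>det (matrix (D\<Phi> z))\<bar> *\<^sub>R (vec (gp (\<Phi> z) * k (\<Phi> z)) :: real^1)) absolutely_integrable_on B0"
      using aq by (subst set_integrable_cong[OF refl refl eq]) auto
    show "integral B0 (\<lambda>z. \<bar>det (matrix (D\<Phi> z))\<bar> *\<^sub>R (vec (gp (\<Phi> z) * k (\<Phi> z)) :: real^1)) = b'"
      unfolding b'_def by (rule Henstock_Kurzweil_Integration.integral_cong[OF eq])
  qed
  have Rr: "(\<lambda>x. vec (gp x * k x) :: real^1) absolutely_integrable_on (\<Phi> ` B0) \<and> integral (\<Phi> ` B0) (\<lambda>x. vec (gp x * k x) :: real^1) = b'"
  proof (rule has_absolute_integral_change_of_variables[THEN iffD1, OF _ _ inj_\<Phi>_B0 L])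
    show "B0 \<in> sets lebesgue" by simp
    show "(\<Phi> has_derivative D\<Phi> z) (at z within B0)" if "z \<in> B0" for z
      using has_derivative_subset[OF \<Phi>_has_derivative B_sub(3)] that B_sub(3) by blast
  qed
  have "(\<integral>x. gp x * k x \<partial>lborel) = integral UNIV (\<lambda>x. gp x * k x)" by (rule integral_lborel[OF int, symmetric])
  also have "\<dots> = integral UNIV (\<lambda>x. if x \<in> \<Phi> ` B0 then gp x * k x else 0)"
    by (rule Henstock_Kurzweil_Integration.integral_cong) (auto simp: gp_def)
  also have "integral UNIV (\<lambda>x. if x \<in> \<Phi> ` B0 then gp x * k x else 0) = integral (\<Phi> ` B0) (\<lambda>x. gp x * k x)"
    by (rule Henstock_Kurzweil_Integration.integral_restrict_UNIV)
  also have "\<dots> = integral (\<Phi> ` B0) (\<lambda>x. (vec (gp x * k x) :: real^1) $ 1)" by simp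
  also have "\<dots> = b' $ 1"
  proof -
    have "(\<lambda>x. vec (gp x * k x) :: real^1) integrable_on (\<Phi> ` B0)"
      using Rr set_lebesgue_integral_eq_integral(1) by blast
    from integral_component_eq_cart[OF this, of 1] show ?thesis using Rr by simp
  qed
  also have "\<dots> = integral B0 (\<lambda>z. (vec (q z) :: real^1) $ 1)"
    unfolding b'_def
    by (rule integral_component_eq_cart[symmetric]) (rule set_lebesgue_integral_eq_integral(1)[OF aq])
  also have "\<dots> = integral B1 q" by (simp add: integral_open_interval)
  also have "\<dots> = integral {0..1} (\<lambda>s. integral {a..b} (\<lambda>u. q (vector [s, u])))"
    by (rule integral_cbox_real2[OF cq])
  finally show ?thesis by (simp add: q_def)
qed

lemma integral_gp_total: "(\<integral>x. gp x \<partial>lborel) = integral {0..1} F * integral {a..b} G"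
proof -
  have "(\<integral>x. gp x \<partial>lborel) = integral {0..1} (\<lambda>s. integral {a..b} (\<lambda>u. F s * G u))"
    using integral_gp[of "\<lambda>x. 1"] by simp
  also have "\<dots> = integral {0..1} (\<lambda>s. F s * integral {a..b} G)"
    by (simp only: Henstock_Kurzweil_Integration.integral_mult_right)
  finally show ?thesis by (simp only: Henstock_Kurzweil_Integration.integral_mult_left)
qed

text \<open>Multiplication from the right by \<open>\<eta>\<close> acts as its transpose and moves
  the rotation from the curve to the frequency, so that the phase becomes an inner product with the
  original tube point.\<close>

definition freq :: "int \<times> int \<Rightarrow> real^2" where
  "freq p = (2*pi/h) *\<^sub>R (vector [of_int (fst p), of_int (snd p)] v* \<eta>)"

lemma freq_inner: "freq p \<bullet> y = 2*pi/h * (vector [of_int (fst p), of_int (snd p)] \<bullet> (\<eta> *v y))"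
  by (simp add: freq_def dot_lmul_matrix)

text \<open>\<open>integral_gp\<close> handles real test functions, so the identity is proved under
  a bounded linear functional \<open>L\<close> and then used for the real and the imaginary
  part.\<close>

lemma fcoef_gp:
  "fcoef gp p = integral {0..1} (\<lambda>s. integral {a..b} (\<lambda>u. (F s * G u) *\<^sub>R cis (freq p \<bullet> (\<gamma> s + (\<epsilon> * u) *\<^sub>R \<nu> s))))"
proof -
  obtain B where B: "\<And>x. \<bar>gp x\<bar> \<le> B" using gp_bounded by blast
  obtain R where R: "\<And>x. norm x > R \<Longrightarrow> gp x = 0" using gp_support by blast
  have int: "integrable lborel (\<lambda>x. gp x *\<^sub>R expi2 p x)"
    by (rule integrable_bounded_support[OF gp_measurable B R, where K=1]) auto
  define E where "E s u = (F s * G u) *\<^sub>R cis (freq p \<bullet> (\<gamma> s + (\<epsilon> * u) *\<^sub>R \<nu> s))" for s u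
  have ph: "expi2 p (\<Phi> (vector [s, u])) = cis (freq p \<bullet> (\<gamma> s + (\<epsilon> * u) *\<^sub>R \<nu> s))" for s u
  proof -
    have "2*pi*(of_int (fst p) * (\<Phi> (vector [s, u]))$1 + of_int (snd p) * (\<Phi> (vector [s, u]))$2)
       = freq p \<bullet> (\<gamma> s + (\<epsilon> * u) *\<^sub>R \<nu> s)"
      unfolding freq_inner by (simp add: \<Phi>_def inner_real2 distrib_left add_divide_distrib mult_ac)
    then show ?thesis by (simp only: expi2_def)
  qed
  have cE: "continuous_on ({0..1} \<times> {a..b}) (\<lambda>z. E (fst z) (snd z))"
    unfolding E_def
    by (intro continuous_intros continuous_on_compose2[OF cF(1)] continuous_on_compose2[OF cG]
       continuous_on_compose2[OF conts(5)] continuous_on_compose2[OF conts(7)]) auto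
  have i1: "(E s) integrable_on {a..b}" if s: "s \<in> {0..1}" for s
  proof -
    have p: "continuous_on {a..b} (Pair s)" by (intro continuous_on_Pair continuous_on_const continuous_on_id)
    have "Pair s ` {a..b} \<subseteq> {0..1} \<times> {a..b}" using s by auto
    from continuous_on_compose2[OF cE p this] show ?thesis by (intro integrable_continuous_interval) simp
  qed
  have i2: "(\<lambda>s. integral {a..b} (E s)) integrable_on {0..1}"
    using integral_continuous_on_param[of "{0..1}" a b E] cE
    by (intro integrable_continuous_interval) (simp add: case_prod_unfold)
  have L: "L (fcoef gp p) = L (integral {0..1} (\<lambda>s. integral {a..b} (E s)))"
    if L: "bounded_linear L" and Lb: "\<And>z. \<bar>L z\<bar> \<le> norm z" for L :: "complex \<Rightarrow> real"
  proof -
    have "L (fcoef gp p) = (\<integral>x. L (gp x *\<^sub>R expi2 p x) \<partial>lborel)"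
      unfolding fcoef_def by (rule integral_bounded_linear[OF L int, symmetric])
    also have "\<dots> = (\<integral>x. gp x * L (expi2 p x) \<partial>lborel)" by (simp add: bounded_linear.linear[OF L] linear_scale)
    also have "\<dots> = integral {0..1} (\<lambda>s. integral {a..b} (\<lambda>u. F s * G u * L (expi2 p (\<Phi> (vector [s, u])))))"
    proof (rule integral_gp)
      show "continuous_on UNIV (\<lambda>x. L (expi2 p x))"
        by (intro bounded_linear.continuous_on[OF L] continuous_intros)
      show "\<bar>L (expi2 p x)\<bar> \<le> 1" for x using Lb[of "expi2 p x"] by simp
    qed
    also have "\<dots> = integral {0..1} (\<lambda>s. integral {a..b} (\<lambda>u. L (E s u)))"
      unfolding E_def ph by (simp add: bounded_linear.linear[OF L] linear_scale)
    also have "\<dots> = integral {0..1} (\<lambda>s. L (integral {a..b} (E s)))"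
      by (rule Henstock_Kurzweil_Integration.integral_cong) (use integral_linear[OF i1 L] in \<open>simp add: o_def\<close>)
    also have "\<dots> = L (integral {0..1} (\<lambda>s. integral {a..b} (E s)))"
      using integral_linear[OF i2 L] by (simp add: o_def)
    finally show ?thesis .
  qed
  have "fcoef gp p = integral {0..1} (\<lambda>s. integral {a..b} (E s))"
    by (rule complex_eqI) (rule L[OF bounded_linear_Re abs_Re_le_cmod], rule L[OF bounded_linear_Im abs_Im_le_cmod])
  then show ?thesis by (simp add: E_def[abs_def])
qed

lemma norm_freq: "norm (freq p) = 2*pi/h * norm (vector [of_int (fst p), of_int (snd p)] :: real^2)"
proof -
  note S = SO2_coords[OF \<eta>]
  define n :: "real^2" where "n = vector [of_int (fst p), of_int (snd p)]"
  have "((n v* \<eta>)$1)\<^sup>2 + ((n v* \<eta>)$2)\<^sup>2 = ((\<eta>$1$1)\<^sup>2 + (\<eta>$1$2)\<^sup>2) * ((n$1)\<^sup>2 + (n$2)\<^sup>2)"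
    by (simp add: vector_matrix_mult_def sum_2 S(2,3) power2_eq_square algebra_simps)
  then have "norm (n v* \<eta>) = norm n" using S(1) by (simp add: norm_real2)
  then show ?thesis using h by (simp add: freq_def n_def)
qed



lemma gp_variance:
  "(\<integral>\<^sup>+\<xi>. indicator (qcube 0) \<xi> * ennreal ((periodization gp \<xi> - integral {0..1} F * integral {a..b} G)\<^sup>2) \<partial>lborel)
    \<le> (\<integral>\<^sup>+p. ennreal ((norm (fcoef gp p))\<^sup>2) \<partial>count_space (-{(0,0)}))"
proof -
  obtain B where B: "\<And>x. \<bar>gp x\<bar> \<le> B" using gp_bounded by blast
  obtain R where R: "\<And>x. norm x > R \<Longrightarrow> gp x = 0" using gp_support by blast
  from Parseval_periodization_le[OF gp_measurable B R AE_isCont_gp] show ?thesis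
    unfolding integral_gp_total .
qed

end

section \<open>The variance bound\<close>

abbreviation ivec :: "int \<times> int \<Rightarrow> real^2" where
  "ivec p \<equiv> vector [of_int (fst p), of_int (snd p)]"

lemma norm_ivec_ge_1: "p \<noteq> (0, 0) \<Longrightarrow> 1 \<le> norm (ivec p)"
proof -
  assume "p \<noteq> (0, 0)"
  then have "1 \<le> \<bar>real_of_int (fst p)\<bar> \<or> 1 \<le> \<bar>real_of_int (snd p)\<bar>" by (cases p) auto
  then show ?thesis
    using component_le_norm_cart[of "ivec p" 1] component_le_norm_cart[of "ivec p" 2] by auto
qed

text \<open>Countability of the index set turns measurability of each term into joint measurability,
  to which the theorem on parameter integrals applies.\<close>

lemma measurable_nn_integral_count_space:
  assumes "countable A" "\<And>p. p \<in> A \<Longrightarrow> (\<lambda>x. f p x) \<in> borel_measurable M"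
  shows "(\<lambda>x. \<integral>\<^sup>+p. f p x \<partial>count_space A) \<in> borel_measurable M"
proof -
  have "(\<lambda>z. f (fst z) (snd z)) \<in> borel_measurable (count_space A \<Otimes>\<^sub>M M)"
    by (rule measurable_pair_measure_countable1[OF assms(1)]) (use assms(2) in simp)
  then have "(\<lambda>(x, p). f p x) \<in> borel_measurable (M \<Otimes>\<^sub>M count_space A)"
    by (subst (asm) measurable_pair_swap_iff) (simp add: case_prod_unfold)
  then show ?thesis
    by (rule sigma_finite_measure.borel_measurable_nn_integral[OF sigma_finite_measure_count_space_countable[OF assms(1)]])
qed

lemma square_estimate:
  fixes C X Y z0 z1 :: real
  shows "(C * (X + Y * (z0 + z1)))\<^sup>2 \<le> C\<^sup>2 * (2 * X\<^sup>2 + 4 * Y\<^sup>2 * (z0\<^sup>2 + z1\<^sup>2))"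
proof -
  have "(X + Y * (z0 + z1))\<^sup>2 \<le> 2 * X\<^sup>2 + 2 * (Y * (z0 + z1))\<^sup>2"
    using zero_le_power2[of "X - Y * (z0 + z1)"] by (simp add: power2_sum power2_diff)
  also have "(Y * (z0 + z1))\<^sup>2 \<le> Y\<^sup>2 * (2 * (z0\<^sup>2 + z1\<^sup>2))"
    unfolding power_mult_distrib
    using zero_le_power2[of "z0 - z1"] by (intro mult_left_mono) (simp_all add: power2_sum power2_diff)
  finally have "(X + Y * (z0 + z1))\<^sup>2 \<le> 2 * X\<^sup>2 + 4 * Y\<^sup>2 * (z0\<^sup>2 + z1\<^sup>2)" by (simp add: algebra_simps)
  then show ?thesis unfolding power_mult_distrib[of C] by (intro mult_left_mono) auto
qed

text \<open>Turns the square of an end contribution into the integrand whose mean over rotations is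
  known.\<close>

lemma inverse_square_le:
  fixes x :: real
  assumes "0 \<le> x" shows "(1 / (1 + x))\<^sup>2 \<le> 1 / (1 + x\<^sup>2)"
proof -
  have "1 + x\<^sup>2 \<le> (1 + x)\<^sup>2" using assms by (simp add: power2_sum)
  moreover have "0 < 1 + x\<^sup>2" by (rule add_pos_nonneg) auto
  ultimately show ?thesis by (simp add: power_divide frac_le)
qed

section \<open>Variance of one piece, averaged over rotations\<close>

context tube_frame
begin

text \<open>\<open>Bnd\<close> is an explicit sum over the frequencies that depends on
  \<open>\<eta>\<close> only through the rotated normals at the two ends; it is measurable, and its
  terms can be averaged before they are summed. The Fourier coefficients are compared with it for
  each rotation separately, so measurability in \<open>\<eta>\<close> is asked of the
  majorant.\<close>

lemma piece_bound:
  fixes F F1 F2 G G' :: "real \<Rightarrow> real" and M :: "(real^2^2) measure"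
  assumes M: "normalized_haar_SO2 M"
    and F: "\<And>s. s \<in> {0..1} \<Longrightarrow> (F has_real_derivative F1 s) (at s within {0..1})"
      "\<And>s. s \<in> {0..1} \<Longrightarrow> (F1 has_real_derivative F2 s) (at s within {0..1})" "continuous_on {0..1} F2"
    and ab: "-1 \<le> a" "a < b" "b \<le> 1"
    and G: "\<And>u. u \<in> {a..b} \<Longrightarrow> (G has_real_derivative G' u) (at u within {a..b})" "continuous_on {a..b} G'"
  shows "\<exists>Bnd C. 0 \<le> C \<and> (\<forall>\<epsilon> h. 0 < \<epsilon> \<longrightarrow> \<epsilon> \<le> e1 \<longrightarrow> 0 < h \<longrightarrow> h \<le> 1 \<longrightarrow>
     Bnd h \<epsilon> \<in> borel_measurable M \<and> (\<integral>\<^sup>+\<eta>. Bnd h \<epsilon> \<eta> \<partial>M) \<le> ennreal (C * (h^3 / \<epsilon>\<^sup>2)) \<and>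
     (\<forall>\<eta>\<in>SO2. (\<integral>\<^sup>+p. ennreal ((norm (fcoef (tube_piece.gp \<gamma> \<nu> v \<mu> \<eta> h \<epsilon> F G a b) p))\<^sup>2) \<partial>count_space (-{(0,0)})) \<le> Bnd h \<epsilon> \<eta>))"
proof -
  obtain C where C0: "0 \<le> C" and C: "\<And>\<epsilon> \<xi>. 0 < \<epsilon> \<Longrightarrow> \<epsilon> \<le> e0 \<Longrightarrow> 1 \<le> norm \<xi> \<Longrightarrow>
     norm (integral {0..1} (\<lambda>s. integral {a..b} (\<lambda>u. (F s * G u) *\<^sub>R cis (\<xi> \<bullet> (\<gamma> s + (\<epsilon> * u) *\<^sub>R \<nu> s)))))
     \<le> C * (1 / (\<epsilon> * norm \<xi> * sqrt (norm \<xi>))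
        + 1 / norm \<xi> * (1 / (1 + \<epsilon> * \<bar>\<xi> \<bullet> \<nu> 0\<bar>) + 1 / (1 + \<epsilon> * \<bar>\<xi> \<bullet> \<nu> 1\<bar>)))"
    using piece_estimate[OF F ab(1) less_imp_le[OF ab(2)] ab(3) G] by blast
  obtain S where S: "0 \<le> S" "(\<integral>\<^sup>+p. ennreal (1 / norm (ivec p) ^ 3) \<partial>count_space (-{(0::int,0::int)})) \<le> ennreal S"
    using sum_lattice_cubes by blast
  define lam where "lam h p = 2*pi/h * norm (ivec p)" for h p
  define q where "q h \<epsilon> p s \<eta> = 1 / (1 + (\<epsilon> * lam h p)\<^sup>2 * ((ivec p /\<^sub>R norm (ivec p)) \<bullet> (\<eta> *v \<nu> s))\<^sup>2)" for h \<epsilon> p s and \<eta> :: "real^2^2"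
  define k where "k h \<epsilon> p \<eta> = C\<^sup>2 * (2 / (\<epsilon>\<^sup>2 * lam h p ^ 3) + 4 / (lam h p)\<^sup>2 * (q h \<epsilon> p 0 \<eta> + q h \<epsilon> p 1 \<eta>))" for h \<epsilon> p \<eta>
  define Bnd where "Bnd h \<epsilon> \<eta> = (\<integral>\<^sup>+p. ennreal (k h \<epsilon> p \<eta>) \<partial>count_space (-{(0::int,0::int)}))" for h \<epsilon> \<eta>
  \<comment> \<open>\<open>3082 = 2 + 4 * (385 + 385)\<close>: the 2 belongs to the interior term,
    and each end contributes 4 times the constant 385 of \<open>haar_average\<close>.\<close>
  define C' where "C' = C\<^sup>2 * 3082 * S"
  have "Bnd h \<epsilon> \<in> borel_measurable M \<and> (\<integral>\<^sup>+\<eta>. Bnd h \<epsilon> \<eta> \<partial>M) \<le> ennreal (C' * (h^3 / \<epsilon>\<^sup>2)) \<and>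
     (\<forall>\<eta>\<in>SO2. (\<integral>\<^sup>+p. ennreal ((norm (fcoef (tube_piece.gp \<gamma> \<nu> v \<mu> \<eta> h \<epsilon> F G a b) p))\<^sup>2) \<partial>count_space (-{(0,0)})) \<le> Bnd h \<epsilon> \<eta>)"
    if \<epsilon>: "0 < \<epsilon>" "\<epsilon> \<le> e1" and h: "0 < h" "h \<le> 1" for \<epsilon> h
  proof (intro conjI ballI)
    have pi1: "1 \<le> 2 * pi" using pi_gt3 by simp
    \<comment> \<open>\<open>h \<le> 1\<close> and \<open>|p| \<ge> 1\<close> make the frequency at
      least 1, as the estimate of a piece requires.\<close>
    have lam_ge: "norm (ivec p) / h \<le> lam h p" "1 \<le> lam h p" "0 < norm (ivec p)" if "p \<noteq> (0,0)" for p
    proof -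
      have n: "1 \<le> norm (ivec p)" by (rule norm_ivec_ge_1[OF that])
      show "0 < norm (ivec p)" using n by linarith
      have "1 * norm (ivec p) / h \<le> 2*pi * norm (ivec p) / h" using h n pi1 by (intro divide_right_mono mult_right_mono) auto
      then show "norm (ivec p) / h \<le> lam h p" by (simp add: lam_def)
      moreover have "1 \<le> norm (ivec p) / h" using h n by (simp add: pos_le_divide_eq)
      ultimately show "1 \<le> lam h p" by linarith
    qed
    have \<nu>1: "norm (\<nu> 0) = 1" "norm (\<nu> 1) = 1" using frame(2) by auto
    have e1': "norm (ivec p /\<^sub>R norm (ivec p)) = 1" "0 < \<epsilon> * lam h p" if "p \<noteq> (0,0)" for p
    proof -
      show "0 < \<epsilon> * lam h p" using lam_ge(2)[OF that] \<epsilon> by simp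
      have "inverse (norm (ivec p)) * norm (ivec p) = 1" using lam_ge(3)[OF that] by simp
      then show "norm (ivec p /\<^sub>R norm (ivec p)) = 1" by simp
    qed
    have qm [measurable]: "q h \<epsilon> p 0 \<in> borel_measurable M" "q h \<epsilon> p 1 \<in> borel_measurable M" if "p \<noteq> (0,0)" for p
      unfolding q_def[abs_def] by (rule haar_average(1)[OF M _ e1'[OF that]], rule \<nu>1)+
    have q0: "0 \<le> q h \<epsilon> p s \<eta>" for p s \<eta> unfolding q_def by (simp add: add_nonneg_nonneg)
    have qi: "(\<integral>\<^sup>+\<eta>. ennreal (q h \<epsilon> p 0 \<eta>) \<partial>M) \<le> ennreal (385 / (\<epsilon> * lam h p))"
      "(\<integral>\<^sup>+\<eta>. ennreal (q h \<epsilon> p 1 \<eta>) \<partial>M) \<le> ennreal (385 / (\<epsilon> * lam h p))" if "p \<noteq> (0,0)" for p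
      unfolding q_def by (rule haar_average(2)[OF M _ e1'[OF that]], rule \<nu>1)+
    have km: "(\<lambda>\<eta>. ennreal (k h \<epsilon> p \<eta>)) \<in> borel_measurable M" if "p \<noteq> (0,0)" for p
      unfolding k_def using qm[OF that] by measurable
    show "Bnd h \<epsilon> \<in> borel_measurable M" unfolding Bnd_def[abs_def]
      by (rule measurable_nn_integral_count_space) (use km in auto)
    have one: "emeasure M (space M) = 1" using M unfolding normalized_haar_SO2_def by simp
    have ki: "(\<integral>\<^sup>+\<eta>. ennreal (k h \<epsilon> p \<eta>) \<partial>M) \<le> ennreal (C\<^sup>2 * 3082 * (h^3 / \<epsilon>\<^sup>2)) * ennreal (1 / norm (ivec p) ^ 3)"
      if p: "p \<noteq> (0,0)" for p
    proof -
      define l where "l = lam h p"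
      have l: "1 \<le> l" "norm (ivec p) / h \<le> l" using lam_ge[OF p] by (simp_all add: l_def)
      define x where "x = C\<^sup>2 * (2 / (\<epsilon>\<^sup>2 * l ^ 3))"
      define y where "y = C\<^sup>2 * (4 / l\<^sup>2)"
      have xy: "0 \<le> x" "0 \<le> y" using l by (simp_all add: x_def y_def)
      have "(\<integral>\<^sup>+\<eta>. ennreal (k h \<epsilon> p \<eta>) \<partial>M) = (\<integral>\<^sup>+\<eta>. ennreal x + ennreal y * (ennreal (q h \<epsilon> p 0 \<eta>) + ennreal (q h \<epsilon> p 1 \<eta>)) \<partial>M)"
      proof (rule nn_integral_cong)
        fix \<eta>
        have "k h \<epsilon> p \<eta> = x + y * (q h \<epsilon> p 0 \<eta> + q h \<epsilon> p 1 \<eta>)"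
          by (simp add: k_def x_def y_def l_def algebra_simps add_divide_distrib)
        then show "ennreal (k h \<epsilon> p \<eta>) = ennreal x + ennreal y * (ennreal (q h \<epsilon> p 0 \<eta>) + ennreal (q h \<epsilon> p 1 \<eta>))"
          by (simp only: ennreal_plus ennreal_mult xy q0 add_nonneg_nonneg mult_nonneg_nonneg)
      qed
      also have "\<dots> = ennreal x + ennreal y * ((\<integral>\<^sup>+\<eta>. ennreal (q h \<epsilon> p 0 \<eta>) \<partial>M) + (\<integral>\<^sup>+\<eta>. ennreal (q h \<epsilon> p 1 \<eta>) \<partial>M))"
        using qm[OF p] one by (simp add: nn_integral_add nn_integral_cmult)
      also have "\<dots> \<le> ennreal x + ennreal y * (ennreal (385 / (\<epsilon> * l)) + ennreal (385 / (\<epsilon> * l)))"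
        unfolding l_def by (intro add_mono mult_left_mono qi p) auto
      also have "\<dots> = ennreal (x + y * (385 / (\<epsilon> * l) + 385 / (\<epsilon> * l)))"
      proof -
        have "0 \<le> 385 / (\<epsilon> * l)" using \<epsilon> l by simp
        then show ?thesis by (simp only: ennreal_plus ennreal_mult xy add_nonneg_nonneg mult_nonneg_nonneg)
      qed
      also have "\<dots> \<le> ennreal (C\<^sup>2 * 3082 * (h^3 / \<epsilon>\<^sup>2) * (1 / norm (ivec p) ^ 3))"
      proof (rule ennreal_leI)
        have il: "0 \<le> 1 / l^3" using l by simp
        have "\<epsilon>\<^sup>2 \<le> \<epsilon> * 1" unfolding power2_eq_square using \<epsilon> e1 e0 by (intro mult_left_mono) auto
        then have ie: "1 / \<epsilon> \<le> 1 / \<epsilon>\<^sup>2" using \<epsilon> by (intro divide_left_mono) auto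
        have "x + y * (385 / (\<epsilon> * l) + 385 / (\<epsilon> * l)) = C\<^sup>2 * (2 * (1 / \<epsilon>\<^sup>2) * (1 / l^3) + 3080 * (1 / \<epsilon>) * (1 / l^3))"
          by (simp add: x_def y_def algebra_simps power2_eq_square power3_eq_cube)
        also have "\<dots> \<le> C\<^sup>2 * (2 * (1 / \<epsilon>\<^sup>2) * (1 / l^3) + 3080 * (1 / \<epsilon>\<^sup>2) * (1 / l^3))"
          using ie il by (intro mult_left_mono add_left_mono mult_right_mono) auto
        also have "\<dots> = C\<^sup>2 * 3082 * (1 / \<epsilon>\<^sup>2) * (1 / l^3)" by (simp add: algebra_simps)
        also have "\<dots> \<le> C\<^sup>2 * 3082 * (1 / \<epsilon>\<^sup>2) * (h^3 / norm (ivec p) ^ 3)"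
        proof (rule mult_left_mono)
          have "(norm (ivec p) / h)^3 \<le> l^3" using l h by (intro power_mono) auto
          then have "1 / l^3 \<le> 1 / (norm (ivec p) / h)^3"
            using lam_ge(3)[OF p] h l by (intro divide_left_mono) auto
          then show "1 / l^3 \<le> h^3 / norm (ivec p) ^ 3" by (simp add: power_divide)
        qed simp
        finally show "x + y * (385 / (\<epsilon> * l) + 385 / (\<epsilon> * l)) \<le> C\<^sup>2 * 3082 * (h^3 / \<epsilon>\<^sup>2) * (1 / norm (ivec p) ^ 3)"
          by (simp add: algebra_simps)
      qed
      also have "\<dots> = ennreal (C\<^sup>2 * 3082 * (h^3 / \<epsilon>\<^sup>2)) * ennreal (1 / norm (ivec p) ^ 3)"
        by (rule ennreal_mult) (use h in auto)
      finally show ?thesis .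
    qed
    have "(\<integral>\<^sup>+\<eta>. Bnd h \<epsilon> \<eta> \<partial>M) = (\<integral>\<^sup>+p. (\<integral>\<^sup>+\<eta>. ennreal (k h \<epsilon> p \<eta>) \<partial>M) \<partial>count_space (-{(0::int,0::int)}))"
      unfolding Bnd_def by (rule nn_integral_count_space_nn_integral) (use km in auto)
    also have "\<dots> \<le> (\<integral>\<^sup>+p. ennreal (C\<^sup>2 * 3082 * (h^3 / \<epsilon>\<^sup>2)) * ennreal (1 / norm (ivec p) ^ 3) \<partial>count_space (-{(0::int,0::int)}))"
      by (rule nn_integral_mono) (use ki in auto)
    also have "\<dots> = ennreal (C\<^sup>2 * 3082 * (h^3 / \<epsilon>\<^sup>2)) * (\<integral>\<^sup>+p. ennreal (1 / norm (ivec p) ^ 3) \<partial>count_space (-{(0::int,0::int)}))"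
      by (rule nn_integral_cmult) simp
    also have "\<dots> \<le> ennreal (C\<^sup>2 * 3082 * (h^3 / \<epsilon>\<^sup>2)) * ennreal S" by (intro mult_left_mono S) auto
    also have "\<dots> = ennreal (C' * (h^3 / \<epsilon>\<^sup>2))"
      using S h by (subst ennreal_mult[symmetric]) (auto simp: C'_def mult_ac)
    finally show "(\<integral>\<^sup>+\<eta>. Bnd h \<epsilon> \<eta> \<partial>M) \<le> ennreal (C' * (h^3 / \<epsilon>\<^sup>2))" .
    fix \<eta> :: "real^2^2" assume \<eta>: "\<eta> \<in> SO2"
    interpret T: tube_piece \<gamma> \<tau> \<nu> v v1 v2 \<mu> \<mu>1 \<mu>2 K c0 e0 e1 \<eta> h \<epsilon> F F1 F2 G G' a b
      by unfold_locales (use \<eta> \<epsilon> h F ab G in auto)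
    show "(\<integral>\<^sup>+p. ennreal ((norm (fcoef (tube_piece.gp \<gamma> \<nu> v \<mu> \<eta> h \<epsilon> F G a b) p))\<^sup>2) \<partial>count_space (-{(0,0)})) \<le> Bnd h \<epsilon> \<eta>"
      unfolding Bnd_def
    proof (rule nn_integral_mono, rule ennreal_leI)
      fix p :: "int \<times> int" assume "p \<in> space (count_space (-{(0,0)}))"
      then have p: "p \<noteq> (0,0)" by simp
      define l where "l = lam h p"
      have nf: "norm (T.freq p) = l" by (simp add: T.norm_freq l_def lam_def)
      have l1: "1 \<le> l" using lam_ge(2)[OF p] by (simp add: l_def)
      have fi: "(1 / (1 + \<epsilon> * \<bar>T.freq p \<bullet> \<nu> s\<bar>))\<^sup>2 \<le> q h \<epsilon> p s \<eta>" for s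
      proof -
        have "l * ((ivec p /\<^sub>R norm (ivec p)) \<bullet> (\<eta> *v \<nu> s)) = T.freq p \<bullet> \<nu> s"
          using lam_ge(3)[OF p] by (simp add: T.freq_inner l_def lam_def)
        then have "(\<epsilon> * \<bar>T.freq p \<bullet> \<nu> s\<bar>)\<^sup>2 = (\<epsilon> * l)\<^sup>2 * ((ivec p /\<^sub>R norm (ivec p)) \<bullet> (\<eta> *v \<nu> s))\<^sup>2"
          by (simp only: power_mult_distrib power2_abs mult.assoc flip: \<open>_ = T.freq p \<bullet> \<nu> s\<close>)
        then show ?thesis
          using inverse_square_le[of "\<epsilon> * \<bar>T.freq p \<bullet> \<nu> s\<bar>"] \<epsilon> by (simp add: q_def l_def)
      qed
      have X2: "(1 / (\<epsilon> * l * sqrt l))\<^sup>2 = 1 / (\<epsilon>\<^sup>2 * l^3)"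
      proof -
        have "(\<epsilon> * l * sqrt l)\<^sup>2 = \<epsilon>\<^sup>2 * l\<^sup>2 * (sqrt l)\<^sup>2" by (simp add: power_mult_distrib)
        also have "(sqrt l)\<^sup>2 = l" using l1 by simp
        finally show ?thesis by (simp add: power_divide power2_eq_square power3_eq_cube mult_ac)
      qed
      have "norm (fcoef T.gp p) \<le> C * (1 / (\<epsilon> * l * sqrt l) + 1 / l * (1 / (1 + \<epsilon> * \<bar>T.freq p \<bullet> \<nu> 0\<bar>) + 1 / (1 + \<epsilon> * \<bar>T.freq p \<bullet> \<nu> 1\<bar>)))"
        unfolding T.fcoef_gp nf[symmetric] by (rule C) (use \<epsilon> e1 l1 nf in auto)
      then have "(norm (fcoef T.gp p))\<^sup>2 \<le> (C * (1 / (\<epsilon> * l * sqrt l) + 1 / l * (1 / (1 + \<epsilon> * \<bar>T.freq p \<bullet> \<nu> 0\<bar>) + 1 / (1 + \<epsilon> * \<bar>T.freq p \<bullet> \<nu> 1\<bar>))))\<^sup>2"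
        by (rule power_mono) simp
      also have "\<dots> \<le> C\<^sup>2 * (2 * (1 / (\<epsilon> * l * sqrt l))\<^sup>2 + 4 * (1 / l)\<^sup>2 * ((1 / (1 + \<epsilon> * \<bar>T.freq p \<bullet> \<nu> 0\<bar>))\<^sup>2 + (1 / (1 + \<epsilon> * \<bar>T.freq p \<bullet> \<nu> 1\<bar>))\<^sup>2))"
        by (rule square_estimate)
      also have "\<dots> \<le> C\<^sup>2 * (2 * (1 / (\<epsilon> * l * sqrt l))\<^sup>2 + 4 * (1 / l)\<^sup>2 * (q h \<epsilon> p 0 \<eta> + q h \<epsilon> p 1 \<eta>))"
        by (intro mult_left_mono add_left_mono add_mono fi) auto
      also have "\<dots> = k h \<epsilon> p \<eta>" unfolding k_def X2 l_def[symmetric] by (simp add: power_divide)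
      finally show "(norm (fcoef (tube_piece.gp \<gamma> \<nu> v \<mu> \<eta> h \<epsilon> F G a b) p))\<^sup>2 \<le> k h \<epsilon> p \<eta>" .
    qed
  qed
  moreover have "0 \<le> C'" using S by (simp add: C'_def)
  ultimately show ?thesis by blast
qed

section \<open>The integrand in tube coordinates\<close>

lemma tube_map_inj:
  assumes n: "\<And>s. s \<in> {0..1} \<Longrightarrow> n (\<gamma> s) = \<nu> s" and \<epsilon>: "\<epsilon> \<le> e1"
  shows "inj_on (tube_map n) (tube_domain \<gamma> \<epsilon>)"
proof (rule inj_onI)
  fix z z' assume z: "z \<in> tube_domain \<gamma> \<epsilon>" "z' \<in> tube_domain \<gamma> \<epsilon>" and eq: "tube_map n z = tube_map n z'"
  obtain s t s' t' where st: "z = (\<gamma> s, t)" "z' = (\<gamma> s', t')" "s \<in> {0..1}" "s' \<in> {0..1}" "\<bar>t\<bar> \<le> e1" "\<bar>t'\<bar> \<le> e1"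
    using z \<epsilon> by (auto simp: tube_domain_def path_image_def)
  then show "z = z'" using eq n tube_inj[OF st(3-6)] by (simp add: tube_map_def)
qed

lemma tube_coordinates:
  assumes n: "\<And>s. s \<in> {0..1} \<Longrightarrow> n (\<gamma> s) = \<nu> s" and \<epsilon>: "\<epsilon> \<le> e1" and s: "s \<in> {0..1}" and t: "\<bar>t\<bar> \<le> \<epsilon>"
  shows "\<gamma> s + t *\<^sub>R \<nu> s \<in> tube \<gamma> n \<epsilon>" "tube_proj \<gamma> n \<epsilon> (\<gamma> s + t *\<^sub>R \<nu> s) = \<gamma> s" "tube_dist \<gamma> n \<epsilon> (\<gamma> s + t *\<^sub>R \<nu> s) = t"
proof -
  have d: "(\<gamma> s, t) \<in> tube_domain \<gamma> \<epsilon>" using s t by (auto simp: tube_domain_def path_image_def)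
  have m: "tube_map n (\<gamma> s, t) = \<gamma> s + t *\<^sub>R \<nu> s" using n[OF s] by (simp add: tube_map_def)
  show "\<gamma> s + t *\<^sub>R \<nu> s \<in> tube \<gamma> n \<epsilon>" unfolding tube_def using d m by (metis imageI)
  have "the_inv_into (tube_domain \<gamma> \<epsilon>) (tube_map n) (\<gamma> s + t *\<^sub>R \<nu> s) = (\<gamma> s, t)"
    using the_inv_into_f_f[OF tube_map_inj[OF n \<epsilon>] d] by (simp add: m)
  then show "tube_proj \<gamma> n \<epsilon> (\<gamma> s + t *\<^sub>R \<nu> s) = \<gamma> s" "tube_dist \<gamma> n \<epsilon> (\<gamma> s + t *\<^sub>R \<nu> s) = t"
    by (simp_all add: tube_proj_def tube_dist_def)
qed

text \<open>For \<open>s\<close> strictly inside, the parameter chosen by \<open>SOME\<close> is the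
  only one over the point; there the projection moves with speed \<open>v\<close> while the level
  curve moves with speed \<open>w\<close>.\<close>

lemma level_jacobian_eq:
  assumes n: "\<And>s. s \<in> {0..1} \<Longrightarrow> n (\<gamma> s) = \<nu> s" and \<epsilon>: "\<epsilon> \<le> e1" and s: "0 < s" "s < 1" and t: "\<bar>t\<bar> \<le> \<epsilon>"
  shows "level_jacobian \<gamma> n \<epsilon> (\<gamma> s + t *\<^sub>R \<nu> s) t = v s / w t s"
proof -
  have s01: "s \<in> {0..1}" using s by simp
  define L where "L u = \<gamma> u + t *\<^sub>R n (\<gamma> u)" for u
  have te: "\<bar>t\<bar> \<le> e1" "\<bar>t\<bar> \<le> e0" using t \<epsilon> e1 by auto
  have some: "(SOME s'. s' \<in> {0..1} \<and> L s' = \<gamma> s + t *\<^sub>R \<nu> s) = s"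
  proof (rule some_equality)
    show "s \<in> {0..1} \<and> L s = \<gamma> s + t *\<^sub>R \<nu> s" using s01 n by (simp add: L_def)
    fix s' assume s': "s' \<in> {0..1} \<and> L s' = \<gamma> s + t *\<^sub>R \<nu> s"
    then have "s' \<in> {0..1}" "\<gamma> s' + t *\<^sub>R \<nu> s' = \<gamma> s + t *\<^sub>R \<nu> s" using n[of s'] by (auto simp: L_def)
    then have "\<gamma> s' = \<gamma> s" using tube_inj[OF _ s01 te(1) te(1)] by blast
    then show "s' = s" using simple s' s unfolding simple_path_def loop_free_def by force
  qed
  have "((\<lambda>u. tube_proj \<gamma> n \<epsilon> (L u)) has_vector_derivative v s *\<^sub>R \<tau> s) (at s within {0..1})"
  proof (rule has_vector_derivative_transform_within[OF d\<gamma>[OF s01] zero_less_one s01])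
    fix x :: real assume "x \<in> {0..1}"
    then show "\<gamma> x = tube_proj \<gamma> n \<epsilon> (L x)" using tube_coordinates(2)[OF n \<epsilon> _ t] n by (simp add: L_def)
  qed
  then have 1: "vector_derivative (\<lambda>u. tube_proj \<gamma> n \<epsilon> (L u)) (at s within {0..1}) = v s *\<^sub>R \<tau> s"
    using vector_derivative_within_closed_interval[of 0 1 s] s01 by simp
  have "((\<lambda>u. \<gamma> u + t *\<^sub>R \<nu> u) has_vector_derivative v s *\<^sub>R \<tau> s + t *\<^sub>R (\<mu> s *\<^sub>R \<tau> s)) (at s within {0..1})"
    by (intro has_vector_derivative_add d\<gamma>[OF s01] bounded_linear.has_vector_derivative[OF bounded_linear_scaleR_right d\<nu>[OF s01]])
  then have "(L has_vector_derivative w t s *\<^sub>R \<tau> s) (at s within {0..1})"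
    unfolding L_def[abs_def] w_def scaleR_add_left scaleR_scaleR[symmetric]
    by (rule has_vector_derivative_transform_within[OF _ zero_less_one s01]) (simp add: n)
  then have 2: "vector_derivative L (at s within {0..1}) = w t s *\<^sub>R \<tau> s"
    using vector_derivative_within_closed_interval[of 0 1 s] s01 by simp
  have "c0 \<le> w t s" "c0 \<le> v s" using w_ge[OF s01 te(2)] nondeg(2)[OF s01, of 0] e0 by auto
  then show ?thesis
    unfolding level_jacobian_def Let_def L_def[symmetric] some 1 2 using frame(1)[OF s01] c0 by simp
qed

end

context scaled_tube
begin

lemma \<eta>_cancel': "\<eta> ** matrix_inv \<eta> = mat 1"
  using \<eta>_cancel matrix_left_right_inverse by blast

text \<open>Excluded are the ends of the curve, which the open pieces miss, and the values in
  \<open>T\<close>, at which the decomposition of the profile may fail. Outside the tube both sides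
  are 0.\<close>

lemma ibi_integrand_pieces:
  fixes G G' :: "real \<times> real \<Rightarrow> real \<Rightarrow> real"
  assumes n: "\<And>s. s \<in> {0..1} \<Longrightarrow> n (\<gamma> s) = \<nu> s"
    and F: "\<And>s. s \<in> {0..1} \<Longrightarrow> F s = f (\<gamma> s) * v s"
    and piece: "\<And>p. p \<in> P \<Longrightarrow> tube_piece \<gamma> \<tau> \<nu> v v1 v2 \<mu> \<mu>1 \<mu>2 K c0 e0 e1 \<eta> h \<epsilon> F F1 F2 (G p) (G' p) (fst p) (snd p)"
    and \<theta>: "\<And>u. u \<notin> T \<Longrightarrow> \<theta> u = (\<Sum>p\<in>P. indicator {fst p<..<snd p} u * G p u)"
    and x: "x \<notin> \<Phi> ` {z \<in> Dom. z$1 = 0 \<or> z$1 = 1 \<or> z$2 \<in> T}"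
  shows "h\<^sup>2 * ibi_integrand \<gamma> n f \<theta> \<epsilon> (h *\<^sub>R (matrix_inv \<eta> *v x)) =
     (\<Sum>p\<in>P. tube_piece.gp \<gamma> \<nu> v \<mu> \<eta> h \<epsilon> F (G p) (fst p) (snd p) x)"
proof (cases "h *\<^sub>R (matrix_inv \<eta> *v x) \<in> tube \<gamma> n \<epsilon>")
  case True
  then obtain y where y: "y \<in> tube_domain \<gamma> \<epsilon>" "h *\<^sub>R (matrix_inv \<eta> *v x) = tube_map n y"
    unfolding tube_def by blast
  then obtain s t where st: "s \<in> {0..1}" "\<bar>t\<bar> \<le> \<epsilon>" "y = (\<gamma> s, t)"
    by (auto simp: tube_domain_def path_image_def)
  have st3: "h *\<^sub>R (matrix_inv \<eta> *v x) = \<gamma> s + t *\<^sub>R \<nu> s"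
    unfolding y(2) st(3) using n[OF st(1)] by (simp add: tube_map_def)
  define u where "u = t / \<epsilon>"
  have tu: "t = \<epsilon> * u" using \<epsilon> by (simp add: u_def)
  have u: "u \<in> {-1..1}" using st(2) \<epsilon> by (auto simp: u_def abs_le_iff field_simps)
  define z where "z = (vector [s, u] :: real^2)"
  have zD: "z \<in> Dom" using st u by (simp add: z_def mem_Dom)
  have "\<Phi> z = (1/h) *\<^sub>R (\<eta> *v (h *\<^sub>R (matrix_inv \<eta> *v x)))" unfolding st3 using tu by (simp add: \<Phi>_def z_def)
  also have "\<dots> = x" using h by (simp add: matrix_vector_mult_scaleR matrix_vector_mul_assoc \<eta>_cancel')
  finally have zx: "\<Phi> z = x" .
  have "\<not> (z$1 = 0 \<or> z$1 = 1 \<or> z$2 \<in> T)" using x zx zD by blast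
  then have s: "0 < s" "s < 1" and uT: "u \<notin> T" using st(1) by (auto simp: z_def less_le)
  have gp: "tube_piece.gp \<gamma> \<nu> v \<mu> \<eta> h \<epsilon> F (G p) (fst p) (snd p) x
      = h\<^sup>2 * (F s / (\<epsilon> * w t s)) * (indicator {fst p<..<snd p} u * G p u)" if p: "p \<in> P" for p
  proof -
    interpret T: tube_piece \<gamma> \<tau> \<nu> v v1 v2 \<mu> \<mu>1 \<mu>2 K c0 e0 e1 \<eta> h \<epsilon> F F1 F2 "G p" "G' p" "fst p" "snd p"
      by (rule piece[OF p])
    show ?thesis
    proof (cases "z \<in> T.B0")
      case True
      then have u': "u \<in> {fst p<..<snd p}" by (simp add: T.mem_B z_def)
      have "T.gp x = T.dens z" using T.gp_\<Phi>[OF True] by (simp only: zx)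
      with u' show ?thesis by (simp add: T.dens_def z_def tu)
    next
      case False
      then have u': "u \<notin> {fst p<..<snd p}" using s by (simp add: T.mem_B z_def)
      have "0 < z$1" "z$1 < 1" using s by (simp_all add: z_def)
      then have "T.gp x = 0" using T.gp_\<Phi>_out[OF zD _ _ False] by (simp only: zx)
      with u' show ?thesis by simp
    qed
  qed
  have "(\<Sum>p\<in>P. tube_piece.gp \<gamma> \<nu> v \<mu> \<eta> h \<epsilon> F (G p) (fst p) (snd p) x) = h\<^sup>2 * (F s / (\<epsilon> * w t s)) * \<theta> u"
    unfolding \<theta>[OF uT] sum_distrib_left by (intro sum.cong refl gp)
  moreover have "ibi_integrand \<gamma> n f \<theta> \<epsilon> (\<gamma> s + t *\<^sub>R \<nu> s) = f (\<gamma> s) * (\<theta> u / \<epsilon>) * (v s / w t s)"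
    using tube_coordinates[OF n \<epsilon>(2) st(1,2)] level_jacobian_eq[OF n \<epsilon>(2) s st(2)]
    by (simp add: ibi_integrand_def u_def)
  ultimately show ?thesis unfolding st3 using F[OF st(1)] by (simp add: mult_ac)
next
  case False
  have "tube_piece.gp \<gamma> \<nu> v \<mu> \<eta> h \<epsilon> F (G p) (fst p) (snd p) x = 0" if p: "p \<in> P" for p
  proof -
    interpret T: tube_piece \<gamma> \<tau> \<nu> v v1 v2 \<mu> \<mu>1 \<mu>2 K c0 e0 e1 \<eta> h \<epsilon> F F1 F2 "G p" "G' p" "fst p" "snd p"
      by (rule piece[OF p])
    have "x \<notin> \<Phi> ` T.B0"
    proof
      assume "x \<in> \<Phi> ` T.B0"
      then obtain z where z: "z \<in> T.B0" "x = \<Phi> z" by blast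
      then have zD: "z$1 \<in> {0..1}" "z$2 \<in> {-1..1}" using T.B_sub(3) mem_Dom by blast+
      have "\<bar>\<epsilon> * z$2\<bar> \<le> \<epsilon> * 1" by (rule abs_mult_le) (use zD \<epsilon> in auto)
      then have "\<gamma> (z$1) + (\<epsilon> * z$2) *\<^sub>R \<nu> (z$1) \<in> tube \<gamma> n \<epsilon>"
        using tube_coordinates(1)[OF n \<epsilon>(2) zD(1)] by simp
      with False z(2) \<Phi>_inverse[of z] show False by simp
    qed
    then show ?thesis by (simp add: T.gp_def)
  qed
  with False show ?thesis by (simp add: ibi_integrand_def)
qed

text \<open>For each lattice point the exceptional translations form a differentiable image of
  finitely many segments, a null set, and there are countably many lattice points.\<close>

lemma AE_not_exceptional:
  assumes T: "finite T"
  shows "AE \<xi> in lborel. \<forall>w\<in>int_lattice. w - \<xi> \<notin> \<Phi> ` {z \<in> Dom. z$1 = 0 \<or> z$1 = 1 \<or> z$2 \<in> T}"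
proof (rule AE_ball_countable'[OF _ countable_int_lattice])
  fix w :: "real^2" assume "w \<in> int_lattice"
  define N where "N = {z \<in> Dom. z$1 = 0 \<or> z$1 = 1 \<or> z$2 \<in> T}"
  have hyp: "negligible {z::real^2. z$i = c}" for i c
  proof -
    have "{z::real^2. z$i = c} = {z. axis i 1 \<bullet> z = c}" by (simp add: inner_axis inner_commute)
    then show ?thesis using negligible_hyperplane[of "axis i 1 :: real^2" c] by (simp add: axis_eq_0_iff)
  qed
  have "N \<subseteq> {z. z$1 = 0} \<union> {z. z$1 = 1} \<union> (\<Union>t\<in>T. {z. z$2 = t})" by (auto simp: N_def)
  then have "negligible N"
    by (rule negligible_subset[rotated]) (intro negligible_Un hyp negligible_Union finite_imageI T, auto intro: hyp)
  then have "AE \<xi> in lborel. \<xi> \<notin> (\<lambda>z. w - \<Phi> z) ` N"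
    by (intro AE_not_in_negligible negligible_\<Phi>_image) (auto simp: N_def)
  then show "AE \<xi> in lborel. w - \<xi> \<notin> \<Phi> ` {z \<in> Dom. z$1 = 0 \<or> z$1 = 1 \<or> z$2 \<in> T}"
    unfolding N_def[symmetric]
  proof eventually_elim
    case (elim \<xi>)
    show ?case
    proof
      assume "w - \<xi> \<in> \<Phi> ` N"
      then obtain z where z: "z \<in> N" "w - \<xi> = \<Phi> z" by blast
      have "\<xi> = w - \<Phi> z" unfolding z(2)[symmetric] by simp
      with z(1) elim show False by blast
    qed
  qed
qed

end

section \<open>Assembly over the pieces and the curves\<close>

lemma summable_on_lattice:
  assumes "\<And>x. norm x > R \<Longrightarrow> g x = (0::real)"
  shows "(\<lambda>w. g (w - \<xi>)) summable_on int_lattice"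
proof (rule finite_nonzero_values_imp_summable_on)
  have "{w \<in> int_lattice. g (w - \<xi>) \<noteq> 0} \<subseteq> {w \<in> int_lattice. norm w \<le> norm \<xi> + R}"
  proof
    fix w assume w: "w \<in> {w \<in> int_lattice. g (w - \<xi>) \<noteq> 0}"
    then have "\<not> norm (w - \<xi>) > R" using assms by blast
    then show "w \<in> {w \<in> int_lattice. norm w \<le> norm \<xi> + R}" using w norm_triangle_ineq2[of w \<xi>] by auto
  qed
  then show "finite {w \<in> int_lattice. g (w - \<xi>) \<noteq> 0}" by (rule finite_subset[OF _ finite_int_lattice_bounded])
qed

lemma measurable_periodization:
  assumes g: "g \<in> borel_measurable borel" and supp: "\<And>x. norm x > R \<Longrightarrow> g x = (0::real)"
  shows "(\<lambda>\<xi>. indicator (qcube 0) \<xi> * ennreal ((periodization g \<xi> - c)\<^sup>2)) \<in> borel_measurable borel"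
proof -
  \<comment> \<open>Translations in the unit square have norm at most 2, so one finite set of
    lattice points serves all of them.\<close>
  define W where "W = {w \<in> int_lattice. norm w \<le> 2 + R}"
  have "indicator (qcube 0) \<xi> * ennreal ((periodization g \<xi> - c)\<^sup>2)
     = indicator (qcube 0) \<xi> * ennreal (((\<Sum>w\<in>W. g (w - \<xi>)) - c)\<^sup>2)" for \<xi>
  proof (cases "\<xi> \<in> qcube 0")
    case True
    then have "norm \<xi> \<le> 2" using norm_le_l1_cart[of \<xi>] by (simp add: sum_2 qcube_def)
    then have "periodization g \<xi> = (\<Sum>w\<in>W. g (w - \<xi>))"
      unfolding W_def by (intro periodization_finite[OF supp]) auto
    then show ?thesis by simp
  qed simp
  moreover have "(\<lambda>\<xi>. indicator (qcube 0) \<xi> * ennreal (((\<Sum>w\<in>W. g (w - \<xi>)) - c)\<^sup>2)) \<in> borel_measurable borel"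
    using g by measurable
  ultimately show ?thesis by simp
qed

text \<open>\<open>V\<close> and \<open>B\<close> are measurable majorants of the squared error,
  before and after integration over the translations. Majorants of several curves can be added under
  the integral, where measurability is required.\<close>

definition variance_bound ::
  "(real^2^2) measure \<Rightarrow> (real \<Rightarrow> real^2) \<Rightarrow> (real^2 \<Rightarrow> real^2) \<Rightarrow> (real^2 \<Rightarrow> real) \<Rightarrow> (real \<Rightarrow> real) \<Rightarrow>
    real \<Rightarrow> real \<Rightarrow> (real^2^2 \<Rightarrow> ennreal) \<Rightarrow> real \<Rightarrow> bool" where
  "variance_bound M \<gamma> n f \<theta> \<epsilon> h B C \<longleftrightarrow>
    B \<in> borel_measurable M \<and> (\<integral>\<^sup>+\<eta>. B \<eta> \<partial>M) \<le> ennreal (C * (h^3 / \<epsilon>\<^sup>2)) \<and>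
    (\<forall>\<eta>\<in>SO2. \<exists>V\<in>borel_measurable borel.
       (AE \<xi> in lborel. \<xi> \<in> qcube 0 \<longrightarrow>
          ennreal ((curve_integral \<gamma> f - h\<^sup>2 * (\<Sum>\<^sub>\<infinity>w\<in>int_lattice. ibi_integrand \<gamma> n f \<theta> \<epsilon> (h *\<^sub>R (matrix_inv \<eta> *v (w - \<xi>)))))\<^sup>2) \<le> V \<xi>) \<and>
       (\<integral>\<^sup>+\<xi>. V \<xi> \<partial>lborel) \<le> B \<eta>)"

lemma infsum_finite_sum:
  fixes f :: "'i \<Rightarrow> 'a \<Rightarrow> real"
  assumes "\<And>p. p \<in> P \<Longrightarrow> f p summable_on A"
  shows "(\<Sum>\<^sub>\<infinity>w\<in>A. \<Sum>p\<in>P. f p w) = (\<Sum>p\<in>P. \<Sum>\<^sub>\<infinity>w\<in>A. f p w)"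
proof -
  have "((\<lambda>w. \<Sum>p\<in>P. f p w) has_sum (\<Sum>p\<in>P. infsum (f p) A)) A"
    using assms by (induction P rule: infinite_finite_induct) (auto intro!: has_sum_add has_sum_infsum)
  then show ?thesis by (rule infsumI)
qed

lemma curve_variance_bound:
  fixes \<gamma> :: "real \<Rightarrow> real^2" and M :: "(real^2^2) measure"
  assumes sc: "smooth_curve \<gamma>" and un: "unit_normal_field \<gamma> n"
    and curv: "\<And>t. t \<in> {0..1} \<Longrightarrow> curvature \<gamma> t \<noteq> 0"
    and f: "smooth_fun_on_curve \<gamma> f" and \<theta>: "weight_profile q \<theta>" and M: "normalized_haar_SO2 M"
  shows "\<exists>e>0. inj_on (tube_map n) (tube_domain \<gamma> e) \<and> (\<exists>Bnd C. 0 \<le> C \<and>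
    (\<forall>\<epsilon> h. 0 < \<epsilon> \<longrightarrow> \<epsilon> \<le> e \<longrightarrow> 0 < h \<longrightarrow> h \<le> 1 \<longrightarrow>
      variance_bound M \<gamma> n f \<theta> \<epsilon> h (Bnd h \<epsilon>) C))"
proof -
  define \<nu> where "\<nu> s = n (\<gamma> s)" for s
  obtain \<tau> v v1 v2 \<mu> \<mu>1 \<mu>2 K c0 e0 where fr: "moving_frame \<gamma> \<tau> \<nu> v v1 v2 \<mu> \<mu>1 \<mu>2 K c0 e0"
    and dv: "\<And>s. s \<in> {0..1} \<Longrightarrow> nderiv {0..1} 1 \<gamma> s = v s *\<^sub>R \<tau> s \<and> 0 < v s" and Cv: "Cinf v"
    and cl: "pathfinish \<gamma> = pathstart \<gamma> \<Longrightarrow> \<tau> 0 = \<tau> 1"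
    using unit_normal_frame[OF sc un curv] unfolding \<nu>_def[abs_def] by blast
  interpret fr: moving_frame \<gamma> \<tau> \<nu> v v1 v2 \<mu> \<mu>1 \<mu>2 K c0 e0 by (rule fr)
  have sp: "simple_path \<gamma>" using sc unfolding smooth_curve_def by blast
  have "pathfinish \<gamma> = pathstart \<gamma> \<Longrightarrow> \<tau> 0 = \<tau> 1 \<and> \<nu> 0 = \<nu> 1"
    using cl by (simp add: \<nu>_def pathfinish_def pathstart_def)
  from fr.tube_injective[OF sp this] obtain e' where e': "e' > 0"
    "\<And>s s' t t'. s \<in> {0..1} \<Longrightarrow> s' \<in> {0..1} \<Longrightarrow> \<bar>t\<bar> \<le> e' \<Longrightarrow> \<bar>t'\<bar> \<le> e' \<Longrightarrow>
      \<gamma> s + t *\<^sub>R \<nu> s = \<gamma> s' + t' *\<^sub>R \<nu> s' \<Longrightarrow> \<gamma> s = \<gamma> s' \<and> t = t'" by blast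
  \<comment> \<open>\<open>e'\<close> is the radius of injectivity, \<open>e0\<close> the radius
    within which the parallel curves keep a positive speed.\<close>
  define e1 where "e1 = min e' e0"
  interpret tf: tube_frame \<gamma> \<tau> \<nu> v v1 v2 \<mu> \<mu>1 \<mu>2 K c0 e0 e1
  proof
    show "0 < e1" "e1 \<le> e0" using e'(1) fr.e0 by (auto simp: e1_def)
    show "simple_path \<gamma>" by (rule sp)
    fix s s' t t' :: real
    assume "s \<in> {0..1}" "s' \<in> {0..1}" "\<bar>t\<bar> \<le> e1" "\<bar>t'\<bar> \<le> e1" "\<gamma> s + t *\<^sub>R \<nu> s = \<gamma> s' + t' *\<^sub>R \<nu> s'"
    then show "\<gamma> s = \<gamma> s' \<and> t = t'" by (intro e'(2)) (auto simp: e1_def)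
  qed
  have n: "n (\<gamma> s) = \<nu> s" for s by (simp add: \<nu>_def)
  define F where "F s = f (\<gamma> s) * v s" for s
  have "Cinf (\<lambda>t. f (\<gamma> t))"
    using Cinf_nderiv[of "\<lambda>t. f (\<gamma> t)" "\<lambda>x. x" 0] f by (simp add: smooth_fun_on_curve_def smooth_along_def)
  then have CF: "Cinf F" unfolding F_def[abs_def] by (intro Cinf_intros(3) Cv)
  obtain F1 where F1: "\<And>s. s \<in> {0..1} \<Longrightarrow> (F has_real_derivative F1 s) (at s within {0..1})" "Cinf F1"
    using Cinf_deriv[OF CF] by blast
  obtain F2 where F2: "\<And>s. s \<in> {0..1} \<Longrightarrow> (F1 has_real_derivative F2 s) (at s within {0..1})" "Cinf F2"
    using Cinf_deriv[OF F1(2)] by blast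
  note dF = F1(1) F2(1) Cinf_continuous[OF F2(2)]
  obtain P G G' T where P: "finite P" "finite T"
    and pc0: "\<forall>p\<in>P. -1 \<le> fst p \<and> fst p < snd p \<and> snd p \<le> (1::real) \<and>
       (\<forall>u\<in>{fst p..snd p}. (G p has_real_derivative G' p u) (at u within {fst p..snd p})) \<and>
       continuous_on {fst p..snd p} (G' p)"
    and dec0: "\<forall>x. x \<notin> T \<longrightarrow> \<theta> x = (\<Sum>p\<in>P. indicator {fst p<..<snd p} x * G p x)"
    and one: "(\<Sum>p\<in>P. integral {fst p..snd p} (G p)) = 1"
    using weight_profile_decomposition[OF \<theta>] by (elim exE conjE) (rule that; assumption)
  note pc = bspec[OF pc0] and dec = dec0[rule_format]
  define R where "R p Bnd C \<longleftrightarrow> 0 \<le> C \<and> (\<forall>\<epsilon> h. 0 < \<epsilon> \<longrightarrow> \<epsilon> \<le> e1 \<longrightarrow> 0 < h \<longrightarrow> h \<le> 1 \<longrightarrow>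
     Bnd h \<epsilon> \<in> borel_measurable M \<and> (\<integral>\<^sup>+\<eta>. Bnd h \<epsilon> \<eta> \<partial>M) \<le> ennreal (C * (h^3 / \<epsilon>\<^sup>2)) \<and>
     (\<forall>\<eta>\<in>SO2. (\<integral>\<^sup>+j. ennreal ((norm (fcoef (tube_piece.gp \<gamma> \<nu> v \<mu> \<eta> h \<epsilon> F (G p) (fst p) (snd p)) j))\<^sup>2) \<partial>count_space (-{(0,0)})) \<le> Bnd h \<epsilon> \<eta>))" for p Bnd C
  have "\<exists>Bnd C. R p Bnd C" if p: "p \<in> P" for p
    unfolding R_def by (rule tf.piece_bound[OF M dF]) (use pc[OF p] in blast)+
  then obtain Bp Cp where R: "\<And>p. p \<in> P \<Longrightarrow> R p (Bp p) (Cp p)" by metis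
  have B: "\<And>p. p \<in> P \<Longrightarrow> 0 \<le> Cp p"
    "\<And>p \<epsilon> h. p \<in> P \<Longrightarrow> 0 < \<epsilon> \<Longrightarrow> \<epsilon> \<le> e1 \<Longrightarrow> 0 < h \<Longrightarrow> h \<le> 1 \<Longrightarrow> Bp p h \<epsilon> \<in> borel_measurable M"
    "\<And>p \<epsilon> h. p \<in> P \<Longrightarrow> 0 < \<epsilon> \<Longrightarrow> \<epsilon> \<le> e1 \<Longrightarrow> 0 < h \<Longrightarrow> h \<le> 1 \<Longrightarrow> (\<integral>\<^sup>+\<eta>. Bp p h \<epsilon> \<eta> \<partial>M) \<le> ennreal (Cp p * (h^3 / \<epsilon>\<^sup>2))"
    "\<And>p \<epsilon> h \<eta>. p \<in> P \<Longrightarrow> 0 < \<epsilon> \<Longrightarrow> \<epsilon> \<le> e1 \<Longrightarrow> 0 < h \<Longrightarrow> h \<le> 1 \<Longrightarrow> \<eta> \<in> SO2 \<Longrightarrow>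
       (\<integral>\<^sup>+j. ennreal ((norm (fcoef (tube_piece.gp \<gamma> \<nu> v \<mu> \<eta> h \<epsilon> F (G p) (fst p) (snd p)) j))\<^sup>2) \<partial>count_space (-{(0,0)})) \<le> Bp p h \<epsilon> \<eta>"
    using R unfolding R_def by blast+
  \<comment> \<open>By Cauchy-Schwarz the square of a sum over the pieces costs their number as a
    factor.\<close>
  define N where "N = real (card P)"
  define Bnd where "Bnd h \<epsilon> \<eta> = ennreal N * (\<Sum>p\<in>P. Bp p h \<epsilon> \<eta>)" for h \<epsilon> \<eta>
  define C where "C = N * (\<Sum>p\<in>P. Cp p)"
  have C0: "0 \<le> C" unfolding C_def N_def by (intro mult_nonneg_nonneg sum_nonneg B) auto
  have ci: "curve_integral \<gamma> f = (\<Sum>p\<in>P. integral {0..1} F * integral {fst p..snd p} (G p))"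
  proof -
    have "curve_integral \<gamma> f = integral {0..1} F"
      unfolding curve_integral_def
    proof (rule Henstock_Kurzweil_Integration.integral_cong)
      fix s :: real assume s: "s \<in> {0..1}"
      show "f (\<gamma> s) * norm (nderiv {0..1} 1 \<gamma> s) = F s"
        using dv[OF s] fr.frame(1)[OF s] by (simp add: F_def)
    qed
    then show ?thesis using one by (simp flip: sum_distrib_left)
  qed
  have main: "variance_bound M \<gamma> n f \<theta> \<epsilon> h (Bnd h \<epsilon>) C"
    if \<epsilon>: "0 < \<epsilon>" "\<epsilon> \<le> e1" and h: "0 < h" "h \<le> 1" for \<epsilon> h
    unfolding variance_bound_def
  proof (intro conjI ballI)
    note B' = B(2,3,4)[OF _ \<epsilon> h]
    show "Bnd h \<epsilon> \<in> borel_measurable M" unfolding Bnd_def[abs_def]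
      by (intro borel_measurable_times_ennreal borel_measurable_const borel_measurable_sum B'(1))
    have r0: "0 \<le> h^3 / \<epsilon>\<^sup>2" using h by simp
    have "(\<integral>\<^sup>+\<eta>. Bnd h \<epsilon> \<eta> \<partial>M) = ennreal N * (\<Sum>p\<in>P. \<integral>\<^sup>+\<eta>. Bp p h \<epsilon> \<eta> \<partial>M)"
      unfolding Bnd_def using B'(1) by (subst nn_integral_cmult) (simp_all add: nn_integral_sum)
    also have "\<dots> \<le> ennreal N * (\<Sum>p\<in>P. ennreal (Cp p * (h^3 / \<epsilon>\<^sup>2)))"
      by (intro mult_left_mono sum_mono B'(2)) auto
    also have "\<dots> = ennreal (C * (h^3 / \<epsilon>\<^sup>2))"
    proof -
      have "(\<Sum>p\<in>P. ennreal (Cp p * (h^3 / \<epsilon>\<^sup>2))) = ennreal (\<Sum>p\<in>P. Cp p * (h^3 / \<epsilon>\<^sup>2))"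
        by (rule sum_ennreal) (intro mult_nonneg_nonneg B r0)
      moreover have "0 \<le> (\<Sum>p\<in>P. Cp p * (h^3 / \<epsilon>\<^sup>2))" by (intro sum_nonneg mult_nonneg_nonneg B r0)
      ultimately have "ennreal N * (\<Sum>p\<in>P. ennreal (Cp p * (h^3 / \<epsilon>\<^sup>2))) = ennreal (N * (\<Sum>p\<in>P. Cp p * (h^3 / \<epsilon>\<^sup>2)))"
        by (simp only: ennreal_mult N_def of_nat_0_le_iff)
      also have "N * (\<Sum>p\<in>P. Cp p * (h^3 / \<epsilon>\<^sup>2)) = C * (h^3 / \<epsilon>\<^sup>2)"
        unfolding C_def sum_distrib_right[symmetric] by (simp only: mult.assoc)
      finally show ?thesis .
    qed
    finally show "(\<integral>\<^sup>+\<eta>. Bnd h \<epsilon> \<eta> \<partial>M) \<le> ennreal (C * (h^3 / \<epsilon>\<^sup>2))" .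
    fix \<eta> :: "real^2^2" assume \<eta>: "\<eta> \<in> SO2"
    interpret st: scaled_tube \<gamma> \<tau> \<nu> v v1 v2 \<mu> \<mu>1 \<mu>2 K c0 e0 e1 \<eta> h \<epsilon>
      by unfold_locales (use \<eta> \<epsilon> h in auto)
    have tp: "tube_piece \<gamma> \<tau> \<nu> v v1 v2 \<mu> \<mu>1 \<mu>2 K c0 e0 e1 \<eta> h \<epsilon> F F1 F2 (G p) (G' p) (fst p) (snd p)"
      if "p \<in> P" for p
      by unfold_locales (use pc[OF that] dF in auto)
    define gp where "gp p = tube_piece.gp \<gamma> \<nu> v \<mu> \<eta> h \<epsilon> F (G p) (fst p) (snd p)" for p
    define I where "I p = integral {0..1} F * integral {fst p..snd p} (G p)" for p
    have gm: "gp p \<in> borel_measurable borel" and gs: "\<exists>R. \<forall>x. norm x > R \<longrightarrow> gp p x = 0"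
      and gv: "(\<integral>\<^sup>+\<xi>. indicator (qcube 0) \<xi> * ennreal ((periodization (gp p) \<xi> - I p)\<^sup>2) \<partial>lborel) \<le> Bp p h \<epsilon> \<eta>"
      if p: "p \<in> P" for p
    proof -
      interpret tp: tube_piece \<gamma> \<tau> \<nu> v v1 v2 \<mu> \<mu>1 \<mu>2 K c0 e0 e1 \<eta> h \<epsilon> F F1 F2 "G p" "G' p" "fst p" "snd p"
        by (rule tp[OF p])
      show "gp p \<in> borel_measurable borel" "\<exists>R. \<forall>x. norm x > R \<longrightarrow> gp p x = 0"
        unfolding gp_def by (rule tp.gp_measurable, rule tp.gp_support)
      show "(\<integral>\<^sup>+\<xi>. indicator (qcube 0) \<xi> * ennreal ((periodization (gp p) \<xi> - I p)\<^sup>2) \<partial>lborel) \<le> Bp p h \<epsilon> \<eta>"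
        unfolding gp_def I_def by (rule order_trans[OF tp.gp_variance B'(3)[OF p \<eta>]])
    qed
    obtain R where R: "\<And>p x. p \<in> P \<Longrightarrow> norm x > R p \<Longrightarrow> gp p x = 0" using gs by metis
    define V where "V \<xi> = ennreal N * (\<Sum>p\<in>P. indicator (qcube 0) \<xi> * ennreal ((periodization (gp p) \<xi> - I p)\<^sup>2))" for \<xi>
    have Vp: "(\<lambda>\<xi>. indicator (qcube 0) \<xi> * ennreal ((periodization (gp p) \<xi> - I p)\<^sup>2)) \<in> borel_measurable borel" if "p \<in> P" for p
      by (rule measurable_periodization[OF gm[OF that] R[OF that]])
    have Vm: "V \<in> borel_measurable borel" unfolding V_def[abs_def]
      by (intro borel_measurable_times_ennreal borel_measurable_const borel_measurable_sum Vp)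
    have "(\<integral>\<^sup>+\<xi>. V \<xi> \<partial>lborel) = ennreal N * (\<Sum>p\<in>P. \<integral>\<^sup>+\<xi>. indicator (qcube 0) \<xi> * ennreal ((periodization (gp p) \<xi> - I p)\<^sup>2) \<partial>lborel)"
      unfolding V_def using Vp by (subst nn_integral_cmult) (simp_all add: nn_integral_sum)
    also have "\<dots> \<le> Bnd h \<epsilon> \<eta>" unfolding Bnd_def by (intro mult_left_mono sum_mono gv) auto
    finally have Vi: "(\<integral>\<^sup>+\<xi>. V \<xi> \<partial>lborel) \<le> Bnd h \<epsilon> \<eta>" .
    have "AE \<xi> in lborel. \<xi> \<in> qcube 0 \<longrightarrow>
            ennreal ((curve_integral \<gamma> f - h\<^sup>2 * (\<Sum>\<^sub>\<infinity>w\<in>int_lattice. ibi_integrand \<gamma> n f \<theta> \<epsilon> (h *\<^sub>R (matrix_inv \<eta> *v (w - \<xi>)))))\<^sup>2) \<le> V \<xi>"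
      using st.AE_not_exceptional[OF P(2)]
    proof eventually_elim
      case (elim \<xi>)
      have "h\<^sup>2 * (\<Sum>\<^sub>\<infinity>w\<in>int_lattice. ibi_integrand \<gamma> n f \<theta> \<epsilon> (h *\<^sub>R (matrix_inv \<eta> *v (w - \<xi>))))
         = (\<Sum>\<^sub>\<infinity>w\<in>int_lattice. h\<^sup>2 * ibi_integrand \<gamma> n f \<theta> \<epsilon> (h *\<^sub>R (matrix_inv \<eta> *v (w - \<xi>))))"
        by (rule infsum_cmult_right'[symmetric])
      also have "\<dots> = (\<Sum>\<^sub>\<infinity>w\<in>int_lattice. \<Sum>p\<in>P. gp p (w - \<xi>))"
      proof (rule infsum_cong)
        fix w assume "w \<in> int_lattice"
        then have x: "w - \<xi> \<notin> st.\<Phi> ` {z \<in> st.Dom. z$1 = 0 \<or> z$1 = 1 \<or> z$2 \<in> T}" using elim by blast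
        show "h\<^sup>2 * ibi_integrand \<gamma> n f \<theta> \<epsilon> (h *\<^sub>R (matrix_inv \<eta> *v (w - \<xi>))) = (\<Sum>p\<in>P. gp p (w - \<xi>))"
          unfolding gp_def by (rule st.ibi_integrand_pieces[OF n F_def tp dec x])
      qed
      also have "\<dots> = (\<Sum>p\<in>P. periodization (gp p) \<xi>)"
        unfolding periodization_def by (rule infsum_finite_sum) (rule summable_on_lattice[OF R])
      finally have eq: "curve_integral \<gamma> f - h\<^sup>2 * (\<Sum>\<^sub>\<infinity>w\<in>int_lattice. ibi_integrand \<gamma> n f \<theta> \<epsilon> (h *\<^sub>R (matrix_inv \<eta> *v (w - \<xi>))))
         = (\<Sum>p\<in>P. I p - periodization (gp p) \<xi>)"
        by (simp add: ci I_def sum_subtractf)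
      have "(\<Sum>p\<in>P. I p - periodization (gp p) \<xi>)\<^sup>2 \<le> (\<Sum>p\<in>P. (I p - periodization (gp p) \<xi>)\<^sup>2) * N"
        unfolding N_def by (rule sum_squared_le_sum_of_squares)
      also have "\<dots> = N * (\<Sum>p\<in>P. (periodization (gp p) \<xi> - I p)\<^sup>2)"
        by (simp add: mult.commute power2_commute)
      finally have "ennreal ((\<Sum>p\<in>P. I p - periodization (gp p) \<xi>)\<^sup>2) \<le> ennreal (N * (\<Sum>p\<in>P. (periodization (gp p) \<xi> - I p)\<^sup>2))"
        by (rule ennreal_leI)
      also have "\<dots> = ennreal N * (\<Sum>p\<in>P. ennreal ((periodization (gp p) \<xi> - I p)\<^sup>2))"
        by (subst ennreal_mult) (auto simp: N_def sum_nonneg sum_ennreal)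
      finally show ?case unfolding eq by (auto simp: V_def)
    qed
    with Vm Vi show "\<exists>V\<in>borel_measurable borel.
         (AE \<xi> in lborel. \<xi> \<in> qcube 0 \<longrightarrow>
            ennreal ((curve_integral \<gamma> f - h\<^sup>2 * (\<Sum>\<^sub>\<infinity>w\<in>int_lattice. ibi_integrand \<gamma> n f \<theta> \<epsilon> (h *\<^sub>R (matrix_inv \<eta> *v (w - \<xi>)))))\<^sup>2) \<le> V \<xi>) \<and>
         (\<integral>\<^sup>+\<xi>. V \<xi> \<partial>lborel) \<le> Bnd h \<epsilon> \<eta>" by blast
  qed
  have "inj_on (tube_map n) (tube_domain \<gamma> e1)" by (rule tf.tube_map_inj[OF n order_refl])
  with main C0 tf.e1(1) show ?thesis by blast
qed

text \<open>The closed square of translations exceeds the half-open cell of the Fourier series by a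
  null set.\<close>

lemma AE_unit_cube: "AE \<xi> in lborel. (\<forall>i. \<xi> $ i \<in> {0..1}) \<longrightarrow> \<xi> \<in> qcube 0"
proof -
  have "negligible {z::real^2. z$i = 1}" for i
  proof -
    have "{z::real^2. z$i = 1} = {z. axis i 1 \<bullet> z = 1}" by (simp add: inner_axis inner_commute)
    then show ?thesis using negligible_hyperplane[of "axis i 1 :: real^2" 1] by (simp add: axis_eq_0_iff)
  qed
  then have "AE \<xi> in lborel. \<xi> \<notin> {z::real^2. z$i = 1}" for i by (rule AE_not_in_negligible)
  from this[of 1] this[of 2] show ?thesis
    by eventually_elim (auto simp: qcube_def forall_2 less_le)
qed

theorem theorem4p1:
  fixes m q :: nat
    and \<gamma> :: "nat \<Rightarrow> real \<Rightarrow> real^2"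
    and n :: "nat \<Rightarrow> real^2 \<Rightarrow> real^2"
    and f :: "real^2 \<Rightarrow> real"
    and \<theta> :: "real \<Rightarrow> real"
    and \<kappa> \<alpha> :: real
    and \<mu> :: "(real^2^2) measure"
  assumes "\<forall>k\<in>{1..m}. smooth_curve (\<gamma> k)"
    and "\<forall>k\<in>{1..m}. unit_normal_field (\<gamma> k) (n k)"
    and "\<forall>k\<in>{1..m}. finite (zero_curvature_points (\<gamma> k))"
    and "((\<forall>k\<in>{1..m}. zero_curvature_points (\<gamma> k) = {}) \<and> \<kappa> = 2) \<or>
         ((\<forall>k\<in>{1..m}. \<forall>z\<in>zero_curvature_points (\<gamma> k).
             \<exists>r\<le>\<kappa> - 2. curvature_vanishes_to_order (\<gamma> k) z r) \<and>
          2 \<le> \<kappa> \<and> \<kappa> < (3 + sqrt 5) / 2)"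
    and "\<forall>k\<in>{1..m}. smooth_fun_on_curve (\<gamma> k) f"
    and "weight_profile q \<theta>"
    and "0 \<le> \<alpha>" "\<alpha> \<le> 1"
    and "normalized_haar_SO2 \<mu>"
  shows "\<exists>\<epsilon>0>0. (\<forall>k\<in>{1..m}. inj_on (tube_map (n k)) (tube_domain (\<gamma> k) \<epsilon>0)) \<and>
    (\<forall>\<epsilon> :: real \<Rightarrow> real. \<forall>c1>0. \<forall>c2>0.
       (\<forall>\<^sub>F h in at_right 0. c1 * h powr \<alpha> \<le> \<epsilon> h \<and> \<epsilon> h \<le> c2 * h powr \<alpha> \<and> \<epsilon> h \<le> \<epsilon>0) \<longrightarrow>
       (\<exists>C. \<forall>\<^sub>F h in at_right 0.
          (\<integral>\<^sup>+\<eta>. (\<integral>\<^sup>+\<xi>\<in>{\<xi>. \<forall>i. \<xi> $ i \<in> {0..1}}.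
              ennreal (\<bar>(\<Sum>k=1..m. curve_integral (\<gamma> k) f)
                        - ibi_transformed m \<gamma> n f \<theta> (\<epsilon> h) h \<eta> \<xi>\<bar>\<^sup>2) \<partial>lborel) \<partial>\<mu>)
          \<le> ennreal (C * h powr (2 / \<kappa> + 2 / (\<kappa> - 1) * (1 - \<alpha>)))))"
proof -
  have \<kappa>: "2 \<le> \<kappa>" using assms(4) by auto
  have curv: "curvature (\<gamma> k) t \<noteq> 0" if k: "k \<in> {1..m}" and t: "t \<in> {0..1}" for k t
    using assms(4)
  proof
    assume "(\<forall>k\<in>{1..m}. zero_curvature_points (\<gamma> k) = {}) \<and> \<kappa> = 2"
    then show ?thesis using k t unfolding zero_curvature_points_def by blast
  next
    assume a: "(\<forall>k\<in>{1..m}. \<forall>z\<in>zero_curvature_points (\<gamma> k). \<exists>r\<le>\<kappa> - 2. curvature_vanishes_to_order (\<gamma> k) z r) \<and>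
          2 \<le> \<kappa> \<and> \<kappa> < (3 + sqrt 5) / 2"
    show ?thesis by (rule curvature_nonvanishing[OF _ _ _ t, of _ \<kappa>]) (use a k assms(1) in auto)
  qed
  have "\<forall>k\<in>{1..m}. \<exists>e. e > 0 \<and> inj_on (tube_map (n k)) (tube_domain (\<gamma> k) e) \<and> (\<exists>Bnd C. 0 \<le> C \<and>
    (\<forall>\<epsilon> h. 0 < \<epsilon> \<longrightarrow> \<epsilon> \<le> e \<longrightarrow> 0 < h \<longrightarrow> h \<le> 1 \<longrightarrow>
      variance_bound \<mu> (\<gamma> k) (n k) f \<theta> \<epsilon> h (Bnd h \<epsilon>) C))"
    by (intro ballI curve_variance_bound[unfolded Bex_def]) (use assms curv in auto)
  then obtain e Bnd C where e: "\<And>k. k \<in> {1..m} \<Longrightarrow> 0 < e k" "\<And>k. k \<in> {1..m} \<Longrightarrow> inj_on (tube_map (n k)) (tube_domain (\<gamma> k) (e k))"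
    and C0: "\<And>k. k \<in> {1..m} \<Longrightarrow> 0 \<le> C k"
    and B: "\<And>k \<epsilon> h. k \<in> {1..m} \<Longrightarrow> 0 < \<epsilon> \<Longrightarrow> \<epsilon> \<le> e k \<Longrightarrow> 0 < h \<Longrightarrow> h \<le> 1 \<Longrightarrow>
      variance_bound \<mu> (\<gamma> k) (n k) f \<theta> \<epsilon> h (Bnd k h \<epsilon>) (C k)"
    by metis
  \<comment> \<open>The 1 keeps the set nonempty when there is no curve.\<close>
  define \<epsilon>0 where "\<epsilon>0 = Min (insert 1 (e ` {1..m}))"
  have \<epsilon>0: "0 < \<epsilon>0" unfolding \<epsilon>0_def using e(1) by (subst Min_gr_iff) auto
  have \<epsilon>0_le: "\<epsilon>0 \<le> e k" if "k \<in> {1..m}" for k unfolding \<epsilon>0_def using that by (intro Min_le) auto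
  have inj: "inj_on (tube_map (n k)) (tube_domain (\<gamma> k) \<epsilon>0)" if k: "k \<in> {1..m}" for k
    by (rule inj_on_subset[OF e(2)[OF k]]) (use \<epsilon>0_le[OF k] in \<open>auto simp: tube_domain_def\<close>)
  \<comment> \<open>Again the Cauchy-Schwarz factor, now for the sum over the curves.\<close>
  define N where "N = real m"
  define Ct where "Ct = N * (\<Sum>k=1..m. C k)"
  have Ct0: "0 \<le> Ct" unfolding Ct_def N_def by (intro mult_nonneg_nonneg sum_nonneg C0) auto
  have SO: "space \<mu> = SO2" using assms(9) unfolding normalized_haar_SO2_def by blast
  have bound: "(\<integral>\<^sup>+\<eta>. (\<integral>\<^sup>+\<xi>\<in>{\<xi>. \<forall>i. \<xi> $ i \<in> {0..1}}.
              ennreal (\<bar>(\<Sum>k=1..m. curve_integral (\<gamma> k) f)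
                        - ibi_transformed m \<gamma> n f \<theta> \<epsilon> h \<eta> \<xi>\<bar>\<^sup>2) \<partial>lborel) \<partial>\<mu>) \<le> ennreal (Ct * (h^3 / \<epsilon>\<^sup>2))"
    if \<epsilon>: "0 < \<epsilon>" "\<epsilon> \<le> \<epsilon>0" and h: "0 < h" "h \<le> 1" for \<epsilon> h
  proof -
    have Bk: "Bnd k h \<epsilon> \<in> borel_measurable \<mu>" "(\<integral>\<^sup>+\<eta>. Bnd k h \<epsilon> \<eta> \<partial>\<mu>) \<le> ennreal (C k * (h^3 / \<epsilon>\<^sup>2))"
      and Vk: "\<And>\<eta>. \<eta> \<in> SO2 \<Longrightarrow> \<exists>V\<in>borel_measurable borel.
         (AE \<xi> in lborel. \<xi> \<in> qcube 0 \<longrightarrow>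
            ennreal ((curve_integral (\<gamma> k) f - h\<^sup>2 * (\<Sum>\<^sub>\<infinity>w\<in>int_lattice. ibi_integrand (\<gamma> k) (n k) f \<theta> \<epsilon> (h *\<^sub>R (matrix_inv \<eta> *v (w - \<xi>)))))\<^sup>2) \<le> V \<xi>) \<and>
         (\<integral>\<^sup>+\<xi>. V \<xi> \<partial>lborel) \<le> Bnd k h \<epsilon> \<eta>"
      if k: "k \<in> {1..m}" for k
      using B[OF k \<epsilon>(1) order_trans[OF \<epsilon>(2) \<epsilon>0_le[OF k]] h] unfolding variance_bound_def by blast+
    have r0: "0 \<le> h^3 / \<epsilon>\<^sup>2" using h by simp
    have "(\<integral>\<^sup>+\<xi>\<in>{\<xi>. \<forall>i. \<xi> $ i \<in> {0..1}}.
              ennreal (\<bar>(\<Sum>k=1..m. curve_integral (\<gamma> k) f)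
                        - ibi_transformed m \<gamma> n f \<theta> \<epsilon> h \<eta> \<xi>\<bar>\<^sup>2) \<partial>lborel) \<le> ennreal N * (\<Sum>k=1..m. Bnd k h \<epsilon> \<eta>)"
      if \<eta>: "\<eta> \<in> SO2" for \<eta>
    proof -
      define D where "D k \<xi> = curve_integral (\<gamma> k) f - h\<^sup>2 * (\<Sum>\<^sub>\<infinity>w\<in>int_lattice. ibi_integrand (\<gamma> k) (n k) f \<theta> \<epsilon> (h *\<^sub>R (matrix_inv \<eta> *v (w - \<xi>))))" for k \<xi>
      have "\<forall>k\<in>{1..m}. \<exists>V. V \<in> borel_measurable borel \<and> (AE \<xi> in lborel. \<xi> \<in> qcube 0 \<longrightarrow> ennreal ((D k \<xi>)\<^sup>2) \<le> V \<xi>) \<and>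
         (\<integral>\<^sup>+\<xi>. V \<xi> \<partial>lborel) \<le> Bnd k h \<epsilon> \<eta>"
        unfolding D_def using Vk[OF _ \<eta>] by blast
      from bchoice[OF this] obtain V where V0: "\<forall>k\<in>{1..m}. V k \<in> borel_measurable borel \<and> (AE \<xi> in lborel. \<xi> \<in> qcube 0 \<longrightarrow> ennreal ((D k \<xi>)\<^sup>2) \<le> V k \<xi>) \<and>
         (\<integral>\<^sup>+\<xi>. V k \<xi> \<partial>lborel) \<le> Bnd k h \<epsilon> \<eta>" ..
      have V: "\<And>k. k \<in> {1..m} \<Longrightarrow> V k \<in> borel_measurable borel"
         "\<And>k. k \<in> {1..m} \<Longrightarrow> AE \<xi> in lborel. \<xi> \<in> qcube 0 \<longrightarrow> ennreal ((D k \<xi>)\<^sup>2) \<le> V k \<xi>"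
         "\<And>k. k \<in> {1..m} \<Longrightarrow> (\<integral>\<^sup>+\<xi>. V k \<xi> \<partial>lborel) \<le> Bnd k h \<epsilon> \<eta>"
        using V0 by blast+
      have all: "AE \<xi> in lborel. \<forall>k\<in>{1..m}. \<xi> \<in> qcube 0 \<longrightarrow> ennreal ((D k \<xi>)\<^sup>2) \<le> V k \<xi>"
        by (rule AE_ball_countable'[OF V(2)]) auto
      have "(\<integral>\<^sup>+\<xi>\<in>{\<xi>. \<forall>i. \<xi> $ i \<in> {0..1}}.
              ennreal (\<bar>(\<Sum>k=1..m. curve_integral (\<gamma> k) f)
                        - ibi_transformed m \<gamma> n f \<theta> \<epsilon> h \<eta> \<xi>\<bar>\<^sup>2) \<partial>lborel) \<le> (\<integral>\<^sup>+\<xi>. ennreal N * (\<Sum>k=1..m. V k \<xi>) \<partial>lborel)"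
      proof (rule nn_integral_mono_AE, use all AE_unit_cube in eventually_elim)
        case (elim \<xi>)
        show "ennreal (\<bar>(\<Sum>k=1..m. curve_integral (\<gamma> k) f) - ibi_transformed m \<gamma> n f \<theta> \<epsilon> h \<eta> \<xi>\<bar>\<^sup>2) * indicator {\<xi>. \<forall>i. \<xi> $ i \<in> {0..1}} \<xi>
           \<le> ennreal N * (\<Sum>k=1..m. V k \<xi>)"
        proof (cases "\<forall>i. \<xi> $ i \<in> {0..1}")
          case True
          then have qc: "\<xi> \<in> qcube 0" using elim by blast
          have eq: "(\<Sum>k=1..m. curve_integral (\<gamma> k) f) - ibi_transformed m \<gamma> n f \<theta> \<epsilon> h \<eta> \<xi> = (\<Sum>k=1..m. D k \<xi>)"
            by (simp add: ibi_transformed_def D_def sum_subtractf sum_distrib_left)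
          have "\<bar>\<Sum>k=1..m. D k \<xi>\<bar>\<^sup>2 \<le> N * (\<Sum>k=1..m. (D k \<xi>)\<^sup>2)"
            using sum_squared_le_sum_of_squares[of "\<lambda>k. D k \<xi>" "{1..m}"] by (simp add: N_def mult.commute)
          then have "ennreal (\<bar>\<Sum>k=1..m. D k \<xi>\<bar>\<^sup>2) \<le> ennreal (N * (\<Sum>k=1..m. (D k \<xi>)\<^sup>2))" by (rule ennreal_leI)
          also have "\<dots> = ennreal N * (\<Sum>k=1..m. ennreal ((D k \<xi>)\<^sup>2))"
            by (subst ennreal_mult) (auto simp: N_def sum_nonneg sum_ennreal)
          also have "\<dots> \<le> ennreal N * (\<Sum>k=1..m. V k \<xi>)"
            using elim qc by (intro mult_left_mono sum_mono) auto
          finally show ?thesis unfolding eq using True by simp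
        qed simp
      qed
      also have "\<dots> = ennreal N * (\<Sum>k=1..m. \<integral>\<^sup>+\<xi>. V k \<xi> \<partial>lborel)"
      proof -
        have V1: "V k \<in> borel_measurable lborel" if "k \<in> {1..m}" for k using V(1)[OF that] by simp
        show ?thesis
          by (subst nn_integral_cmult, intro borel_measurable_sum V1, assumption,
            subst nn_integral_sum, rule V1, assumption, rule refl)
      qed
      also have "\<dots> \<le> ennreal N * (\<Sum>k=1..m. Bnd k h \<epsilon> \<eta>)"
        by (intro mult_left_mono sum_mono V(3)) auto
      finally show ?thesis .
    qed
    then have "(\<integral>\<^sup>+\<eta>. (\<integral>\<^sup>+\<xi>\<in>{\<xi>. \<forall>i. \<xi> $ i \<in> {0..1}}.
              ennreal (\<bar>(\<Sum>k=1..m. curve_integral (\<gamma> k) f)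
                        - ibi_transformed m \<gamma> n f \<theta> \<epsilon> h \<eta> \<xi>\<bar>\<^sup>2) \<partial>lborel) \<partial>\<mu>) \<le> (\<integral>\<^sup>+\<eta>. ennreal N * (\<Sum>k=1..m. Bnd k h \<epsilon> \<eta>) \<partial>\<mu>)"
      by (intro nn_integral_mono) (simp add: SO)
    also have "\<dots> = ennreal N * (\<Sum>k=1..m. \<integral>\<^sup>+\<eta>. Bnd k h \<epsilon> \<eta> \<partial>\<mu>)"
      by (subst nn_integral_cmult, intro borel_measurable_sum Bk(1), assumption,
        subst nn_integral_sum, rule Bk(1), assumption, rule refl)
    also have "\<dots> \<le> ennreal N * (\<Sum>k=1..m. ennreal (C k * (h^3 / \<epsilon>\<^sup>2)))"
      by (intro mult_left_mono sum_mono Bk(2)) auto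
    also have "\<dots> = ennreal N * ennreal (\<Sum>k=1..m. C k * (h^3 / \<epsilon>\<^sup>2))"
      by (subst sum_ennreal) (rule mult_nonneg_nonneg[OF C0 r0], assumption, rule refl)
    also have "\<dots> = ennreal (N * (\<Sum>k=1..m. C k * (h^3 / \<epsilon>\<^sup>2)))"
      by (rule ennreal_mult[symmetric]) (simp add: N_def, intro sum_nonneg mult_nonneg_nonneg C0 r0)
    also have "N * (\<Sum>k=1..m. C k * (h^3 / \<epsilon>\<^sup>2)) = Ct * (h^3 / \<epsilon>\<^sup>2)"
      unfolding Ct_def sum_distrib_right[symmetric] by (simp only: mult.assoc)
    finally show ?thesis .
  qed
  \<comment> \<open>As \<open>h \<le> 1\<close>, a smaller exponent gives a weaker bound. The
    exponent \<open>3 - 2*\<alpha>\<close> of \<open>h^3 / \<epsilon>\<^sup>2\<close> is the value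
    of \<open>ex\<close> at \<open>\<kappa> = 2\<close>, the largest one.\<close>
  define ex where "ex = 2 / \<kappa> + 2 / (\<kappa> - 1) * (1 - \<alpha>)"
  have ex: "ex \<le> 3 - 2 * \<alpha>"
  proof -
    have "2 / \<kappa> \<le> 1" "2 / (\<kappa> - 1) \<le> 2" using \<kappa> by (simp_all add: divide_le_eq)
    then have "2 / (\<kappa> - 1) * (1 - \<alpha>) \<le> 2 * (1 - \<alpha>)" using assms(8) by (intro mult_right_mono) auto
    then have "ex \<le> 1 + 2 * (1 - \<alpha>)" unfolding ex_def using \<open>2 / \<kappa> \<le> 1\<close> by (intro add_mono)
    then show ?thesis by (simp add: algebra_simps)
  qed
  have fin: "\<exists>C. \<forall>\<^sub>F h in at_right 0.
          (\<integral>\<^sup>+\<eta>. (\<integral>\<^sup>+\<xi>\<in>{\<xi>. \<forall>i. \<xi> $ i \<in> {0..1}}.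
              ennreal (\<bar>(\<Sum>k=1..m. curve_integral (\<gamma> k) f)
                        - ibi_transformed m \<gamma> n f \<theta> (\<epsilon> h) h \<eta> \<xi>\<bar>\<^sup>2) \<partial>lborel) \<partial>\<mu>) \<le> ennreal (C * h powr ex)"
    if c: "0 < c1" and ev: "\<forall>\<^sub>F h in at_right 0. c1 * h powr \<alpha> \<le> \<epsilon> h \<and> \<epsilon> h \<le> c2 * h powr \<alpha> \<and> \<epsilon> h \<le> \<epsilon>0"
    for \<epsilon> :: "real \<Rightarrow> real" and c1 c2
  \<comment> \<open>\<open>\<epsilon>\<^sup>2\<close> stands in a denominator, so it is the lower
    bound \<open>c1 * h powr \<alpha>\<close> that turns \<open>h^3 / \<epsilon>\<^sup>2\<close>
    into a power of \<open>h\<close>.\<close>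
  proof (rule exI[of _ "Ct / c1\<^sup>2"])
    have "\<forall>\<^sub>F h in at_right (0::real). h < 1" by (rule order_tendstoD(2)[OF tendsto_ident_at]) simp
    with ev eventually_at_right_less[of "0::real"]
    show "\<forall>\<^sub>F h in at_right 0.
          (\<integral>\<^sup>+\<eta>. (\<integral>\<^sup>+\<xi>\<in>{\<xi>. \<forall>i. \<xi> $ i \<in> {0..1}}.
              ennreal (\<bar>(\<Sum>k=1..m. curve_integral (\<gamma> k) f)
                        - ibi_transformed m \<gamma> n f \<theta> (\<epsilon> h) h \<eta> \<xi>\<bar>\<^sup>2) \<partial>lborel) \<partial>\<mu>) \<le> ennreal (Ct / c1\<^sup>2 * h powr ex)"
    proof eventually_elim
      case (elim h)
      have h: "0 < h" "h \<le> 1" using elim by auto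
      have lower: "0 < c1 * h powr \<alpha>" using c h by simp
      then have \<epsilon>: "0 < \<epsilon> h" "\<epsilon> h \<le> \<epsilon>0" using elim by linarith+
      have "h^3 / (\<epsilon> h)\<^sup>2 \<le> h^3 / (c1 * h powr \<alpha>)\<^sup>2"
        using elim lower h \<epsilon> by (intro divide_left_mono power_mono mult_pos_pos) auto
      also have "\<dots> = h powr (3 - 2 * \<alpha>) / c1\<^sup>2"
      proof -
        have "(h powr \<alpha>)\<^sup>2 = h powr (2 * \<alpha>)" by (simp add: power2_eq_square flip: powr_add)
        moreover have "h^3 = h powr 3" using h by simp
        ultimately show ?thesis by (simp add: power_mult_distrib powr_diff)
      qed
      also have "\<dots> \<le> h powr ex / c1\<^sup>2"
        using powr_mono'[OF ex] h by (intro divide_right_mono) auto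
      finally have "Ct * (h^3 / (\<epsilon> h)\<^sup>2) \<le> Ct * (h powr ex / c1\<^sup>2)" by (rule mult_left_mono[OF _ Ct0])
      then have "ennreal (Ct * (h^3 / (\<epsilon> h)\<^sup>2)) \<le> ennreal (Ct / c1\<^sup>2 * h powr ex)"
        by (intro ennreal_leI) (simp add: mult_ac)
      with bound[OF \<epsilon> h] show ?case by (rule order_trans)
    qed
  qed
  show ?thesis unfolding ex_def[symmetric]
    by (rule exI[of _ \<epsilon>0]) (use \<epsilon>0 inj fin in blast)
qed

end
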